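(* Let $d\in\{2,3\}$, $T>0$, $\gamma>1$, and let $\mu,\lambda$ satisfy $\mu\ge 0$ and $2\mu+d\lambda>0$. Let $(\rho,v)$ be a weak solution (in the sense defined in the context) on $(0,T)\times\mathbb{T}^d$ of the isentropic compressible Navier-Stokes equations $$\rho_t+\nabla\cdot(\rho v)=0,\qquad (\rho v)_t+\mathrm{div}(\rho v\otimes v)+\nabla(\rho^\gamma)-\mu\Delta v-(\mu+\lambda)\nabla\,\mathrm{div}\,v=0,$$ with initial data $\rho(0,x)=\rho_0(x)$, $(\rho v)(0,x)=(\rho_0v_0)(x)$. Then the energy equality $$\int_{\mathbb{T}^{d}}\Big(\tfrac12\rho|v|^2+\tfrac{\rho^{\gamma}}{\gamma-1}\Big)(T,x)\,dx+\int_0^T\int_{\mathbb{T}^{d}}\Big[\mu|\nabla v|^2+(\mu+\lambda)|\mathrm{div}\,v|^2\Big]dx\,dt=\int_{\mathbb{T}^{d}}\Big(\tfrac12\rho_0|v_0|^2+\tfrac{\rho_0^{\gamma}}{\gamma-1}\Big)dx$$ holds if one of the following four conditions is satisfied (where $c_2$ denotes a constant): (1) $0\le\rho\le c_2<\infty$, $\nabla\sqrt\rho\in L^4(0,T;L^4(\mathbb{T}^d))$, $\nabla v\in L^2(0,T;L^2(\mathbb{T}^d))$, $v_0\in L^2(\mathbb{T}^d)$, and $v\in L^4(0,T;L^4(\mathbb{T}^d))$; (2) $0\le\rho\le c_2<\infty$, $\nabla\sqrt\rho\in L^4(0,T;L^4(\mathbb{T}^d))$, $\nabla v\in L^2(0,T;L^2(\mathbb{T}^d))$,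 $v_0\in L^2(\mathbb{T}^d)$, and $v\in L^p(0,T;L^q(\mathbb{T}^d))$ for some $p,q$ with $\frac1p+\frac3q=1$ and $3<q\le4$; (3) $0\le\rho\le c_2<\infty$, $\nabla\sqrt\rho\in L^4(0,T;L^2(\mathbb{T}^d))$, $\nabla v\in L^2(0,T;L^2(\mathbb{T}^d))$, $v_0\in L^3(\mathbb{T}^d)$, and $v\in L^4(0,T;L^6(\mathbb{T}^d))$; (4) $0\le\rho\le c_2<\infty$, $\nabla\sqrt\rho\in L^4(0,T;L^4(\mathbb{T}^d))$, $\nabla v\in L^2(0,T;L^2(\mathbb{T}^d))$, $v_0\in L^2(\mathbb{T}^d)$, and $\nabla v\in L^p(0,T;L^r(\mathbb{T}^d))$ for some $p,r$ with $\frac1p+\frac3r=1+\frac3d$ and $\frac{3d}{d+3}<r\le\frac{4d}{d+4}$.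
   Context: $\Omega=\mathbb{T}^d$ is the $d$-dimensional flat torus (periodic domain). $\rho\ge0$ is the density (vacuum allowed), $v$ is the $\mathbb{R}^d$-valued velocity, and the pressure is $P(\rho)=\rho^\gamma$. By convention $v_0=0$ on $\{x\in\Omega:\rho_0(x)=0\}$. $L^p(0,T;X)$ is the set of measurable functions $f$ on $(0,T)$ with values in $X$ such that $\|f(t,\cdot)\|_X\in L^p(0,T)$. Weak solution: a pair $(\rho,v)$ is a weak solution with initial data $(\rho_0,\rho_0v_0)$ if (i) the equations hold in the sense of distributions on $(0,T)\times\Omega$, with $P(\rho),\ \rho|v|^2\in L^\infty(0,T;L^1(\Omega))$ and $\nabla v\in L^2(0,T;L^2(\Omega))$; (ii) $\rho$ is a renormalized solution of the continuity equation in the sense of DiPerna-Lions, i.e. $\partial_t b(\rho)+\mathrm{div}(b(\rho)v)+(b'(\rho)\rho-b(\rho))\,\mathrm{div}\,v=0$ in the sense of distributions for every $b\in C^1([0,\infty))$ with $b'(z)=0$ for all sufficiently large $z$; (iii) the energy inequality $E(t)+\int_0^t\int_\Omega(\mu|\nabla v|^2+(\mu+\lambda)|\mathrm{div}\,v|^2)\,dx\,ds\le E(0)$ holds for a.e. $t\in(0,T)$, where $E(t)=\int_\Omega(\frac12\rho|v|^2+\frac{\rho^\gamma}{\gamma-1})(t,x)\,dx$ and $E(0)=\int_\Omega(\frac12\rho_0|v_0|^2+\frac{\rho_0^\gamma}{\gamma-1})dx$. Values at a fixed time are understood through the weakly continuous in time representatives of $\rho$ and $\rho v$, with $\frac12\rho|v|^2$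 read as $|\rho v|^2/(2\rho)$ on $\{\rho>0\}$ and $0$ on $\{\rho=0\}$. *)

theory Defs
  imports "HOL-Analysis.Analysis"
begin

text \<open>
  The torus is \<open>\<real>\<^sup>d / \<int>\<^sup>d\<close>, \<open>d = CARD('d)\<close>. A measurable function on it is, up to null sets,
  a measurable function on the unit cell, so densities, velocities and the like are functions on
  \<^typ>\<open>real^'d\<close> of which only the values on the cell matter. The periodic structure enters through
  the test functions, which are smooth and periodic on the whole space.
\<close>

definition torus :: "(real^'d::finite) measure"
  where "torus = restrict_space lborel (cbox 0 1)"

definition time :: "real \<Rightarrow> real measure"
  where "time T = restrict_space lborel {0<..<T}"

abbreviation spacetime :: "real \<Rightarrow> (real \<times> (real^'d::finite)) measure"
  where "spacetime T \<equiv> time T \<Otimes>\<^sub>M torus"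


subsection \<open>Lebesgue and Bochner spaces\<close>

definition Lp :: "'a measure \<Rightarrow> real \<Rightarrow> ('a \<Rightarrow> 'b::real_normed_vector) set"
  where "Lp M p = {f. f \<in> borel_measurable M \<and> integrable M (\<lambda>x. norm (f x) powr p)}"

definition Lp_norm :: "'a measure \<Rightarrow> real \<Rightarrow> ('a \<Rightarrow> 'b::real_normed_vector) \<Rightarrow> real"
  where "Lp_norm M p f = (\<integral>x. norm (f x) powr p \<partial>M) powr (1 / p)"

definition LpLq :: "real \<Rightarrow> real \<Rightarrow> real \<Rightarrow> (real \<Rightarrow> real^'d::finite \<Rightarrow> 'b::real_normed_vector) set"
  where "LpLq T p q = {f. (\<lambda>(t, x). f t x) \<in> borel_measurable (spacetime T)
    \<and> (AE t in time T. f t \<in> Lp torus q)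
    \<and> (\<lambda>t. Lp_norm torus q (f t)) \<in> Lp (time T) p}"

definition LinfL1 :: "real \<Rightarrow> (real \<Rightarrow> real^'d::finite \<Rightarrow> 'b::real_normed_vector) set"
  where "LinfL1 T = {f. (\<lambda>(t, x). f t x) \<in> borel_measurable (spacetime T)
    \<and> (AE t in time T. f t \<in> Lp torus 1)
    \<and> (\<exists>C. AE t in time T. Lp_norm torus 1 (f t) \<le> C)}"

definition L1_loc :: "real \<Rightarrow> (real \<Rightarrow> real^'d::finite \<Rightarrow> 'b::euclidean_space) set"
  where "L1_loc T = {f. (\<lambda>(t, x). f t x) \<in> borel_measurable (spacetime T)
    \<and> (\<forall>a b. 0 < a \<longrightarrow> b < T \<longrightarrow> set_integrable (spacetime T) ({a..b} \<times> UNIV) (\<lambda>(t, x). f t x))}"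


subsection \<open>Test functions and weak gradients\<close>

primrec C_k :: "nat \<Rightarrow> ('a::euclidean_space \<Rightarrow> real) \<Rightarrow> bool" where
  "C_k 0 f \<longleftrightarrow> continuous_on UNIV f"
| "C_k (Suc k) f \<longleftrightarrow> (\<forall>x. f differentiable (at x))
      \<and> (\<forall>b\<in>Basis. C_k k (\<lambda>x. frechet_derivative f (at x) b))"

definition smooth :: "('a::euclidean_space \<Rightarrow> real) \<Rightarrow> bool"
  where "smooth f \<longleftrightarrow> (\<forall>k. C_k k f)"

definition test_fun :: "real \<Rightarrow> (real \<times> (real^'d::finite) \<Rightarrow> real) \<Rightarrow> bool"
  where "test_fun T \<phi> \<longleftrightarrow> smooth \<phi>
    \<and> (\<forall>t x i. \<phi> (t, x + axis i 1) = \<phi> (t, x))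
    \<and> (\<exists>a b. 0 < a \<and> b < T \<and> (\<forall>t x. t \<notin> {a..b} \<longrightarrow> \<phi> (t, x) = 0))"

definition dt :: "(real \<times> (real^'d::finite) \<Rightarrow> real) \<Rightarrow> real \<Rightarrow> real^'d \<Rightarrow> real"
  where "dt \<phi> t x = frechet_derivative \<phi> (at (t, x)) (1, 0)"

definition grad :: "(real \<times> (real^'d::finite) \<Rightarrow> real) \<Rightarrow> real \<Rightarrow> real^'d \<Rightarrow> real^'d"
  where "grad \<phi> t x = (\<chi> i. frechet_derivative \<phi> (at (t, x)) (0, axis i 1))"

definition weak_grad ::
    "real \<Rightarrow> (real \<Rightarrow> real^'d::finite \<Rightarrow> real) \<Rightarrow> (real \<Rightarrow> real^'d \<Rightarrow> real^'d) \<Rightarrow> bool"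
  where "weak_grad T f G \<longleftrightarrow> f \<in> L1_loc T \<and> G \<in> L1_loc T
    \<and> (\<forall>\<phi>. test_fun T \<phi> \<longrightarrow>
        (\<integral>(t, x). f t x *\<^sub>R grad \<phi> t x \<partial>spacetime T)
          = - (\<integral>(t, x). \<phi> (t, x) *\<^sub>R G t x \<partial>spacetime T))"

text \<open>\<open>Dv t x $ i $ j\<close> is \<open>\<partial>\<^sub>j v\<^sub>i\<close>, so \<^term>\<open>norm (Dv t x)\<close> is the Frobenius norm
  and \<^term>\<open>trace (Dv t x)\<close> the divergence.\<close>

definition weak_grad_vec ::
    "real \<Rightarrow> (real \<Rightarrow> real^'d::finite \<Rightarrow> real^'d) \<Rightarrow> (real \<Rightarrow> real^'d \<Rightarrow> real^'d^'d) \<Rightarrow> bool"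
  where "weak_grad_vec T v Dv \<longleftrightarrow> (\<forall>i. weak_grad T (\<lambda>t x. v t x $ i) (\<lambda>t x. Dv t x $ i))"


subsection \<open>Weakly continuous representatives\<close>

definition weakly_continuous ::
    "real \<Rightarrow> real \<Rightarrow> (real \<Rightarrow> real^'d::finite \<Rightarrow> 'b::euclidean_space) \<Rightarrow> bool"
  where "weakly_continuous T p f \<longleftrightarrow> (\<forall>t\<in>{0..T}. f t \<in> Lp torus p)
    \<and> (\<forall>g\<in>Lp torus (p / (p - 1)). continuous_on {0..T} (\<lambda>t. \<integral>x. f t x \<bullet> g x \<partial>torus))"

definition weak_rep :: "real \<Rightarrow> real \<Rightarrow> (real \<Rightarrow> real^'d::finite \<Rightarrow> 'b::euclidean_space)
    \<Rightarrow> (real \<Rightarrow> real^'d \<Rightarrow> 'b) \<Rightarrow> bool"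
  where "weak_rep T p f fc \<longleftrightarrow> weakly_continuous T p fc
    \<and> (AE t in time T. AE x in torus. fc t x = f t x)"

text \<open>The bounds \<open>\<rho>\<^sup>\<gamma>, \<rho> |v|\<^sup>2 \<in> L\<^sup>\<infinity>(0,T;L\<^sup>1)\<close> put \<open>\<rho>\<close> in \<open>L\<^sup>\<infinity>(0,T;L\<^sup>\<gamma>)\<close> and, by Hoelder,
  \<open>\<rho> v\<close> in \<open>L\<^sup>\<infinity>(0,T;L\<^sup>p)\<close> with \<open>p = 2\<gamma>/(\<gamma>+1)\<close>. At each time of \<open>[0,T]\<close> the representatives below
  are unique up to null sets of the torus.\<close>

definition density_momentum_rep :: "real \<Rightarrow> real \<Rightarrow> (real \<Rightarrow> real^'d::finite \<Rightarrow> real)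
    \<Rightarrow> (real \<Rightarrow> real^'d \<Rightarrow> real^'d) \<Rightarrow> (real \<Rightarrow> real^'d \<Rightarrow> real) \<Rightarrow> (real \<Rightarrow> real^'d \<Rightarrow> real^'d) \<Rightarrow> bool"
  where "density_momentum_rep T \<gamma> \<rho> v \<rho>c mc \<longleftrightarrow> weak_rep T \<gamma> \<rho> \<rho>c
    \<and> weak_rep T (2 * \<gamma> / (\<gamma> + 1)) (\<lambda>t x. \<rho> t x *\<^sub>R v t x) mc"


subsection \<open>Energy and dissipation\<close>

definition energy :: "real \<Rightarrow> (real^'d::finite \<Rightarrow> real) \<Rightarrow> (real^'d \<Rightarrow> real^'d) \<Rightarrow> ennreal"
  where "energy \<gamma> r u =
    (\<integral>\<^sup>+x. ennreal (1 / 2 * r x * (norm (u x))\<^sup>2 + r x powr \<gamma> / (\<gamma> - 1)) \<partial>torus)"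

text \<open>The same energy in terms of the momentum \<open>m\<close> instead of the velocity.\<close>

definition energy_mom :: "real \<Rightarrow> (real^'d::finite \<Rightarrow> real) \<Rightarrow> (real^'d \<Rightarrow> real^'d) \<Rightarrow> ennreal"
  where "energy_mom \<gamma> r m =
    (\<integral>\<^sup>+x. ennreal ((if r x > 0 then (norm (m x))\<^sup>2 / (2 * r x) else 0) + r x powr \<gamma> / (\<gamma> - 1)) \<partial>torus)"

text \<open>The integrand is nonnegative, so that nothing is truncated, when \<open>\<mu> \<ge> 0\<close>, \<open>2 \<mu> + d \<lambda> > 0\<close>
  and \<open>d \<ge> 2\<close>: then \<open>\<mu> + \<lambda> > (1 - 2 / d) \<mu> \<ge> 0\<close>.\<close>

definition dissipation :: "real \<Rightarrow> real \<Rightarrow> real \<Rightarrow> (real \<Rightarrow> real^'d::finite \<Rightarrow> real^'d^'d) \<Rightarrow> ennreal"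
  where "dissipation \<mu> lam s Dv =
    (\<integral>\<^sup>+t. (\<integral>\<^sup>+x. ennreal (\<mu> * (norm (Dv t x))\<^sup>2 + (\<mu> + lam) * (trace (Dv t x))\<^sup>2) \<partial>torus) \<partial>time s)"


subsection \<open>Weak solutions\<close>

definition continuity_eq ::
    "real \<Rightarrow> (real \<Rightarrow> real^'d::finite \<Rightarrow> real) \<Rightarrow> (real \<Rightarrow> real^'d \<Rightarrow> real^'d) \<Rightarrow> bool"
  where "continuity_eq T \<rho> v \<longleftrightarrow> (\<forall>\<phi>. test_fun T \<phi> \<longrightarrow>
    (\<integral>(t, x). \<rho> t x * dt \<phi> t x + \<rho> t x * (v t x \<bullet> grad \<phi> t x) \<partial>spacetime T) = 0)"

definition momentum_eq :: "real \<Rightarrow> real \<Rightarrow> real \<Rightarrow> real \<Rightarrow> (real \<Rightarrow> real^'d::finite \<Rightarrow> real)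
    \<Rightarrow> (real \<Rightarrow> real^'d \<Rightarrow> real^'d) \<Rightarrow> (real \<Rightarrow> real^'d \<Rightarrow> real^'d^'d) \<Rightarrow> bool"
  where "momentum_eq T \<gamma> \<mu> lam \<rho> v Dv \<longleftrightarrow> (\<forall>\<phi> i. test_fun T \<phi> \<longrightarrow>
    (\<integral>(t, x). \<rho> t x * v t x $ i * dt \<phi> t x
        + \<rho> t x * v t x $ i * (v t x \<bullet> grad \<phi> t x)
        + \<rho> t x powr \<gamma> * grad \<phi> t x $ i
        - \<mu> * (Dv t x $ i \<bullet> grad \<phi> t x)
        - (\<mu> + lam) * trace (Dv t x) * grad \<phi> t x $ i \<partial>spacetime T) = 0)"

definition renormalized :: "real \<Rightarrow> (real \<Rightarrow> real^'d::finite \<Rightarrow> real)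
    \<Rightarrow> (real \<Rightarrow> real^'d \<Rightarrow> real^'d) \<Rightarrow> (real \<Rightarrow> real^'d \<Rightarrow> real^'d^'d) \<Rightarrow> bool"
  where "renormalized T \<rho> v Dv \<longleftrightarrow> (\<forall>b b' :: real \<Rightarrow> real.
      (\<forall>z\<ge>0. (b has_real_derivative b' z) (at z within {0..})) \<and> continuous_on {0..} b'
        \<and> (\<exists>M. \<forall>z\<ge>M. b' z = 0) \<longrightarrow>
      (\<forall>\<phi>. test_fun T \<phi> \<longrightarrow>
        (\<integral>(t, x). b (\<rho> t x) * dt \<phi> t x + b (\<rho> t x) * (v t x \<bullet> grad \<phi> t x)
            - (b' (\<rho> t x) * \<rho> t x - b (\<rho> t x)) * trace (Dv t x) * \<phi> (t, x) \<partial>spacetime T) = 0))"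

text \<open>\<open>Dv\<close> is the weak gradient of \<open>v\<close>, determined by \<open>v\<close> up to null sets.\<close>

definition weak_solution :: "real \<Rightarrow> real \<Rightarrow> real \<Rightarrow> real
    \<Rightarrow> (real^'d::finite \<Rightarrow> real) \<Rightarrow> (real^'d \<Rightarrow> real^'d)
    \<Rightarrow> (real \<Rightarrow> real^'d \<Rightarrow> real) \<Rightarrow> (real \<Rightarrow> real^'d \<Rightarrow> real^'d) \<Rightarrow> (real \<Rightarrow> real^'d \<Rightarrow> real^'d^'d) \<Rightarrow> bool"
  where "weak_solution T \<gamma> \<mu> lam \<rho>0 v0 \<rho> v Dv \<longleftrightarrow>
      (\<lambda>(t, x). \<rho> t x) \<in> borel_measurable (spacetime T)
    \<and> (\<lambda>(t, x). v t x) \<in> borel_measurable (spacetime T)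
    \<and> (AE (t, x) in spacetime T. 0 \<le> \<rho> t x)
    \<and> weak_grad_vec T v Dv
    \<and> (\<lambda>t x. \<rho> t x powr \<gamma>) \<in> LinfL1 T
    \<and> (\<lambda>t x. \<rho> t x * (norm (v t x))\<^sup>2) \<in> LinfL1 T
    \<and> Dv \<in> LpLq T 2 2
    \<and> continuity_eq T \<rho> v
    \<and> momentum_eq T \<gamma> \<mu> lam \<rho> v Dv
    \<and> renormalized T \<rho> v Dv
    \<and> (AE t in time T. energy \<gamma> (\<rho> t) (v t) + dissipation \<mu> lam t Dv \<le> energy \<gamma> \<rho>0 v0)
    \<and> \<rho>0 \<in> borel_measurable torus \<and> v0 \<in> borel_measurable torus
    \<and> (\<exists>\<rho>c mc. density_momentum_rep T \<gamma> \<rho> v \<rho>c mc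
        \<and> (AE x in torus. \<rho>c 0 x = \<rho>0 x) \<and> (AE x in torus. mc 0 x = \<rho>0 x *\<^sub>R v0 x))"

end

theory Submission
  imports Defs
begin

text \<open>
  For every smooth periodic \<open>U\<close> the kinetic energy at time \<open>t\<close> is at least
  \<open>\<integral> m \<cdot> U - 1/2 \<integral> \<rho> |U|\<^sup>2\<close>, with defect \<open>1/2 \<integral> \<rho> |v - U|\<^sup>2\<close>. Take for \<open>U\<close> the mollification
  of \<open>v(s)\<close>, for \<open>t\<close> the time \<open>s + h\<close>, capped at \<open>T\<close>, and average over \<open>s\<close>. Removing the mollifier
  and then letting \<open>h\<close> tend to \<open>0\<close> gives the kinetic energy balance as an inequality from below,
  without commutators; this needs only a bounded density, \<open>v \<in> L\<^sup>4\<close> and \<open>\<nabla>v \<in> L\<^sup>2\<close> in space-time.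
  The internal energy follows from the renormalized equation in the interior, and up to time \<open>T\<close>
  because \<open>\<nabla>\<surd>\<rho> \<in> L\<^sup>2\<close> makes \<open>\<rho>\<close> strongly continuous there. The opposite inequality is lower
  semicontinuity. Conditions (2) and (4) reduce to \<open>v \<in> L\<^sup>4\<close> by Sobolev's inequality and
  interpolation; for (4) the mean of \<open>v\<close> is controlled through the total mass, and if that vanishes
  all the energies do.
\<close>

text \<open>The obstacle is at the two end times: energies there are read off weakly continuous
  representatives, along which they are only lower semicontinuous. At time 0 this has the right
  sign, since averages over a short initial layer dominate the initial energy in the limit. At time
  T it has the wrong one; the cap makes the final kinetic term the value at T itself, while the
  internal energy needs strong convergence of the density. With U frozen, the lower bound is linear
  in density and momentum, so its increment is exact by the two balance laws. The defect at the base
  time vanishes with the mollifier because U then tends to v; the defect at the later time is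
  nonnegative and is dropped. In the increment the convective part of the momentum flux meets the
  mass flux times the gradient of \<open>|U|^2 / 2\<close>, and the two cancel in the limit. These
  are products of type L^4 L^4 L^2, whence the exponent 4. The remaining pressure work cancels
  against that of the internal energy.\<close>

abbreviation borel_functions ("\<B>") where "\<B> \<equiv> borel_measurable"
abbreviation space_time ("\<S>") where "\<S> \<equiv> spacetime"
abbreviation torus_integral :: "(real^'d::finite => 'b::{banach, second_countable_topology}) => 'b" (binder "\<oint>" [60] 60)
  where "torus_integral f \<equiv> integral\<^sup>L torus f"
abbreviation torus_nn_integral :: "(real^'d::finite => ennreal) => ennreal" (binder "NN " [60] 60)
  where "torus_nn_integral f \<equiv> integral\<^sup>N torus f"
abbreviation sequence_limit :: "(nat => 'a::topological_space) => 'a => bool" (infix "\<leadsto>" 60)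
  where "X \<leadsto> a \<equiv> X \<longlonglongrightarrow> a"

lemmas L_integrable_add = Bochner_Integration.integrable_add
lemmas L_integrable_bound = Bochner_Integration.integrable_bound
lemmas L_integrable_cong = Bochner_Integration.integrable_cong
lemmas L_integrable_diff = Bochner_Integration.integrable_diff
lemmas L_integrable_sum = Bochner_Integration.integrable_sum
lemmas L_integral_add = Bochner_Integration.integral_add
lemmas L_integral_cong = Bochner_Integration.integral_cong
lemmas L_integral_diff = Bochner_Integration.integral_diff
lemmas L_integral_indicator = Bochner_Integration.integral_indicator
lemmas L_integral_nonneg = Bochner_Integration.integral_nonneg
lemmas L_integral_sum = Bochner_Integration.integral_sum

section \<open>Calculus of smooth functions\<close>

lemma C_k_SucI:
 assumes "!!x. (f has_derivative f' x) (at x)" "!!b. b \<in> Basis ==> C_k k (%x. f' x b)"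
 shows "C_k (Suc k) f"
proof -
 have "frechet_derivative f (at x) = f' x" for x
  using frechet_derivative_at[OF assms(1)] by simp
 then show ?thesis using assms by (auto simp: differentiable_def)
qed

lemma C_k_Suc_has_derivative:
 "C_k (Suc k) f ==> (f has_derivative frechet_derivative f (at x)) (at x)"
 using frechet_derivative_works by (auto simp del: )

text \<open>\<open>C_k (Suc k)\<close> speaks of derivatives only, so the lower order is recovered
  by induction, with differentiability giving continuity at the bottom.\<close>

lemma C_k_SucD: "C_k (Suc k) f ==> C_k k f"
proof (induction k arbitrary: f)
 case 0
 then have "!!x. isCont f x" by (auto intro: differentiable_imp_continuous_within)
 then show ?case by (simp add: continuous_on_eq_continuous_at)
next
 case (Suc k)
 show ?case
  unfolding C_k.simps(2)[of k]
 proof (intro conjI allI ballI)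
  fix x show "f differentiable at x" using Suc.prems by simp
  fix b :: 'a assume "b \<in> Basis"
  then have "C_k (Suc k) (%x. frechet_derivative f (at x) b)" using Suc.prems by simp
  then show "C_k k (%x. frechet_derivative f (at x) b)" by (rule Suc.IH)
 qed
qed

lemma C_k_const: "C_k k (%x. c)"
proof (induction k arbitrary: c)
 case (Suc k)
 show ?case by (rule C_k_SucI[where f' = "%_ _. 0"]) (auto intro: Suc)
qed auto

lemma C_k_add: "C_k k f ==> C_k k g ==> C_k k (%x. f x + g x)"
proof (induction k arbitrary: f g)
 case 0
 then show ?case by (auto intro: continuous_intros)
next
 case (Suc k)
 show ?case
  by (rule C_k_SucI[OF has_derivative_add[OF C_k_Suc_has_derivative[OF Suc.prems(1)]
    C_k_Suc_has_derivative[OF Suc.prems(2)]]])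
   (use Suc in auto)
qed

lemma C_k_mult: "C_k k f ==> C_k k g ==> C_k k (%x. f x * g x)"
proof (induction k arbitrary: f g)
 case 0
 then show ?case by (auto intro: continuous_intros)
next
 case (Suc k)
 show ?case
 proof (rule C_k_SucI[OF has_derivative_mult[OF C_k_Suc_has_derivative[OF Suc.prems(1)]
    C_k_Suc_has_derivative[OF Suc.prems(2)]]])
  fix b :: 'a assume b: "b \<in> Basis"
  show "C_k k (%x. f x * frechet_derivative g (at x) b + frechet_derivative f (at x) b * g x)"
   using Suc.prems b by (intro C_k_add Suc.IH) (auto intro: C_k_SucD simp del: C_k.simps(2) simp: C_k.simps(2)[of k])
 qed
qed

lemma C_k_sum: "(!!i. i \<in> I ==> C_k k (f i)) ==> C_k k (%x. \<Sum>i\<in>I. f i x)"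
 by (induction I rule: infinite_finite_induct) (auto intro: C_k_const C_k_add)

lemma C_k_prod: "(!!i. i \<in> I ==> C_k k (f i)) ==> C_k k (%x. \<Prod>i\<in>I. f i x)"
 by (induction I rule: infinite_finite_induct) (auto intro: C_k_const C_k_mult)

lemma C_k_compose_linear:
 fixes f :: "'a::euclidean_space => real" and L :: "'b::euclidean_space => 'a"
 assumes L: "bounded_linear L"
 shows "C_k k f ==> C_k k (%x. f (L x))"
proof (induction k arbitrary: f)
 case 0
 then show ?case
  using linear_continuous_on[OF L, of UNIV] by (auto intro: continuous_on_compose2)
next
 case (Suc k)
 let ?D = "frechet_derivative f"
 show ?case
 proof (rule C_k_SucI[where f' = "%x b. ?D (at (L x)) (L b)"])
  show "((%x. f (L x)) has_derivative (%b. ?D (at (L x)) (L b))) (at x)" for x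
   using has_derivative_compose[OF bounded_linear_imp_has_derivative[OF L]
     C_k_Suc_has_derivative[OF Suc.prems]] by simp
  fix b :: 'b
  have lin: "linear (?D (at y))" for y
   using C_k_Suc_has_derivative[OF Suc.prems] has_derivative_linear by blast
  \<comment> \<open>\<open>L b\<close> need not be a basis vector, while \<open>C_k\<close> knows
    derivatives along \<open>Basis\<close> only; expanding by linearity makes the induction
    hypothesis applicable.\<close>
  have "?D (at (L x)) (L b) = (\<Sum>c\<in>Basis. (L b \<bullet> c) * ?D (at (L x)) c)" for x
  proof -
   have "?D (at (L x)) (L b) = ?D (at (L x)) (\<Sum>c\<in>Basis. (L b \<bullet> c) *\<^sub>R c)"
    by (simp add: euclidean_representation)
   also have "... = (\<Sum>c\<in>Basis. (L b \<bullet> c) * ?D (at (L x)) c)"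
    by (simp add: linear_sum[OF lin] linear_cmul[OF lin])
   finally show ?thesis .
  qed
  moreover have "C_k k (%x. \<Sum>c\<in>Basis. (L b \<bullet> c) * ?D (at (L x)) c)"
   using Suc by (intro C_k_sum C_k_mult C_k_const) auto
  ultimately show "C_k k (%x. ?D (at (L x)) (L b))" by simp
 qed
qed

lemma C_k_SucI_real:
 fixes f :: "real => real"
 assumes "!!x. (f has_real_derivative f' x) (at x)" "C_k k f'"
 shows "C_k (Suc k) f"
 by (rule C_k_SucI[OF assms(1)[unfolded has_field_derivative_def]]) (use assms(2) in auto)

lemma smooth_const [simp]: "smooth (%x. c)"
 by (simp add: smooth_def C_k_const)

lemma smooth_add: "smooth f ==> smooth g ==> smooth (%x. f x + g x)"
 by (simp add: smooth_def C_k_add)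

lemma smooth_mult: "smooth f ==> smooth g ==> smooth (%x. f x * g x)"
 by (simp add: smooth_def C_k_mult)

lemma smooth_diff: "smooth f ==> smooth g ==> smooth (%x. f x - g x)"
 using smooth_add[of f "%x. (-1) * g x"] smooth_mult[of "%x. -1" g] by simp

lemma smooth_sum: "(!!i. i \<in> I ==> smooth (f i)) ==> smooth (%x. \<Sum>i\<in>I. f i x)"
 by (simp add: smooth_def C_k_sum)

lemma smooth_prod: "(!!i. i \<in> I ==> smooth (f i)) ==> smooth (%x. \<Prod>i\<in>I. f i x)"
 by (simp add: smooth_def C_k_prod)

lemma smooth_power: "smooth f ==> smooth (%x. f x ^ n)"
 by (induction n) (auto intro: smooth_mult)

lemma smooth_compose_linear:
 "bounded_linear L ==> smooth f ==> smooth (%x. f (L x))"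
 by (simp add: smooth_def C_k_compose_linear)

lemma smooth_has_derivative: "smooth f ==> (f has_derivative frechet_derivative f (at x)) (at x)"
 using C_k_Suc_has_derivative[of 0 f] by (auto simp: smooth_def)

lemma smooth_continuous_on: "smooth f ==> continuous_on A f"
 unfolding smooth_def by (metis C_k.simps(1) continuous_on_subset top_greatest)

lemma smooth_frechet_derivative:
 assumes f: "smooth (f :: 'a::euclidean_space => real)"
 shows "smooth (%x. frechet_derivative f (at x) b)"
proof -
 have lin: "linear (frechet_derivative f (at x))" for x
  using smooth_has_derivative[OF f] has_derivative_linear by blast
 have "frechet_derivative f (at x) b = (\<Sum>c\<in>Basis. (b \<bullet> c) * frechet_derivative f (at x) c)" for x
 proof -
  have "frechet_derivative f (at x) b = frechet_derivative f (at x) (\<Sum>c\<in>Basis. (b \<bullet> c) *\<^sub>R c)"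
   by (simp add: euclidean_representation)
  also have "... = (\<Sum>c\<in>Basis. (b \<bullet> c) * frechet_derivative f (at x) c)"
   by (simp add: linear_sum[OF lin] linear_cmul[OF lin])
  finally show ?thesis .
 qed
 moreover have "smooth (%x. frechet_derivative f (at x) c)" if "c \<in> Basis" for c
  using f that unfolding smooth_def by (metis C_k.simps(2))
 ultimately show ?thesis by (auto intro!: smooth_sum smooth_mult)
qed

lemma smooth_realI:
 fixes f :: "real => real"
 assumes "!!x. (f has_real_derivative f' x) (at x)" "smooth f'"
 shows "smooth f"
 unfolding smooth_def
proof
 \<comment> \<open>Order \<open>k + 1\<close> is shown and then lowered, which covers
   \<open>k = 0\<close> as well.\<close>
 fix k show "C_k k f"
  by (rule C_k_SucD, rule C_k_SucI_real[OF assms(1)]) (use assms(2) in \<open>auto simp: smooth_def\<close>)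
qed

text \<open>The phase \<open>d\<close> is general because differentiation shifts it by
  \<open>pi / 2\<close>; the family is then closed under derivatives.\<close>

lemma smooth_cos: "smooth (%x::real. cos (c * x + d))"
proof -
 have "C_k k (%x::real. cos (c * x + d))" for k d
 proof (induction k arbitrary: d)
  case (Suc k)
  show ?case
  proof (rule C_k_SucI_real)
   show "((%x. cos (c * x + d)) has_real_derivative c * cos (c * x + (d + pi / 2))) (at x)" for x
   proof -
    have "((%x. cos (c * x + d)) has_real_derivative - sin (c * x + d) * c) (at x)"
     by (auto intro!: derivative_eq_intros)
    moreover have "cos (c * x + (d + pi / 2)) = - sin (c * x + d)"
     using minus_sin_cos_eq[of "c * x + d"] by (simp only: add.assoc of_real_eq_id id_apply)
    ultimately show ?thesis by (simp add: mult.commute)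
   qed
   show "C_k k (%x. c * cos (c * x + (d + pi / 2)))"
    by (intro C_k_mult C_k_const Suc)
  qed
 qed (auto intro!: continuous_intros)
 then show ?thesis by (simp add: smooth_def)
qed


section \<open>Smooth bumps and steps on the line\<close>

definition flat_exp :: "real poly => real => real"
 where "flat_exp p x = (if x > 0 then poly p (1 / x) * exp (- (1 / x)) else 0)"

lemma poly_times_exp_tendsto_0: "((%y::real. poly p y * exp (- y)) \<longlongrightarrow> 0) at_top"
proof -
 \<comment> \<open>The free power \<open>y ^ k\<close> absorbs the factor \<open>y\<close> that
   \<open>pCons\<close> puts in front of the remaining polynomial.\<close>
 have "((%y::real. y ^ k * (poly p y * exp (- y))) \<longlongrightarrow> 0) at_top" for k
 proof (induction p arbitrary: k)
  case (pCons a p)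
  have "((%y::real. a * (y ^ k / exp y) + y ^ Suc k * (poly p y * exp (- y))) \<longlongrightarrow> a * 0 + 0) at_top"
   by (rule tendsto_add[OF tendsto_mult[OF tendsto_const tendsto_power_div_exp_0] pCons.IH])
  moreover have "(%y::real. a * (y ^ k / exp y) + y ^ Suc k * (poly p y * exp (- y)))
    = (%y. y ^ k * (poly (pCons a p) y * exp (- y)))"
   by (rule ext) (simp add: exp_minus divide_inverse algebra_simps)
  ultimately show ?case by simp
 qed simp
 from this[of 0] show ?thesis by simp
qed

lemma flat_exp_tendsto_0: "(flat_exp p \<longlongrightarrow> 0) (at 0)"
proof (rule filterlim_split_at)
 show "(flat_exp p \<longlongrightarrow> 0) (at_left 0)"
  by (rule tendsto_eventually) (auto simp: flat_exp_def eventually_at_filter)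
 have "((%x. poly p (inverse x) * exp (- inverse x)) \<longlongrightarrow> 0) (at_right 0)"
  by (rule filterlim_compose[OF poly_times_exp_tendsto_0 filterlim_inverse_at_top_right])
 then have "((%x. poly p (1 / x) * exp (- (1 / x))) \<longlongrightarrow> 0) (at_right 0)"
  by (simp only: inverse_eq_divide)
 then show "(flat_exp p \<longlongrightarrow> 0) (at_right 0)"
  by (rule Lim_transform_eventually) (auto simp: flat_exp_def eventually_at_filter)
qed

text \<open>With \<open>y = 1 / x\<close>, the derivative of \<open>p(y) exp(-y)\<close> is
  \<open>y^2 (p - p')(y) exp(-y)\<close>. The family is closed under differentiation, which makes
  smoothness one induction over all \<open>p\<close>.\<close>

lemma flat_exp_DERIV:
 "(flat_exp p has_real_derivative flat_exp ([:0, 0, 1:] * (p - pderiv p)) x) (at x)"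
proof (cases x "0::real" rule: linorder_cases)
 case less
 have "((%_. 0) has_real_derivative 0) (at x)" by simp
 then have "(flat_exp p has_real_derivative 0) (at x)"
  by (rule has_field_derivative_transform_within_open[of _ _ _ "{..<0}"])
   (use less in \<open>auto simp: flat_exp_def\<close>)
 then show ?thesis using less by (simp add: flat_exp_def)
next
 case equal
 \<comment> \<open>The difference quotient at 0 stays in the family: dividing by \<open>h\<close>
   multiplies the polynomial by its variable.\<close>
 have "((%h. flat_exp p h / h) \<longlongrightarrow> 0) (at 0)"
  by (rule Lim_transform_eventually[OF flat_exp_tendsto_0[of "pCons 0 p"]])
   (auto simp: flat_exp_def eventually_at_filter)
 then have "(flat_exp p has_real_derivative 0) (at 0)"
  by (simp add: DERIV_def flat_exp_def)
 then show ?thesis using equal by (simp add: flat_exp_def)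
next
 case greater
 have inv: "((%x. 1 / x) has_real_derivative - (1 / x * (1 / x))) (at x)"
  using greater by (auto intro!: derivative_eq_intros simp: field_simps)
 have "((%x. poly p (1 / x) * exp (- (1 / x))) has_real_derivative
   (poly (pderiv p) (1 / x) * - (1 / x * (1 / x))) * exp (- (1 / x))
   + (exp (- (1 / x)) * - (- (1 / x * (1 / x)))) * poly p (1 / x)) (at x)"
  by (intro DERIV_mult DERIV_chain2[OF poly_DERIV] DERIV_chain2[OF DERIV_exp] DERIV_minus inv)
 then have "((%x. poly p (1 / x) * exp (- (1 / x))) has_real_derivative
   poly ([:0, 0, 1:] * (p - pderiv p)) (1 / x) * exp (- (1 / x))) (at x)"
  by (rule DERIV_cong) (simp add: algebra_simps)
 then have "(flat_exp p has_real_derivative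
   poly ([:0, 0, 1:] * (p - pderiv p)) (1 / x) * exp (- (1 / x))) (at x)"
  by (rule has_field_derivative_transform_within_open[of _ _ _ "{0<..}"])
   (use greater in \<open>auto simp: flat_exp_def\<close>)
 then show ?thesis using greater by (simp add: flat_exp_def)
qed

lemma smooth_flat_exp: "smooth (flat_exp p)"
proof -
 have "C_k k (flat_exp p)" for k
 proof (induction k arbitrary: p)
  case 0
  have "isCont (flat_exp p) x" for x using DERIV_isCont[OF flat_exp_DERIV] .
  then show ?case by (simp add: continuous_on_eq_continuous_at)
 next
  case (Suc k)
  show ?case by (rule C_k_SucI_real[OF flat_exp_DERIV Suc])
 qed
 then show ?thesis by (simp add: smooth_def)
qed

definition bump :: "real => real"
 where "bump x = flat_exp 1 x * flat_exp 1 (1 - x)"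

lemma smooth_affine_compose:
 fixes f :: "real => real"
 assumes "smooth f"
 shows "smooth (%x. f (c * x + d))"
proof -
 have "C_k k g ==> C_k k (%x. g (c * x + d))" for k and g :: "real => real"
 proof (induction k arbitrary: g)
  case 0
  then show ?case by (auto intro!: continuous_on_compose2[of UNIV g] continuous_intros)
 next
  case (Suc k)
  have "(g has_real_derivative frechet_derivative g (at x) 1) (at x)" for x
  proof -
   have "linear (frechet_derivative g (at x))"
    using C_k_Suc_has_derivative[OF Suc.prems] has_derivative_linear by blast
   then have "frechet_derivative g (at x) h = frechet_derivative g (at x) 1 * h" for h
    using linear_cmul[of "frechet_derivative g (at x)" h 1] by simp
   then have "frechet_derivative g (at x) = (*) (frechet_derivative g (at x) 1)"
    by blast
   then show ?thesis
    unfolding has_field_derivative_def using C_k_Suc_has_derivative[OF Suc.prems, of x] by simp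
  qed
  then have "((%x. g (c * x + d)) has_real_derivative frechet_derivative g (at (c * x + d)) 1 * c) (at x)" for x
   by (rule DERIV_chain2) (auto intro!: derivative_eq_intros)
  then show ?case
  proof (rule C_k_SucI_real)
   have "C_k k (%x. frechet_derivative g (at x) 1)" using Suc.prems by simp
   from Suc.IH[OF this] show "C_k k (%x. frechet_derivative g (at (c * x + d)) 1 * c)"
    by (intro C_k_mult C_k_const)
  qed
 qed
 then show ?thesis using assms by (simp add: smooth_def)
qed

lemma smooth_bump: "smooth bump"
 unfolding bump_def
 using smooth_affine_compose[OF smooth_flat_exp, of 1 "-1" 1]
 by (intro smooth_mult smooth_flat_exp) (simp add: algebra_simps)

lemma bump_nonneg: "0 \<le> bump x"
 by (simp add: bump_def flat_exp_def)

lemma bump_eq_0: "x \<le> 0 \<or> 1 \<le> x ==> bump x = 0"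
 by (auto simp: bump_def flat_exp_def)

lemma bump_pos: "0 < x ==> x < 1 ==> 0 < bump x"
 by (simp add: bump_def flat_exp_def)

text \<open>Since \<open>f\<close> vanishes left of \<open>a\<close>, the base point may be moved to
  the left of \<open>x\<close>; this makes \<open>x\<close> an interior point and yields a two-sided
  derivative also for \<open>x \<le> a\<close>, where the integral is over an empty or trivial
  interval.\<close>

lemma antiderivative_real:
 fixes f :: "real => real"
 assumes "continuous_on UNIV f" and "!!x. x \<le> a ==> f x = 0"
 shows "((%x. integral {a..x} f) has_real_derivative f x) (at x)"
proof -
 have eq: "integral {a..y} f = integral {min a x - 1..y} f" if "y \<ge> min a x - 1" for y
 proof (cases "y \<le> a")
  case True
  have "integral {a..y} f = 0" using True by (cases "y = a") auto
  moreover have "integral {min a x - 1..y} f = integral {min a x - 1..y} (%_. 0)"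
   using True assms(2) by (intro integral_cong) auto
  ultimately show ?thesis by simp
 next
  case False
  have "integral {min a x - 1..a} f + integral {a..y} f = integral {min a x - 1..y} f"
   using False by (intro Henstock_Kurzweil_Integration.integral_combine integrable_continuous_real
     continuous_on_subset[OF assms(1)]) auto
  moreover have "integral {min a x - 1..a} f = integral {min a x - 1..a} (%_. 0)"
   using assms(2) by (intro integral_cong) auto
  ultimately show ?thesis by simp
 qed
 have "((%y. integral {min a x - 1..y} f) has_real_derivative f x) (at x within {min a x - 1..x + 1})"
  by (rule integral_has_real_derivative) (auto intro: continuous_on_subset[OF assms(1)])
 then have "((%y. integral {min a x - 1..y} f) has_real_derivative f x) (at x)"
  by (subst (asm) at_within_interior) auto
 then show ?thesis
  by (rule has_field_derivative_transform_within_open[of _ _ _ "{min a x - 1<..}"]) (auto simp: eq)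
qed

lemma smooth_step_exists:
 obtains S :: "real => real" where "smooth S" "mono S" "!!x. x \<le> 0 ==> S x = 0" "!!x. x \<ge> 1 ==> S x = 1"
proof -
 define I where "I = integral {0..1} bump"
 have cont: "continuous_on A bump" for A by (rule smooth_continuous_on[OF smooth_bump])
 have int: "bump integrable_on {a..b}" for a b
  by (rule integrable_continuous_real[OF cont])
 have "I \<ge> 0" unfolding I_def by (intro Henstock_Kurzweil_Integration.integral_nonneg int) (simp add: bump_nonneg)
 moreover have "I \<noteq> 0"
 proof
  assume "I = 0"
  then have "bump (1/2) = 0"
   using integral_eq_0_iff[OF cont, of 0 1] by (auto simp: I_def bump_nonneg)
  then show False using bump_pos[of "1/2"] by simp
 qed
 ultimately have I: "I > 0" by simp
 define S where "S x = integral {0..x} bump / I" for x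
 have D: "(S has_real_derivative bump x / I) (at x)" for x
  unfolding S_def
  by (rule DERIV_cdivide[OF antiderivative_real[OF cont]]) (simp add: bump_eq_0)
 show thesis
 proof
  show "smooth S"
   using smooth_mult[OF smooth_bump smooth_const[of "1 / I"]] by (intro smooth_realI[OF D]) simp
  show "mono S"
   by (rule monoI, rule DERIV_nonneg_imp_nondecreasing)
    (use D I bump_nonneg in \<open>auto intro!: exI divide_nonneg_pos\<close>)
  show "S x = 0" if "x \<le> 0" for x
   using that by (cases "x = 0") (auto simp: S_def)
  show "S x = 1" if "x \<ge> 1" for x
  proof -
   have "integral {0..1} bump + integral {1..x} bump = integral {0..x} bump"
    using that by (intro Henstock_Kurzweil_Integration.integral_combine int) auto
   moreover have "integral {1..x} bump = integral {1..x} (%_. 0)"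
    by (intro integral_cong) (auto simp: bump_eq_0)
   ultimately show ?thesis using I by (simp add: S_def I_def)
  qed
 qed
qed

lemma smooth_DERIV: "smooth f ==> (f has_real_derivative deriv f x) (at x)"
 using smooth_has_derivative[of f x]
 by (auto simp: DERIV_deriv_iff_real_differentiable differentiable_def)

lemma frechet_derivative_real: "smooth f ==> frechet_derivative f (at x) h = deriv f x * h"
 using frechet_derivative_at[OF smooth_DERIV[unfolded has_field_derivative_def]] by metis

lemma smooth_deriv: "smooth f ==> smooth (deriv f)"
 using smooth_frechet_derivative[of f 1] by (simp add: frechet_derivative_real)

section \<open>Separated test functions\<close>

definition time_test :: "real => (real => real) => bool"
 where "time_test T \<tau> \<longleftrightarrow> smooth \<tau> \<and> (\<exists>a b. 0 < a \<and> b < T \<and> (\<forall>t. t \<notin> {a..b} --> \<tau> t = 0))"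

definition periodic_smooth :: "(real^'d::finite => real) => bool"
 where "periodic_smooth \<psi> \<longleftrightarrow> smooth \<psi> \<and> (\<forall>x i. \<psi> (x + axis i 1) = \<psi> x)"

definition gradient :: "(real^'d::finite => real) => real^'d => real^'d"
 where "gradient \<psi> x = (\<chi> i. frechet_derivative \<psi> (at x) (axis i 1))"

text \<open>Only products of a time factor and a space factor are ever tested: for a fixed space
  factor each weak equation becomes a scalar relation in time.\<close>

lemma test_fun_product:
 fixes \<psi> :: "real^'d::finite => real"
 assumes \<tau>: "time_test T \<tau>" and \<psi>: "periodic_smooth \<psi>"
 shows "test_fun T (%(t, x). \<tau> t * \<psi> x)"
  and "dt (%(t, x). \<tau> t * \<psi> x) t x = deriv \<tau> t * \<psi> x"
  and "grad (%(t, x). \<tau> t * \<psi> x) t x = \<tau> t *\<^sub>R gradient \<psi> x"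
proof -
 let ?\<phi> = "%(t, x). \<tau> t * \<psi> x"
 have s: "smooth \<tau>" "smooth \<psi>" using assms by (auto simp: time_test_def periodic_smooth_def)
 have "smooth (%p::real \<times> (real^'d). \<tau> (fst p) * \<psi> (snd p))"
  by (rule smooth_mult[OF smooth_compose_linear[OF bounded_linear_fst s(1)]
     smooth_compose_linear[OF bounded_linear_snd s(2)]])
 then have "smooth ?\<phi>" by (simp add: case_prod_unfold)
 moreover obtain a b where ab: "0 < a" "b < T" "!!t. t \<notin> {a..b} ==> \<tau> t = 0"
  using \<tau> unfolding time_test_def by blast
 moreover have "?\<phi> (t, x + axis i 1) = ?\<phi> (t, x)" for t x i
  using \<psi> by (simp add: periodic_smooth_def)
 moreover have "?\<phi> (t, x) = 0" if "t \<notin> {a..b}" for t x using ab(3)[OF that] by simp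
 ultimately show "test_fun T ?\<phi>" unfolding test_fun_def by blast
 have "((%p. \<tau> (fst p) * \<psi> (snd p)) has_derivative
   (%h. \<tau> t * frechet_derivative \<psi> (at x) (snd h) + deriv \<tau> t * fst h * \<psi> x)) (at (t, x))"
 proof (rule has_derivative_eq_rhs[OF has_derivative_mult])
  show "((%p. \<tau> (fst p)) has_derivative (%h. deriv \<tau> t * fst h)) (at (t, x))"
   by (rule has_derivative_compose[OF bounded_linear_imp_has_derivative[OF bounded_linear_fst],
      where g' = "(*) (deriv \<tau> t)"])
    (use smooth_DERIV[OF s(1), of t] in \<open>simp add: has_field_derivative_def\<close>)
  show "((%p. \<psi> (snd p)) has_derivative (%h. frechet_derivative \<psi> (at x) (snd h))) (at (t, x))"
   by (rule has_derivative_compose[OF bounded_linear_imp_has_derivative[OF bounded_linear_snd],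
      where g' = "frechet_derivative \<psi> (at x)"])
    (use smooth_has_derivative[OF s(2), of x] in simp)
 qed simp
 note fd = fun_cong[OF frechet_derivative_at[OF this]]
 have D: "frechet_derivative ?\<phi> (at (t, x)) h
   = \<tau> t * frechet_derivative \<psi> (at x) (snd h) + deriv \<tau> t * fst h * \<psi> x" for h
  using fd[of h] by (simp add: case_prod_unfold)
 have "frechet_derivative \<psi> (at x) 0 = 0"
  by (rule linear_0[OF has_derivative_linear[OF smooth_has_derivative[OF s(2)]]])
 then show "dt ?\<phi> t x = deriv \<tau> t * \<psi> x" "grad ?\<phi> t x = \<tau> t *\<^sub>R gradient \<psi> x"
  by (simp_all add: dt_def grad_def gradient_def D vec_eq_iff)
qed

section \<open>The open time interval as a measure space\<close>

lemma space_time [simp]: "space (time T) = {0<..<T}"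
 by (simp add: time_def space_restrict_space)

lemma sets_time: "A \<in> sets (time T) \<longleftrightarrow> A \<in> sets borel \<and> A \<subseteq> {0<..<T}"
 unfolding time_def by (subst sets_restrict_space_iff) auto

lemma finite_measure_time: "finite_measure (time T)"
 unfolding time_def
 using emeasure_bounded_finite[of "{0<..<T}"] bounded_subset[of "{0..T}" "{0<..<T}"]
 by (intro finite_measureI) (auto simp: emeasure_restrict_space space_restrict_space)

interpretation time: finite_measure "time T" for T by (rule finite_measure_time)

lemma borel_measurable_timeI: "f \<in> \<B> borel ==> f \<in> \<B> (time T)"
 unfolding time_def by (intro measurable_restrict_space1) simp

lemma integrable_bounded_times:
 fixes f g :: "'a => real"
 assumes f: "integrable M f" and [measurable]: "g \<in> \<B> M" and g: "!!x. x \<in> space M ==> \<bar>g x\<bar> \<le> B"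
 shows "integrable M (%x. g x * f x)"
proof (rule L_integrable_bound)
 show "integrable M (%x. B * f x)" using f by simp
 have [measurable]: "f \<in> \<B> M" using f by simp
 show "(%x. g x * f x) \<in> \<B> M" by measurable
 show "AE x in M. norm (g x * f x) \<le> norm (B * f x)"
  by (rule AE_I2) (auto simp: abs_mult intro!: mult_right_mono order_trans[OF g abs_ge_self])
qed

lemma integrable_time_indicator:
 fixes f :: "real => real"
 assumes A: "A \<in> sets borel" and f: "integrable (time T) f"
 shows "integrable (time T) (%t. indicator A t * f t)"
 by (rule integrable_bounded_times[OF f borel_measurable_timeI[OF borel_measurable_indicator[OF A]], of 1]) (simp add: indicator_def)

lemma time_test_continuous: "time_test T \<tau> ==> continuous_on A \<tau>"
 by (simp add: time_test_def smooth_continuous_on)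

lemma time_test_measurable [measurable_dest]: "time_test T \<tau> ==> \<tau> \<in> \<B> (time T')"
 by (intro borel_measurable_timeI borel_measurable_continuous_onI time_test_continuous)

lemma time_test_bounded:
 assumes "time_test T \<tau>"
 obtains B where "!!t. \<bar>\<tau> t\<bar> \<le> B"
proof -
 obtain a b where ab: "!!t. t \<notin> {a..b} ==> \<tau> t = 0" using assms by (auto simp: time_test_def)
 have "compact (\<tau> ` {a..b})"
  by (intro compact_continuous_image time_test_continuous[OF assms]) auto
 then obtain B where "\<forall>y\<in>\<tau> ` {a..b}. norm y \<le> B"
  using compact_imp_bounded bounded_iff by metis
 then have "\<bar>\<tau> t\<bar> \<le> max B 0" for t
  using ab[of t] by (cases "t \<in> {a..b}") (force simp: le_max_iff_disj)+
 then show ?thesis using that by blast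
qed

lemma time_test_integrable:
 assumes "time_test T \<tau>" "integrable (time T') u"
 shows "integrable (time T') (%t. \<tau> t * u t)"
proof -
 obtain B where B: "!!t. \<bar>\<tau> t\<bar> \<le> B" using time_test_bounded[OF assms(1)] by blast
 show ?thesis by (rule integrable_bounded_times[OF assms(2) time_test_measurable[OF assms(1)] B])
qed

lemma time_test_deriv: "time_test T \<tau> ==> time_test T (deriv \<tau>)"
 unfolding time_test_def
proof (elim conjE exE, intro conjI)
 fix a b assume \<tau>: "smooth \<tau>" "0 < a" "b < T" "\<forall>t. t \<notin> {a..b} --> \<tau> t = 0"
 show "smooth (deriv \<tau>)" using \<tau> by (intro smooth_deriv)
 have "deriv \<tau> t = 0" if "t \<notin> {a..b}" for t
 proof -
  have "((%_. 0) has_real_derivative 0) (at t)" by simp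
  then have "(\<tau> has_real_derivative 0) (at t)"
   by (rule has_field_derivative_transform_within_open[of _ _ _ "- {a..b}"]) (use that \<tau> in auto)
  then show ?thesis by (rule DERIV_imp_deriv)
 qed
 then show "\<exists>a b. 0 < a \<and> b < T \<and> (\<forall>t. t \<notin> {a..b} --> deriv \<tau> t = 0)" using \<tau> by blast
qed

lemma time_test_lincomb:
 assumes "time_test T f" "time_test T g"
 shows "time_test T (%t. f t - c * g t)"
proof -
 obtain a b where f: "smooth f" "0 < a" "b < T" "!!t. t \<notin> {a..b} ==> f t = 0"
  using assms by (auto simp: time_test_def)
 obtain a' b' where g: "smooth g" "0 < a'" "b' < T" "!!t. t \<notin> {a'..b'} ==> g t = 0"
  using assms by (auto simp: time_test_def)
 have "f t - c * g t = 0" if "t \<notin> {min a a'..max b b'}" for t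
  using that f(4)[of t] g(4)[of t] by (auto simp: min_def max_def split: if_splits)
 moreover have "smooth (%t. f t - c * g t)" by (intro smooth_diff smooth_mult smooth_const f g)
 ultimately show ?thesis
  unfolding time_test_def using f g by (intro conjI exI[of _ "min a a'"] exI[of _ "max b b'"]) auto
qed

lemma time_test_indicator:
 assumes "0 < a" "a < b" "b < T"
 obtains \<sigma> where "!!n. time_test T (\<sigma> n)" "!!n t. 0 \<le> \<sigma> n t" "!!n t. \<sigma> n t \<le> 1"
  "!!t. (%n::nat. \<sigma> n t) \<leadsto> indicator {a<..b} t"
proof -
 obtain S :: "real => real" where S: "smooth S" "mono S" "!!x. x \<le> 0 ==> S x = 0" "!!x. x \<ge> 1 ==> S x = 1"
  using smooth_step_exists by metis
 \<comment> \<open>All slopes \<open>c n\<close> are at least \<open>N\<close>, so the descending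
   ramp that starts at \<open>b\<close> ends before \<open>T\<close>.\<close>
 define N :: nat where "N = nat \<lceil>1 / (T - b)\<rceil> + 1"
 have N: "1 / (T - b) < real N" unfolding N_def using assms by linarith
 define c where "c n = real (n + N)" for n
 have c: "c n > 0" "c n * (T - b) > 1" for n
 proof -
  have "c n \<ge> real N" "real N > 0" by (auto simp: c_def N_def)
  then show "c n > 0" by linarith
  have "1 < real N * (T - b)" using N assms by (simp add: field_simps)
  also have "... \<le> c n * (T - b)" using \<open>c n \<ge> real N\<close> assms by (intro mult_right_mono) auto
  finally show "c n * (T - b) > 1" .
 qed
 define \<sigma> where "\<sigma> n t = S (c n * (t - a)) - S (c n * (t - b))" for n t
 have S01: "0 \<le> S x" "S x \<le> 1" for x
  using monoD[OF S(2), of "min 0 x" x] monoD[OF S(2), of x "max 1 x"] S(3)[of "min 0 x"] S(4)[of "max 1 x"] by auto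
 have lim: "(%n. S (c n * (t - a))) \<leadsto> indicator {a<..} t" for t a
 proof (cases "t > a")
  case True
  obtain M :: nat where M: "1 / (t - a) < real M" using reals_Archimedean2 by blast
  have "eventually (%n. S (c n * (t - a)) = 1) sequentially"
   unfolding eventually_sequentially
  proof (intro exI allI impI)
   fix n assume "M \<le> n"
   then have "1 / (t - a) \<le> c n" using M by (simp add: c_def)
   then show "S (c n * (t - a)) = 1" using True by (intro S) (simp add: field_simps)
  qed
  then show ?thesis using True by (simp add: tendsto_eventually)
 next
  case False
  then have "S (c n * (t - a)) = 0" for n using c(1)[of n] by (intro S) (simp add: mult_nonneg_nonpos)
  then show ?thesis using False by simp
 qed
 show thesis
 proof
  fix n t
  have "smooth (%t. S (c n * t + - c n * a))" "smooth (%t. S (c n * t + - c n * b))"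
   by (intro smooth_affine_compose S)+
  then have "smooth (\<sigma> n)"
   unfolding \<sigma>_def by (intro smooth_diff) (simp_all add: algebra_simps)
  moreover have "\<sigma> n t = 0" if "t \<notin> {a..b + 1 / c n}" for t
  proof (cases "t < a")
   case True
   then show ?thesis using assms c(1)[of n] by (simp add: \<sigma>_def S(3) mult_nonneg_nonpos)
  next
   case False
   then have "c n * (t - b) \<ge> 1" using that c(1)[of n] by (auto simp: field_simps)
   moreover from this have "c n * (t - a) \<ge> 1"
    using mult_left_mono[of "t - b" "t - a" "c n"] c(1)[of n] assms by linarith
   ultimately show ?thesis by (simp add: \<sigma>_def S(4))
  qed
  moreover have "b + 1 / c n < T" using c[of n] by (simp add: field_simps)
  ultimately show "time_test T (\<sigma> n)" unfolding time_test_def using assms by blast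
  show "0 \<le> \<sigma> n t"
   using monoD[OF S(2), of "c n * (t - b)" "c n * (t - a)"] c(1)[of n] assms by (simp add: \<sigma>_def)
  show "\<sigma> n t \<le> 1" using S01(1)[of "c n * (t - b)"] S01(2)[of "c n * (t - a)"] by (simp add: \<sigma>_def)
  have "(%n. \<sigma> n t) \<leadsto> indicator {a<..} t - indicator {b<..} t"
   unfolding \<sigma>_def by (intro tendsto_diff lim)
  moreover have "indicator {a<..} t - indicator {b<..} t = (indicator {a<..b} t :: real)"
   using assms by (auto simp: indicator_def)
  ultimately show "(%n. \<sigma> n t) \<leadsto> indicator {a<..b} t" by simp
 qed
qed

section \<open>The fundamental lemma and du Bois-Reymond's lemma in time\<close>

lemma AE_eq_0_if_set_integrals_0:
 fixes w :: "'a => real"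
 assumes w: "integrable M w" and 0: "!!A. A \<in> sets M ==> (LINT x|M. indicator A x * w x) = 0"
 shows "AE x in M. w x = 0"
proof -
 have [measurable]: "w \<in> \<B> M" using w by simp
 have *: "AE x in M. indicator A x * w x = 0" if A: "A = {x\<in>space M. 0 \<le> c * w x}" "c \<noteq> 0" for A c
 proof -
  have [measurable]: "A \<in> sets M" unfolding A by measurable
  have "integrable M (%x. c * (indicator A x * w x))"
   using integrable_real_mult_indicator[OF \<open>A \<in> sets M\<close> w] by (simp add: mult.commute)
  moreover have "(LINT x|M. c * (indicator A x * w x)) = 0" using 0[of A] by simp
  ultimately have "AE x in M. c * (indicator A x * w x) = 0"
   by (subst (asm) integral_nonneg_eq_0_iff_AE) (auto simp: A indicator_def)
  then show ?thesis using A by simp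
 qed
 have "AE x in M. indicator {x\<in>space M. 0 \<le> 1 * w x} x * w x = 0"
  "AE x in M. indicator {x\<in>space M. 0 \<le> -1 * w x} x * w x = 0"
  by (rule *[OF refl]; simp)+
 with AE_space show ?thesis by eventually_elim (auto simp: indicator_def split: if_splits)
qed

text \<open>The half-lines \<open>{..b}\<close> form an intersection-stable generator, so a Dynkin
  argument reaches all Borel sets. The hypothesis concerns intervals away from both ends, hence each
  half-line is first exhausted from inside by dominated convergence.\<close>

lemma AE_time_eq_0:
 fixes w :: "real => real"
 assumes w: "integrable (time T) w" and "T > 0"
  and 0: "!!a b. 0 < a ==> a < b ==> b < T ==> (LINT t|time T. indicator {a<..b} t * w t) = 0"
 shows "AE t in time T. w t = 0"
proof (rule AE_eq_0_if_set_integrals_0[OF w])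
 have [measurable]: "w \<in> \<B> (time T)" using w by simp
 have mI [measurable]: "(%t. indicator A t * w t) \<in> \<B> (time T)" if "A \<in> sets borel" for A
  by (intro borel_measurable_times borel_measurable_timeI[OF borel_measurable_indicator[OF that]]) simp
 note wint = integrable_time_indicator[OF _ w]
 have atMost: "(LINT t|time T. indicator {..b} t * w t) = 0" for b
 proof -
  define d where "d n = T / (real n + 2)" for n
  have d: "d \<leadsto> 0" unfolding d_def by real_asymp
  have d0: "0 < d n" for n using \<open>T > 0\<close> by (simp add: d_def)
  have "(%n. (LINT t|time T. indicator {d n<..min b (T - d n)} t * w t)) \<leadsto> (LINT t|time T. indicator {..b} t * w t)"
  proof (rule integral_dominated_convergence[where w = "%t. \<bar>w t\<bar>"])
   show "AE t in time T. (%n. indicator {d n<..min b (T - d n)} t * w t) \<leadsto> indicator {..b} t * w t"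
   proof (rule AE_I2)
    fix t assume t: "t \<in> space (time T)"
    then have "eventually (%n. d n < t) sequentially" "eventually (%n. d n < T - t) sequentially"
     using order_tendstoD(2)[OF d] by auto
    then have "eventually (%n. indicator {d n<..min b (T - d n)} t = (indicator {..b} t :: real)) sequentially"
     by eventually_elim (auto simp: indicator_def)
    then show "(%n. indicator {d n<..min b (T - d n)} t * w t) \<leadsto> indicator {..b} t * w t"
     by (intro tendsto_mult_right tendsto_eventually)
   qed
   show "AE t in time T. norm (indicator {d n<..min b (T - d n)} t * w t) \<le> \<bar>w t\<bar>" for n
    by (auto simp: indicator_def)
  qed (use w in simp_all)
  moreover have "(LINT t|time T. indicator {d n<..min b (T - d n)} t * w t) = 0" for n
   using 0[of "d n" "min b (T - d n)"] d0[of n] by (cases "d n < min b (T - d n)") auto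
  ultimately show ?thesis by (simp add: LIMSEQ_const_iff)
 qed
 have "(LINT t|time T. w t) = (LINT t|time T. indicator {..T} t * w t)"
  by (rule L_integral_cong) auto
 then have tot: "(LINT t|time T. w t) = 0" using atMost by simp
 fix A assume "A \<in> sets (time T)"
 then have "A \<in> sigma_sets UNIV (range atMost)"
  by (simp add: sets_time borel_eq_atMost)
 then have "A \<in> sets borel \<and> (LINT t|time T. indicator A t * w t) = 0"
 proof (induction rule: sigma_sets_induct_disjoint[rotated 2, consumes 1, case_names basic empty compl union stable sub])
  case stable
  show ?case by (auto simp: Int_stable_def Int_atMost)
 next
  case (compl A)
  have "(LINT t|time T. indicator (UNIV - A) t * w t) = (LINT t|time T. w t - indicator A t * w t)"
   by (rule L_integral_cong) (auto simp: indicator_def)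
  also have "... = 0" using w wint compl tot by simp
  finally show ?case using compl by auto
 next
  case (union A)
  have "(\<Union>i. A i) \<in> sets borel" using union by (intro sets.countable_UN) auto
  then have "set_integrable (time T) (\<Union>i. A i \<inter> {0<..<T}) w"
   unfolding set_integrable_def using w
   by (intro integrable_mult_indicator) (use union in \<open>auto simp: sets_time\<close>)
  then have "(LINT t:(\<Union>i. A i \<inter> {0<..<T})|time T. w t) = (\<Sum>i. (LINT t:A i \<inter> {0<..<T}|time T. w t))"
   using union by (intro lebesgue_integral_countable_add) (auto simp: sets_time disjoint_family_on_def)
  moreover have "(LINT t:B \<inter> {0<..<T}|time T. w t) = (LINT t|time T. indicator B t * w t)" for B
   unfolding set_lebesgue_integral_def
   by (rule L_integral_cong) (auto simp: indicator_def)
  moreover have "(LINT t:(\<Union>i. A i \<inter> {0<..<T})|time T. w t) = (LINT t|time T. indicator (\<Union>i. A i) t * w t)"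
   unfolding set_lebesgue_integral_def
   by (rule L_integral_cong) (auto simp: indicator_def)
  ultimately show ?case using union by auto
 qed (auto simp: atMost)
 then show "(LINT t|time T. indicator A t * w t) = 0" by simp
qed

lemma fundamental_lemma_time:
 fixes w :: "real => real"
 assumes w: "integrable (time T) w" and "T > 0"
  and 0: "!!\<tau>. time_test T \<tau> ==> (LINT t|time T. \<tau> t * w t) = 0"
 shows "AE t in time T. w t = 0"
proof (rule AE_time_eq_0[OF w \<open>T > 0\<close>])
 fix a b assume "0 < a" "a < b" "b < T"
 then obtain \<sigma> where \<sigma>: "!!n. time_test T (\<sigma> n)" "!!n t. 0 \<le> \<sigma> n t" "!!n t. \<sigma> n t \<le> 1"
  "!!t. (%n::nat. \<sigma> n t) \<leadsto> indicator {a<..b} t" using time_test_indicator by metis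
 have [measurable]: "w \<in> \<B> (time T)" using w by simp
 have "(%n. (LINT t|time T. \<sigma> n t * w t)) \<leadsto> (LINT t|time T. indicator {a<..b} t * w t)"
 proof (rule integral_dominated_convergence[where w = "%t. \<bar>w t\<bar>"])
  have [measurable]: "indicator {a<..b} \<in> \<B> (time T)"
   by (intro borel_measurable_timeI borel_measurable_indicator) simp
  show "(%t. indicator {a<..b} t * w t) \<in> \<B> (time T)" by measurable
  show "(%t. \<sigma> n t * w t) \<in> \<B> (time T)" for n
   using time_test_measurable[OF \<sigma>(1)] by measurable
  show "AE t in time T. norm (\<sigma> n t * w t) \<le> \<bar>w t\<bar>" for n
   using \<sigma>(2,3)[of n] by (auto simp: abs_mult intro!: AE_I2 mult_left_le_one_le)
  show "AE t in time T. (%n. \<sigma> n t * w t) \<leadsto> indicator {a<..b} t * w t"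
   by (intro AE_I2 tendsto_mult_right \<sigma>)
 qed (use w in auto)
 then show "(LINT t|time T. indicator {a<..b} t * w t) = 0"
  using 0[OF \<sigma>(1)] by (simp add: LIMSEQ_const_iff)
qed

text \<open>The mean zero condition is what makes the primitive vanish again to the right of the
  support.\<close>

lemma time_test_antiderivative:
 assumes \<eta>: "time_test T \<eta>" and 0: "(LINT t|time T. \<eta> t) = 0"
 obtains \<tau> where "time_test T \<tau>" "!!t. deriv \<tau> t = \<eta> t"
  "!!t. t \<in> {0<..<T} ==> \<tau> t = (LINT r|time T. indicator {..t} r * \<eta> r)"
proof -
 obtain a b where ab: "0 < a" "b < T" "!!t. t \<notin> {a..b} ==> \<eta> t = 0"
  using \<eta> by (auto simp: time_test_def)
 have cont: "continuous_on A \<eta>" for A by (rule time_test_continuous[OF \<eta>])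
 define \<tau> where "\<tau> t = integral {0..t} \<eta>" for t
 have D: "(\<tau> has_real_derivative \<eta> t) (at t)" for t
  unfolding \<tau>_def by (rule antiderivative_real[OF cont]) (use ab in auto)
 have [measurable]: "\<eta> \<in> \<B> borel" by (intro borel_measurable_continuous_onI cont)
 have eq: "\<tau> t = (LINT r|time T. indicator {..t} r * \<eta> r)" if "T > b" for t
 proof -
  have "\<tau> t = (LINT r:{0..t}|lborel. \<eta> r)"
   unfolding \<tau>_def
   by (rule set_borel_integral_eq_integral(2)[symmetric])
    (intro borel_integrable_atLeastAtMost' cont)
  also have "... = (LINT r|lborel. indicator {0<..<T} r *\<^sub>R (indicator {..t} r * \<eta> r))"
   unfolding set_lebesgue_integral_def
  proof (rule L_integral_cong[OF refl])
   fix r show "indicat_real {0..t} r *\<^sub>R \<eta> r = indicator {0<..<T} r *\<^sub>R (indicator {..t} r * \<eta> r)"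
   proof (cases "r \<in> {a..b}")
    case True
    then show ?thesis using ab(1) that by (auto simp: indicator_def)
   next
    case False
    then show ?thesis using ab(3)[of r] by simp
   qed
  qed
  also have "... = (LINT r|time T. indicator {..t} r * \<eta> r)"
   unfolding time_def by (subst integral_restrict_space) auto
  finally show ?thesis .
 qed
 have "\<tau> t = 0" if "t \<notin> {a..b}" for t
 proof (cases "t < a")
  case True
  have "\<tau> t = integral {0..t} (%_. 0)" unfolding \<tau>_def using True ab by (intro integral_cong) auto
  then show ?thesis by simp
 next
  case False
  have "\<tau> t = (LINT r|time T. \<eta> r)"
   unfolding eq[OF ab(2)] by (rule L_integral_cong)
    (use False that ab(3) in \<open>auto simp: indicator_def\<close>)
  then show ?thesis using 0 by simp
 qed
 moreover have "smooth \<tau>"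
  by (rule smooth_realI[OF D]) (use \<eta> in \<open>simp add: time_test_def\<close>)
 ultimately have "time_test T \<tau>" using ab by (auto simp: time_test_def)
 then show thesis by (rule that[OF _ DERIV_imp_deriv[OF D] eq[OF ab(2)]])
qed

lemma borel_measurable_indicator_less [measurable (raw)]:
 fixes f g :: "'a => real"
 assumes [measurable]: "f \<in> \<B> M" "g \<in> \<B> M"
 shows "(%x. indicator {..<f x} (g x) :: real) \<in> \<B> M"
  "(%x. indicator {..f x} (g x) :: real) \<in> \<B> M"
proof -
 have "indicator {x\<in>space M. g x < f x} \<in> \<B> M"
  "indicator {x\<in>space M. g x \<le> f x} \<in> \<B> M"
  by (rule borel_measurable_indicator; measurable)+
 then show "(%x. indicator {..<f x} (g x) :: real) \<in> \<B> M"
  "(%x. indicator {..f x} (g x) :: real) \<in> \<B> M"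
  by (auto simp: indicator_def cong: measurable_cong)
qed

text \<open>Let \<open>G\<close> be the primitive of \<open>g\<close>. For a test function
  \<open>\<eta>\<close> of mean zero with primitive \<open>\<tau>\<close>, Fubini turns the integral
  of \<open>\<tau> g\<close> into minus that of \<open>\<eta> G\<close>, so \<open>u - G\<close> is
  orthogonal to all such \<open>\<eta>\<close> and hence constant.\<close>

theorem du_Bois_Reymond_time:
 assumes u: "integrable (time T) u" and g: "integrable (time T) g" and "T > 0"
  and eq: "!!\<tau>. time_test T \<tau> ==> (LINT t|time T. deriv \<tau> t * u t + \<tau> t * g t) = 0"
 obtains C where "AE t in time T. u t = C + (LINT s|time T. indicator {..<t} s * g s)"
proof -
 interpret P: pair_sigma_finite "time T" "time T" by unfold_locales
 have [measurable]: "u \<in> \<B> (time T)" "g \<in> \<B> (time T)" using u g by auto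
 have id [measurable]: "(%x. x) \<in> \<B> (time T)" by (rule borel_measurable_timeI) simp
 define G where "G t = (LINT s|time T. indicator {..<t} s * g s)" for t
 have [measurable]: "G \<in> \<B> (time T)"
  unfolding G_def
  by measurable
 have G_le: "\<bar>G t\<bar> \<le> (LINT s|time T. \<bar>g s\<bar>)" for t
  unfolding G_def
  by (rule order_trans[OF integral_abs_bound integral_mono'])
   (use g in \<open>auto simp: indicator_def\<close>)
 have Gint: "integrable (time T) G"
  by (rule time.integrable_const_bound[OF AE_I2]) (use G_le in auto)
 have w: "integrable (time T) (%t. u t - G t)" using u Gint by simp
 have mean0: "(LINT t|time T. \<eta> t * (u t - G t)) = 0"
  if \<eta>: "time_test T \<eta>" and \<eta>0: "(LINT t|time T. \<eta> t) = 0" for \<eta>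
 proof -
  obtain \<tau> where \<tau>: "time_test T \<tau>" "!!t. deriv \<tau> t = \<eta> t"
   "!!t. t \<in> {0<..<T} ==> \<tau> t = (LINT r|time T. indicator {..t} r * \<eta> r)"
   using time_test_antiderivative[OF \<eta> \<eta>0] by metis
  have [measurable]: "\<eta> \<in> \<B> (time T)" using \<eta> by (rule time_test_measurable)
  have \<eta>i: "integrable (time T) \<eta>" using time_test_integrable[OF \<eta>, of T "%_. 1"] by simp
  obtain B where B: "!!t. \<bar>\<eta> t\<bar> \<le> B" using time_test_bounded[OF \<eta>] by blast
  have le_ind: "indicator {..t} r = (indicator {r..} t :: real)" for t r :: real
   by (auto simp: indicator_def)
  have int2: "integrable (time T \<Otimes>\<^sub>M time T) (%(t, r). g t * (indicator {..t} r * \<eta> r))"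
  proof (rule P.Fubini_integrable)
   show "(%(t, r). g t * (indicator {..t} r * \<eta> r)) \<in> \<B> (time T \<Otimes>\<^sub>M time T)"
    by measurable
   have "integrable (time T) (%r. indicator {..t} r * \<eta> r)" for t
    by (rule integrable_time_indicator[OF _ \<eta>i]) simp
   then show "AE t in time T. integrable (time T) (%r. case (t, r) of (t, r) => g t * (indicator {..t} r * \<eta> r))"
    by simp
   show "integrable (time T) (%t. (LINT r|time T. norm (case (t, r) of (t, r) => g t * (indicator {..t} r * \<eta> r))))"
   proof (rule L_integrable_bound[OF integrable_mult_left[OF integrable_norm[OF g], of "LINT r|time T. \<bar>\<eta> r\<bar>"]])
    show "(%t. (LINT r|time T. norm (case (t, r) of (t, r) => g t * (indicator {..t} r * \<eta> r)))) \<in> \<B> (time T)"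
     by measurable
    have "(LINT r|time T. \<bar>indicator {..t} r * \<eta> r\<bar>) \<le> (LINT r|time T. \<bar>\<eta> r\<bar>)" for t
     by (rule integral_mono') (use \<eta>i in \<open>auto simp: indicator_def\<close>)
    then show "AE t in time T. norm (LINT r|time T. norm (case (t, r) of (t, r) => g t * (indicator {..t} r * \<eta> r)))
      \<le> norm (norm (g t) * (LINT r|time T. \<bar>\<eta> r\<bar>))"
     by (auto simp: abs_mult intro!: AE_I2 mult_left_mono)
   qed
  qed
  have "(LINT t|time T. \<tau> t * g t) = (LINT t|time T. (LINT r|time T. g t * (indicator {..t} r * \<eta> r)))"
   by (rule L_integral_cong) (auto simp: \<tau>(3) mult.commute)
  also have "... = (LINT r|time T. (LINT t|time T. g t * (indicator {..t} r * \<eta> r)))"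
   using P.Fubini_integral[OF int2] by simp
  also have "... = (LINT r|time T. \<eta> r * ((LINT t|time T. g t) - G r))"
  proof (rule L_integral_cong[OF refl])
   fix r
   have gi: "integrable (time T) (%s. indicator {..<r} s * g s)"
    by (rule integrable_time_indicator[OF _ g]) simp
   have "(LINT t|time T. g t * (indicator {..t} r * \<eta> r)) = (LINT t|time T. \<eta> r * (g t - indicator {..<r} t * g t))"
    by (rule L_integral_cong) (auto simp: indicator_def)
   also have "... = \<eta> r * ((LINT t|time T. g t) - G r)" using g gi by (simp add: G_def)
   finally show "(LINT t|time T. g t * (indicator {..t} r * \<eta> r)) = \<eta> r * ((LINT t|time T. g t) - G r)" .
  qed
  also have "... = (LINT r|time T. (LINT t|time T. g t) * \<eta> r - \<eta> r * G r)"
   by (simp add: algebra_simps)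
  also have "... = - (LINT r|time T. \<eta> r * G r)"
   using time_test_integrable[OF \<eta> Gint] \<eta>i \<eta>0 by simp
  finally have "(LINT t|time T. \<tau> t * g t) = - (LINT r|time T. \<eta> r * G r)" .
  moreover have "(LINT t|time T. \<eta> t * u t) + (LINT t|time T. \<tau> t * g t) = 0"
   using eq[OF \<tau>(1)] time_test_integrable[OF \<eta> u] time_test_integrable[OF \<tau>(1) g] by (simp add: \<tau>(2))
  ultimately show ?thesis
   using time_test_integrable[OF \<eta> u] time_test_integrable[OF \<eta> Gint] by (simp add: algebra_simps)
 qed
 \<comment> \<open>If all test functions had mean zero, the constant 1 would vanish almost
   everywhere.\<close>
 obtain \<beta> where \<beta>: "time_test T \<beta>" "(LINT t|time T. \<beta> t) \<noteq> 0"
 proof (rule ccontr)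
  assume "\<not> thesis"
  then have "AE t in time T. (1::real) = 0"
   using that by (intro fundamental_lemma_time[OF _ \<open>T > 0\<close>]) auto
  then have "emeasure (time T) {0<..<T} = 0"
   by (subst (asm) AE_iff_measurable[of "{0<..<T}"]) (auto simp: sets_time)
  then show False using \<open>T > 0\<close> by (simp add: time_def emeasure_restrict_space)
 qed
 \<comment> \<open>Subtracting the right multiple of \<open>\<beta>\<close> from any test function
   gives mean zero; \<open>C\<close> is the value that this forces.\<close>
 define C where "C = (LINT t|time T. \<beta> t * (u t - G t)) / (LINT t|time T. \<beta> t)"
 have "AE t in time T. u t - G t - C = 0"
 proof (rule fundamental_lemma_time[OF _ \<open>T > 0\<close>])
  show "integrable (time T) (%t. u t - G t - C)" using w by simp
  fix \<eta> assume \<eta>: "time_test T \<eta>"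
  define c where "c = (LINT t|time T. \<eta> t) / (LINT t|time T. \<beta> t)"
  have i: "integrable (time T) \<eta>" "integrable (time T) \<beta>"
   using time_test_integrable[OF \<eta>, of T "%_. 1"] time_test_integrable[OF \<beta>(1), of T "%_. 1"] by simp_all
  have i2: "integrable (time T) (%t. \<eta> t * (u t - G t))" "integrable (time T) (%t. \<beta> t * (u t - G t))"
   by (rule time_test_integrable[OF _ w], fact)+
  have "(LINT t|time T. (\<eta> t - c * \<beta> t) * (u t - G t)) = 0"
   using i \<beta>(2) by (intro mean0 time_test_lincomb \<eta> \<beta>) (simp add: c_def)
  also have "(LINT t|time T. (\<eta> t - c * \<beta> t) * (u t - G t))
    = (LINT t|time T. \<eta> t * (u t - G t) - c * (\<beta> t * (u t - G t)))"
   by (rule L_integral_cong) (simp_all add: algebra_simps)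
  also have "... = (LINT t|time T. \<eta> t * (u t - G t)) - C * (LINT t|time T. \<eta> t)"
   using i2 by (simp add: c_def C_def)
  also have "... = (LINT t|time T. \<eta> t * (u t - G t) - C * \<eta> t)"
   using i2 i by simp
  also have "... = (LINT t|time T. \<eta> t * (u t - G t - C))"
   by (rule L_integral_cong) (simp_all add: algebra_simps)
  finally show "(LINT t|time T. \<eta> t * (u t - G t - C)) = 0" by simp
 qed
 then have "AE t in time T. u t = C + (LINT s|time T. indicator {..<t} s * g s)"
  by eventually_elim (simp add: G_def)
 then show thesis by (rule that)
qed

section \<open>Convergence in L^p with natural exponents\<close>

lemma power_add_le:
 fixes a b :: real
 assumes "0 \<le> a" "0 \<le> b"
 shows "(a + b) ^ p \<le> 2 ^ p * (a ^ p + b ^ p)"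
proof -
 have "(a + b) ^ p \<le> (2 * max a b) ^ p" using assms by (intro power_mono) auto
 also have "... = 2 ^ p * (max a b) ^ p" by (simp add: power_mult_distrib)
 also have "(max a b) ^ p \<le> a ^ p + b ^ p" using assms by (auto simp: max_def)
 finally show ?thesis by simp
qed

lemma abs_diff_power_le: "\<bar>a - b\<bar> ^ p \<le> 2 ^ p * (\<bar>a\<bar> ^ p + \<bar>b\<bar> ^ p)" for a b :: real
 by (rule order_trans[OF power_mono[OF abs_triangle_ineq4] power_add_le]) auto

lemma abs_add_power_le: "\<bar>a + b\<bar> ^ p \<le> 2 ^ p * (\<bar>a\<bar> ^ p + \<bar>b\<bar> ^ p)" for a b :: real
 by (rule order_trans[OF power_mono[OF abs_triangle_ineq] power_add_le]) auto

lemma integrable_power_diff: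
 fixes f g :: "'a => real"
 assumes [measurable]: "f \<in> \<B> M" "g \<in> \<B> M"
  and "integrable M (%x. \<bar>f x\<bar> ^ p)" "integrable M (%x. \<bar>g x\<bar> ^ p)"
 shows "integrable M (%x. \<bar>f x - g x\<bar> ^ p)"
 by (rule L_integrable_bound[where f = "%x. 2 ^ p * (\<bar>f x\<bar> ^ p + \<bar>g x\<bar> ^ p)"])
  (use assms(3,4) abs_diff_power_le in \<open>auto simp del: power_abs\<close>)

lemma integrable_power_add:
 fixes f g :: "'a => real"
 assumes [measurable]: "f \<in> \<B> M" "g \<in> \<B> M"
  and "integrable M (%x. \<bar>f x\<bar> ^ p)" "integrable M (%x. \<bar>g x\<bar> ^ p)"
 shows "integrable M (%x. \<bar>f x + g x\<bar> ^ p)"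
 by (rule L_integrable_bound[where f = "%x. 2 ^ p * (\<bar>f x\<bar> ^ p + \<bar>g x\<bar> ^ p)"])
  (use assms(3,4) abs_add_power_le in \<open>auto simp del: power_abs\<close>)

lemma tendsto_0_ge_le:
 fixes f :: "nat => real"
 assumes "!!n. 0 \<le> f n" "!!e. e > 0 ==> eventually (%n. f n \<le> e) sequentially"
 shows "f \<leadsto> 0"
proof (rule order_tendstoI)
 fix a :: real assume "0 < a"
 then show "eventually (%n. f n < a) sequentially"
  using assms(2)[of "a / 2"] by (auto elim: eventually_mono)
qed (use assms(1) in \<open>auto intro: less_le_trans always_eventually\<close>)

text \<open>Membership of the sequence and of the limit in L^p is part of the notion, so that sums
  and products of convergent sequences compose without side conditions. Only the exponents 1, 2 and
  4 occur for limits of fluxes, so natural exponents are enough.\<close>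

definition Lp_conv :: "nat => 'a measure => (nat => 'a => real) => ('a => real) => bool"
 where "Lp_conv p M f g \<longleftrightarrow> (\<forall>n. f n \<in> \<B> M \<and> integrable M (%x. \<bar>f n x\<bar> ^ p))
  \<and> g \<in> \<B> M \<and> integrable M (%x. \<bar>g x\<bar> ^ p)
  \<and> (%n. (LINT x|M. \<bar>f n x - g x\<bar> ^ p)) \<leadsto> 0"

lemma Lp_conv_const:
 "0 < p ==> g \<in> \<B> M ==> integrable M (%x. \<bar>g x\<bar> ^ p) ==> Lp_conv p M (%n. g) g"
 by (simp add: Lp_conv_def power_0_left)

lemma Lp_conv_add:
 assumes "Lp_conv p M f g" "Lp_conv p M h k"
 shows "Lp_conv p M (%n x. f n x + h n x) (%x. g x + k x)"
proof -
 have [measurable]: "f n \<in> \<B> M" "h n \<in> \<B> M"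
  "g \<in> \<B> M" "k \<in> \<B> M" for n
  using assms by (auto simp: Lp_conv_def)
 have i: "integrable M (%x. \<bar>f n x - g x\<bar> ^ p)" "integrable M (%x. \<bar>h n x - k x\<bar> ^ p)" for n
  using assms by (auto simp: Lp_conv_def intro!: integrable_power_diff)
 have "(%n. (LINT x|M. \<bar>(f n x + h n x) - (g x + k x)\<bar> ^ p)) \<leadsto> 0"
 proof (rule tendsto_sandwich[of "%_. 0"])
  show "(%n. 2 ^ p * ((LINT x|M. \<bar>f n x - g x\<bar> ^ p) + (LINT x|M. \<bar>h n x - k x\<bar> ^ p))) \<leadsto> 0"
   using assms by (auto simp: Lp_conv_def intro!: tendsto_mult_right_zero tendsto_add_zero)
  have "(LINT x|M. \<bar>(f n x + h n x) - (g x + k x)\<bar> ^ p)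
    \<le> (LINT x|M. 2 ^ p * (\<bar>f n x - g x\<bar> ^ p + \<bar>h n x - k x\<bar> ^ p))" for n
  proof (rule integral_mono')
   show "integrable M (%x. 2 ^ p * (\<bar>f n x - g x\<bar> ^ p + \<bar>h n x - k x\<bar> ^ p))"
    using i by simp
   show "\<bar>(f n x + h n x) - (g x + k x)\<bar> ^ p \<le> 2 ^ p * (\<bar>f n x - g x\<bar> ^ p + \<bar>h n x - k x\<bar> ^ p)" for x
    using abs_add_power_le[of "f n x - g x" "h n x - k x" p] by (simp add: algebra_simps)
  qed simp
  then show "eventually (%n. (LINT x|M. \<bar>(f n x + h n x) - (g x + k x)\<bar> ^ p)
    \<le> 2 ^ p * ((LINT x|M. \<bar>f n x - g x\<bar> ^ p) + (LINT x|M. \<bar>h n x - k x\<bar> ^ p))) sequentially"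
   using i by simp
 qed auto
 then show ?thesis
  using assms by (auto simp: Lp_conv_def intro!: integrable_power_add)
qed

lemma Lp_conv_cmult:
 assumes "Lp_conv p M f g"
 shows "Lp_conv p M (%n x. c * f n x) (%x. c * g x)"
proof -
 have "\<bar>c * f n x - c * g x\<bar> ^ p = \<bar>c\<bar> ^ p * \<bar>f n x - g x\<bar> ^ p" for n x
  by (metis abs_mult power_mult_distrib right_diff_distrib)
 moreover have "\<bar>c * y\<bar> ^ p = \<bar>c\<bar> ^ p * \<bar>y\<bar> ^ p" for y by (simp only: abs_mult power_mult_distrib)
 moreover have [measurable]: "f n \<in> \<B> M" "g \<in> \<B> M" for n
  using assms by (auto simp: Lp_conv_def)
 ultimately show ?thesis using assms
  by (auto simp: Lp_conv_def simp del: power_abs intro!: tendsto_mult_right_zero)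
qed

lemma Lp_conv_sum:
 assumes "0 < p" "!!i. i \<in> I ==> Lp_conv p M (f i) (g i)"
 shows "Lp_conv p M (%n x. \<Sum>i\<in>I. f i n x) (%x. \<Sum>i\<in>I. g i x)"
 using assms(2)
 by (induction I rule: infinite_finite_induct)
  (use assms(1) in \<open>auto intro: Lp_conv_add Lp_conv_const[of p "%_. 0", simplified] simp: power_0_left\<close>)

lemma Lp_conv_1_integral:
 assumes "Lp_conv 1 M f g"
 shows "(%n. (LINT x|M. f n x)) \<leadsto> (LINT x|M. g x)"
proof -
 have [measurable]: "f n \<in> \<B> M" "g \<in> \<B> M" for n
  using assms by (auto simp: Lp_conv_def)
 have "integrable M (%x. \<bar>f n x\<bar>)" "integrable M (%x. \<bar>g x\<bar>)" for n
  using assms by (auto simp: Lp_conv_def)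
 then have "integrable M (f n)" "integrable M g" for n
  by (simp_all add: integrable_abs_iff)
 then have "(LINT x|M. f n x) - (LINT x|M. g x) = (LINT x|M. f n x - g x)" for n
  by simp
 then have le: "norm ((LINT x|M. f n x) - (LINT x|M. g x)) \<le> (LINT x|M. \<bar>f n x - g x\<bar>)" for n
  using integral_abs_bound[of M "%x. f n x - g x"] by simp
 have "(%n. (LINT x|M. \<bar>f n x - g x\<bar>)) \<leadsto> 0"
  using assms by (simp add: Lp_conv_def)
 then have "(%n. (LINT x|M. f n x) - (LINT x|M. g x)) \<leadsto> 0"
  by (rule Lim_null_comparison[rotated]) (use le in simp)
 then show ?thesis by (simp add: LIM_zero_iff)
qed

text \<open>Weighted AM-GM, with a small weight on the factors that are merely bounded.\<close>

lemma Lp_conv_mult: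
 assumes fg: "Lp_conv (2 * p) M f g" and hk: "Lp_conv (2 * p) M h k"
 shows "Lp_conv p M (%n x. f n x * h n x) (%x. g x * k x)"
proof -
 have [measurable]: "f n \<in> \<B> M" "h n \<in> \<B> M"
  "g \<in> \<B> M" "k \<in> \<B> M" for n
  using assms by (auto simp: Lp_conv_def)
 have young: "\<bar>a * b\<bar> ^ p \<le> \<bar>a\<bar> ^ (2 * p) / e + e * \<bar>b\<bar> ^ (2 * p)" if "e > 0" for a b e :: real
 proof -
  have "0 \<le> (\<bar>a\<bar> ^ p / sqrt e - sqrt e * \<bar>b\<bar> ^ p)\<^sup>2" by simp
  also have "... = (\<bar>a\<bar> ^ p)\<^sup>2 / e + e * (\<bar>b\<bar> ^ p)\<^sup>2 - 2 * (\<bar>a\<bar> ^ p * \<bar>b\<bar> ^ p)"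
   using that by (simp add: power2_diff power_divide power_mult_distrib)
  finally have "2 * \<bar>a * b\<bar> ^ p \<le> \<bar>a\<bar> ^ (2 * p) / e + e * \<bar>b\<bar> ^ (2 * p)"
   by (simp add: abs_mult power_mult_distrib power_even_eq del: power_abs)
  moreover have "0 \<le> \<bar>a * b\<bar> ^ p" by simp
  ultimately show ?thesis by linarith
 qed
 have int_prod: "integrable M (%x. \<bar>a x * b x\<bar> ^ p)"
  if [measurable]: "a \<in> \<B> M" "b \<in> \<B> M"
   and "integrable M (%x. \<bar>a x\<bar> ^ (2 * p))" "integrable M (%x. \<bar>b x\<bar> ^ (2 * p))" for a b :: "'a => real"
 proof (rule L_integrable_bound[where f = "%x. \<bar>a x\<bar> ^ (2 * p) + \<bar>b x\<bar> ^ (2 * p)"])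
  show "AE x in M. norm (\<bar>a x * b x\<bar> ^ p) \<le> norm (\<bar>a x\<bar> ^ (2 * p) + \<bar>b x\<bar> ^ (2 * p))"
   using young[of 1] by (intro AE_I2) simp
 qed (use that(3,4) in simp_all)
 note ifg = integrable_power_diff[of "f n" M g "2 * p" for n]
 have i: "integrable M (%x. \<bar>f n x - g x\<bar> ^ (2 * p))" "integrable M (%x. \<bar>h n x - k x\<bar> ^ (2 * p))"
  "integrable M (%x. \<bar>f n x\<bar> ^ (2 * p))" "integrable M (%x. \<bar>h n x\<bar> ^ (2 * p))"
  "integrable M (%x. \<bar>g x\<bar> ^ (2 * p))" "integrable M (%x. \<bar>k x\<bar> ^ (2 * p))" for n
  using fg hk by (auto simp: Lp_conv_def simp del: power_abs intro!: integrable_power_diff)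
 define A B where "A n = (LINT x|M. \<bar>f n x - g x\<bar> ^ (2 * p))" and "B n = (LINT x|M. \<bar>h n x - k x\<bar> ^ (2 * p))" for n
 define G K where "G = (LINT x|M. \<bar>g x\<bar> ^ (2 * p))" and "K = (LINT x|M. \<bar>k x\<bar> ^ (2 * p))"
 have A: "A \<leadsto> 0" and B: "B \<leadsto> 0"
  unfolding A_def B_def using fg hk by (auto simp: Lp_conv_def)
 have GK: "0 \<le> G" "0 \<le> K" by (auto simp: G_def K_def)
 have main: "(LINT x|M. \<bar>f n x * h n x - g x * k x\<bar> ^ p)
   \<le> 2 ^ p * (A n / e + e * (2 ^ (2 * p) * (B n + K)) + e * G + B n / e)" if "e > 0" for n e
 proof -
  let ?h = "%x. 2 ^ (2 * p) * (\<bar>h n x - k x\<bar> ^ (2 * p) + \<bar>k x\<bar> ^ (2 * p))"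
  have "(LINT x|M. \<bar>f n x * h n x - g x * k x\<bar> ^ p)
   \<le> (LINT x|M. 2 ^ p * ((\<bar>f n x - g x\<bar> ^ (2 * p) / e + e * ?h x)
     + (\<bar>h n x - k x\<bar> ^ (2 * p) / e + e * \<bar>g x\<bar> ^ (2 * p))))"
  proof (rule integral_mono')
   show "integrable M (%x. 2 ^ p * ((\<bar>f n x - g x\<bar> ^ (2 * p) / e + e * ?h x)
     + (\<bar>h n x - k x\<bar> ^ (2 * p) / e + e * \<bar>g x\<bar> ^ (2 * p))))"
    by (intro L_integrable_add integrable_mult_right integrable_divide i)
   fix x
   have eq: "f n x * h n x - g x * k x = (f n x - g x) * h n x + (h n x - k x) * g x"
    by (simp add: algebra_simps)
   have "\<bar>f n x * h n x - g x * k x\<bar> ^ p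
     \<le> 2 ^ p * (\<bar>(f n x - g x) * h n x\<bar> ^ p + \<bar>(h n x - k x) * g x\<bar> ^ p)"
    unfolding eq by (rule abs_add_power_le)
   also have "... \<le> 2 ^ p * ((\<bar>f n x - g x\<bar> ^ (2 * p) / e + e * ?h x)
     + (\<bar>h n x - k x\<bar> ^ (2 * p) / e + e * \<bar>g x\<bar> ^ (2 * p)))"
   proof (intro mult_left_mono add_mono young[OF that])
    have "\<bar>h n x\<bar> ^ (2 * p) \<le> ?h x"
     using abs_add_power_le[of "h n x - k x" "k x" "2 * p"] by simp
    then have "e * \<bar>h n x\<bar> ^ (2 * p) \<le> e * ?h x" using that by (intro mult_left_mono) auto
    then show "\<bar>(f n x - g x) * h n x\<bar> ^ p \<le> \<bar>f n x - g x\<bar> ^ (2 * p) / e + e * ?h x"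
     using young[OF that, of "f n x - g x" "h n x"] by linarith
   qed simp
   finally show "\<bar>f n x * h n x - g x * k x\<bar> ^ p \<le> ..." .
  qed (use that in simp)
  also have "... = 2 ^ p * (A n / e + e * (2 ^ (2 * p) * (B n + K)) + (B n / e + e * G))"
   unfolding A_def B_def G_def K_def
   by (simp only: L_integral_add integral_mult_right_zero integral_divide_zero
     L_integrable_add integrable_mult_right integrable_divide i)
  finally show ?thesis by (simp add: algebra_simps)
 qed
 have "(%n. (LINT x|M. \<bar>f n x * h n x - g x * k x\<bar> ^ p)) \<leadsto> 0"
 proof (rule tendsto_0_ge_le)
  fix e :: real assume "e > 0"
  \<comment> \<open>Once \<open>A\<close> and \<open>B\<close> have vanished, \<open>main\<close>
    leaves \<open>(c - 1)\<close> times the weight; the added 1 keeps \<open>c\<close> positive, and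
    the weight \<open>d\<close> makes the product with \<open>c\<close> equal to half the
    tolerance.\<close>
  define c where "c = 2 ^ p * (2 ^ (2 * p) * K + G) + 1"
  have c: "c > 0" unfolding c_def using GK by (intro add_nonneg_pos mult_nonneg_nonneg add_nonneg_nonneg) auto
  define d where "d = e / 2 / c"
  have d: "d > 0" using \<open>e > 0\<close> c by (simp add: d_def)
  have lim: "(%n. 2 ^ p * (A n / d + d * (2 ^ (2 * p) * (B n + K)) + d * G + B n / d))
    \<leadsto> 2 ^ p * (0 / d + d * (2 ^ (2 * p) * (0 + K)) + d * G + 0 / d)"
   using d by (intro tendsto_intros A B) auto
  have "2 ^ p * (0 / d + d * (2 ^ (2 * p) * (0 + K)) + d * G + 0 / d) = d * c - d"
   by (simp add: c_def algebra_simps)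
  also have "... < e"
  proof -
   have "d * c = e / 2" using c by (simp add: d_def)
   then show ?thesis using d \<open>e > 0\<close> by simp
  qed
  finally have "eventually (%n. 2 ^ p * (A n / d + d * (2 ^ (2 * p) * (B n + K)) + d * G + B n / d) < e) sequentially"
   by (rule order_tendstoD(2)[OF lim])
  then show "eventually (%n. (LINT x|M. \<bar>f n x * h n x - g x * k x\<bar> ^ p) \<le> e) sequentially"
   by (rule eventually_mono) (rule order_trans[OF main[OF d]], simp)
 qed simp
 then show ?thesis
  using i by (auto simp: Lp_conv_def simp del: power_abs intro!: int_prod)
qed

section \<open>Averaging kernels\<close>

lemma power_eq_powr: "0 < p ==> \<bar>x\<bar> ^ p = \<bar>x\<bar> powr real p" for x :: real
 by (cases "x = 0") (simp_all add: powr_realpow)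

text \<open>Young's inequality with exponents \<open>p\<close> and \<open>p / (p - 1)\<close>,
  arranged to say that the power lies above its tangent at \<open>b\<close>.\<close>

lemma powr_tangent:
 fixes a b :: real
 assumes "p \<ge> 1" "a \<ge> 0" "b > 0"
 shows "p * a * b powr (p - 1) \<le> a powr p + (p - 1) * b powr p"
proof (cases "p = 1")
 case False
 then have p: "p > 1" using assms by simp
 have "a * b powr (p - 1) \<le> a powr p / p + (b powr (p - 1)) powr (p / (p - 1)) / (p / (p - 1))"
  using p assms by (intro Youngs_inequality) (auto simp: field_simps)
 also have "(b powr (p - 1)) powr (p / (p - 1)) = b powr p" using p by (simp add: powr_powr)
 finally show ?thesis using p by (simp add: field_simps)
qed (use assms in auto)

lemma le_one_plus_powr: "p \<ge> 1 ==> 0 \<le> a ==> a \<le> 1 + a powr p" for a p :: real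
 using powr_mono[of 1 p a] by (cases "a \<le> 1") (auto intro: order_trans[of _ "a powr p"] add_increasing2)

lemma (in finite_measure) integrable_of_powr:
 fixes f :: "'a => real"
 assumes [measurable]: "f \<in> \<B> M" and "p \<ge> 1" "integrable M (%x. \<bar>f x\<bar> powr p)"
 shows "integrable M f"
proof (rule L_integrable_bound[where f = "%x. 1 + \<bar>f x\<bar> powr p"])
 show "integrable M (%x. 1 + \<bar>f x\<bar> powr p)" using assms(3) by simp
 have "norm (f x) \<le> norm (1 + \<bar>f x\<bar> powr p)" for x
  using order_trans[OF le_one_plus_powr[OF assms(2) abs_ge_zero] abs_ge_self] by simp
 then show "AE x in M. norm (f x) \<le> norm (1 + \<bar>f x\<bar> powr p)" by simp
qed measurable

lemma (in finite_measure) integrable_of_power: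
 fixes f :: "'a => real"
 assumes "f \<in> \<B> M" and "0 < p" "integrable M (%x. \<bar>f x\<bar> ^ p)"
 shows "integrable M f"
 by (rule integrable_of_powr[of f "real p"]) (use assms in \<open>simp_all add: power_eq_powr del: power_abs\<close>)


definition kernel_op :: "'a measure => ('a => 'a => real) => ('a => real) => 'a => real"
 where "kernel_op M k f x = (LINT y|M. k x y * f y)"

text \<open>Schur's conditions with constant one, which make \<open>kernel_op\<close> a contraction
  on every L^p. Mass at most one, rather than exactly one, admits time averages whose window leaves
  the interval. The pointwise bound makes every single average well defined on L^1.\<close>

locale bounded_kernel = finite_measure M for M :: "'a measure" +
 fixes k :: "'a => 'a => real"
 assumes k_measurable [measurable]: "(%(x, y). k x y) \<in> \<B> (M \<Otimes>\<^sub>M M)"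
  and k_nonneg: "0 \<le> k x y"
  and k_bounded: "\<exists>C. \<forall>x y. k x y \<le> C"
  and k_row: "x \<in> space M ==> (LINT y|M. k x y) \<le> 1"
  and k_col: "y \<in> space M ==> (LINT x|M. k x y) \<le> 1"
begin

sublocale MM: pair_sigma_finite M M by unfold_locales

lemma k_section [measurable]: "x \<in> space M ==> (%y. k x y) \<in> \<B> M"
 using measurable_compose[OF measurable_Pair1' k_measurable] by simp

lemma k_section' [measurable]: "y \<in> space M ==> (%x. k x y) \<in> \<B> M"
 using measurable_compose[OF measurable_Pair2' k_measurable] by simp

lemma k_times_integrable:
 assumes "x \<in> space M" and f: "integrable M f"
 shows "integrable M (%y. k x y * f y)"
proof -
 obtain C where C: "!!x y. k x y \<le> C" using k_bounded by blast
 show ?thesis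
  by (rule integrable_bounded_times[OF f k_section[OF assms(1)], of C]) (use C k_nonneg in auto)
qed

lemma kernel_op_measurable [measurable]:
 assumes [measurable]: "f \<in> \<B> M"
 shows "kernel_op M k f \<in> \<B> M"
 unfolding kernel_op_def by measurable

lemma k_integrable: "x \<in> space M ==> integrable M (%y. k x y)"
 using k_times_integrable[of x "%_. 1"] by simp

lemma kernel_op_diff:
 assumes "x \<in> space M" "integrable M f" "integrable M g"
 shows "kernel_op M k (%y. f y - g y) x = kernel_op M k f x - kernel_op M k g x"
 using k_times_integrable[OF assms(1,2)] k_times_integrable[OF assms(1,3)]
 by (simp add: kernel_op_def right_diff_distrib)

lemma kernel_op_abs_le:
 assumes "x \<in> space M" "integrable M f"
 shows "\<bar>kernel_op M k f x\<bar> \<le> kernel_op M k (%y. \<bar>f y\<bar>) x"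
 using integral_abs_bound[of M "%y. k x y * f y"] k_nonneg by (simp add: kernel_op_def abs_mult)

lemma kernel_op_bounded:
 assumes "x \<in> space M" and [measurable]: "f \<in> \<B> M" and B: "!!y. y \<in> space M ==> \<bar>f y\<bar> \<le> B"
 shows "\<bar>kernel_op M k f x\<bar> \<le> B"
proof -
 have f: "integrable M f" by (rule integrable_const_bound[of _ B]) (use B in auto)
 have "B \<ge> 0" using B[OF assms(1)] by simp
 have "\<bar>kernel_op M k f x\<bar> \<le> kernel_op M k (%y. \<bar>f y\<bar>) x" by (rule kernel_op_abs_le[OF assms(1) f])
 also have "... \<le> (LINT y|M. B * k x y)"
  unfolding kernel_op_def
  using k_times_integrable[OF assms(1) integrable_abs[OF f]] k_integrable[OF assms(1)] B k_nonneg
  by (intro integral_mono) (auto simp: mult.commute intro!: mult_right_mono)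
 also have "... \<le> B" using mult_left_mono[OF k_row[OF assms(1)] \<open>B \<ge> 0\<close>] by simp
 finally show ?thesis .
qed

text \<open>Jensen's inequality, integrating the tangent line of \<open>a \<mapsto> a powr p\<close> at the average.\<close>

lemma kernel_op_Jensen:
 assumes x: "x \<in> space M" and [measurable]: "f \<in> \<B> M" and p: "p \<ge> 1"
  and fp: "integrable M (%y. \<bar>f y\<bar> powr p)"
 shows "\<bar>kernel_op M k f x\<bar> powr p \<le> kernel_op M k (%y. \<bar>f y\<bar> powr p) x"
proof -
 have f: "integrable M f" by (rule integrable_of_powr[OF _ p fp]) simp
 define b where "b = kernel_op M k (%y. \<bar>f y\<bar>) x"
 define R where "R = (LINT y|M. k x y)"
 have R: "0 \<le> R" "R \<le> 1" unfolding R_def using k_row[OF x] k_nonneg by (auto intro!: L_integral_nonneg)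
 have le: "\<bar>kernel_op M k f x\<bar> \<le> b" unfolding b_def by (rule kernel_op_abs_le[OF x f])
 then have le': "\<bar>kernel_op M k f x\<bar> powr p \<le> b powr p" using p by (intro powr_mono2) auto
 show ?thesis
 proof (cases "b > 0")
  case False
  then have "\<bar>kernel_op M k f x\<bar> = 0" using le by linarith
  moreover have "0 \<le> kernel_op M k (%y. \<bar>f y\<bar> powr p) x"
   unfolding kernel_op_def using k_nonneg by (intro L_integral_nonneg) auto
  ultimately show ?thesis by simp
 next
  case True
  note ka = k_times_integrable[OF x integrable_abs[OF f]] and kp = k_times_integrable[OF x fp]
  have "p * b powr (p - 1) * b = (LINT y|M. p * b powr (p - 1) * (k x y * \<bar>f y\<bar>))"
   by (simp add: b_def kernel_op_def)
  also have "... \<le> (LINT y|M. k x y * \<bar>f y\<bar> powr p + (p - 1) * b powr p * k x y)"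
  proof (rule integral_mono)
   fix y
   show "p * b powr (p - 1) * (k x y * \<bar>f y\<bar>) \<le> k x y * \<bar>f y\<bar> powr p + (p - 1) * b powr p * k x y"
    using mult_left_mono[OF powr_tangent[OF p abs_ge_zero True, of "f y"] k_nonneg[of x y]]
    by (simp add: algebra_simps)
  qed (use ka kp k_integrable[OF x] in auto)
  also have "... = kernel_op M k (%y. \<bar>f y\<bar> powr p) x + (p - 1) * b powr p * R"
   using kp k_integrable[OF x] by (simp add: kernel_op_def R_def)
  \<comment> \<open>The constant part of the tangent is nonnegative, so a row mass below one is no
    loss.\<close>
  also have "... \<le> kernel_op M k (%y. \<bar>f y\<bar> powr p) x + (p - 1) * b powr p"
   using R p mult_left_mono[OF R(2), of "(p - 1) * b powr p"] by simp
  also have "p * b powr (p - 1) * b = p * b powr p"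
   using True powr_mult_base[of b "p - 1"] by (simp add: mult.commute)
  finally have "b powr p \<le> kernel_op M k (%y. \<bar>f y\<bar> powr p) x" by (simp add: algebra_simps)
  then show ?thesis using le' by simp
 qed
qed

text \<open>Integrating in the other order, the column mass appears and is at most one.\<close>

lemma kernel_op_contraction:
 assumes g: "integrable M g" and g0: "!!y. 0 \<le> g y"
 shows "integrable M (kernel_op M k g)" "(LINT x|M. kernel_op M k g x) \<le> (LINT y|M. g y)"
proof -
 have [measurable]: "g \<in> \<B> M" using g by simp
 obtain C where C: "!!x y. k x y \<le> C" using k_bounded by blast
 have int: "integrable (M \<Otimes>\<^sub>M M) (%(x, y). k x y * g y)"
 proof (rule MM.Fubini_integrable)
  show "(%(x, y). k x y * g y) \<in> \<B> (M \<Otimes>\<^sub>M M)" by measurable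
  have "C \<ge> 0" using C k_nonneg order_trans by blast
  have *: "0 \<le> (LINT y|M. k x y * g y)" "(LINT y|M. k x y * g y) \<le> C * (LINT y|M. g y)" if "x \<in> space M" for x
  proof -
   have "(LINT y|M. k x y * g y) \<le> (LINT y|M. C * g y)"
    using k_times_integrable[OF that g] g g0 C by (intro integral_mono) (auto intro: mult_right_mono)
   then show "(LINT y|M. k x y * g y) \<le> C * (LINT y|M. g y)" by simp
   show "0 \<le> (LINT y|M. k x y * g y)" using k_nonneg g0 by simp
  qed
  show "integrable M (%x. (LINT y|M. norm (case (x, y) of (x, y) => k x y * g y)))"
   using * by (intro integrable_const_bound[of _ "C * (LINT y|M. g y)"]) (auto simp: k_nonneg g0 abs_mult)
  show "AE x in M. integrable M (%y. case (x, y) of (x, y) => k x y * g y)"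
   using k_times_integrable g by auto
 qed
 show "integrable M (kernel_op M k g)"
  using MM.integrable_fst[OF int] by (simp add: kernel_op_def[abs_def])
 have "(LINT x|M. kernel_op M k g x) = (LINT y|M. (LINT x|M. k x y * g y))"
  unfolding kernel_op_def using MM.Fubini_integral[OF int] by simp
 also have "... \<le> (LINT y|M. g y)"
 proof (rule integral_mono)
  show "integrable M (%y. (LINT x|M. k x y * g y))" using MM.integrable_snd[OF int] by simp
  show "(LINT x|M. k x y * g y) \<le> g y" if "y \<in> space M" for y
   using mult_right_mono[OF k_col[OF that] g0[of y]] by simp
 qed (rule g)
 finally show "(LINT x|M. kernel_op M k g x) \<le> (LINT y|M. g y)" .
qed

lemma kernel_op_powr_integrable:
 assumes [measurable]: "f \<in> \<B> M" and p: "p \<ge> 1" and fp: "integrable M (%y. \<bar>f y\<bar> powr p)"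
 shows "integrable M (%x. \<bar>kernel_op M k f x\<bar> powr p)"
  and "(LINT x|M. \<bar>kernel_op M k f x\<bar> powr p) \<le> (LINT y|M. \<bar>f y\<bar> powr p)"
proof -
 note c = kernel_op_contraction[OF fp powr_ge_zero]
 show i: "integrable M (%x. \<bar>kernel_op M k f x\<bar> powr p)"
  by (rule L_integrable_bound[OF c(1)])
   (auto intro!: AE_I2 order_trans[OF kernel_op_Jensen[OF _ _ p fp] abs_ge_self])
 have "(LINT x|M. \<bar>kernel_op M k f x\<bar> powr p) \<le> (LINT x|M. kernel_op M k (%y. \<bar>f y\<bar> powr p) x)"
  by (rule integral_mono[OF i c(1)]) (auto intro!: kernel_op_Jensen[OF _ _ p fp])
 then show "(LINT x|M. \<bar>kernel_op M k f x\<bar> powr p) \<le> (LINT y|M. \<bar>f y\<bar> powr p)" using c(2) by simp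
qed

lemma kernel_op_power_integrable:
 assumes [measurable]: "f \<in> \<B> M" and p: "0 < p" and fp: "integrable M (%y. \<bar>f y\<bar> ^ p)"
 shows "integrable M (%x. \<bar>kernel_op M k f x\<bar> ^ p)"
  and "(LINT x|M. \<bar>kernel_op M k f x\<bar> ^ p) \<le> (LINT y|M. \<bar>f y\<bar> ^ p)"
 using kernel_op_powr_integrable[of f "real p"] assms by (simp_all add: power_eq_powr del: power_abs)

end

lemma power_add3_le:
 fixes a b c :: real
 assumes "0 \<le> a" "0 \<le> b" "0 \<le> c"
 shows "(a + b + c) ^ p \<le> 3 ^ p * (a ^ p + b ^ p + c ^ p)"
proof -
 define m where "m = max a (max b c)"
 have "(a + b + c) ^ p \<le> (3 * m) ^ p" using assms unfolding m_def by (intro power_mono) auto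
 also have "... = 3 ^ p * m ^ p" by (simp add: power_mult_distrib)
 also have "m ^ p \<le> a ^ p + b ^ p + c ^ p" using assms unfolding m_def by (auto simp: max_def)
 finally show ?thesis by simp
qed

text \<open>Truncation reduces L^p to L^1: the tail of \<open>f\<close> is controlled by the
  contraction property, and on the truncated part the p-th power of the error is at most
  \<open>(2 B)^(p - 1)\<close> times the error itself.\<close>

theorem kernel_op_tendsto:
 fixes f :: "'a => real"
 assumes k: "!!n. bounded_kernel M (k n)"
  and bdd: "!!f B. f \<in> \<B> M ==> (!!x. \<bar>f x\<bar> \<le> B) ==>
   (%n. (LINT x|M. \<bar>kernel_op M (k n) f x - f x\<bar>)) \<leadsto> 0"
  and [measurable]: "f \<in> \<B> M" and p: "0 < p" and fp: "integrable M (%x. \<bar>f x\<bar> ^ p)"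
 shows "(%n. (LINT x|M. \<bar>kernel_op M (k n) f x - f x\<bar> ^ p)) \<leadsto> 0"
proof (rule tendsto_0_ge_le)
 interpret k: bounded_kernel M "k n" for n by (rule k)
 fix e :: real assume "e > 0"
 define t where "t B x = max (- real B) (min (real B) (f x))" for B :: nat and x
 have [measurable]: "t B \<in> \<B> M" for B unfolding t_def by measurable
 have tB: "\<bar>t B x\<bar> \<le> real B" and tf: "\<bar>t B x\<bar> \<le> \<bar>f x\<bar>" and tf': "\<bar>f x - t B x\<bar> \<le> \<bar>f x\<bar>" for B x
  unfolding t_def by (auto simp: max_def min_def abs_if)
 have "(%B. (LINT x|M. \<bar>f x - t B x\<bar> ^ p)) \<leadsto> (LINT x|M. 0)"
 proof (rule integral_dominated_convergence[OF _ _ fp])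
  show "AE x in M. (%B. \<bar>f x - t B x\<bar> ^ p) \<leadsto> 0"
  proof (rule AE_I2)
   fix x
   obtain N :: nat where "\<bar>f x\<bar> \<le> real N" using real_arch_simple by blast
   then have "eventually (%B. \<bar>f x - t B x\<bar> ^ p = 0) sequentially"
    using p unfolding eventually_sequentially t_def
    by (intro exI[of _ N]) (auto simp: max_def min_def power_0_left abs_if split: if_splits)
   then show "(%B. \<bar>f x - t B x\<bar> ^ p) \<leadsto> 0" by (rule tendsto_eventually)
  qed
  show "AE x in M. norm (\<bar>f x - t B x\<bar> ^ p) \<le> \<bar>f x\<bar> ^ p" for B
   using tf' by (auto intro!: AE_I2 power_mono simp del: power_abs)
 qed measurable
 \<comment> \<open>The error splits into three parts, each weighted by the \<open>3 ^ p\<close> of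
   \<open>power_add3_le\<close>; with this share their sum is half of \<open>e\<close>.\<close>
 then have "eventually (%B. (LINT x|M. \<bar>f x - t B x\<bar> ^ p) < e / (6 * 3 ^ p)) sequentially"
  using \<open>e > 0\<close> by (intro order_tendstoD(2)) auto
 then obtain B where B: "(LINT x|M. \<bar>f x - t B x\<bar> ^ p) < e / (6 * 3 ^ p)"
  by (auto simp: eventually_sequentially)
 have ft: "integrable M (%x. \<bar>f x - t B x\<bar> ^ p)" and tp: "integrable M (%x. \<bar>t B x\<bar> ^ p)"
  by (rule L_integrable_bound[OF fp];
   use tf tf' in \<open>auto intro!: AE_I2 power_mono simp del: power_abs\<close>)+
 have fi: "integrable M f" and ti: "integrable M (t B)"
  using k.integrable_of_power[OF _ p fp] k.integrable_of_power[OF _ p tp] by auto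
 define Q where "Q n = (LINT x|M. \<bar>kernel_op M (k n) (t B) x - t B x\<bar>)" for n
 have "Q \<leadsto> 0" unfolding Q_def by (rule bdd[of _ "real B"]) (use tB in auto)
 then have "(%n. (2 * real B) ^ (p - 1) * Q n) \<leadsto> 0" by (intro tendsto_mult_right_zero)
 then have "eventually (%n. (2 * real B) ^ (p - 1) * Q n < e / (6 * 3 ^ p)) sequentially"
  using \<open>e > 0\<close> by (intro order_tendstoD(2)) auto
 then show "eventually (%n. (LINT x|M. \<bar>kernel_op M (k n) f x - f x\<bar> ^ p) \<le> e) sequentially"
 proof eventually_elim
  case (elim n)
  let ?K = "kernel_op M (k n)"
  note c1 = k.kernel_op_power_integrable[OF _ p ft, of n]
  note c2 = k.kernel_op_power_integrable[OF _ p tp, of n]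
  have i2: "integrable M (%x. \<bar>?K (t B) x - t B x\<bar> ^ p)"
   by (rule integrable_power_diff) (use c2 tp in auto)
  have i3: "integrable M (%x. \<bar>?K (t B) x - t B x\<bar>)"
   using k.integrable_of_power[OF _ p i2] by (simp add: integrable_abs_iff)
  have "(LINT x|M. \<bar>?K f x - f x\<bar> ^ p) \<le> (LINT x|M. 3 ^ p * (\<bar>?K (%y. f y - t B y) x\<bar> ^ p
    + \<bar>?K (t B) x - t B x\<bar> ^ p + \<bar>f x - t B x\<bar> ^ p))"
  proof (rule integral_mono')
   show "integrable M (%x. 3 ^ p * (\<bar>?K (%y. f y - t B y) x\<bar> ^ p
    + \<bar>?K (t B) x - t B x\<bar> ^ p + \<bar>f x - t B x\<bar> ^ p))"
    using c1 i2 ft by (simp del: power_abs)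
   fix x assume x: "x \<in> space M"
   have "\<bar>?K f x - f x\<bar> \<le> \<bar>?K (%y. f y - t B y) x\<bar> + \<bar>?K (t B) x - t B x\<bar> + \<bar>f x - t B x\<bar>"
    using k.kernel_op_diff[OF x fi ti, of n] by simp
   then show "\<bar>?K f x - f x\<bar> ^ p \<le> 3 ^ p * (\<bar>?K (%y. f y - t B y) x\<bar> ^ p
    + \<bar>?K (t B) x - t B x\<bar> ^ p + \<bar>f x - t B x\<bar> ^ p)"
    by (intro order_trans[OF power_mono power_add3_le]) auto
  qed simp
  also have "... = 3 ^ p * ((LINT x|M. \<bar>?K (%y. f y - t B y) x\<bar> ^ p)
    + (LINT x|M. \<bar>?K (t B) x - t B x\<bar> ^ p) + (LINT x|M. \<bar>f x - t B x\<bar> ^ p))"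
   using c1 i2 ft by (simp del: power_abs)
  also have "... \<le> 3 ^ p * (e / (6 * 3 ^ p) + e / (6 * 3 ^ p) + e / (6 * 3 ^ p))"
  proof (intro mult_left_mono add_mono)
   have "(LINT x|M. \<bar>?K (t B) x - t B x\<bar> ^ p) \<le> (LINT x|M. (2 * real B) ^ (p - 1) * \<bar>?K (t B) x - t B x\<bar>)"
   proof (rule integral_mono')
    fix x assume x: "x \<in> space M"
    have "\<bar>?K (t B) x - t B x\<bar> \<le> 2 * real B"
    proof -
     have "\<bar>?K (t B) x\<bar> \<le> real B" by (rule k.kernel_op_bounded[OF x _ tB]) measurable
     then show ?thesis using tB[of B x] by simp
    qed
    then have "\<bar>?K (t B) x - t B x\<bar> ^ (p - 1) * \<bar>?K (t B) x - t B x\<bar> \<le> (2 * real B) ^ (p - 1) * \<bar>?K (t B) x - t B x\<bar>"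
     by (intro mult_right_mono power_mono) auto
    then show "\<bar>?K (t B) x - t B x\<bar> ^ p \<le> (2 * real B) ^ (p - 1) * \<bar>?K (t B) x - t B x\<bar>"
     using p by (simp add: power_eq_if[of _ p] mult.commute del: power_abs)
   qed (use i3 in auto)
   also have "... \<le> e / (6 * 3 ^ p)" using elim by (simp add: Q_def)
   finally show "(LINT x|M. \<bar>?K (t B) x - t B x\<bar> ^ p) \<le> e / (6 * 3 ^ p)" .
  qed (use c1(2) B in auto)
  also have "... \<le> e" using \<open>e > 0\<close> by simp
  finally show ?case .
 qed
qed simp

text \<open>The kernel acts on the second variable only.\<close>

theorem Lp_conv_kernel_op:
 fixes f :: "'b \<times> 'a => real"
 assumes N: "sigma_finite_measure N" and k: "!!n. bounded_kernel M (k n)"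
  and bdd: "!!f B. f \<in> \<B> M ==> (!!x. \<bar>f x\<bar> \<le> B) ==>
   (%n. (LINT x|M. \<bar>kernel_op M (k n) f x - f x\<bar>)) \<leadsto> 0"
  and [measurable]: "f \<in> \<B> (N \<Otimes>\<^sub>M M)" and p: "0 < p"
  and fp: "integrable (N \<Otimes>\<^sub>M M) (%z. \<bar>f z\<bar> ^ p)"
 shows "Lp_conv p (N \<Otimes>\<^sub>M M) (%n (s, x). kernel_op M (k n) (%y. f (s, y)) x) f"
proof -
 interpret k: bounded_kernel M "k n" for n by (rule k)
 interpret N: sigma_finite_measure N by (rule N)
 interpret NM: pair_sigma_finite N M by unfold_locales
 let ?K = "%n (s, x). kernel_op M (k n) (%y. f (s, y)) x"
 have km: "(%z. k n (snd (fst z)) (snd z)) \<in> \<B> ((N \<Otimes>\<^sub>M M) \<Otimes>\<^sub>M M)" for n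
 proof -
  have "(%z. (snd (fst z), snd z)) \<in> (N \<Otimes>\<^sub>M M) \<Otimes>\<^sub>M M \<rightarrow>\<^sub>M M \<Otimes>\<^sub>M M" by measurable
  from measurable_compose[OF this k.k_measurable[of n]] show ?thesis by simp
 qed
 have [measurable]: "?K n \<in> \<B> (N \<Otimes>\<^sub>M M)" for n
 proof -
  have "(%z. k n (snd (fst z)) (snd z) * f (fst (fst z), snd z)) \<in> \<B> ((N \<Otimes>\<^sub>M M) \<Otimes>\<^sub>M M)"
   using km[of n] by measurable
  then have "(%z. (LINT y|M. k n (snd z) y * f (fst z, y))) \<in> \<B> (N \<Otimes>\<^sub>M M)"
   by (intro k.borel_measurable_lebesgue_integral) (simp add: case_prod_unfold)
  then show ?thesis by (simp add: kernel_op_def case_prod_unfold)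
 qed
 define F where "F s = (LINT y|M. \<bar>f (s, y)\<bar> ^ p)" for s
 have Fi: "integrable N F" unfolding F_def using NM.integrable_fst'[OF fp] .
 have AEs: "AE s in N. integrable M (%y. \<bar>f (s, y)\<bar> ^ p)" using NM.AE_integrable_fst'[OF fp] .
 have Ki: "integrable (N \<Otimes>\<^sub>M M) (%z. \<bar>?K n z\<bar> ^ p)" for n
 proof (rule NM.Fubini_integrable)
  show "(%z. \<bar>?K n z\<bar> ^ p) \<in> \<B> (N \<Otimes>\<^sub>M M)" by measurable
  show "AE s in N. integrable M (%x. \<bar>?K n (s, x)\<bar> ^ p)"
   using AEs AE_space
   by eventually_elim (auto intro!: k.kernel_op_power_integrable(1)[OF _ p] simp del: power_abs)
  show "integrable N (%s. (LINT x|M. norm (\<bar>?K n (s, x)\<bar> ^ p)))"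
  proof (rule L_integrable_bound[OF Fi])
   show "AE s in N. norm (LINT x|M. norm (\<bar>?K n (s, x)\<bar> ^ p)) \<le> norm (F s)"
    using AEs AE_space
   proof eventually_elim
    case (elim s)
    then have "(LINT x|M. \<bar>kernel_op M (k n) (%y. f (s, y)) x\<bar> ^ p) \<le> F s"
     unfolding F_def by (intro k.kernel_op_power_integrable(2)[OF _ p]) auto
    moreover have "0 \<le> F s" by (simp add: F_def)
    ultimately show ?case by (simp del: power_abs)
   qed
  qed measurable
 qed
 have Di: "integrable (N \<Otimes>\<^sub>M M) (%z. \<bar>?K n z - f z\<bar> ^ p)" for n
  by (rule integrable_power_diff[OF _ _ Ki fp]) auto
 \<comment> \<open>Convergence holds on almost every slice, and the contraction property supplies
   the majorant for dominated convergence in the first variable.\<close>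
 have "(%n. (LINT s|N. (LINT x|M. \<bar>?K n (s, x) - f (s, x)\<bar> ^ p))) \<leadsto> (LINT s|N. 0)"
 proof (rule integral_dominated_convergence[where w = "%s. 2 ^ p * (F s + F s)"])
  show "integrable N (%s. 2 ^ p * (F s + F s))" using Fi by simp
  show "AE s in N. (%n. (LINT x|M. \<bar>?K n (s, x) - f (s, x)\<bar> ^ p)) \<leadsto> 0"
   using AEs AE_space
  proof eventually_elim
   case (elim s)
   have "(%n. (LINT x|M. \<bar>kernel_op M (k n) (%y. f (s, y)) x - f (s, x)\<bar> ^ p)) \<leadsto> 0"
    by (rule kernel_op_tendsto[OF k bdd _ p elim(1)]) (use elim(2) in auto)
   then show ?case by simp
  qed
  show "AE s in N. norm (LINT x|M. \<bar>?K n (s, x) - f (s, x)\<bar> ^ p) \<le> 2 ^ p * (F s + F s)" for n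
   using AEs AE_space
  proof eventually_elim
   case (elim s)
   have [measurable]: "(%y. f (s, y)) \<in> \<B> M" using elim(2) by measurable
   note c = k.kernel_op_power_integrable[OF _ p elim(1), of n]
   have "(LINT x|M. \<bar>kernel_op M (k n) (%y. f (s, y)) x - f (s, x)\<bar> ^ p)
     \<le> (LINT x|M. 2 ^ p * (\<bar>kernel_op M (k n) (%y. f (s, y)) x\<bar> ^ p + \<bar>f (s, x)\<bar> ^ p))"
    using c elim(1) by (intro integral_mono' abs_diff_power_le) (auto simp del: power_abs)
   also have "... \<le> 2 ^ p * (F s + F s)"
    using c elim(1) by (simp add: F_def del: power_abs)
   finally show ?case by (simp add: abs_of_nonneg del: power_abs)
  qed
 qed measurable
 then have "(%n. (LINT z|(N \<Otimes>\<^sub>M M). \<bar>?K n z - f z\<bar> ^ p)) \<leadsto> 0"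
  using NM.integral_fst'[OF Di] by simp
 then show ?thesis unfolding Lp_conv_def using Ki fp by auto
qed

section \<open>The unit cell and its translations\<close>

lemma space_torus [simp]: "space torus = cbox 0 1"
 by (simp add: torus_def space_restrict_space)

lemma borel_measurable_torusI: "f \<in> \<B> borel ==> f \<in> \<B> torus"
 unfolding torus_def by (intro measurable_restrict_space1) simp

lemma one_inner_Basis: "b \<in> Basis ==> (1 :: real^'d::finite) \<bullet> b = 1"
 by (auto simp: Basis_vec_def inner_axis)

lemma emeasure_torus: "emeasure torus (cbox 0 1 :: (real^'d::finite) set) = 1"
 by (simp add: torus_def emeasure_restrict_space emeasure_lborel_cbox_eq one_inner_Basis)

lemma finite_measure_torus: "finite_measure (torus :: (real^'d::finite) measure)"
 by (rule finite_measureI) (simp add: emeasure_torus)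

lemma measure_torus [simp]: "measure torus (cbox 0 1 :: (real^'d::finite) set) = 1"
 by (simp add: measure_def emeasure_torus)

interpretation torus: finite_measure "torus :: (real^'d::finite) measure"
 by (rule finite_measure_torus)

interpretation TX: pair_sigma_finite "time T" "torus :: (real^'d::finite) measure" for T
 by unfold_locales

lemma finite_measure_spacetime: "finite_measure (\<S> T)"
 by (intro finite_measure_pair_measure finite_measure_time torus.finite_measure_axioms)

interpretation spacetime: finite_measure "\<S> T" for T
 by (rule finite_measure_spacetime)

lemma mem_cell: "x \<in> cbox 0 (1 :: real^'d::finite) \<longleftrightarrow> (\<forall>i. 0 \<le> x $ i \<and> x $ i \<le> 1)"
 by (simp add: mem_box_cart)

text \<open>The faces of the cell and of its translates are null, so the double counting of opposite
  faces does no harm.\<close>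

lemma AE_coordinate_neq:
 fixes i :: "'d::finite" and c :: real
 shows "AE x :: real^'d in lborel. x $ i \<noteq> c"
proof -
 have "negligible {x :: real^'d. x $ i = c}" 
  using negligible_standard_hyperplane[of "axis i 1 :: real^'d" c] by (simp add: inner_axis)
 moreover have "{x :: real^'d. x $ i = c} \<in> sets borel"
  by (intro borel_closed closed_Collect_eq continuous_intros)
 ultimately have "{x :: real^'d. x $ i = c} \<in> null_sets lborel"
  by (simp add: negligible_iff_null_sets null_sets_completion_iff)
 then show ?thesis by (rule AE_I') auto
qed

lemma nn_integral_lborel_shift:
 fixes g :: "'a::euclidean_space => ennreal"
 assumes [measurable]: "g \<in> \<B> borel"
 shows "(\<integral>\<^sup>+x. g (c + x) \<partial>lborel) = (\<integral>\<^sup>+x. g x \<partial>lborel)"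
proof -
 have "(\<integral>\<^sup>+x. g x \<partial>lborel) = (\<integral>\<^sup>+x. g x \<partial>distr lborel borel ((+) c))"
  by (simp add: lborel_distr_plus)
 also have "... = (\<integral>\<^sup>+x. g (c + x) \<partial>lborel)" by (subst nn_integral_distr) auto
 finally show ?thesis by simp
qed

definition periodic :: "(real^'d::finite => 'b) => bool"
 where "periodic f \<longleftrightarrow> (\<forall>x i. f (x + axis i 1) = f x)"

lemma periodicD: "periodic f ==> f (x + axis i 1) = f x"
 by (simp add: periodic_def)

lemma periodic_of_int:
 assumes "periodic f"
 shows "f (x + of_int k *\<^sub>R axis i 1) = f x"
proof -
 have *: "f (x + of_nat n *\<^sub>R axis i 1) = f x" for n x
 proof (induction n)
  case (Suc n)
  have "x + of_nat (Suc n) *\<^sub>R axis i 1 = (x + of_nat n *\<^sub>R axis i 1) + axis i 1"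
   by (simp add: scaleR_add_left)
  then show ?case using Suc periodicD[OF assms] by metis
 qed simp
 show ?thesis
 proof (cases "k \<ge> 0")
  case True
  then show ?thesis using *[of x "nat k"] by simp
 next
  case False
  then show ?thesis using *[of "x + of_int k *\<^sub>R axis i 1" "nat (- k)"] by simp
 qed
qed

text \<open>The cell translated by \<open>s\<close> along one axis is cut at the face: one piece
  lies in the original cell, the other re-enters it after a unit translation, under which
  \<open>f\<close> does not change.\<close>

lemma nn_integral_torus_shift_unit:
 fixes f :: "real^'d::finite => ennreal"
 assumes [measurable]: "f \<in> \<B> borel" and f: "periodic f" and s: "0 \<le> s" "s \<le> 1"
 shows "(NN x. f (s *\<^sub>R axis i 1 + x)) = (NN x. f x)"
proof -
 let ?e = "axis i 1 :: real^'d" and ?Q = "cbox 0 1 :: (real^'d) set"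
 let ?L = "%y. indicator {y. s \<le> y $ i} y :: ennreal" and ?U = "%y. indicator {y. y $ i \<le> s} y :: ennreal"
 have [measurable]: "{y :: real^'d. s \<le> y $ i} \<in> sets borel" "{y :: real^'d. y $ i \<le> s} \<in> sets borel"
  by (intro borel_closed closed_Collect_le continuous_intros)+
 have "(NN x. f (s *\<^sub>R ?e + x)) = (\<integral>\<^sup>+x. f (s *\<^sub>R ?e + x) * indicator ?Q (- (s *\<^sub>R ?e) + (s *\<^sub>R ?e + x)) \<partial>lborel)"
  unfolding torus_def by (subst nn_integral_restrict_space) auto
 also have "... = (\<integral>\<^sup>+y. f y * indicator ?Q (- (s *\<^sub>R ?e) + y) \<partial>lborel)"
  by (rule nn_integral_lborel_shift[of "%y. f y * indicator ?Q (- (s *\<^sub>R ?e) + y)"]) measurable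
 \<comment> \<open>The pieces are those with \<open>y $ i\<close> between \<open>s\<close> and 1 and
   between 1 and \<open>1 + s\<close>; they overlap only where \<open>y $ i = 1\<close>.\<close>
 also have "... = (\<integral>\<^sup>+y. f y * indicator ?Q y * ?L y + f y * indicator ?Q (- ?e + y) * ?U (- ?e + y) \<partial>lborel)"
 proof (rule nn_integral_cong_AE)
  show "AE y in lborel. f y * indicator ?Q (- (s *\<^sub>R ?e) + y)
    = f y * indicator ?Q y * ?L y + f y * indicator ?Q (- ?e + y) * ?U (- ?e + y)"
   using AE_coordinate_neq[of i 1]
  proof eventually_elim
   case (elim y)
   have 1: "- (s *\<^sub>R ?e) + y \<in> ?Q \<longleftrightarrow> (\<forall>j. j \<noteq> i --> 0 \<le> y $ j \<and> y $ j \<le> 1) \<and> s \<le> y $ i \<and> y $ i \<le> 1 + s"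
    unfolding mem_cell by (auto simp: axis_def)
   have 2: "- ?e + y \<in> ?Q \<longleftrightarrow> (\<forall>j. j \<noteq> i --> 0 \<le> y $ j \<and> y $ j \<le> 1) \<and> 1 \<le> y $ i \<and> y $ i \<le> 2"
    unfolding mem_cell by (auto simp: axis_def)
   have 3: "y \<in> ?Q \<longleftrightarrow> (\<forall>j. j \<noteq> i --> 0 \<le> y $ j \<and> y $ j \<le> 1) \<and> 0 \<le> y $ i \<and> y $ i \<le> 1"
    unfolding mem_cell by auto
   show ?case using elim s unfolding indicator_def mem_Collect_eq 1 2 3 by auto
  qed
 qed
 also have "... = (\<integral>\<^sup>+y. f y * indicator ?Q y * ?L y \<partial>lborel) + (\<integral>\<^sup>+y. f y * indicator ?Q (- ?e + y) * ?U (- ?e + y) \<partial>lborel)"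
  by (rule nn_integral_add) measurable
 also have "(\<integral>\<^sup>+y. f y * indicator ?Q (- ?e + y) * ?U (- ?e + y) \<partial>lborel)
   = (\<integral>\<^sup>+y. f (?e + y) * indicator ?Q (- ?e + (?e + y)) * ?U (- ?e + (?e + y)) \<partial>lborel)"
  by (rule nn_integral_lborel_shift[of "%y. f y * indicator ?Q (- ?e + y) * ?U (- ?e + y)", symmetric]) measurable
 also have "... = (\<integral>\<^sup>+y. f y * indicator ?Q y * ?U y \<partial>lborel)"
  using periodicD[OF f] by (simp add: add.commute)
 also have "(\<integral>\<^sup>+y. f y * indicator ?Q y * ?L y \<partial>lborel) + (\<integral>\<^sup>+y. f y * indicator ?Q y * ?U y \<partial>lborel)
   = (\<integral>\<^sup>+y. f y * indicator ?Q y * ?L y + f y * indicator ?Q y * ?U y \<partial>lborel)"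
  by (rule nn_integral_add[symmetric]) measurable
 also have "... = (\<integral>\<^sup>+y. f y * indicator ?Q y \<partial>lborel)"
  by (rule nn_integral_cong_AE, use AE_coordinate_neq[of i s] in eventually_elim) (auto simp: indicator_def)
 also have "... = (NN y. f y)"
  unfolding torus_def by (subst nn_integral_restrict_space) auto
 finally show ?thesis .
qed

text \<open>A general vector is added one coordinate at a time, after periodicity has reduced each
  coordinate to its fractional part.\<close>

lemma nn_integral_torus_shift:
 fixes f :: "real^'d::finite => ennreal"
 assumes f: "f \<in> \<B> borel" "periodic f"
 shows "(NN x. f (a + x)) = (NN x. f x)"
proof -
 have one: "(NN x. g (s *\<^sub>R axis i 1 + x)) = (NN x. g x)"
  if g: "g \<in> \<B> borel" "periodic g" for g :: "real^'d => ennreal" and s i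
 proof -
  have "g (s *\<^sub>R axis i 1 + x) = g (frac s *\<^sub>R axis i 1 + x)" for x
  proof -
   have "s *\<^sub>R axis i 1 + x = (frac s *\<^sub>R axis i 1 + x) + of_int \<lfloor>s\<rfloor> *\<^sub>R axis i (1::real)"
    by (simp add: frac_def algebra_simps)
   then show ?thesis using periodic_of_int[OF g(2)] by metis
  qed
  then show ?thesis
   using nn_integral_torus_shift_unit[OF g, of "frac s" i] by (simp add: frac_ge_0 less_imp_le frac_lt_1)
 qed
 have "(NN x. f ((\<Sum>i\<in>I. a $ i *\<^sub>R axis i 1) + x)) = (NN x. f x)" if "finite I" for I
  using that
 proof (induction I)
  case (insert j I)
  let ?g = "%x. f ((\<Sum>i\<in>I. a $ i *\<^sub>R axis i 1) + x)"
  have "?g \<in> \<B> borel" using f(1) by measurable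
  moreover have "periodic ?g" using periodicD[OF f(2)] by (simp add: periodic_def add.assoc[symmetric])
  ultimately have "(NN x. ?g (a $ j *\<^sub>R axis j 1 + x)) = (NN x. ?g x)" by (rule one)
  then show ?case using insert by (simp add: algebra_simps)
 qed simp
 from this[of UNIV] show ?thesis using basis_expansion[of a] by (simp add: scalar_mult_eq_scaleR)
qed

lemma integral_torus_shift:
 fixes f :: "real^'d::finite => real"
 assumes [measurable]: "f \<in> \<B> borel" and f: "periodic f" "integrable torus f"
 shows "integrable torus (%x. f (a + x))" "(\<oint>x. f (a + x)) = (\<oint>x. f x)"
proof -
 have [measurable]: "f \<in> \<B> torus" "(%x. f (a + x)) \<in> \<B> torus"
  by (rule borel_measurable_torusI, measurable)+
 have sh: "(NN x. ennreal (h (f (a + x)))) = (NN x. ennreal (h (f x)))"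
  if [measurable]: "h \<in> \<B> borel" for h :: "real => real"
  by (rule nn_integral_torus_shift[of "%x. ennreal (h (f x))"])
   (use f(1) in \<open>auto simp: periodic_def\<close>)
 have "(NN x. ennreal (norm (f (a + x)))) < \<infinity>"
  using f(2) sh[of norm] by (simp add: integrable_iff_bounded)
 then show i: "integrable torus (%x. f (a + x))" by (intro integrableI_bounded) auto
 show "(\<oint>x. f (a + x)) = (\<oint>x. f x)"
  unfolding real_lebesgue_integral_def[OF i] real_lebesgue_integral_def[OF f(2)]
  using sh[of "%x. x"] sh[of uminus] by simp
qed


section \<open>Smooth periodic functions and separable kernels\<close>

lemma periodic_smooth_const [simp]: "periodic_smooth (%x. c)"
 by (simp add: periodic_smooth_def)

lemma periodic_smooth_add: "periodic_smooth f ==> periodic_smooth g ==> periodic_smooth (%x. f x + g x)"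
 by (simp add: periodic_smooth_def smooth_add)

lemma periodic_smooth_mult: "periodic_smooth f ==> periodic_smooth g ==> periodic_smooth (%x. f x * g x)"
 by (simp add: periodic_smooth_def smooth_mult)

lemma periodic_smooth_sum:
 "(!!i. i \<in> I ==> periodic_smooth (f i)) ==> periodic_smooth (%x. \<Sum>i\<in>I. f i x)"
 by (simp add: periodic_smooth_def smooth_sum)

lemma periodic_smooth_cos: "periodic_smooth (%x::real^'d::finite. cos (2 * pi * x $ i + c))"
proof -
 have "smooth (%x::real^'d. cos (2 * pi * x $ i + c))"
  by (rule smooth_compose_linear[OF bounded_linear_vec_nth smooth_cos])
 moreover have "cos (2 * pi * (x + axis j 1) $ i + c) = cos (2 * pi * x $ i + c)" for x :: "real^'d" and j
 proof (cases "i = j")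
  case True
  have "2 * pi * (x $ i + 1) + c = (2 * pi * x $ i + c) + 2 * pi" by (simp add: algebra_simps)
  then show ?thesis using True by (simp only: vector_add_component axis_nth cos_periodic)
 qed (simp add: axis_def)
 ultimately show ?thesis by (simp add: periodic_smooth_def)
qed

lemma periodic_smooth_smooth: "periodic_smooth f ==> smooth f"
 by (simp add: periodic_smooth_def)

lemma periodic_smooth_periodic: "periodic_smooth f ==> periodic f"
 by (simp add: periodic_smooth_def periodic_def)

lemma periodic_smooth_continuous: "periodic_smooth f ==> continuous_on A f"
 by (simp add: periodic_smooth_def smooth_continuous_on)

lemma periodic_smooth_measurable [measurable_dest]:
 "periodic_smooth f ==> f \<in> \<B> borel"
 by (intro borel_measurable_continuous_onI periodic_smooth_continuous)

lemma continuous_bounded_on_cell: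
 fixes f :: "real^'d::finite => real"
 assumes "continuous_on UNIV f"
 obtains B where "0 \<le> B" "!!x. x \<in> cbox 0 1 ==> \<bar>f x\<bar> \<le> B"
proof -
 have "compact (f ` cbox 0 1)"
  by (intro compact_continuous_image continuous_on_subset[OF assms]) auto
 then obtain B where "\<forall>y\<in>f ` cbox 0 1. norm y \<le> B"
  using compact_imp_bounded bounded_iff by metis
 then show ?thesis by (intro that[of "max B 0"]) (auto simp: le_max_iff_disj)
qed

lemma continuous_times_integrable_torus:
 fixes a f :: "real^'d::finite => real"
 assumes a: "continuous_on UNIV a" and f: "integrable torus f"
 shows "integrable torus (%x. a x * f x)"
proof -
 obtain B where B: "0 \<le> B" "!!x. x \<in> cbox 0 1 ==> \<bar>a x\<bar> \<le> B" using continuous_bounded_on_cell[OF a] by metis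
 have [measurable]: "a \<in> \<B> torus" "f \<in> \<B> torus"
  using f by (auto intro: borel_measurable_torusI borel_measurable_continuous_onI[OF a])
 show ?thesis
  by (rule integrable_bounded_times[OF f, of _ B]) (use B in auto)
qed

lemma continuous_integrable_torus: "continuous_on UNIV a ==> integrable torus a" for a :: "real^'d::finite => real"
 using continuous_times_integrable_torus[of a "%_. 1"] by simp

lemma gradient_nth: "gradient \<psi> x $ i = frechet_derivative \<psi> (at x) (axis i 1)"
 by (simp add: gradient_def)

lemma gradient_add:
 assumes "smooth f" "smooth g"
 shows "gradient (%x. f x + g x) x = gradient f x + gradient g x"
 using frechet_derivative_at[OF has_derivative_add[OF smooth_has_derivative[OF assms(1), of x]
    smooth_has_derivative[OF assms(2), of x]], symmetric]
 by (simp add: gradient_def vec_eq_iff)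

lemma gradient_mult:
 assumes "smooth f" "smooth g"
 shows "gradient (%x. f x * g x) x = f x *\<^sub>R gradient g x + g x *\<^sub>R gradient f x"
 using frechet_derivative_at[OF has_derivative_mult[OF smooth_has_derivative[OF assms(1), of x]
    smooth_has_derivative[OF assms(2), of x]], symmetric]
 by (simp add: gradient_def vec_eq_iff)

lemma gradient_const [simp]: "gradient (%x. c) x = 0"
 by (simp add: gradient_def vec_eq_iff)

lemma gradient_sum:
 assumes "!!i. i \<in> I ==> smooth (f i)"
 shows "gradient (%x. \<Sum>i\<in>I. f i x) x = (\<Sum>i\<in>I. gradient (f i) x)"
 using assms
 by (induction I rule: infinite_finite_induct) (simp_all add: gradient_add smooth_sum)

lemma smooth_gradient: "smooth f ==> smooth (%x. gradient f x $ i)"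
 by (simp add: gradient_nth smooth_frechet_derivative)


text \<open>Kernels of this kind turn integrable functions into smooth ones without differentiation
 under the integral sign.\<close>

inductive separable :: "(real^'d::finite => real^'d => real) => bool" where
 rank1: "periodic_smooth a ==> periodic_smooth b ==> separable (%x y. a x * b y)"
| add: "separable k ==> separable l ==> separable (%x y. k x y + l x y)"

lemma separable_rank1_mult:
 assumes "periodic_smooth a" "periodic_smooth b" "separable k"
 shows "separable (%x y. a x * b y * k x y)"
 using assms(3)
proof induction
 case (rank1 a' b')
 have "separable (%x y. (a x * a' x) * (b y * b' y))"
  by (intro separable.rank1 periodic_smooth_mult assms rank1)
 then show ?case by (simp add: mult_ac)
next
 case (add k l)
 then have "separable (%x y. a x * b y * k x y + a x * b y * l x y)" by (intro separable.add)
 then show ?case by (simp add: algebra_simps)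
qed

lemma separable_mult:
 assumes "separable k" "separable l"
 shows "separable (%x y. k x y * l x y)"
 using assms(1)
proof induction
 case (add k k')
 then have "separable (%x y. k x y * l x y + k' x y * l x y)" by (intro separable.add)
 then show ?case by (simp add: algebra_simps)
qed (rule separable_rank1_mult[OF _ _ assms(2)])

lemma separable_const: "separable (%x y. c)"
 using separable.rank1[OF periodic_smooth_const[of c] periodic_smooth_const[of 1]] by simp

lemma separable_prod:
 "finite I ==> (!!i. i \<in> I ==> separable (k i)) ==> separable (%x y. \<Prod>i\<in>I. k i x y)"
 by (induction I rule: finite_induct) (simp_all add: separable_const separable_mult)

lemma separable_power: "separable k ==> separable (%x y. k x y ^ n)"
 by (induction n) (simp_all add: separable_const separable_mult)

lemma separable_sections:
 "separable k ==> periodic_smooth (%x. k x y)" "separable k ==> periodic_smooth (%y. k x y)"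
 by (induction rule: separable.induct) (simp_all add: periodic_smooth_mult periodic_smooth_add)

lemma separable_kernel_op:
 assumes k: "separable k" and f: "integrable torus f"
 shows "periodic_smooth (kernel_op torus k f)"
  and "gradient (kernel_op torus k f) x $ i = (\<oint>y. gradient (%x. k x y) x $ i * f y)"
  and "integrable torus (%y. gradient (%x. k x y) x $ i * f y)"
 using k
proof (induction arbitrary: x)
 case (rank1 a b)
 have b: "integrable torus (%y. b y * f y)"
  using rank1(2) f by (intro continuous_times_integrable_torus periodic_smooth_continuous)
 have eq: "kernel_op torus (%x y. a x * b y) f = (%x. a x * (\<oint>y. b y * f y))"
  by (rule ext) (simp add: kernel_op_def mult.assoc)
 { case 1 show ?case unfolding eq using rank1 by (intro periodic_smooth_mult) auto }
 have g: "gradient (%x. a x * c) x = c *\<^sub>R gradient a x" for c x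
  using gradient_mult[OF periodic_smooth_smooth[OF rank1(1)] smooth_const[of c], of x] by simp
 have g': "gradient (%x. a x * b y) x $ i * f y = gradient a x $ i * (b y * f y)" for x y
  by (simp add: g mult_ac)
 { case 2
  have "(\<oint>y. gradient (%x. a x * b y) x $ i * f y) = gradient a x $ i * (\<oint>y. b y * f y)"
   by (simp only: g' integral_mult_right_zero)
  then show ?case unfolding eq by (simp add: g) }
 { case 3 show ?case unfolding g' using b by simp }
next
 case (add k l)
 have c: "continuous_on UNIV (%y. k x y)" "continuous_on UNIV (%y. l x y)" for x
  using add.hyps by (auto intro: periodic_smooth_continuous separable_sections)
 have eq: "kernel_op torus (%x y. k x y + l x y) f = (%x. kernel_op torus k f x + kernel_op torus l f x)"
  by (rule ext) (simp add: kernel_op_def distrib_right continuous_times_integrable_torus c f)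
 { case 1 show ?case unfolding eq by (rule periodic_smooth_add[OF add.IH(1,4)]) }
 have g': "gradient (%x. k x y + l x y) x = gradient (%x. k x y) x + gradient (%x. l x y) x" for x y
  using add.hyps by (intro gradient_add periodic_smooth_smooth separable_sections)
 { case 2 show ?case unfolding eq
   by (subst gradient_add) (use add.IH in \<open>auto simp: g' distrib_right intro: periodic_smooth_smooth\<close>) }
 { case 3 show ?case using add.IH by (simp add: g' distrib_right) }
qed

section \<open>The mollifier\<close>

definition peak :: "real^'d::finite => real"
 where "peak z = (\<Prod>i\<in>UNIV. (1 + cos (2 * pi * z $ i)) / 2)"

text \<open>\<open>peak\<close> is a trigonometric polynomial with values in \<open>[0, 1]\<close>
  that reaches 1 exactly on the integer lattice, so its normalised powers concentrate there. Being
  trigonometric polynomials, they are finite sums of products, as \<open>separable\<close>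
  requires.\<close>

definition mollifier :: "nat => real^'d::finite => real^'d => real"
 where "mollifier n x y = peak (x - y) ^ n / (LINT z|(torus :: (real^'d) measure). peak z ^ n)"

lemma half_one_plus_cos: "0 \<le> (1 + cos t) / 2" "(1 + cos t) / 2 \<le> 1" for t :: real
proof -
 have "1 + - 1 \<le> 1 + cos t" by (intro add_left_mono cos_ge_minus_one)
 then have "0 \<le> 1 + cos t" by (simp only: add.right_inverse)
 then show "0 \<le> (1 + cos t) / 2" by simp
 have "(1 + cos t) / 2 \<le> (1 + 1) / 2"
  by (rule divide_right_mono[OF add_left_mono[OF cos_le_one]]) simp
 also have "... = (1 :: real)" by simp
 finally show "(1 + cos t) / 2 \<le> 1" .
qed

lemma peak_bounds: "0 \<le> peak z" "peak z \<le> 1"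
 unfolding peak_def by (intro prod_nonneg prod_le_1 conjI ballI half_one_plus_cos)+

lemma peak_periodic_smooth: "periodic_smooth (%z :: real^'d::finite. peak z ^ n)"
proof -
 have "smooth (%z::real^'d. \<Prod>i\<in>UNIV. (1 / 2) * (1 + cos (2 * pi * z $ i + 0)))"
  by (intro smooth_prod smooth_mult smooth_add smooth_const periodic_smooth_smooth[OF periodic_smooth_cos])
 moreover have "peak (x + axis j 1) = peak x" for x :: "real^'d" and j
  unfolding peak_def
  using periodic_smooth_cos[where c = 0, unfolded periodic_smooth_def] by (intro prod.cong) auto
 moreover from this have "peak (x + axis j 1) ^ n = peak x ^ n" for x :: "real^'d" and j by simp
 moreover have "smooth (%z::real^'d. peak z)" using calculation(1) by (simp add: peak_def)
 ultimately show ?thesis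
  unfolding periodic_smooth_def by (blast intro: smooth_power)
qed

lemma peak_continuous: "continuous_on A peak"
 using periodic_smooth_continuous[OF peak_periodic_smooth[of 1]] by simp

lemma peak_uminus: "peak (- z) = peak z"
 by (simp add: peak_def)

lemma peak_zero: "peak 0 = 1"
 by (simp add: peak_def)

text \<open>All factors lie in \<open>[0, 1]\<close>, so each single one must equal 1.\<close>

lemma peak_eq_1D:
 assumes "peak z = 1"
 shows "z $ i \<in> \<int>"
proof -
 let ?c = "%i. (1 + cos (2 * pi * z $ i)) / 2"
 have c: "0 \<le> ?c j" "?c j \<le> 1" for j by (rule half_one_plus_cos)+
 have "peak z = ?c i * (\<Prod>j\<in>UNIV - {i}. ?c j)"
  unfolding peak_def by (rule prod.remove) auto
 also have "... \<le> ?c i * 1" using c by (intro mult_left_mono prod_le_1) auto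
 finally have "1 \<le> cos (2 * pi * z $ i)" using assms by simp
 then have "cos (2 * pi * z $ i) = 1" by (intro antisym cos_le_one)
 then obtain n :: int where "2 * pi * z $ i = of_int n * 2 * pi" by (auto simp: cos_one_2pi_int)
 then have "z $ i = of_int n" by simp
 then show ?thesis by simp
qed

text \<open>The set where \<open>peak\<close> exceeds \<open>c\<close> has positive measure
  \<open>m\<close>. The normaliser therefore decays no faster than \<open>c ^ n\<close>, for every
  \<open>c\<close> below 1; this is what beats the powers of \<open>peak\<close> away from the
  lattice.\<close>

lemma peak_integral_ge:
 assumes "c < 1" "0 \<le> c"
 obtains m where "m > 0" "!!n. c ^ n * m \<le> (LINT z|(torus :: (real^'d::finite) measure). peak z ^ n)"
proof -
 define S where "S = {z :: real^'d. c < peak z} \<inter> box 0 1"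
 have "open {z :: real^'d. c < peak z}"
  using peak_continuous by (intro open_Collect_less) auto
 then have "open S" by (auto simp: S_def)
 have "(0 :: real^'d) \<in> {z. c < peak z}" using assms by (simp add: peak_zero)
 then obtain e where e: "e > 0" "ball 0 e \<subseteq> {z :: real^'d. c < peak z}"
  using \<open>open {z. c < peak z}\<close> open_contains_ball by blast
 have n1: "norm (1 :: real^'d) > 0" by simp
 \<comment> \<open>The maximum point 0 is a corner of the cell; moving by \<open>r\<close> along the
   diagonal gives a point of the open cell that is still close to it.\<close>
 define r where "r = min (1/2) (e / (2 * norm (1 :: real^'d)))"
 have r: "r > 0" "r < 1" "r \<le> e / (2 * norm (1 :: real^'d))"
  unfolding r_def using e n1 by auto
 define z :: "real^'d" where "z = r *\<^sub>R 1"
 have "norm z = r * norm (1 :: real^'d)" using r(1) by (simp add: z_def)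
 also have "... \<le> e / (2 * norm (1 :: real^'d)) * norm (1 :: real^'d)" by (intro mult_right_mono r) auto
 also have "... < e" using e n1 by simp
 finally have "z \<in> {z. c < peak z}" using e(2) by (auto simp: subset_iff)
 moreover have "z \<in> box 0 1" using r by (simp add: mem_box_cart z_def)
 ultimately have "z \<in> S" by (simp add: S_def)
 then have "\<not> negligible S" using open_not_negligible[OF \<open>open S\<close>] by blast
 then have "emeasure lborel S \<noteq> 0"
  using \<open>open S\<close> by (simp add: negligible_iff_null_sets null_sets_completion_iff null_sets_def)
 moreover have S_sub: "S \<subseteq> cbox 0 1" using box_subset_cbox by (auto simp: S_def)
 ultimately have "emeasure torus S \<noteq> 0"
  by (simp add: torus_def emeasure_restrict_space)
 then have m: "measure torus S > 0"
  by (simp add: torus.emeasure_eq_measure zero_less_measure_iff)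
 have [measurable]: "S \<in> sets torus"
  using \<open>open S\<close> S_sub by (auto simp: torus_def sets_restrict_space_iff)
 show thesis
 proof
  fix n
  have "c ^ n * measure torus S = (\<oint>z. c ^ n * indicator S z)"
   using S_sub by (simp add: Int_absorb1 Int_absorb2)
  also have "... \<le> (LINT z|(torus :: (real^'d) measure). peak z ^ n)"
  proof (rule integral_mono')
   show "integrable torus (%z :: real^'d. peak z ^ n)"
    by (intro continuous_integrable_torus continuous_intros peak_continuous)
   show "c ^ n * indicator S z \<le> peak z ^ n" for z
    using assms by (auto simp: S_def indicator_def peak_bounds intro!: power_mono)
  qed (auto intro!: zero_le_power peak_bounds)
  finally show "c ^ n * measure torus S \<le> (LINT z|(torus :: (real^'d) measure). peak z ^ n)" .
 qed (rule m)
qed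

lemma peak_integral_pos: "0 < (LINT z|(torus :: (real^'d::finite) measure). peak z ^ n)"
proof -
 obtain m where "m > 0" "(1/2) ^ n * m \<le> (LINT z|(torus :: (real^'d) measure). peak z ^ n)"
  using peak_integral_ge[of "1/2"] by auto
 moreover have "0 < (1/2) ^ n * m" using \<open>m > 0\<close> by simp
 ultimately show ?thesis by linarith
qed

text \<open>The addition theorem splits the cosine of \<open>x - y\<close> into products. The sine
  is written as a shifted cosine so that one smoothness lemma serves both.\<close>

lemma mollifier_separable: "separable (mollifier n :: real^'d::finite => _)"
proof -
 let ?Z = "LINT z|(torus :: (real^'d) measure). peak z ^ n"
 have sep: "separable (%x y :: real^'d. 1 / 2 + (cos (2 * pi * x $ i + 0) * (1 / 2 * cos (2 * pi * y $ i + 0))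
   + cos (2 * pi * x $ i + - pi / 2) * (1 / 2 * cos (2 * pi * y $ i + - pi / 2))))" for i
  by (intro separable.add separable_const separable.rank1 periodic_smooth_mult periodic_smooth_const periodic_smooth_cos)
 have sin: "cos (t + - pi / 2) = sin t" for t :: real by (simp add: cos_diff)
 have eq: "1 / 2 + (cos (2 * pi * x $ i + 0) * (1 / 2 * cos (2 * pi * y $ i + 0))
   + cos (2 * pi * x $ i + - pi / 2) * (1 / 2 * cos (2 * pi * y $ i + - pi / 2)))
   = (1 + cos (2 * pi * (x - y) $ i)) / 2" for x y :: "real^'d" and i
  unfolding sin by (simp add: cos_diff right_diff_distrib add_divide_distrib)
 have "separable (%x y :: real^'d. (1 + cos (2 * pi * (x - y) $ i)) / 2)" for i
  using sep[of i] unfolding eq .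
 then have "separable (%x y :: real^'d. (\<Prod>i\<in>UNIV. (1 + cos (2 * pi * (x - y) $ i)) / 2) ^ n * (1 / ?Z))"
  by (intro separable_mult separable_power separable_prod separable_const) auto
 then show ?thesis by (simp add: mollifier_def[abs_def] peak_def)
qed

lemma mollifier_sym: "mollifier n x y = mollifier n y x"
 using peak_uminus[of "x - y"] by (simp add: mollifier_def)

lemma mollifier_integral: "(\<oint>y. mollifier n (x :: real^'d::finite) y) = 1"
proof -
 let ?Z = "LINT z|(torus :: (real^'d) measure). peak z ^ n"
 have "(\<oint>y. peak (- x + y) ^ n) = ?Z"
  by (intro integral_torus_shift(2)[of "%z. peak z ^ n"] periodic_smooth_measurable
    periodic_smooth_periodic continuous_integrable_torus periodic_smooth_continuous peak_periodic_smooth)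
 moreover have "peak (x - y) = peak (- x + y)" for y using peak_uminus[of "x - y"] by simp
 ultimately show ?thesis using peak_integral_pos[of n, where 'd = 'd] by (simp add: mollifier_def)
qed

lemma mollifier_kernel: "bounded_kernel torus (mollifier n)"
proof
 have "continuous_on UNIV (%z::(real^'d) \<times> (real^'d). peak (fst z - snd z) ^ n / (LINT z|(torus :: (real^'d) measure). peak z ^ n))"
  using peak_integral_pos[of n, where 'd = 'd]
  by (intro continuous_intros continuous_on_compose2[OF peak_continuous[of UNIV]]) auto
 then have m: "(%z::(real^'d) \<times> (real^'d). mollifier n (fst z) (snd z)) \<in> \<B> (borel \<Otimes>\<^sub>M borel)"
  unfolding mollifier_def borel_prod by (rule borel_measurable_continuous_onI)
 have "(%z. (fst z, snd z)) \<in> torus \<Otimes>\<^sub>M torus \<rightarrow>\<^sub>M (borel :: (real^'d) measure) \<Otimes>\<^sub>M (borel :: (real^'d) measure)"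
 proof (rule measurable_Pair)
  have id: "(%x. x) \<in> torus \<rightarrow>\<^sub>M borel" by (rule borel_measurable_torusI) simp
  show "fst \<in> torus \<Otimes>\<^sub>M torus \<rightarrow>\<^sub>M borel" by (rule measurable_compose[OF measurable_fst id])
  show "snd \<in> torus \<Otimes>\<^sub>M torus \<rightarrow>\<^sub>M borel" by (rule measurable_compose[OF measurable_snd id])
 qed
 from measurable_compose[OF this m]
 show "(%(x, y). mollifier n x (y :: real^'d)) \<in> \<B> (torus \<Otimes>\<^sub>M torus)"
  by (simp add: case_prod_unfold)
 show nn: "0 \<le> mollifier n x y" for x y :: "real^'d"
  using peak_integral_pos[of n, where 'd = 'd] by (simp add: mollifier_def peak_bounds)
 have "mollifier n x y \<le> 1 / (LINT z|(torus :: (real^'d) measure). peak z ^ n)" for x y :: "real^'d"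
  unfolding mollifier_def using peak_integral_pos[of n, where 'd = 'd] peak_bounds[of "x - y"]
  by (intro divide_right_mono) (auto intro: power_le_one)
 then show "\<exists>C. \<forall>x y :: real^'d. mollifier n x y \<le> C" by blast
 show "(\<oint>y. mollifier n x y) \<le> 1" for x :: "real^'d" by (simp add: mollifier_integral)
 show "(\<oint>x. mollifier n x y) \<le> 1" for y :: "real^'d"
  using mollifier_integral[of n y] by (simp add: mollifier_sym[of n _ y])
qed

text \<open>The kernel depends on \<open>x - y\<close> only. The minus sign will cancel the one in
  the definition of weak gradients.\<close>

lemma gradient_mollifier:
 fixes x y :: "real^'d::finite"
 shows "gradient (%x. mollifier n x y) x = - gradient (%y. mollifier n x y) y"
proof -
 let ?f = "%z :: real^'d. peak z ^ n / (LINT z|(torus :: (real^'d) measure). peak z ^ n)"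
 have s: "smooth ?f"
  using smooth_mult[OF periodic_smooth_smooth[OF peak_periodic_smooth[of n]]
    smooth_const[of "1 / (LINT z|(torus :: (real^'d) measure). peak z ^ n)"]] by simp
 note D = smooth_has_derivative[OF s, of "x - y"]
 have "((%x. ?f (x - y)) has_derivative frechet_derivative ?f (at (x - y))) (at x)"
  by (rule has_derivative_compose[of "%x. x - y" "%h. h", OF _ D]) (auto intro!: derivative_eq_intros)
 moreover have "((%y. ?f (x - y)) has_derivative (%h. frechet_derivative ?f (at (x - y)) (- h))) (at y)"
  by (rule has_derivative_compose[of "%y. x - y" "%h. - h", OF _ D]) (auto intro!: derivative_eq_intros)
 moreover have "frechet_derivative ?f (at (x - y)) (- h) = - frechet_derivative ?f (at (x - y)) h" for h
  using has_derivative_linear[OF D] by (rule linear_neg)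
 ultimately show ?thesis
  unfolding gradient_def vec_eq_iff mollifier_def
  using frechet_derivative_at[symmetric] by (simp add: frechet_derivative_at[symmetric])
qed

text \<open>Opposite faces are identified on the torus, so continuity on the cell is not continuity
  on the torus; vanishing on the faces repairs this. Where \<open>g\<close> differs from
  \<open>g x\<close> by at least \<open>e / 2\<close>, compactness keeps \<open>peak (x - y)\<close>
  below some \<open>s < 1\<close>, while the normaliser is at least \<open>m c^n\<close> with
  \<open>s < c\<close>.\<close>

theorem mollifier_tendsto:
 fixes g :: "real^'d::finite => real"
 assumes g: "continuous_on UNIV g" and B: "!!x. \<bar>g x\<bar> \<le> B" and 0: "!!x. x \<notin> box 0 1 ==> g x = 0"
  and x: "x \<in> cbox 0 1"
 shows "(%n. kernel_op torus (mollifier n) g x) \<leadsto> g x"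
proof -
 let ?Q = "cbox 0 1 :: (real^'d) set"
 have "B \<ge> 0" using B[of 0] by linarith
 have gi: "integrable torus g" by (rule continuous_integrable_torus[OF g])
 have "(%n. \<bar>kernel_op torus (mollifier n) g x - g x\<bar>) \<leadsto> 0"
 proof (rule tendsto_0_ge_le)
  fix e :: real assume "e > 0"
  define A where "A = {y \<in> ?Q. e / 2 \<le> \<bar>g x - g y\<bar>}"
  have "closed {y. e / 2 \<le> \<bar>g x - g y\<bar>}"
   by (intro closed_Collect_le continuous_intros g)
  then have "compact A" unfolding A_def
   using compact_Int_closed[OF compact_cbox] by (simp add: Collect_conj_eq)
  \<comment> \<open>If \<open>peak\<close> is 1, the points differ by integers. Two different points
    of the cell with this property both lie on faces, where \<open>g\<close> vanishes.\<close>
  have lt: "peak (x - y) < 1" if "y \<in> A" for y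
  proof (rule ccontr)
   assume "\<not> peak (x - y) < 1"
   then have p: "peak (x - y) = 1" using peak_bounds(2)[of "x - y"] by linarith
   have "y \<in> ?Q" "g x \<noteq> g y" using that \<open>e > 0\<close> by (auto simp: A_def)
   then obtain i where "x $ i \<noteq> y $ i" by (metis vec_eq_iff)
   moreover have "(x - y) $ i \<in> \<int>" by (rule peak_eq_1D[OF p])
   then obtain m :: int where "x $ i - y $ i = of_int m" by (auto elim: Ints_cases)
   moreover have b: "0 \<le> x $ i" "x $ i \<le> 1" "0 \<le> y $ i" "y $ i \<le> 1"
    using x \<open>y \<in> ?Q\<close> by (auto simp: mem_cell)
   ultimately have "m \<noteq> 0" "of_int m \<le> (1::real)" "-1 \<le> (of_int m :: real)" by auto
   then have "m = 1 \<or> m = -1" by linarith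
   then have "x $ i \<in> {0, 1}" "y $ i \<in> {0, 1}" using \<open>x $ i - y $ i = of_int m\<close> b by auto
   then have "x \<notin> box 0 1" "y \<notin> box 0 1" by (auto simp: mem_box_cart intro!: exI[of _ i])
   then show False using 0 \<open>g x \<noteq> g y\<close> by simp
  qed
  obtain s where s: "0 \<le> s" "s < 1" "!!y. y \<in> A ==> peak (x - y) \<le> s"
  proof (cases "A = {}")
   case False
   have "continuous_on A (%y. peak (x - y))"
    by (intro continuous_on_compose2[OF peak_continuous[of UNIV]] continuous_intros) auto
   then obtain y0 where "y0 \<in> A" "\<forall>y\<in>A. peak (x - y) \<le> peak (x - y0)"
    using continuous_attains_sup[OF \<open>compact A\<close> False] by blast
   then show thesis using that[of "peak (x - y0)"] lt peak_bounds by blast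
  qed (use that[of 0] in auto)
  \<comment> \<open>The midpoint leaves room on both sides: \<open>s / c < 1\<close> gives decay,
    \<open>c < 1\<close> permits \<open>peak_integral_ge\<close>.\<close>
  define c where "c = (1 + s) / 2"
  have c: "0 < c" "c < 1" "s < c" using s by (auto simp: c_def)
  obtain m where m: "m > 0" "!!n. c ^ n * m \<le> (LINT z|(torus :: (real^'d) measure). peak z ^ n)"
   using peak_integral_ge[of c] c by (metis less_imp_le)
  have "(%n. 2 * B / m * (s / c) ^ n) \<leadsto> 0"
   using s c by (intro tendsto_mult_right_zero LIMSEQ_realpow_zero) auto
  then have "eventually (%n. 2 * B / m * (s / c) ^ n < e / 2) sequentially"
   using \<open>e > 0\<close> by (intro order_tendstoD(2)) auto
  then show "eventually (%n. \<bar>kernel_op torus (mollifier n) g x - g x\<bar> \<le> e) sequentially"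
  proof eventually_elim
   case (elim n)
   interpret k: bounded_kernel torus "mollifier n :: real^'d => _" by (rule mollifier_kernel)
   have kx: "integrable torus (%y. mollifier n x y)" using k.k_integrable[of x] x by simp
   have kg: "integrable torus (%y. mollifier n x y * g y)" using k.k_times_integrable[OF _ gi, of x] x by simp
   have gm [measurable]: "g \<in> \<B> torus" using gi by simp
   have kd: "integrable torus (%y. mollifier n x y * \<bar>g y - g x\<bar>)"
    using x gi by (intro k.k_times_integrable) auto
   have "kernel_op torus (mollifier n) g x - g x = (\<oint>y. mollifier n x y * (g y - g x))"
    using kx kg mollifier_integral[of n x] by (simp add: kernel_op_def right_diff_distrib)
   then have "\<bar>kernel_op torus (mollifier n) g x - g x\<bar> \<le> (\<oint>y. mollifier n x y * \<bar>g y - g x\<bar>)"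
    using integral_abs_bound[of torus "%y. mollifier n x y * (g y - g x)"] k.k_nonneg by (simp add: abs_mult)
   also have "... \<le> (\<oint>y. mollifier n x y * (e / 2) + 2 * B / m * (s / c) ^ n)"
   proof (rule integral_mono[OF kd])
    fix y assume y: "y \<in> space (torus :: (real^'d) measure)"
    have k2: "0 \<le> 2 * B / m * (s / c) ^ n" using \<open>B \<ge> 0\<close> m s c by simp
    show "mollifier n x y * \<bar>g y - g x\<bar> \<le> mollifier n x y * (e / 2) + 2 * B / m * (s / c) ^ n"
    proof (cases "y \<in> A")
     case True
     have "mollifier n x y \<le> s ^ n / (c ^ n * m)"
      unfolding mollifier_def using m c s(1) s(3)[of y] True peak_bounds[of "x - y"]
      by (intro frac_le power_mono) auto
     moreover have "\<bar>g y - g x\<bar> \<le> 2 * B" using B[of x] B[of y] by linarith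
     ultimately have "mollifier n x y * \<bar>g y - g x\<bar> \<le> s ^ n / (c ^ n * m) * (2 * B)"
      using k.k_nonneg[of x y] s(1) c(1) m(1) by (intro mult_mono) auto
     also have "... = 2 * B / m * (s / c) ^ n" by (simp add: power_divide mult_ac)
     also have "... \<le> mollifier n x y * (e / 2) + 2 * B / m * (s / c) ^ n"
      using k.k_nonneg[of x y] \<open>e > 0\<close> by simp
     finally show ?thesis .
    next
     case False
     then have "\<bar>g y - g x\<bar> \<le> e / 2" using y by (auto simp: A_def abs_minus_commute)
     then have "mollifier n x y * \<bar>g y - g x\<bar> \<le> mollifier n x y * (e / 2)"
      using k.k_nonneg by (intro mult_left_mono) auto
     then show ?thesis using k2 by linarith
    qed
   qed (use kx in simp)
   also have "... = e / 2 + 2 * B / m * (s / c) ^ n"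
    using kx mollifier_integral[of n x] by simp
   finally show ?case using elim by linarith
  qed
 qed simp
 then have "(%n. kernel_op torus (mollifier n) g x - g x) \<leadsto> 0"
  by (simp only: tendsto_rabs_zero_iff)
 then show ?thesis by (simp add: LIM_zero_iff)
qed

text \<open>A density argument, kept abstract so that it serves both the cell and the time interval.
  Bounded measurable functions are L^1 limits of bounded continuous ones vanishing outside the open
  set \<open>U\<close>; for these the kernels converge pointwise, and the contraction property
  transfers the convergence.\<close>

theorem kernel_op_tendsto_bounded:
 fixes k :: "nat => 'a::euclidean_space => 'a => real"
 assumes k: "!!n. bounded_kernel (restrict_space lborel S) (k n)"
  and S: "S \<in> sets borel" "open U" "U \<subseteq> S" "- U \<noteq> {}" and null: "AE x in restrict_space lborel S. x \<in> U"
  and lim: "!!g B x. continuous_on UNIV g ==> (!!x. \<bar>g x\<bar> \<le> B) ==> (!!x. x \<notin> U ==> g x = 0) ==> x \<in> U ==>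
   (%n. kernel_op (restrict_space lborel S) (k n) g x) \<leadsto> g x"
  and f [measurable]: "f \<in> \<B> (restrict_space lborel S)" and B: "!!x. \<bar>f x\<bar> \<le> B"
 shows "(%n. (LINT x|restrict_space lborel S. \<bar>kernel_op (restrict_space lborel S) (k n) f x - f x\<bar>)) \<leadsto> 0"
proof -
 let ?M = "restrict_space lborel S"
 interpret k: bounded_kernel ?M "k n" for n by (rule k)
 have B0: "B \<ge> 0" using B[of undefined] by linarith
 have sp: "space ?M = S" by (simp add: space_restrict_space)
 have "(%x. indicator S x *\<^sub>R f x) \<in> \<B> lborel"
  using f S(1) by (subst (asm) borel_measurable_restrict_space_iff) auto
 then have "(%x. indicator S x *\<^sub>R f x) \<in> \<B> lebesgue" by (rule measurable_completion)
 then have "(%x. indicator S x *\<^sub>R f x) measurable_on UNIV"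
  by (subst measurable_on_iff_borel_measurable) (auto simp: lebesgue_on_UNIV_eq)
 then obtain N g where N: "negligible N" and gc: "!!m. continuous_on UNIV (g m)"
  and g: "!!x. x \<notin> N ==> (%m::nat. g m x) \<leadsto> indicator S x *\<^sub>R f x"
  unfolding measurable_on_def by auto
 \<comment> \<open>Clipping enforces the bound \<open>B\<close>; the distance factor is 0 outside
   \<open>U\<close> and tends to 1 inside.\<close>
 define h where "h m x = max (- B) (min B (g m x)) * min 1 (real m * infdist x (- U))" for m x
 have hc: "continuous_on UNIV (h m)" for m
  unfolding h_def by (intro continuous_intros gc)
 have hB: "\<bar>h m x\<bar> \<le> B" for m x
 proof -
  have "\<bar>h m x\<bar> \<le> B * 1"
   unfolding h_def abs_mult using B0 by (intro mult_mono) (auto simp: infdist_nonneg)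
  then show ?thesis by simp
 qed
 have h0: "h m x = 0" if "x \<notin> U" for m x using that by (simp add: h_def)
 have hm [measurable]: "h m \<in> \<B> ?M" for m
  by (intro measurable_restrict_space1) (simp add: borel_measurable_continuous_onI hc)
 have lim_h: "(%m. h m x) \<leadsto> f x" if x: "x \<in> U" "x \<notin> N" for x
 proof -
  have "(%m. max (- B) (min B (g m x))) \<leadsto> max (- B) (min B (indicator S x *\<^sub>R f x))"
   by (intro tendsto_intros g x)
  moreover have "max (- B) (min B (indicator S x *\<^sub>R f x)) = f x"
   using x S(3) B[of x] by (auto simp: abs_le_iff max_def min_def)
  moreover have "(%m. min 1 (real m * infdist x (- U))) \<leadsto> 1"
  proof (rule tendsto_eventually)
   have "infdist x (- U) \<noteq> 0"
    using x S in_closed_iff_infdist_zero[of "- U" x] by auto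
   then have d: "infdist x (- U) > 0" using infdist_nonneg[of x "- U"] by linarith
   then obtain m0 :: nat where m0: "1 / infdist x (- U) < real m0" using reals_Archimedean2 by blast
   show "eventually (%m. min 1 (real m * infdist x (- U)) = 1) sequentially"
    unfolding eventually_sequentially
   proof (intro exI allI impI)
    fix m assume "m0 \<le> m"
    then have "1 / infdist x (- U) \<le> real m" using m0 by linarith
    then have "1 \<le> real m * infdist x (- U)" using d by (simp add: field_simps)
    then show "min 1 (real m * infdist x (- U)) = 1" by simp
   qed
  qed
  ultimately show ?thesis unfolding h_def using tendsto_mult by fastforce
 qed
 have AEN: "AE x in ?M. x \<notin> N"
 proof -
  have "AE x in lebesgue. x \<notin> N"
   using N by (intro AE_not_in) (simp add: negligible_iff_null_sets)
  then have "AE x in lborel. x \<notin> N" by (simp add: AE_completion_iff)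
  then show ?thesis using S(1) by (subst AE_restrict_space_iff) auto
 qed
 have "(%m. (LINT x|?M. \<bar>f x - h m x\<bar>)) \<leadsto> (LINT x|?M. 0)"
 proof (rule integral_dominated_convergence[where w = "%_. 2 * B"])
  show "AE x in ?M. (%m. \<bar>f x - h m x\<bar>) \<leadsto> 0"
   using AEN null
  proof eventually_elim
   case (elim x)
   have "(%m. \<bar>f x - h m x\<bar>) \<leadsto> \<bar>f x - f x\<bar>" by (intro tendsto_intros lim_h elim)
   then show ?case by simp
  qed
  show "AE x in ?M. norm \<bar>f x - h m x\<bar> \<le> 2 * B" for m
  proof (rule AE_I2)
   show "norm \<bar>f x - h m x\<bar> \<le> 2 * B" for x using hB[of m x] B[of x] by simp
  qed
 qed auto
 then have lim0: "(%m. (LINT x|?M. \<bar>f x - h m x\<bar>)) \<leadsto> 0" by simp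
 have bi: "integrable ?M u" if "u \<in> \<B> ?M" "!!x. \<bar>u x\<bar> \<le> b" for u :: "'a => real" and b
  using that by (intro k.integrable_const_bound[of u b]) auto
 have Kb: "integrable ?M (kernel_op ?M (k n) u)" if [measurable]: "u \<in> \<B> ?M" and "!!x. \<bar>u x\<bar> \<le> b" for u b n
  by (rule k.integrable_const_bound[of _ b]) (use that k.kernel_op_bounded[OF _ that(1), of _ b n] in auto)
 note fi = bi[OF f B] and hi = bi[OF hm hB]
 note Kfi = Kb[OF f B] and Khi = Kb[OF hm hB]
 have step: "(LINT x|?M. \<bar>kernel_op ?M (k n) f x - f x\<bar>)
   \<le> 2 * (LINT x|?M. \<bar>f x - h m x\<bar>) + (LINT x|?M. \<bar>kernel_op ?M (k n) (h m) x - h m x\<bar>)" for n m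
 proof -
  let ?K = "kernel_op ?M (k n)"
  have fh: "integrable ?M (%x. \<bar>f x - h m x\<bar>)" using fi hi by simp
  note c = k.kernel_op_contraction[OF fh abs_ge_zero, of n]
  have "(LINT x|?M. \<bar>?K f x - f x\<bar>) \<le> (LINT x|?M. ?K (%y. \<bar>f y - h m y\<bar>) x + \<bar>?K (h m) x - h m x\<bar> + \<bar>f x - h m x\<bar>)"
  proof (rule integral_mono)
   show "integrable ?M (%x. \<bar>?K f x - f x\<bar>)" using Kfi fi by simp
   show "integrable ?M (%x. ?K (%y. \<bar>f y - h m y\<bar>) x + \<bar>?K (h m) x - h m x\<bar> + \<bar>f x - h m x\<bar>)"
    using c(1) Khi hi fh by simp
   fix x assume x: "x \<in> space ?M"
   have "\<bar>?K (%y. f y - h m y) x\<bar> \<le> ?K (%y. \<bar>f y - h m y\<bar>) x"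
    using k.kernel_op_abs_le[OF x, of "%y. f y - h m y" n] fi hi by simp
   then show "\<bar>?K f x - f x\<bar> \<le> ?K (%y. \<bar>f y - h m y\<bar>) x + \<bar>?K (h m) x - h m x\<bar> + \<bar>f x - h m x\<bar>"
    using k.kernel_op_diff[OF x fi hi, of n m] by linarith
  qed
  also have "... = (LINT x|?M. ?K (%y. \<bar>f y - h m y\<bar>) x) + (LINT x|?M. \<bar>?K (h m) x - h m x\<bar>) + (LINT x|?M. \<bar>f x - h m x\<bar>)"
   using c(1) Khi hi fh by simp
  finally show ?thesis using c(2) by linarith
 qed
 have conv: "(%n. (LINT x|?M. \<bar>kernel_op ?M (k n) (h m) x - h m x\<bar>)) \<leadsto> 0" for m
 proof -
  have "(%n. (LINT x|?M. \<bar>kernel_op ?M (k n) (h m) x - h m x\<bar>)) \<leadsto> (LINT x|?M. 0)"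
  proof (rule integral_dominated_convergence[where w = "%_. 2 * B"])
   show "AE x in ?M. (%n. \<bar>kernel_op ?M (k n) (h m) x - h m x\<bar>) \<leadsto> 0"
    using null
   proof eventually_elim
    case (elim x)
    have "(%n. \<bar>kernel_op ?M (k n) (h m) x - h m x\<bar>) \<leadsto> \<bar>h m x - h m x\<bar>"
     by (intro tendsto_intros lim[OF hc hB h0 elim])
    then show ?case by simp
   qed
   show "AE x in ?M. norm \<bar>kernel_op ?M (k n) (h m) x - h m x\<bar> \<le> 2 * B" for n
   proof (rule AE_I2)
    fix x assume x: "x \<in> space ?M"
    have "\<bar>kernel_op ?M (k n) (h m) x\<bar> \<le> B" by (rule k.kernel_op_bounded[OF x hm hB])
    then show "norm \<bar>kernel_op ?M (k n) (h m) x - h m x\<bar> \<le> 2 * B" using hB[of m x] by simp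
   qed
  qed auto
  then show ?thesis by simp
 qed
 show ?thesis
 proof (rule tendsto_0_ge_le)
  fix e :: real assume e: "e > 0"
  then have "eventually (%m. (LINT x|?M. \<bar>f x - h m x\<bar>) < e / 4) sequentially"
   using order_tendstoD(2)[OF lim0, of "e / 4"] by simp
  then obtain m where m: "(LINT x|?M. \<bar>f x - h m x\<bar>) < e / 4" by (auto simp: eventually_sequentially)
  have "eventually (%n. (LINT x|?M. \<bar>kernel_op ?M (k n) (h m) x - h m x\<bar>) < e / 4) sequentially"
   using order_tendstoD(2)[OF conv, of "e / 4"] e by simp
  then show "eventually (%n. (LINT x|?M. \<bar>kernel_op ?M (k n) f x - f x\<bar>) \<le> e) sequentially"
  proof eventually_elim
   case (elim n)
   then show ?case using step[of n m] m e by linarith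
  qed
 qed simp
qed

lemma AE_torus_in_box: "AE x in torus. x \<in> box 0 (1 :: real^'d::finite)"
proof -
 have "AE x in lborel. \<forall>i. x $ i \<noteq> 0 \<and> x $ i \<noteq> (1 :: real)"
  by (simp add: AE_all_countable AE_coordinate_neq AE_conj_iff)
 then have "AE x in (torus :: (real^'d) measure). \<forall>i. x $ i \<noteq> 0 \<and> x $ i \<noteq> 1"
  unfolding torus_def by (subst AE_restrict_space_iff) auto
 with AE_space show ?thesis
  by eventually_elim (auto simp: mem_box_cart less_le)
qed

lemma mollify_tendsto_bounded:
 fixes f :: "real^'d::finite => real"
 assumes f: "f \<in> \<B> torus" "!!x. \<bar>f x\<bar> \<le> B"
 shows "(%n. (\<oint>x. \<bar>kernel_op torus (mollifier n) f x - f x\<bar>)) \<leadsto> 0"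
 unfolding torus_def
proof (rule kernel_op_tendsto_bounded[of _ _ "box 0 1"])
 have "(0 :: real^'d) \<notin> box 0 1" by (simp add: mem_box_cart)
 then show "- box 0 1 \<noteq> ({} :: (real^'d) set)" by blast
 show "AE x in restrict_space lborel (cbox 0 1). x \<in> box 0 (1 :: real^'d)"
  using AE_torus_in_box[where 'd = 'd] unfolding torus_def .
 show "box 0 1 \<subseteq> cbox 0 (1 :: real^'d)" by (rule box_subset_cbox)
 show "(%n. kernel_op (restrict_space lborel (cbox 0 1)) (mollifier n) g x) \<leadsto> g x"
  if "continuous_on UNIV g" "!!x. \<bar>g x\<bar> \<le> B" "!!x. x \<notin> box 0 1 ==> g x = 0" "x \<in> box 0 1"
  for g :: "real^'d => real" and B x
  using mollifier_tendsto[OF that(1-3)] that(4) box_subset_cbox by (auto simp: torus_def)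
qed (use f mollifier_kernel in \<open>auto simp: torus_def\<close>)

theorem Lp_conv_mollify:
 fixes f :: "real \<times> (real^'d::finite) => real"
 assumes "f \<in> \<B> (\<S> T)" "0 < p" "integrable (\<S> T) (%z. \<bar>f z\<bar> ^ p)"
 shows "Lp_conv p (\<S> T) (%n (t, x). kernel_op torus (mollifier n) (%y. f (t, y)) x) f"
 by (rule Lp_conv_kernel_op[OF _ _ _ assms]) (auto intro: time.sigma_finite_measure_axioms mollifier_kernel mollify_tendsto_bounded)

section \<open>Forward averages in time\<close>

definition forward_kernel :: "real => real => real => real"
 where "forward_kernel h t s = indicator {..<s} t * indicator {..<t + h} s / h"

lemma measure_time: "A \<subseteq> {0<..<T} ==> measure (time T) A = measure lborel A"
 by (simp add: time_def measure_def emeasure_restrict_space)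

lemma measure_time_Ioo:
 assumes "a \<le> b" "0 \<le> a" "b \<le> T"
 shows "measure (time T) {a<..<b} = b - a"
 using assms by (subst measure_time) auto

text \<open>The part of the window beyond \<open>T\<close> is simply lost, so full mass is available
  only while the window fits. This truncation later performs the cap at \<open>T\<close>.\<close>

lemma forward_kernel_row:
 assumes h: "h > 0"
 shows "0 \<le> (LINT s|time T. forward_kernel h t s)" "(LINT s|time T. forward_kernel h t s) \<le> 1"
  "0 < t ==> t + h \<le> T ==> (LINT s|time T. forward_kernel h t s) = 1"
proof -
 have fk: "forward_kernel h t s = indicator {t<..<t + h} s / h" for s
  by (auto simp: forward_kernel_def indicator_def)
 have eq: "(LINT s|time T. forward_kernel h t s) = measure (time T) ({t<..<t + h} \<inter> {0<..<T}) / h"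
  by (simp add: fk)
 then show "0 \<le> (LINT s|time T. forward_kernel h t s)" using h by simp
 have "measure (time T) ({t<..<t + h} \<inter> {0<..<T}) = measure lborel ({t<..<t + h} \<inter> {0<..<T})"
  by (rule measure_time) auto
 also have "... \<le> measure lborel {t<..<t + h}"
  by (rule measure_mono_fmeasurable) (use h in \<open>auto simp: fmeasurable_def\<close>)
 also have "... = h" using h by simp
 finally show "(LINT s|time T. forward_kernel h t s) \<le> 1" using h by (simp add: eq)
 assume "0 < t" "t + h \<le> T"
 then have "{t<..<t + h} \<inter> {0<..<T} = {t<..<t + h}" by auto
 then show "(LINT s|time T. forward_kernel h t s) = 1"
  using h \<open>0 < t\<close> \<open>t + h \<le> T\<close> by (simp add: eq measure_time_Ioo)
qed

lemma forward_kernel_kernel: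
 assumes h: "h > 0"
 shows "bounded_kernel (time T) (forward_kernel h)"
proof
 have [measurable]: "(%x. x) \<in> \<B> (time T)" by (rule borel_measurable_timeI) simp
 have "(%z. forward_kernel h (fst z) (snd z)) \<in> \<B> (time T \<Otimes>\<^sub>M time T)"
  unfolding forward_kernel_def by measurable
 then show "(%(x, y). forward_kernel h x y) \<in> \<B> (time T \<Otimes>\<^sub>M time T)"
  by (simp add: case_prod_unfold)
 show "0 \<le> forward_kernel h x y" for x y using h by (simp add: forward_kernel_def)
 show "\<exists>C. \<forall>x y. forward_kernel h x y \<le> C"
  using h by (intro exI[of _ "1 / h"]) (auto simp: forward_kernel_def indicator_def)
 show "(LINT y|time T. forward_kernel h x y) \<le> 1" for x by (rule forward_kernel_row[OF h])
 \<comment> \<open>A column is a row based at the earlier time \<open>y - h\<close>, so the row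
   bound applies to it.\<close>
 have sym: "forward_kernel h x y = forward_kernel h (y - h) x" for x y
  by (auto simp: forward_kernel_def indicator_def)
 show "(LINT x|time T. forward_kernel h x y) \<le> 1" for y
  unfolding sym[of _ y] by (rule forward_kernel_row(2)[OF h])
qed

lemma forward_kernel_tendsto:
 fixes g :: "real => real"
 assumes h: "!!n::nat. h n > 0" "h \<leadsto> 0" and g: "continuous_on UNIV g" and B: "!!x. \<bar>g x\<bar> \<le> B"
  and t: "t \<in> {0<..<T}"
 shows "(%n. kernel_op (time T) (forward_kernel (h n)) g t) \<leadsto> g t"
proof -
 have [measurable]: "g \<in> \<B> (time T)"
  by (intro borel_measurable_timeI borel_measurable_continuous_onI g)
 have gi: "integrable (time T) g" by (rule time.integrable_const_bound[of _ B]) (use B in auto)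
 have "(%n. \<bar>kernel_op (time T) (forward_kernel (h n)) g t - g t\<bar>) \<leadsto> 0"
 proof (rule tendsto_0_ge_le)
  fix e :: real assume "e > 0"
  have "isCont g t" using g by (simp add: continuous_on_eq_continuous_at)
  then obtain d where d: "d > 0" "!!s. dist s t < d ==> dist (g s) (g t) < e"
   using \<open>e > 0\<close> unfolding continuous_at_eps_delta by (metis dist_norm)
  have "eventually (%n. h n < d) sequentially" "eventually (%n. h n < T - t) sequentially"
   using order_tendstoD(2)[OF h(2), of d] order_tendstoD(2)[OF h(2), of "T - t"] d t by auto
  then show "eventually (%n. \<bar>kernel_op (time T) (forward_kernel (h n)) g t - g t\<bar> \<le> e) sequentially"
  proof eventually_elim
   case (elim n)
   interpret k: bounded_kernel "time T" "forward_kernel (h n)" by (rule forward_kernel_kernel[OF h(1)])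
   have one: "(LINT s|time T. forward_kernel (h n) t s) = 1"
    using elim t h(1) by (intro forward_kernel_row) auto
   have ki: "integrable (time T) (%s. forward_kernel (h n) t s)" using k.k_integrable t by simp
   have kg: "integrable (time T) (%s. forward_kernel (h n) t s * g s)" using k.k_times_integrable[OF _ gi] t by simp
   have kd: "integrable (time T) (%s. forward_kernel (h n) t s * \<bar>g s - g t\<bar>)"
    using t gi by (intro k.k_times_integrable) auto
   have "kernel_op (time T) (forward_kernel (h n)) g t - g t = (LINT s|time T. forward_kernel (h n) t s * (g s - g t))"
    using ki kg one by (simp add: kernel_op_def right_diff_distrib)
   then have "\<bar>kernel_op (time T) (forward_kernel (h n)) g t - g t\<bar>
     \<le> (LINT s|time T. forward_kernel (h n) t s * \<bar>g s - g t\<bar>)"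
    using integral_abs_bound[of "time T" "%s. forward_kernel (h n) t s * (g s - g t)"] k.k_nonneg
    by (simp add: abs_mult)
   also have "... \<le> (LINT s|time T. forward_kernel (h n) t s * e)"
   proof (rule integral_mono[OF kd])
    fix s
    show "forward_kernel (h n) t s * \<bar>g s - g t\<bar> \<le> forward_kernel (h n) t s * e"
    proof (cases "t < s \<and> s < t + h n")
     case True
     then have "\<bar>g s - g t\<bar> \<le> e" using d(2)[of s] elim by (simp add: dist_real_def)
     then show ?thesis using k.k_nonneg by (intro mult_left_mono) auto
    qed (auto simp: forward_kernel_def indicator_def)
   qed (use ki in simp)
   also have "... = e" using one by simp
   finally show ?case .
  qed
 qed simp
 then have "(%n. kernel_op (time T) (forward_kernel (h n)) g t - g t) \<leadsto> 0"
  by (simp only: tendsto_rabs_zero_iff)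
 then show ?thesis by (simp add: LIM_zero_iff)
qed

lemma (in pair_sigma_finite) Lp_conv_swap:
 assumes "Lp_conv p (M2 \<Otimes>\<^sub>M M1) F f"
 shows "Lp_conv p (M1 \<Otimes>\<^sub>M M2) (%n (x, y). F n (y, x)) (%(x, y). f (y, x))"
proof -
 interpret Q: pair_sigma_finite M2 M1 ..
 have m [measurable]: "F n \<in> \<B> (M2 \<Otimes>\<^sub>M M1)" "f \<in> \<B> (M2 \<Otimes>\<^sub>M M1)" for n
  using assms by (auto simp: Lp_conv_def)
 have i: "integrable (M1 \<Otimes>\<^sub>M M2) (%(x, y). \<bar>F n (y, x)\<bar> ^ p)"
  "integrable (M1 \<Otimes>\<^sub>M M2) (%(x, y). \<bar>f (y, x)\<bar> ^ p)" for n
  using assms Q.integrable_product_swap by (auto simp: Lp_conv_def simp del: power_abs)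
 have e: "(LINT (x, y)|(M1 \<Otimes>\<^sub>M M2). \<bar>F n (y, x) - f (y, x)\<bar> ^ p) = (LINT z|(M2 \<Otimes>\<^sub>M M1). \<bar>F n z - f z\<bar> ^ p)" for n
  by (rule Q.integral_product_swap[of "%z. \<bar>F n z - f z\<bar> ^ p"]) measurable
 have "(%(x, y). F n (y, x)) \<in> \<B> (M1 \<Otimes>\<^sub>M M2)" "(%(x, y). f (y, x)) \<in> \<B> (M1 \<Otimes>\<^sub>M M2)" for n
  by measurable
 then show ?thesis
  using assms i e unfolding Lp_conv_def by (simp add: case_prod_unfold del: power_abs)
qed

text \<open>\<open>Lp_conv_kernel_op\<close> averages in the second variable, so time and space are
  exchanged before and after.\<close>

theorem Lp_conv_forward:
 fixes f :: "real \<times> (real^'d::finite) => real"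
 assumes h: "!!n::nat. h n > 0" "h \<leadsto> 0"
  and f [measurable]: "f \<in> \<B> (\<S> T)" and p: "0 < p" "integrable (\<S> T) (%z. \<bar>f z\<bar> ^ p)"
 shows "Lp_conv p (\<S> T) (%n (t, x). kernel_op (time T) (forward_kernel (h n)) (%s. f (s, x)) t) f"
proof -
 have "Lp_conv p (torus \<Otimes>\<^sub>M time T)
   (%n (x, t). kernel_op (time T) (forward_kernel (h n)) (%s. (%(x, s). f (s, x)) (x, s)) t) (%(x, s). f (s, x))"
 proof (rule Lp_conv_kernel_op)
  show "integrable (torus \<Otimes>\<^sub>M time T) (%z. \<bar>case z of (x, s) => f (s, x)\<bar> ^ p)"
   using TX.integrable_product_swap[OF p(2)] by (simp add: case_prod_unfold del: power_abs)
  show "(%(x, s). f (s, x)) \<in> \<B> (torus \<Otimes>\<^sub>M time T)" by measurable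
  fix g :: "real => real" and B assume g: "g \<in> \<B> (time T)" "!!x. \<bar>g x\<bar> \<le> B"
  show "(%n. (LINT x|time T. \<bar>kernel_op (time T) (forward_kernel (h n)) g x - g x\<bar>)) \<leadsto> 0"
   unfolding time_def
  proof (rule kernel_op_tendsto_bounded[of _ _ "{0<..<T}"])
   have "0 \<notin> {0<..<T}" by simp
   then show "- {0<..<T} \<noteq> {}" by blast
   show "AE x in restrict_space lborel {0<..<T}. x \<in> {0<..<T}"
    by (rule AE_I2) (simp add: space_restrict_space)
   show "(%n. kernel_op (restrict_space lborel {0<..<T}) (forward_kernel (h n)) g x) \<leadsto> g x"
    if "continuous_on UNIV g" "!!x. \<bar>g x\<bar> \<le> B" "x \<in> {0<..<T}" for g B x
    using forward_kernel_tendsto[OF h that] by (simp add: time_def)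
  qed (use g forward_kernel_kernel[OF h(1)] in \<open>auto simp: time_def\<close>)
 qed (auto intro: torus.sigma_finite_measure_axioms forward_kernel_kernel h p)
 from TX.Lp_conv_swap[OF this] show ?thesis by (simp add: case_prod_unfold)
qed

section \<open>Continuous representatives and balance laws\<close>

lemma continuous_AE_time_zero:
 fixes f :: "real => real"
 assumes "T > 0" and f: "continuous_on {0..T} f" and ae: "AE t in time T. f t = 0" and t: "t \<in> {0..T}"
 shows "f t = 0"
proof -
 let ?N = "{s \<in> {0<..<T}. f s \<noteq> 0}"
 have "continuous_on {0<..<T} f" by (rule continuous_on_subset[OF f]) auto
 then have "open ({0<..<T} \<inter> f -` (- {0}))"
  by (rule continuous_open_preimage) auto
 moreover have "{0<..<T} \<inter> f -` (- {0}) = ?N" by auto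
 ultimately have "open ?N" by simp
 have "AE s in lborel. s \<in> {0<..<T} --> f s = 0"
  using ae unfolding time_def by (subst (asm) AE_restrict_space_iff) auto
 then have "AE s in lborel. s \<notin> ?N" by eventually_elim auto
 then have "?N \<in> null_sets lborel"
  using \<open>open ?N\<close> by (subst AE_iff_null_sets) auto
 then have "negligible ?N"
  using \<open>open ?N\<close> by (simp add: negligible_iff_null_sets null_sets_completion_iff)
 then have "?N = {}" using open_not_negligible[OF \<open>open ?N\<close>] by blast
 then have "f s = 0" if "s \<in> {0<..<T}" for s using that by blast
 then show ?thesis
  using continuous_constant_on_closure[of "{0<..<T}" f 0 t] f t \<open>T > 0\<close> by simp
qed

lemma integral_before_continuous:
 fixes g :: "real => real"
 assumes g: "integrable (time T) g"
 shows "continuous_on UNIV (%t. (LINT s|time T. indicator {..<t} s * g s))"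
proof (rule continuous_on_sequentiallyI)
 fix u a assume u: "u \<leadsto> (a :: real)"
 have [measurable]: "g \<in> \<B> (time T)" "(%x. x) \<in> \<B> (time T)"
  using g by (auto intro: borel_measurable_timeI)
 have "AE s in time T. s \<noteq> a"
 proof -
  have "AE s in lborel. s \<noteq> a" by (rule AE_lborel_singleton)
  then show ?thesis unfolding time_def by (subst AE_restrict_space_iff) auto
 qed
 then have "AE s in time T. (%n. indicator {..<u n} s * g s) \<leadsto> indicator {..<a} s * g s"
 proof eventually_elim
  case (elim s)
  have "eventually (%n. indicator {..<u n} s = (indicator {..<a} s :: real)) sequentially"
  proof (cases "s < a")
   case True
   show ?thesis using order_tendstoD(1)[OF u True] by eventually_elim (use True in auto)
  next
   case False
   then have "a < s" using elim by simp
   show ?thesis using order_tendstoD(2)[OF u \<open>a < s\<close>] by eventually_elim (use False in auto)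
  qed
  then show ?case by (intro tendsto_mult_right tendsto_eventually)
 qed
 then show "(%n. (LINT s|time T. indicator {..<u n} s * g s)) \<leadsto> (LINT s|time T. indicator {..<a} s * g s)"
  by (intro integral_dominated_convergence[where w = "%s. \<bar>g s\<bar>"])
   (use g in \<open>auto simp: indicator_def\<close>)
qed

lemma AE_time_neq: "AE s in time T. s \<noteq> a"
proof -
 have "AE s in lborel. s \<noteq> a" by (rule AE_lborel_singleton)
 then show ?thesis unfolding time_def by (subst AE_restrict_space_iff) auto
qed

lemma (in pair_sigma_finite) AE_fst:
 assumes "AE x in M1. P x"
 shows "AE z in M1 \<Otimes>\<^sub>M M2. P (fst z)"
proof -
 obtain N where N: "{x \<in> space M1. \<not> P x} \<subseteq> N" "N \<in> sets M1" "emeasure M1 N = 0"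
  using AE_E[OF assms] by metis
 have null: "N \<times> space M2 \<in> null_sets (M1 \<Otimes>\<^sub>M M2)"
  using N M2.emeasure_pair_measure_Times[of N M1 "space M2"] by (auto simp: null_sets_def)
 show ?thesis by (rule AE_I'[OF null]) (use N(1) in \<open>auto simp: space_pair_measure\<close>)
qed

text \<open>The distributional form of \<open>u_t + div G = 0\<close>. Mass and every component of
  momentum have this shape, so both are treated once.\<close>

definition balance :: "real => (real \<times> (real^'d::finite) => real) => ('d => real \<times> (real^'d) => real) => bool"
 where "balance T u G \<longleftrightarrow> (\<forall>\<tau> \<psi>. time_test T \<tau> --> periodic_smooth \<psi> -->
  (LINT (t, x)|\<S> T. deriv \<tau> t * (\<psi> x * u (t, x)) + \<tau> t * (\<Sum>j\<in>UNIV. G j (t, x) * gradient \<psi> x $ j)) = 0)"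

lemma snd_measurable_spacetime:
 fixes a :: "real^'d::finite => real"
 assumes "continuous_on UNIV a"
 shows "(%z. a (snd z)) \<in> \<B> (\<S> T)"
 by (rule measurable_compose[OF measurable_snd])
  (rule borel_measurable_torusI[OF borel_measurable_continuous_onI[OF assms]])

lemma continuous_times_integrable_spacetime:
 fixes a :: "real^'d::finite => real"
 assumes a: "continuous_on UNIV a" and f: "integrable (\<S> T) f"
 shows "integrable (\<S> T) (%z. a (snd z) * f z)"
proof -
 obtain B where B: "0 \<le> B" "!!x. x \<in> cbox 0 1 ==> \<bar>a x\<bar> \<le> B" using continuous_bounded_on_cell[OF a] by metis
 show ?thesis
  by (rule integrable_bounded_times[OF f snd_measurable_spacetime[OF a], of B]) (use B in \<open>auto simp: space_pair_measure\<close>)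
qed

lemma bounded_time_times_integrable_spacetime:
 fixes a :: "real => real" and f :: "real \<times> (real^'d::finite) => real"
 assumes a: "a \<in> \<B> (time T)" and B: "!!t. \<bar>a t\<bar> \<le> B" and f: "integrable (\<S> T) f"
 shows "integrable (\<S> T) (%z. a (fst z) * f z)"
 by (rule integrable_bounded_times[OF f measurable_compose[OF measurable_fst a] B])

lemma smooth_gradient_continuous: "periodic_smooth \<psi> ==> continuous_on A (%x. gradient \<psi> x $ i)"
 by (intro smooth_continuous_on smooth_gradient periodic_smooth_smooth)

text \<open>Du Bois-Reymond's lemma gives the integrated law for almost every time; both sides are
  continuous for the weakly continuous representative, so it holds at every time, in particular at
  \<open>T\<close>.\<close>

lemma balance_representative:
 fixes u :: "real \<times> (real^'d::finite) => real"
 assumes "T > 0" and u: "integrable (\<S> T) u" and G: "!!j. integrable (\<S> T) (G j)"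
  and bal: "balance T u G" and \<psi>: "periodic_smooth \<psi>"
  and rep: "AE t in time T. AE x in torus. uc t x = u (t, x)"
  and meas: "!!t. t \<in> {0..T} ==> uc t \<in> \<B> torus"
  and cont: "continuous_on {0..T} (%t. (\<oint>x. uc t x * \<psi> x))"
 obtains C where "!!t. t \<in> {0..T} ==> (\<oint>x. uc t x * \<psi> x)
   = C + (LINT s|time T. indicator {..<t} s * (\<oint>x. (\<Sum>j\<in>UNIV. G j (s, x) * gradient \<psi> x $ j)))"
proof -
 define U where "U t = (\<oint>x. \<psi> x * u (t, x))" for t
 define g where "g t = (\<oint>x. (\<Sum>j\<in>UNIV. G j (t, x) * gradient \<psi> x $ j))" for t
 have iu: "integrable (\<S> T) (%z. \<psi> (snd z) * u z)"
  by (rule continuous_times_integrable_spacetime[OF periodic_smooth_continuous[OF \<psi>] u])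
 have iG: "integrable (\<S> T) (%z. \<Sum>j\<in>UNIV. G j z * gradient \<psi> (snd z) $ j)"
  using continuous_times_integrable_spacetime[OF smooth_gradient_continuous[OF \<psi>] G]
  by (intro L_integrable_sum) (simp add: mult.commute)
 have U: "integrable (time T) U" and g: "integrable (time T) g"
  using TX.integrable_fst'[OF iu] TX.integrable_fst'[OF iG] by (simp_all add: U_def[abs_def] g_def[abs_def])
 obtain C where C: "AE t in time T. U t = C + (LINT s|time T. indicator {..<t} s * g s)"
 proof (rule du_Bois_Reymond_time[OF U g \<open>T > 0\<close>])
  fix \<tau> assume \<tau>: "time_test T \<tau>"
  obtain B B' where B: "!!t. \<bar>\<tau> t\<bar> \<le> B" "!!t. \<bar>deriv \<tau> t\<bar> \<le> B'"
   using time_test_bounded[OF \<tau>] time_test_bounded[OF time_test_deriv[OF \<tau>]] by metis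
  have i1: "integrable (\<S> T) (%z. deriv \<tau> (fst z) * (\<psi> (snd z) * u z))"
   by (rule bounded_time_times_integrable_spacetime[OF time_test_measurable[OF time_test_deriv[OF \<tau>]] B(2) iu])
  have i2: "integrable (\<S> T) (%z. \<tau> (fst z) * (\<Sum>j\<in>UNIV. G j z * gradient \<psi> (snd z) $ j))"
   by (rule bounded_time_times_integrable_spacetime[OF time_test_measurable[OF \<tau>] B(1) iG])
  have "0 = (LINT z|\<S> T. deriv \<tau> (fst z) * (\<psi> (snd z) * u z) + \<tau> (fst z) * (\<Sum>j\<in>UNIV. G j z * gradient \<psi> (snd z) $ j))"
   using bal \<tau> \<psi> unfolding balance_def by (simp add: case_prod_unfold)
  also have "... = (LINT z|\<S> T. deriv \<tau> (fst z) * (\<psi> (snd z) * u z))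
    + (LINT z|\<S> T. \<tau> (fst z) * (\<Sum>j\<in>UNIV. G j z * gradient \<psi> (snd z) $ j))"
   by (rule L_integral_add[OF i1 i2])
  also have "... = (LINT t|time T. deriv \<tau> t * U t) + (LINT t|time T. \<tau> t * g t)"
   unfolding TX.integral_fst'[OF i1, symmetric] TX.integral_fst'[OF i2, symmetric] by (simp add: U_def g_def)
  also have "... = (LINT t|time T. deriv \<tau> t * U t + \<tau> t * g t)"
   by (rule L_integral_add[symmetric])
    (intro time_test_integrable[OF time_test_deriv[OF \<tau>] U] time_test_integrable[OF \<tau> g])+
  finally show "(LINT t|time T. deriv \<tau> t * U t + \<tau> t * g t) = 0" by simp
 qed
 have "(\<oint>x. uc t x * \<psi> x) - (C + (LINT s|time T. indicator {..<t} s * g s)) = 0" if "t \<in> {0..T}" for t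
 proof (rule continuous_AE_time_zero[OF \<open>T > 0\<close> _ _ that])
  show "continuous_on {0..T} (%t. (\<oint>x. uc t x * \<psi> x) - (C + (LINT s|time T. indicator {..<t} s * g s)))"
   by (intro continuous_intros cont continuous_on_subset[OF integral_before_continuous[OF g]]) auto
  have um [measurable]: "u \<in> \<B> (\<S> T)" using u by simp
  have [measurable]: "\<psi> \<in> \<B> torus"
   by (rule borel_measurable_torusI[OF periodic_smooth_measurable[OF \<psi>]])
  show "AE t in time T. (\<oint>x. uc t x * \<psi> x) - (C + (LINT s|time T. indicator {..<t} s * g s)) = 0"
   using C rep AE_space
  proof eventually_elim
   case (elim t)
   then have [measurable]: "uc t \<in> \<B> torus" by (intro meas) auto
   have "(%x. u (t, x)) \<in> \<B> torus" using elim(3) by measurable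
   then have "(\<oint>x. uc t x * \<psi> x) = U t"
    unfolding U_def using elim(2) by (intro integral_cong_AE) (auto simp: mult.commute)
   then show ?case using elim(1) by simp
  qed
 qed
 then show thesis by (intro that[of C]) (auto simp: g_def algebra_simps)
qed

lemma forward_kernel_section_integrable:
 fixes f :: "real \<times> (real^'d::finite) => real"
 assumes "h > 0" and f: "integrable (\<S> T) f"
 shows "integrable (\<S> T) (%(s, x). forward_kernel h t s * f (s, x))"
  and "integrable torus (%x. kernel_op (time T) (forward_kernel h) (%s. f (s, x)) t)"
proof -
 have [measurable]: "(%x. x) \<in> \<B> (time T)" by (rule borel_measurable_timeI) simp
 have "(%s. forward_kernel h t s) \<in> \<B> (time T)"
  unfolding forward_kernel_def by measurable
 moreover have "\<bar>forward_kernel h t s\<bar> \<le> 1 / h" for s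
  using \<open>h > 0\<close> by (auto simp: forward_kernel_def indicator_def)
 ultimately show i: "integrable (\<S> T) (%(s, x). forward_kernel h t s * f (s, x))"
  using bounded_time_times_integrable_spacetime[of "forward_kernel h t" T "1 / h", OF _ _ f]
  by (simp add: case_prod_unfold)
 show "integrable torus (%x. kernel_op (time T) (forward_kernel h) (%s. f (s, x)) t)"
  unfolding kernel_op_def by (rule TX.integrable_snd[OF i])
qed

text \<open>The increment over the window is the time integral of the flux, and Fubini moves that
  integral into the flux as a forward average. The capped end point needs no extra term because the
  average also stops at \<open>T\<close>.\<close>

theorem balance_forward:
 fixes u :: "real \<times> (real^'d::finite) => real"
 assumes "T > 0" and u: "integrable (\<S> T) u" and G: "!!j. integrable (\<S> T) (G j)"
  and bal: "balance T u G" and \<psi>: "periodic_smooth \<psi>"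
  and rep: "AE t in time T. AE x in torus. uc t x = u (t, x)"
  and meas: "!!t. t \<in> {0..T} ==> uc t \<in> \<B> torus"
  and cont: "continuous_on {0..T} (%t. (\<oint>x. uc t x * \<psi> x))"
  and t: "t \<in> {0<..<T}" and h: "h > 0"
 shows "(\<oint>x. uc (min (t + h) T) x * \<psi> x) - (\<oint>x. uc t x * \<psi> x)
  = h * (\<Sum>j\<in>UNIV. (\<oint>x. kernel_op (time T) (forward_kernel h) (%s. G j (s, x)) t * gradient \<psi> x $ j))"
proof -
 define g where "g t = (\<oint>x. (\<Sum>j\<in>UNIV. G j (t, x) * gradient \<psi> x $ j))" for t
 obtain C where C: "!!t. t \<in> {0..T} ==> (\<oint>x. uc t x * \<psi> x)
   = C + (LINT s|time T. indicator {..<t} s * g s)"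
 proof (rule balance_representative[OF assms(1-8)])
  fix C assume "!!t. t \<in> {0..T} ==> (\<oint>x. uc t x * \<psi> x)
   = C + (LINT s|time T. indicator {..<t} s * (\<oint>x. (\<Sum>j\<in>UNIV. G j (s, x) * gradient \<psi> x $ j)))"
  then show thesis by (intro that[of C]) (simp add: g_def)
 qed
 let ?k = "forward_kernel h t"
 have iGj: "integrable (\<S> T) (%z. G j z * gradient \<psi> (snd z) $ j)" for j
  using continuous_times_integrable_spacetime[OF smooth_gradient_continuous[OF \<psi>] G] by (simp add: mult.commute)
 have iG: "integrable (\<S> T) (%z. \<Sum>j\<in>UNIV. G j z * gradient \<psi> (snd z) $ j)"
  by (intro L_integrable_sum iGj)
 have g: "integrable (time T) g"
  using TX.integrable_fst'[OF iG] by (simp add: g_def[abs_def])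
 have [measurable]: "g \<in> \<B> (time T)" "(%x. x) \<in> \<B> (time T)"
  using g by (auto intro: borel_measurable_timeI)
 have gb: "integrable (time T) (%s. indicator {..<r} s * g s)" for r
  by (rule integrable_time_indicator[OF _ g]) simp
 have "(\<oint>x. uc (min (t + h) T) x * \<psi> x) - (\<oint>x. uc t x * \<psi> x)
   = (LINT s|time T. indicator {..<min (t + h) T} s * g s) - (LINT s|time T. indicator {..<t} s * g s)"
  using t h by (subst (1 2) C) auto
 also have "... = (LINT s|time T. indicator {..<min (t + h) T} s * g s - indicator {..<t} s * g s)"
  using gb by simp
 \<comment> \<open>The difference of the two half-line indicators is \<open>h\<close> times the
   kernel except at the single time \<open>s = t\<close>.\<close>
 also have "... = (LINT s|time T. h * (?k s * g s))"
 proof (rule integral_cong_AE)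
  show "AE s in time T. indicator {..<min (t + h) T} s * g s - indicator {..<t} s * g s = h * (?k s * g s)"
   using AE_time_neq[of t] AE_space
   by eventually_elim (use h in \<open>auto simp: forward_kernel_def indicator_def\<close>)
  show "(%s. h * (?k s * g s)) \<in> \<B> (time T)"
   unfolding forward_kernel_def by measurable
 qed measurable
 also have "... = h * (LINT s|time T. (\<oint>x. (\<Sum>j\<in>UNIV. ?k s * (G j (s, x) * gradient \<psi> x $ j))))"
  by (simp add: g_def sum_distrib_left[symmetric])
 also have "(LINT s|time T. (\<oint>x. (\<Sum>j\<in>UNIV. ?k s * (G j (s, x) * gradient \<psi> x $ j))))
   = (\<oint>x. (LINT s|time T. (\<Sum>j\<in>UNIV. ?k s * (G j (s, x) * gradient \<psi> x $ j))))"
 proof (rule TX.Fubini_integral[symmetric])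
  have "integrable (\<S> T) (%z. \<Sum>j\<in>UNIV. ?k (fst z) * (G j z * gradient \<psi> (snd z) $ j))"
   using forward_kernel_section_integrable(1)[OF h iGj, where t = t]
   by (intro L_integrable_sum) (simp add: case_prod_unfold)
  then show "integrable (\<S> T) (%(s, x). \<Sum>j\<in>UNIV. ?k s * (G j (s, x) * gradient \<psi> x $ j))"
   by (simp add: case_prod_unfold)
 qed
 also have "... = (\<oint>x. (\<Sum>j\<in>UNIV. kernel_op (time T) (forward_kernel h) (%s. G j (s, x)) t * gradient \<psi> x $ j))"
 proof (rule integral_cong_AE)
  have *: "AE x in torus. \<forall>j. integrable (time T) (%s. ?k s * G j (s, x))"
   unfolding AE_all_countable using TX.AE_integrable_snd[OF forward_kernel_section_integrable(1)[OF h G, where t = t]] by simp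
  show "AE x in torus. (LINT s|time T. (\<Sum>j\<in>UNIV. ?k s * (G j (s, x) * gradient \<psi> x $ j)))
    = (\<Sum>j\<in>UNIV. kernel_op (time T) (forward_kernel h) (%s. G j (s, x)) t * gradient \<psi> x $ j)"
   using *
  proof eventually_elim
   case (elim x)
   then show ?case
    by (simp add: kernel_op_def mult.assoc[symmetric])
  qed
  have [measurable]: "!!j. G j \<in> \<B> (\<S> T)" using G by simp
  have fk [measurable]: "(%s. ?k s) \<in> \<B> (time T)" unfolding forward_kernel_def by measurable
  have gm [measurable]: "!!j. (%x. gradient \<psi> x $ j) \<in> \<B> torus"
   by (intro borel_measurable_torusI borel_measurable_continuous_onI smooth_gradient_continuous \<psi>)
  have sw [measurable]: "!!j. (%z. G j (snd z, fst z)) \<in> \<B> (torus \<Otimes>\<^sub>M time T)"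
  proof -
   fix j have "(%(x, y). G j (y, x)) \<in> \<B> (torus \<Otimes>\<^sub>M time T)" by measurable
   then show "(%z. G j (snd z, fst z)) \<in> \<B> (torus \<Otimes>\<^sub>M time T)" by (simp add: case_prod_unfold)
  qed
  have m1: "(%z. \<Sum>j\<in>UNIV. ?k (snd z) * (G j (snd z, fst z) * gradient \<psi> (fst z) $ j)) \<in> \<B> (torus \<Otimes>\<^sub>M time T)"
   by measurable
  have m2: "(%z. ?k (snd z) * G j (snd z, fst z)) \<in> \<B> (torus \<Otimes>\<^sub>M time T)" for j
   by measurable
  show "(%x. (LINT s|time T. (\<Sum>j\<in>UNIV. ?k s * (G j (s, x) * gradient \<psi> x $ j)))) \<in> \<B> torus"
   using m1 by (intro time.borel_measurable_lebesgue_integral) (simp add: case_prod_unfold)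
  have "(%x. kernel_op (time T) (forward_kernel h) (%s. G j (s, x)) t) \<in> \<B> torus" for j
   unfolding kernel_op_def using m2[of j] by (intro time.borel_measurable_lebesgue_integral) (simp add: case_prod_unfold)
  then show "(%x. \<Sum>j\<in>UNIV. kernel_op (time T) (forward_kernel h) (%s. G j (s, x)) t * gradient \<psi> x $ j) \<in> \<B> torus"
   by measurable
 qed
 also have "... = (\<Sum>j\<in>UNIV. (\<oint>x. kernel_op (time T) (forward_kernel h) (%s. G j (s, x)) t * gradient \<psi> x $ j))"
  using continuous_times_integrable_torus[OF smooth_gradient_continuous[OF \<psi>] forward_kernel_section_integrable(2)[OF h G]]
  by (intro L_integral_sum) (simp add: mult.commute)
 finally show ?thesis .
qed

section \<open>Weak gradients on time slices\<close>

lemma fundamental_lemma_time_local: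
 fixes w :: "real => real"
 assumes "T > 0" and w: "!!a b. 0 < a ==> b < T ==> integrable (time T) (%t. indicator {a..b} t * w t)"
  and 0: "!!\<tau>. time_test T \<tau> ==> (LINT t|time T. \<tau> t * w t) = 0"
 shows "AE t in time T. w t = 0"
proof -
 define a b where "a n = T / (real n + 3)" and "b n = T - T / (real n + 3)" for n
 have ab: "0 < a n" "a n < b n" "b n < T" for n
 proof -
  show "0 < a n" "b n < T" using \<open>T > 0\<close> by (auto simp: a_def b_def)
  have "T / (real n + 3) \<le> T / 3" using \<open>T > 0\<close> by (intro divide_left_mono) auto
  then show "a n < b n" using \<open>T > 0\<close> by (simp add: a_def b_def)
 qed
 \<comment> \<open>\<open>w\<close> is integrable only on compact subintervals, so it is multiplied
   by rescaled bumps; these are positive inside, and their supports exhaust the interval.\<close>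
 define cut where "cut n t = bump ((t - a n) / (b n - a n))" for n t
 have cut_zero: "cut n t = 0" if "t \<notin> {a n..b n}" for n t
  unfolding cut_def using that ab(2)[of n] by (intro bump_eq_0) (auto simp: divide_simps)
 have cut_test: "time_test T (cut n)" for n
 proof -
  have "smooth (%t. bump ((1 / (b n - a n)) * t + - a n / (b n - a n)))"
   by (rule smooth_affine_compose[OF smooth_bump])
  then have "smooth (cut n)" by (simp add: cut_def[abs_def] diff_divide_distrib)
  then show ?thesis unfolding time_test_def using ab cut_zero by blast
 qed
 have cut_eq: "cut n t = cut n t * indicator {a n..b n} t" for n t
  using cut_zero[of t n] by (auto simp: indicator_def)
 have "AE t in time T. cut n t * w t = 0" for n
 proof (rule fundamental_lemma_time[OF _ \<open>T > 0\<close>])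
  have "integrable (time T) (%t. cut n t * (indicator {a n..b n} t * w t))"
   by (rule time_test_integrable[OF cut_test w]) (use ab in auto)
  then show "integrable (time T) (%t. cut n t * w t)" using cut_eq[of n] by (simp add: mult.assoc[symmetric])
  fix \<tau> assume \<tau>: "time_test T \<tau>"
  then have "time_test T (%t. \<tau> t * cut n t)"
   using cut_test[of n] unfolding time_test_def by (auto intro: smooth_mult)
  from 0[OF this] show "(LINT t|time T. \<tau> t * (cut n t * w t)) = 0" by (simp add: mult.assoc)
 qed
 then have "AE t in time T. \<forall>n. cut n t * w t = 0" unfolding AE_all_countable by blast
 with AE_space show ?thesis
 proof eventually_elim
  case (elim t)
  have "a \<leadsto> 0" "b \<leadsto> T" unfolding a_def b_def by real_asymp+
  then have "eventually (%n. a n < t) sequentially" "eventually (%n. t < b n) sequentially"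
   using elim(1) by (auto dest: order_tendstoD)
  then have "eventually (%n. a n < t \<and> t < b n) sequentially" by eventually_elim auto
  then obtain n where "a n < t" "t < b n" by (auto simp: eventually_sequentially)
  then have "cut n t > 0" unfolding cut_def by (intro bump_pos) auto
  then show ?case using elim(2) by auto
 qed
qed

lemma L1_loc_integrable:
 fixes f :: "real => real^'d::finite => 'b::euclidean_space"
 assumes f: "f \<in> L1_loc T" and "0 < a" "b < T"
 shows "integrable (\<S> T) (%z. indicator {a..b} (fst z) *\<^sub>R f (fst z) (snd z))"
proof -
 have "set_integrable (\<S> T) ({a..b} \<times> UNIV) (%(t, x). f t x)"
  using assms by (auto simp: L1_loc_def)
 then show ?thesis by (simp add: set_integrable_def indicator_times case_prod_unfold)
qed

lemma AE_time_local:
 assumes "!!a b. 0 < a ==> b < T ==> AE t in time T. t \<in> {a..b} --> P t"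
 shows "AE t in time T. P t"
proof -
 have "AE t in time T. \<forall>n::nat. t \<in> {1 / (real n + 1)..T - 1 / (real n + 1)} --> P t"
  unfolding AE_all_countable by (intro allI assms) auto
 with AE_space show ?thesis
 proof eventually_elim
  case (elim t)
  have "(%n. 1 / (real n + 1)) \<leadsto> 0" "(%n. T - 1 / (real n + 1)) \<leadsto> T" by real_asymp+
  then have "eventually (%n. 1 / (real n + 1) < t) sequentially" "eventually (%n. t < T - 1 / (real n + 1)) sequentially"
   using elim(1) by (auto dest: order_tendstoD)
  then have "eventually (%n. 1 / (real n + 1) < t \<and> t < T - 1 / (real n + 1)) sequentially" by eventually_elim auto
  then obtain n :: nat where "1 / (real n + 1) < t" "t < T - 1 / (real n + 1)" by (auto simp: eventually_sequentially)
  then show ?case using spec[OF elim(2), of n] by simp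
 qed
qed

lemma L1_loc_AE_integrable:
 fixes f :: "real => real^'d::finite => 'b::euclidean_space"
 assumes f: "f \<in> L1_loc T"
 shows "AE t in time T. integrable torus (f t)"
proof (rule AE_time_local)
 fix a b :: real assume "0 < a" "b < T"
 from TX.AE_integrable_fst'[OF L1_loc_integrable[OF f this]]
 show "AE t in time T. t \<in> {a..b} --> integrable torus (f t)"
  by eventually_elim (auto simp: indicator_def)
qed

lemma integrable_componentwise:
 fixes f :: "'a => real^'d::finite"
 assumes "!!k. integrable M (%z. f z $ k)"
 shows "integrable M f"
proof -
 have "f = (%z. \<Sum>k\<in>UNIV. f z $ k *\<^sub>R axis k 1)"
  using basis_expansion[of "f z" for z] by (simp add: scalar_mult_eq_scaleR fun_eq_iff)
 then show ?thesis by (rule ssubst) (intro L_integrable_sum integrable_scaleR_left assms)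
qed

text \<open>Testing with \<open>\<tau> \<psi>\<close> for all \<open>\<tau>\<close> frees the
  identity from the time integral. The exceptional set of times depends on \<open>\<psi>\<close>.
  Integrability is only local in time, hence the cut to the support of
  \<open>\<tau>\<close>.\<close>

lemma weak_grad_slices:
 fixes f :: "real => real^'d::finite => real"
 assumes "T > 0" and wg: "weak_grad T f G" and \<psi>: "periodic_smooth \<psi>"
 shows "AE t in time T. (\<oint>x. gradient \<psi> x $ i * f t x) + (\<oint>x. \<psi> x * G t x $ i) = 0"
proof -
 have f: "f \<in> L1_loc T" and G: "G \<in> L1_loc T" using wg by (auto simp: weak_grad_def)
 define w where "w t = (\<oint>x. gradient \<psi> x $ i * f t x) + (\<oint>x. \<psi> x * G t x $ i)" for t
 have G': "integrable (\<S> T) (%z. indicator {a..b} (fst z) * G (fst z) (snd z) $ k)" if "0 < a" "b < T" for a b :: real and k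
  using integrable_bounded_linear[OF bounded_linear_vec_nth L1_loc_integrable[OF G that], of k] by simp
 have f': "integrable (\<S> T) (%z. indicator {a..b} (fst z) * f (fst z) (snd z))" if "0 < a" "b < T" for a b :: real
  using L1_loc_integrable[OF f that] by simp
 have i1: "integrable (\<S> T) (%z. gradient \<psi> (snd z) $ k * (indicator {a..b} (fst z) * f (fst z) (snd z)))"
  and i2: "integrable (\<S> T) (%z. \<psi> (snd z) * (indicator {a..b} (fst z) * G (fst z) (snd z) $ k))"
  if "0 < a" "b < T" for a b :: real and k
  by (rule continuous_times_integrable_spacetime[OF smooth_gradient_continuous[OF \<psi>] f'[OF that]])
   (rule continuous_times_integrable_spacetime[OF periodic_smooth_continuous[OF \<psi>] G'[OF that]])
 have "AE t in time T. w t = 0"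
 proof (rule fundamental_lemma_time_local[OF \<open>T > 0\<close>])
  fix a b :: real assume ab: "0 < a" "b < T"
  have "integrable (time T) (%t. (\<oint>x. gradient \<psi> x $ i * (indicator {a..b} t * f t x))
    + (\<oint>x. \<psi> x * (indicator {a..b} t * G t x $ i)))"
   using TX.integrable_fst'[OF i1[OF ab, of i]] TX.integrable_fst'[OF i2[OF ab, of i]] by simp
  moreover have "(\<oint>x. gradient \<psi> x $ i * (indicator {a..b} t * f t x))
    + (\<oint>x. \<psi> x * (indicator {a..b} t * G t x $ i)) = indicator {a..b} t * w t" for t
   by (simp add: w_def distrib_left mult.left_commute[of _ "indicator {a..b} t"])
  ultimately show "integrable (time T) (%t. indicator {a..b} t * w t)" by simp
 next
  fix \<tau> assume \<tau>: "time_test T \<tau>"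
  then obtain a b where ab: "0 < a" "b < T" "!!t. t \<notin> {a..b} ==> \<tau> t = 0"
   unfolding time_test_def by blast
  have \<tau>': "\<tau> t = \<tau> t * indicator {a..b} t" for t using ab(3)[of t] by (auto simp: indicator_def)
  obtain B where B: "!!t. \<bar>\<tau> t\<bar> \<le> B" using time_test_bounded[OF \<tau>] by metis
  note test = test_fun_product[OF \<tau> \<psi>]
  have j1: "integrable (\<S> T) (%z. \<tau> (fst z) * (gradient \<psi> (snd z) $ k * f (fst z) (snd z)))" for k
  proof -
   have eq: "\<tau> (fst z) * (gradient \<psi> (snd z) $ k * (indicator {a..b} (fst z) * f (fst z) (snd z)))
     = \<tau> (fst z) * (gradient \<psi> (snd z) $ k * f (fst z) (snd z))" for z
    using ab(3)[of "fst z"] by (auto simp: indicator_def)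
   show ?thesis
    using bounded_time_times_integrable_spacetime[OF time_test_measurable[OF \<tau>] B i1[OF ab(1,2), of k]] unfolding eq .
  qed
  have j2: "integrable (\<S> T) (%z. \<tau> (fst z) * (\<psi> (snd z) * G (fst z) (snd z) $ k))" for k
  proof -
   have eq: "\<tau> (fst z) * (\<psi> (snd z) * (indicator {a..b} (fst z) * G (fst z) (snd z) $ k))
     = \<tau> (fst z) * (\<psi> (snd z) * G (fst z) (snd z) $ k)" for z
    using ab(3)[of "fst z"] by (auto simp: indicator_def)
   show ?thesis
    using bounded_time_times_integrable_spacetime[OF time_test_measurable[OF \<tau>] B i2[OF ab(1,2), of k]] unfolding eq .
  qed
  have eq: "(LINT (t, x)|\<S> T. f t x *\<^sub>R grad (%(t, x). \<tau> t * \<psi> x) t x)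
    = - (LINT (t, x)|\<S> T. (case (t, x) of (t, x) => \<tau> t * \<psi> x) *\<^sub>R G t x)"
   using wg test(1) unfolding weak_grad_def by blast
  have v1: "integrable (\<S> T) (%z. f (fst z) (snd z) *\<^sub>R (\<tau> (fst z) *\<^sub>R gradient \<psi> (snd z)))"
   by (rule integrable_componentwise) (use j1 in \<open>simp add: mult_ac\<close>)
  have v2: "integrable (\<S> T) (%z. (\<tau> (fst z) * \<psi> (snd z)) *\<^sub>R G (fst z) (snd z))"
   by (rule integrable_componentwise) (use j2 in \<open>simp add: mult_ac\<close>)
  have "(LINT z|\<S> T. f (fst z) (snd z) *\<^sub>R (\<tau> (fst z) *\<^sub>R gradient \<psi> (snd z))) $ i
    = - (LINT z|\<S> T. (\<tau> (fst z) * \<psi> (snd z)) *\<^sub>R G (fst z) (snd z)) $ i"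
   using eq unfolding test(3) by (simp add: case_prod_unfold)
  then have "(LINT z|\<S> T. (f (fst z) (snd z) *\<^sub>R (\<tau> (fst z) *\<^sub>R gradient \<psi> (snd z))) $ i)
    = - (LINT z|\<S> T. ((\<tau> (fst z) * \<psi> (snd z)) *\<^sub>R G (fst z) (snd z)) $ i)"
   using integral_bounded_linear[OF bounded_linear_vec_nth v1, of i]
    integral_bounded_linear[OF bounded_linear_vec_nth v2, of i] by simp
  then have "(LINT z|\<S> T. \<tau> (fst z) * (gradient \<psi> (snd z) $ i * f (fst z) (snd z)))
    + (LINT z|\<S> T. \<tau> (fst z) * (\<psi> (snd z) * G (fst z) (snd z) $ i)) = 0"
   by (simp add: mult_ac)
  then have "(LINT t|time T. \<tau> t * (\<oint>x. gradient \<psi> x $ i * f t x))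
    + (LINT t|time T. \<tau> t * (\<oint>x. \<psi> x * G t x $ i)) = 0"
   unfolding TX.integral_fst'[OF j1[of i], symmetric] TX.integral_fst'[OF j2[of i], symmetric] by simp
  moreover have "integrable (time T) (%t. \<tau> t * (\<oint>x. gradient \<psi> x $ i * f t x))"
   "integrable (time T) (%t. \<tau> t * (\<oint>x. \<psi> x * G t x $ i))"
   using TX.integrable_fst'[OF j1[of i]] TX.integrable_fst'[OF j2[of i]] by simp_all
  ultimately show "(LINT t|time T. \<tau> t * w t) = 0" by (simp add: w_def distrib_left)
 qed
 then show ?thesis by (simp add: w_def)
qed

text \<open>Mollification commutes with the weak gradient: for fixed \<open>x\<close> the kernel is
  itself an admissible test function of \<open>y\<close>.\<close>

theorem weak_grad_mollify:
 fixes f :: "real => real^'d::finite => real"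
 assumes "T > 0" and wg: "weak_grad T f G"
 shows "AE z in \<S> T. gradient (kernel_op torus (mollifier n) (f (fst z))) (snd z) $ i
  = kernel_op torus (mollifier n) (%y. G (fst z) y $ i) (snd z)"
proof -
 have f: "f \<in> L1_loc T" and G: "G \<in> L1_loc T" using wg by (auto simp: weak_grad_def)
 define Z where "Z = (LINT z|(torus :: (real^'d) measure). peak z ^ n)"
 define \<eta> where "\<eta> z = peak z ^ n / Z" for z :: "real^'d"
 have \<eta>: "smooth \<eta>"
  unfolding \<eta>_def using smooth_mult[OF periodic_smooth_smooth[OF peak_periodic_smooth[of n]] smooth_const[of "1 / Z"]] by simp
 have mol: "mollifier n x y = \<eta> (x - y)" for x y :: "real^'d" by (simp add: mollifier_def \<eta>_def Z_def)
 have grad: "gradient (%x. mollifier n x y) x = gradient \<eta> (x - y)" for x y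
 proof -
  have "((%x. \<eta> (x - y)) has_derivative frechet_derivative \<eta> (at (x - y))) (at x)"
   by (rule has_derivative_compose[of "%x. x - y" "%h. h", OF _ smooth_has_derivative[OF \<eta>]])
    (auto intro!: derivative_eq_intros)
  from frechet_derivative_at[OF this, symmetric] show ?thesis by (simp add: gradient_def mol)
 qed
 let ?L = "%z. (\<oint>y. gradient \<eta> (snd z - y) $ i * f (fst z) y)"
 let ?R = "%z. kernel_op torus (mollifier n) (%y. G (fst z) y $ i) (snd z)"
 have "AE z in \<S> T. ?L z = ?R z"
 proof -
  have fm: "(%z. f (fst z) (snd z)) \<in> \<B> (\<S> T)"
   using f by (simp add: L1_loc_def case_prod_unfold)
  have Gm: "(%z. G (fst z) (snd z)) \<in> \<B> (\<S> T)"
   using G by (simp add: L1_loc_def case_prod_unfold)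
  have proj: "(%p. (fst (fst p), snd p)) \<in> \<S> T \<Otimes>\<^sub>M torus \<rightarrow>\<^sub>M (\<S> T :: (real \<times> (real^'d)) measure)"
   by measurable
  have f3: "(%p. f (fst (fst p)) (snd p)) \<in> \<B> (\<S> T \<Otimes>\<^sub>M torus)"
   and G3: "(%p. G (fst (fst p)) (snd p)) \<in> \<B> (\<S> T \<Otimes>\<^sub>M torus)"
   using measurable_compose[OF proj fm] measurable_compose[OF proj Gm] by simp_all
  have id: "(%x. x) \<in> torus \<rightarrow>\<^sub>M (borel :: (real^'d) measure)" by (rule borel_measurable_torusI) simp
  have d3: "(%p. snd (fst p) - snd p) \<in> \<S> T \<Otimes>\<^sub>M torus \<rightarrow>\<^sub>M (borel :: (real^'d) measure)"
  proof (rule borel_measurable_diff)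
   show "(%p. snd (fst p)) \<in> \<S> T \<Otimes>\<^sub>M torus \<rightarrow>\<^sub>M (borel :: (real^'d) measure)"
    by (rule measurable_compose[OF measurable_compose[OF measurable_fst measurable_snd] id])
   show "snd \<in> \<S> T \<Otimes>\<^sub>M torus \<rightarrow>\<^sub>M (borel :: (real^'d) measure)"
    by (rule measurable_compose[OF measurable_snd id])
  qed
  have g3: "(%p. gradient \<eta> (snd (fst p) - snd p) $ i) \<in> \<B> (\<S> T \<Otimes>\<^sub>M torus)"
   "(%p. \<eta> (snd (fst p) - snd p)) \<in> \<B> (\<S> T \<Otimes>\<^sub>M torus)"
   by (rule measurable_compose[OF d3], intro borel_measurable_continuous_onI smooth_continuous_on smooth_gradient \<eta>)+
  have "?L \<in> \<B> (\<S> T)"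
   using borel_measurable_times[OF g3(1) f3]
   by (intro torus.borel_measurable_lebesgue_integral) (simp add: case_prod_unfold)
  moreover have "?R \<in> \<B> (\<S> T)"
   unfolding kernel_op_def mol
   using borel_measurable_times[OF g3(2) measurable_compose[OF G3 borel_measurable_nth[of i]]]
   by (intro torus.borel_measurable_lebesgue_integral) (simp add: case_prod_unfold)
 
  ultimately have M: "{z \<in> space (\<S> T). ?L z = ?R z} \<in> sets (\<S> T)" by measurable
  \<comment> \<open>The exceptional times depend on \<open>x\<close>, so only the order
    \<open>x\<close> first is available; joint measurability of both sides permits the
    exchange.\<close>
  have "AE x in torus. AE t in time T. ?L (t, x) = ?R (t, x)"
  proof (rule AE_I2)
   fix x :: "real^'d"
   have per: "periodic_smooth (%y. mollifier n x y)" by (rule separable_sections(2)[OF mollifier_separable])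
   from weak_grad_slices[OF \<open>T > 0\<close> wg per, of i]
   show "AE t in time T. ?L (t, x) = ?R (t, x)"
   proof eventually_elim
    case (elim t)
    \<comment> \<open>This minus sign cancels the one from integration by parts.\<close>
    have "gradient (%y. mollifier n x y) y $ i = - gradient \<eta> (x - y) $ i" for y
     using gradient_mollifier[of n y x] grad[of y x] by (metis minus_minus vector_uminus_component)
    then show ?case using elim by (simp add: kernel_op_def)
   qed
  qed
  then have "AE t in time T. AE x in torus. ?L (t, x) = ?R (t, x)"
   using M by (subst TX.AE_commute) simp_all
  then show ?thesis by (rule TX.AE_pair_measure[OF M])
 qed
 moreover have "AE t in time T. \<forall>x. gradient (kernel_op torus (mollifier n) (f t)) x $ i = ?L (t, x)"
  using L1_loc_AE_integrable[OF f]
  by eventually_elim (simp add: separable_kernel_op(2)[OF mollifier_separable] grad)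
 from TX.AE_fst[OF this] have "AE z in \<S> T. \<forall>x. gradient (kernel_op torus (mollifier n) (f (fst z))) x $ i = ?L (fst z, x)" .
 ultimately show ?thesis by eventually_elim simp
qed

lemma continuous_AE_time_nonneg:
 fixes f :: "real => real"
 assumes "T > 0" and f: "continuous_on {0..T} f" and ae: "AE t in time T. 0 \<le> f t" and t: "t \<in> {0..T}"
 shows "0 \<le> f t"
proof -
 have "min (f t) 0 = 0"
 proof (rule continuous_AE_time_zero[OF \<open>T > 0\<close> _ _ t])
  show "continuous_on {0..T} (%t. min (f t) 0)" by (intro continuous_intros f)
  show "AE t in time T. min (f t) 0 = 0" using ae by eventually_elim simp
 qed
 then show ?thesis by (simp add: min_def split: if_splits)
qed


section \<open>The fluid: fluxes and internal energy\<close>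

definition clamp_unit :: "real => real => real"
 where "clamp_unit c z = max 0 (min 1 (c + 1 - z))"

text \<open>Renormalization admits only functions whose derivative vanishes for large arguments.
  Since the density stays below \<open>c\<close>, the power may be altered beyond \<open>c\<close>:
  its derivative is faded out on \<open>[c, c + 1]\<close>.\<close>

lemma powr_truncation:
 fixes c \<gamma> :: real
 assumes "c \<ge> 0" "\<gamma> > 1"
 obtains b b' :: "real => real" where
  "!!z. (b has_real_derivative b' z) (at z)" "continuous_on UNIV b'"
  "!!z. z \<ge> c + 1 ==> b' z = 0"
  "!!z. 0 \<le> z ==> z \<le> c ==> b z = z powr \<gamma>" "!!z. 0 \<le> z ==> z \<le> c ==> b' z * z = \<gamma> * z powr \<gamma>"
proof -
 define b' where "b' z = \<gamma> * (max 0 z) powr (\<gamma> - 1) * clamp_unit c z" for z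
 define b where "b z = integral {0..z} b'" for z
 have cont: "continuous_on UNIV b'"
  unfolding b'_def clamp_unit_def using assms
  by (intro continuous_intros continuous_on_powr') auto
 show thesis
 proof
  show "continuous_on UNIV b'" by (rule cont)
  fix z :: real
  show "b' z = 0" if "z \<ge> c + 1" using that by (simp add: b'_def clamp_unit_def)
  show "(b has_real_derivative b' z) (at z)"
   unfolding b_def by (rule antiderivative_real[OF cont]) (use assms in \<open>auto simp: b'_def\<close>)
  assume z: "0 \<le> z" "z \<le> c"
  have "((%s. \<gamma> * s powr (\<gamma> - 1)) has_integral (z powr \<gamma> - 0 powr \<gamma>)) {0..z}"
  proof (rule fundamental_theorem_of_calculus_interior[OF z(1)])
   show "continuous_on {0..z} (%s. s powr \<gamma>)"
    using assms by (intro continuous_on_powr' continuous_intros) auto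
   show "((%s. s powr \<gamma>) has_vector_derivative \<gamma> * s powr (\<gamma> - 1)) (at s)" if "s \<in> {0<..<z}" for s
    using that unfolding has_real_derivative_iff_has_vector_derivative[symmetric]
    by (auto intro!: derivative_eq_intros)
  qed
  then have "(b' has_integral (z powr \<gamma> - 0 powr \<gamma>)) {0..z}"
   by (rule has_integral_eq[rotated]) (use z in \<open>auto simp: b'_def clamp_unit_def\<close>)
  then show "b z = z powr \<gamma>" unfolding b_def by (simp add: integral_unique)
  show "b' z * z = \<gamma> * z powr \<gamma>"
   using z powr_mult_base[of z "\<gamma> - 1"] by (simp add: b'_def clamp_unit_def mult_ac)
 qed
qed

locale fluid =
 fixes T \<gamma> \<mu> lam c :: real
  and \<rho> :: "real => real^'d::finite => real" and v :: "real => real^'d => real^'d"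
  and Dv :: "real => real^'d => real^'d^'d"
 assumes T_pos: "T > 0" and \<gamma>_gt: "\<gamma> > 1" and c_nonneg: "c \<ge> 0"
  and \<rho>_measurable: "(%(t, x). \<rho> t x) \<in> \<B> (\<S> T)"
  and v_measurable: "(%(t, x). v t x) \<in> \<B> (\<S> T)"
  and Dv_measurable: "(%(t, x). Dv t x) \<in> \<B> (\<S> T)"
  and \<rho>_bounds: "AE (t, x) in \<S> T. 0 \<le> \<rho> t x \<and> \<rho> t x \<le> c"
  and v_weak_grad: "weak_grad_vec T v Dv"
  and v_L4: "integrable (\<S> T) (%(t, x). norm (v t x) ^ 4)"
  and Dv_L2: "integrable (\<S> T) (%(t, x). (norm (Dv t x))\<^sup>2)"
  and mass: "continuity_eq T \<rho> v"
  and momentum: "momentum_eq T \<gamma> \<mu> lam \<rho> v Dv"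
  and renorm: "renormalized T \<rho> v Dv"
begin

text \<open>A version of the density that satisfies the bounds everywhere and not just almost
  everywhere; products with it need no exceptional sets.\<close>

definition r :: "real \<times> (real^'d) => real"
 where "r z = max 0 (min c (\<rho> (fst z) (snd z)))"

definition V :: "'d => real \<times> (real^'d) => real"
 where "V i z = v (fst z) (snd z) $ i"

definition D :: "'d => 'd => real \<times> (real^'d) => real"
 where "D i j z = Dv (fst z) (snd z) $ i $ j"

definition divv :: "real \<times> (real^'d) => real"
 where "divv z = (\<Sum>i\<in>UNIV. D i i z)"

definition p :: "real \<times> (real^'d) => real"
 where "p z = r z powr \<gamma>"

text \<open>The momentum flux: convection and pressure minus the viscous stress, the bulk part of
  which sits on the diagonal together with the pressure.\<close>

definition F :: "'d => 'd => real \<times> (real^'d) => real"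
 where "F i j z = r z * V i z * V j z + (if i = j then p z - (\<mu> + lam) * divv z else 0) - \<mu> * D i j z"

lemma r_bounds: "0 \<le> r z" "r z \<le> c"
 using c_nonneg by (auto simp: r_def)

lemma r_AE: "AE z in \<S> T. \<rho> (fst z) (snd z) = r z"
 using \<rho>_bounds by eventually_elim (auto simp: r_def case_prod_unfold)

lemma \<rho>_measurable' [measurable]: "(%z. \<rho> (fst z) (snd z)) \<in> \<B> (\<S> T)"
 using \<rho>_measurable by (simp add: case_prod_unfold)

lemma v_measurable' [measurable]: "(%z. v (fst z) (snd z)) \<in> \<B> (\<S> T)"
 using v_measurable by (simp add: case_prod_unfold)

lemma Dv_measurable' [measurable]: "(%z. Dv (fst z) (snd z)) \<in> \<B> (\<S> T)"
 using Dv_measurable by (simp add: case_prod_unfold)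

lemma r_measurable [measurable]: "r \<in> \<B> (\<S> T)"
 unfolding r_def[abs_def] by measurable

lemma V_measurable [measurable]: "V i \<in> \<B> (\<S> T)"
 unfolding V_def[abs_def] by (rule measurable_compose[OF v_measurable' borel_measurable_nth])

lemma D_measurable [measurable]: "D i j \<in> \<B> (\<S> T)"
proof -
 have "(%A :: real^'d^'d. A $ i $ j) \<in> \<B> borel"
  by (intro borel_measurable_continuous_onI continuous_intros)
 from measurable_compose[OF Dv_measurable' this] show ?thesis by (simp add: D_def[abs_def])
qed

lemma divv_measurable [measurable]: "divv \<in> \<B> (\<S> T)"
 unfolding divv_def[abs_def] by measurable

lemma p_measurable [measurable]: "p \<in> \<B> (\<S> T)"
 unfolding p_def[abs_def] by measurable

lemma F_measurable [measurable]: "F i j \<in> \<B> (\<S> T)"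
 unfolding F_def[abs_def] by measurable

lemma p_bounds: "0 \<le> p z" "p z \<le> c powr \<gamma>"
 using r_bounds[of z] \<gamma>_gt by (auto simp: p_def intro: powr_mono2)

lemma V_L4: "integrable (\<S> T) (%z. \<bar>V i z\<bar> ^ 4)"
proof (rule L_integrable_bound)
 show "integrable (\<S> T) (%z. norm (v (fst z) (snd z)) ^ 4)"
  using v_L4 by (simp add: case_prod_unfold)
 have "\<bar>V i z\<bar> ^ 4 \<le> norm (v (fst z) (snd z)) ^ 4" for z
  by (rule power_mono) (auto simp: V_def component_le_norm_cart)
 then show "AE z in \<S> T. norm (\<bar>V i z\<bar> ^ 4) \<le> norm (norm (v (fst z) (snd z)) ^ 4)"
  by simp
qed measurable

lemma D_L2: "integrable (\<S> T) (%z. \<bar>D i j z\<bar> ^ 2)"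
proof (rule L_integrable_bound)
 show "integrable (\<S> T) (%z. (norm (Dv (fst z) (snd z)))\<^sup>2)"
  using Dv_L2 by (simp add: case_prod_unfold)
 have "\<bar>D i j z\<bar> \<le> norm (Dv (fst z) (snd z))" for z
  unfolding D_def using component_le_norm_cart[of "Dv (fst z) (snd z) $ i" j] Finite_Cartesian_Product.norm_nth_le[of "Dv (fst z) (snd z)" i]
  by linarith
 then have "\<bar>D i j z\<bar> ^ 2 \<le> (norm (Dv (fst z) (snd z)))\<^sup>2" for z
  by (rule power_mono) simp
 then show "AE z in \<S> T. norm (\<bar>D i j z\<bar> ^ 2) \<le> norm ((norm (Dv (fst z) (snd z)))\<^sup>2)"
  by simp
qed measurable

lemma bounded_power_integrable:
 fixes a :: "real \<times> (real^'d) => real"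
 assumes [measurable]: "a \<in> \<B> (\<S> T)" and "!!z. \<bar>a z\<bar> \<le> B"
 shows "integrable (\<S> T) (%z. \<bar>a z\<bar> ^ n)"
 by (rule spacetime.integrable_const_bound[of _ "B ^ n"])
  (use assms(2) in \<open>auto intro!: AE_I2 power_mono simp del: power_abs\<close>)

lemma bounded_times_power_integrable:
 fixes a f :: "real \<times> (real^'d) => real"
 assumes [measurable]: "a \<in> \<B> (\<S> T)" "f \<in> \<B> (\<S> T)"
  and a: "!!z. \<bar>a z\<bar> \<le> B" and f: "integrable (\<S> T) (%z. \<bar>f z\<bar> ^ n)"
 shows "integrable (\<S> T) (%z. \<bar>a z * f z\<bar> ^ n)"
proof (rule L_integrable_bound)
 show "integrable (\<S> T) (%z. B ^ n * \<bar>f z\<bar> ^ n)" using f by simp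
 have "\<bar>a z * f z\<bar> ^ n \<le> B ^ n * \<bar>f z\<bar> ^ n" for z
  unfolding abs_mult power_mult_distrib using a[of z] by (intro mult_right_mono power_mono) auto
 then have "norm (\<bar>a z * f z\<bar> ^ n) \<le> norm (B ^ n * \<bar>f z\<bar> ^ n)" for z
  unfolding real_norm_def by (subst abs_of_nonneg[OF zero_le_power[OF abs_ge_zero]]) (rule order_trans[OF _ abs_ge_self])
 then show "AE z in \<S> T. norm (\<bar>a z * f z\<bar> ^ n) \<le> norm (B ^ n * \<bar>f z\<bar> ^ n)"
  by (rule AE_I2)
qed measurable

lemma r_abs: "\<bar>r z\<bar> \<le> c" using r_bounds[of z] by simp

text \<open>The product rule for constant sequences doubles as Hoelder's inequality.\<close>

lemma VV_L2: "integrable (\<S> T) (%z. \<bar>V i z * V j z\<bar> ^ 2)"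
proof -
 have "Lp_conv (2 * 2) (\<S> T) (%n. V k) (V k)" for k
  using V_L4[of k] by (intro Lp_conv_const) auto
 from Lp_conv_mult[OF this this, of i j] show ?thesis by (simp add: Lp_conv_def)
qed

lemma divv_L2: "integrable (\<S> T) (%z. \<bar>divv z\<bar> ^ 2)"
proof -
 have "Lp_conv 2 (\<S> T) (%n z. \<Sum>i\<in>UNIV. D i i z) (%z. \<Sum>i\<in>UNIV. D i i z)"
  using D_L2 by (intro Lp_conv_sum Lp_conv_const) auto
 then show ?thesis by (simp add: Lp_conv_def divv_def)
qed

lemma F_L2: "integrable (\<S> T) (%z. \<bar>F i j z\<bar> ^ 2)"
proof -
 have 1: "integrable (\<S> T) (%z. \<bar>r z * (V i z * V j z)\<bar> ^ 2)"
  by (rule bounded_times_power_integrable[OF _ _ r_abs VV_L2]) auto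
 have 2: "integrable (\<S> T) (%z. \<bar>if i = j then p z - (\<mu> + lam) * divv z else 0\<bar> ^ 2)"
 proof (cases "i = j")
  case True
  have "integrable (\<S> T) (%z. \<bar>p z - (\<mu> + lam) * divv z\<bar> ^ 2)"
   by (intro integrable_power_diff bounded_times_power_integrable[where B = "\<bar>\<mu> + lam\<bar>"] divv_L2
     bounded_power_integrable[where B = "c powr \<gamma>"])
    (use p_bounds in auto)
  then show ?thesis using True by simp
 qed simp
 have 3: "integrable (\<S> T) (%z. \<bar>\<mu> * D i j z\<bar> ^ 2)"
  by (intro bounded_times_power_integrable[where B = "\<bar>\<mu>\<bar>"] D_L2) auto
 have "integrable (\<S> T) (%z. \<bar>r z * (V i z * V j z) + (if i = j then p z - (\<mu> + lam) * divv z else 0) - \<mu> * D i j z\<bar> ^ 2)"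
  by (intro integrable_power_diff integrable_power_add 1 2 3) auto
 then show ?thesis by (simp add: F_def mult.assoc)
qed

lemma rV_L4: "integrable (\<S> T) (%z. \<bar>r z * V j z\<bar> ^ 4)"
 by (rule bounded_times_power_integrable[OF _ _ r_abs V_L4]) auto

lemma L1_facts:
 "integrable (\<S> T) r" "integrable (\<S> T) (%z. r z * V j z)" "integrable (\<S> T) (V j)"
 "integrable (\<S> T) (F i j)" "integrable (\<S> T) (D i j)" "integrable (\<S> T) divv"
 "integrable (\<S> T) p"
proof -
 show "integrable (\<S> T) r"
  by (rule spacetime.integrable_const_bound[of _ c]) (simp_all add: r_bounds)
 show "integrable (\<S> T) p"
  by (rule spacetime.integrable_const_bound[of _ "c powr \<gamma>"]) (simp_all add: p_bounds)
 show "integrable (\<S> T) (%z. r z * V j z)"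
  by (rule spacetime.integrable_of_power[OF _ _ rV_L4]) simp_all
 show "integrable (\<S> T) (V j)"
  by (rule spacetime.integrable_of_power[OF _ _ V_L4]) simp_all
 show "integrable (\<S> T) (F i j)"
  by (rule spacetime.integrable_of_power[OF _ _ F_L2]) simp_all
 show "integrable (\<S> T) (D i j)"
  by (rule spacetime.integrable_of_power[OF _ _ D_L2]) simp_all
 show "integrable (\<S> T) divv"
  by (rule spacetime.integrable_of_power[OF _ _ divv_L2]) simp_all
qed

lemma inner_gradient: "v t x \<bullet> (a *\<^sub>R g) = a * (\<Sum>j\<in>UNIV. V j (t, x) * g $ j)"
 by (simp add: inner_vec_def V_def sum_distrib_left mult_ac)

lemma gradient_measurable_spacetime:
 "periodic_smooth \<psi> ==> (%z. gradient \<psi> (snd z) $ j) \<in> \<B> (\<S> T)"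
 by (intro snd_measurable_spacetime smooth_gradient_continuous)

lemma balance_mass: "balance T r (%j z. r z * V j z)"
 unfolding balance_def
proof (intro allI impI)
 fix \<tau> and \<psi> :: "real^'d => real"
 assume \<tau>: "time_test T \<tau>" and \<psi>: "periodic_smooth \<psi>"
 note test = test_fun_product[OF \<tau> \<psi>]
 have [measurable]: "\<tau> \<in> \<B> (time T)" "deriv \<tau> \<in> \<B> (time T)"
  using time_test_measurable[OF \<tau>] time_test_measurable[OF time_test_deriv[OF \<tau>]] by auto
 note gradient_measurable_spacetime[OF \<psi>, measurable]
  snd_measurable_spacetime[OF periodic_smooth_continuous[OF \<psi>], measurable]
 have "0 = (LINT (t, x)|\<S> T. \<rho> t x * dt (%(t, x). \<tau> t * \<psi> x) t x
   + \<rho> t x * (v t x \<bullet> grad (%(t, x). \<tau> t * \<psi> x) t x))"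
  by (rule mass[unfolded continuity_eq_def, rule_format, OF test(1), symmetric])
 also have "... = (LINT z|\<S> T. \<rho> (fst z) (snd z) * (deriv \<tau> (fst z) * \<psi> (snd z))
   + \<rho> (fst z) (snd z) * (\<tau> (fst z) * (\<Sum>j\<in>UNIV. V j z * gradient \<psi> (snd z) $ j)))"
  unfolding test(2,3) inner_gradient by (simp add: case_prod_unfold)
 also have "... = (LINT z|\<S> T. deriv \<tau> (fst z) * (\<psi> (snd z) * r z)
   + \<tau> (fst z) * (\<Sum>j\<in>UNIV. r z * V j z * gradient \<psi> (snd z) $ j))"
 proof (rule integral_cong_AE)
  show "AE z in \<S> T. \<rho> (fst z) (snd z) * (deriv \<tau> (fst z) * \<psi> (snd z))
   + \<rho> (fst z) (snd z) * (\<tau> (fst z) * (\<Sum>j\<in>UNIV. V j z * gradient \<psi> (snd z) $ j))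
   = deriv \<tau> (fst z) * (\<psi> (snd z) * r z) + \<tau> (fst z) * (\<Sum>j\<in>UNIV. r z * V j z * gradient \<psi> (snd z) $ j)"
   using r_AE by eventually_elim (simp add: sum_distrib_left mult_ac)
 qed measurable
 finally show "(LINT (t, x)|\<S> T. deriv \<tau> t * (\<psi> x * r (t, x))
   + \<tau> t * (\<Sum>j\<in>UNIV. r (t, x) * V j (t, x) * gradient \<psi> x $ j)) = 0"
  by (simp add: case_prod_unfold)
qed

lemma balance_momentum: "balance T (%z. r z * V i z) (F i)"
 unfolding balance_def
proof (intro allI impI)
 fix \<tau> and \<psi> :: "real^'d => real"
 assume \<tau>: "time_test T \<tau>" and \<psi>: "periodic_smooth \<psi>"
 note test = test_fun_product[OF \<tau> \<psi>]
 have [measurable]: "\<tau> \<in> \<B> (time T)" "deriv \<tau> \<in> \<B> (time T)"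
  using time_test_measurable[OF \<tau>] time_test_measurable[OF time_test_deriv[OF \<tau>]] by auto
 note gradient_measurable_spacetime[OF \<psi>, measurable]
  snd_measurable_spacetime[OF periodic_smooth_continuous[OF \<psi>], measurable]
 have Dinner: "Dv t x $ i \<bullet> (a *\<^sub>R g) = a * (\<Sum>j\<in>UNIV. D i j (t, x) * g $ j)" for t x a g
  by (simp add: inner_vec_def D_def sum_distrib_left mult_ac)
 have tr: "trace (Dv t x) = divv (t, x)" for t x by (simp add: trace_def divv_def D_def)
 have "0 = (LINT (t, x)|\<S> T. \<rho> t x * v t x $ i * dt (%(t, x). \<tau> t * \<psi> x) t x
    + \<rho> t x * v t x $ i * (v t x \<bullet> grad (%(t, x). \<tau> t * \<psi> x) t x)
    + \<rho> t x powr \<gamma> * grad (%(t, x). \<tau> t * \<psi> x) t x $ i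
    - \<mu> * (Dv t x $ i \<bullet> grad (%(t, x). \<tau> t * \<psi> x) t x)
    - (\<mu> + lam) * trace (Dv t x) * grad (%(t, x). \<tau> t * \<psi> x) t x $ i)"
  by (rule momentum[unfolded momentum_eq_def, rule_format, OF test(1), symmetric])
 also have "... = (LINT z|\<S> T. \<rho> (fst z) (snd z) * V i z * (deriv \<tau> (fst z) * \<psi> (snd z))
    + \<rho> (fst z) (snd z) * V i z * (\<tau> (fst z) * (\<Sum>j\<in>UNIV. V j z * gradient \<psi> (snd z) $ j))
    + \<rho> (fst z) (snd z) powr \<gamma> * (\<tau> (fst z) * gradient \<psi> (snd z) $ i)
    - \<mu> * (\<tau> (fst z) * (\<Sum>j\<in>UNIV. D i j z * gradient \<psi> (snd z) $ j))
    - (\<mu> + lam) * divv z * (\<tau> (fst z) * gradient \<psi> (snd z) $ i))"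
  unfolding test(2,3) inner_gradient Dinner tr by (simp add: case_prod_unfold V_def)
 also have "... = (LINT z|\<S> T. deriv \<tau> (fst z) * (\<psi> (snd z) * (r z * V i z))
   + \<tau> (fst z) * (\<Sum>j\<in>UNIV. F i j z * gradient \<psi> (snd z) $ j))"
 proof (rule integral_cong_AE)
  have Fsum: "(\<Sum>j\<in>UNIV. F i j z * g $ j) = r z * V i z * (\<Sum>j\<in>UNIV. V j z * g $ j)
    + (p z - (\<mu> + lam) * divv z) * g $ i - \<mu> * (\<Sum>j\<in>UNIV. D i j z * g $ j)" for z and g :: "real^'d"
  proof -
   have "F i j z * g $ j = r z * V i z * (V j z * g $ j)
     + (if i = j then (p z - (\<mu> + lam) * divv z) * g $ j else 0) - \<mu> * (D i j z * g $ j)" for j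
    by (simp add: F_def algebra_simps)
   then show ?thesis by (simp add: sum.distrib sum_subtractf sum_distrib_left)
  qed
  show "AE z in \<S> T. \<rho> (fst z) (snd z) * V i z * (deriv \<tau> (fst z) * \<psi> (snd z))
    + \<rho> (fst z) (snd z) * V i z * (\<tau> (fst z) * (\<Sum>j\<in>UNIV. V j z * gradient \<psi> (snd z) $ j))
    + \<rho> (fst z) (snd z) powr \<gamma> * (\<tau> (fst z) * gradient \<psi> (snd z) $ i)
    - \<mu> * (\<tau> (fst z) * (\<Sum>j\<in>UNIV. D i j z * gradient \<psi> (snd z) $ j))
    - (\<mu> + lam) * divv z * (\<tau> (fst z) * gradient \<psi> (snd z) $ i)
   = deriv \<tau> (fst z) * (\<psi> (snd z) * (r z * V i z))
   + \<tau> (fst z) * (\<Sum>j\<in>UNIV. F i j z * gradient \<psi> (snd z) $ j)"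
   using r_AE by eventually_elim (simp only: Fsum p_def, simp add: algebra_simps)
 qed measurable
 finally show "(LINT (t, x)|\<S> T. deriv \<tau> t * (\<psi> x * (r (t, x) * V i (t, x)))
   + \<tau> t * (\<Sum>j\<in>UNIV. F i j (t, x) * gradient \<psi> x $ j)) = 0"
  by (simp add: case_prod_unfold)
qed

lemma p_divv_integrable: "integrable (\<S> T) (%z. p z * divv z)"
 by (rule integrable_bounded_times[OF L1_facts(6) p_measurable, of "c powr \<gamma>"]) (simp add: p_bounds)

text \<open>Renormalization with the truncated power and a test function constant in space.
  Transport drops out, and on the range of the density \<open>b' z * z - b z\<close> is
  \<open>\<gamma> - 1\<close> times the pressure, so only the pressure work remains.\<close>

lemma internal_energy_evolution:
 obtains C where "AE t in time T. (\<oint>x. p (t, x))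
  = C - (\<gamma> - 1) * (LINT s|time T. indicator {..<t} s * (\<oint>x. p (s, x) * divv (s, x)))"
proof -
 obtain b b' :: "real => real" where b:
  "!!z. (b has_real_derivative b' z) (at z)" "continuous_on UNIV b'"
  "!!z. z \<ge> c + 1 ==> b' z = 0"
  "!!z. 0 \<le> z ==> z \<le> c ==> b z = z powr \<gamma>" "!!z. 0 \<le> z ==> z \<le> c ==> b' z * z = \<gamma> * z powr \<gamma>"
  using powr_truncation[OF c_nonneg \<gamma>_gt] by metis
 have "isCont b z" for z using DERIV_isCont[OF b(1)] .
 then have [measurable]: "b \<in> \<B> borel" "b' \<in> \<B> borel"
  using b(2) by (auto intro!: borel_measurable_continuous_onI simp: continuous_on_eq_continuous_at)
 note pd = p_divv_integrable
 have neg: "- ((\<gamma> - 1) * X) = (1 - \<gamma>) * X" "a - (\<gamma> - 1) * X = a + (1 - \<gamma>) * X" for a X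
  by (simp_all add: algebra_simps)
 have U: "integrable (time T) (%t. (\<oint>x. p (t, x)))"
  and g: "integrable (time T) (%t. - (\<gamma> - 1) * (\<oint>x. p (t, x) * divv (t, x)))"
  using TX.integrable_fst'[OF L1_facts(7)] TX.integrable_fst'[OF pd] by simp_all
 obtain C where "AE t in time T. (\<oint>x. p (t, x))
   = C + (LINT s|time T. indicator {..<t} s * (- (\<gamma> - 1) * (\<oint>x. p (s, x) * divv (s, x))))"
 proof (rule du_Bois_Reymond_time[OF U g T_pos])
  fix \<tau> assume \<tau>: "time_test T \<tau>"
  note test = test_fun_product[OF \<tau> periodic_smooth_const[of 1]]
  have [measurable]: "\<tau> \<in> \<B> (time T)" "deriv \<tau> \<in> \<B> (time T)"
   using time_test_measurable[OF \<tau>] time_test_measurable[OF time_test_deriv[OF \<tau>]] by auto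
  obtain B B' where B: "!!t. \<bar>\<tau> t\<bar> \<le> B" "!!t. \<bar>deriv \<tau> t\<bar> \<le> B'"
   using time_test_bounded[OF \<tau>] time_test_bounded[OF time_test_deriv[OF \<tau>]] by metis
  have tr: "trace (Dv t x) = divv (t, x)" for t x by (simp add: trace_def divv_def D_def)
  have i1: "integrable (\<S> T) (%z. deriv \<tau> (fst z) * p z)"
   by (rule bounded_time_times_integrable_spacetime[OF _ B(2) L1_facts(7)]) simp
  have i2: "integrable (\<S> T) (%z. \<tau> (fst z) * (p z * divv z))"
   by (rule bounded_time_times_integrable_spacetime[OF _ B(1) pd]) simp
  have "0 = (LINT (t, x)|\<S> T. b (\<rho> t x) * dt (%(t, x :: real^'d). \<tau> t * 1) t x
    + b (\<rho> t x) * (v t x \<bullet> grad (%(t, x). \<tau> t * 1) t x)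
    - (b' (\<rho> t x) * \<rho> t x - b (\<rho> t x)) * trace (Dv t x) * (case (t, x) of (t, x :: real^'d) => \<tau> t * 1))"
  proof -
   have "\<forall>z\<ge>0. (b has_real_derivative b' z) (at z within {0..})"
    using has_field_derivative_at_within[OF b(1)] by blast
   moreover have "continuous_on {0..} b'" using continuous_on_subset[OF b(2)] by blast
   moreover have "\<exists>M. \<forall>z\<ge>M. b' z = 0" using b(3) by blast
   ultimately show ?thesis
    by (intro renorm[unfolded renormalized_def, rule_format, OF _ test(1), symmetric]) blast
  qed
  also have "... = (LINT z|\<S> T. b (\<rho> (fst z) (snd z)) * deriv \<tau> (fst z)
    - (b' (\<rho> (fst z) (snd z)) * \<rho> (fst z) (snd z) - b (\<rho> (fst z) (snd z))) * divv z * \<tau> (fst z))"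
   unfolding test(2,3) tr by (simp add: case_prod_unfold)
  also have "... = (LINT z|\<S> T. deriv \<tau> (fst z) * p z - (\<gamma> - 1) * (\<tau> (fst z) * (p z * divv z)))"
  proof (rule integral_cong_AE)
   show "AE z in \<S> T. b (\<rho> (fst z) (snd z)) * deriv \<tau> (fst z)
    - (b' (\<rho> (fst z) (snd z)) * \<rho> (fst z) (snd z) - b (\<rho> (fst z) (snd z))) * divv z * \<tau> (fst z)
    = deriv \<tau> (fst z) * p z - (\<gamma> - 1) * (\<tau> (fst z) * (p z * divv z))"
    using r_AE
   proof eventually_elim
    case (elim z)
    show ?case
     unfolding elim b(4)[OF r_bounds] b(5)[OF r_bounds] p_def[symmetric] by (simp add: algebra_simps)
   qed
  qed measurable
  also have "... = (LINT z|\<S> T. deriv \<tau> (fst z) * p z) - (\<gamma> - 1) * (LINT z|\<S> T. \<tau> (fst z) * (p z * divv z))"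
   using i1 i2 by simp
  also have "... = (LINT t|time T. deriv \<tau> t * (\<oint>x. p (t, x)))
    - (\<gamma> - 1) * (LINT t|time T. \<tau> t * (\<oint>x. p (t, x) * divv (t, x)))"
   unfolding TX.integral_fst'[OF i1, symmetric] TX.integral_fst'[OF i2, symmetric] by simp
  also have "... = (LINT t|time T. deriv \<tau> t * (\<oint>x. p (t, x)) + \<tau> t * (- (\<gamma> - 1) * (\<oint>x. p (t, x) * divv (t, x))))"
  proof -
   have "(LINT t|time T. \<tau> t * (- (\<gamma> - 1) * (\<oint>x. p (t, x) * divv (t, x))))
     = (LINT t|time T. - (\<gamma> - 1) * (\<tau> t * (\<oint>x. p (t, x) * divv (t, x))))"
    by (rule L_integral_cong[OF refl]) (rule mult.left_commute)
   also have "... = - (\<gamma> - 1) * (LINT t|time T. \<tau> t * (\<oint>x. p (t, x) * divv (t, x)))"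
    by (rule integral_mult_right_zero)
   finally show ?thesis
    using L_integral_add[OF time_test_integrable[OF time_test_deriv[OF \<tau>] U] time_test_integrable[OF \<tau> g]]
    by (simp add: neg)
  qed
  finally show "(LINT t|time T. deriv \<tau> t * (\<oint>x. p (t, x))
    + \<tau> t * (- (\<gamma> - 1) * (\<oint>x. p (t, x) * divv (t, x)))) = 0" by simp
 qed
 then have "AE t in time T. (\<oint>x. p (t, x))
  = C - (\<gamma> - 1) * (LINT s|time T. indicator {..<t} s * (\<oint>x. p (s, x) * divv (s, x)))"
 proof eventually_elim
  case (elim t)
  have "(LINT s|time T. indicator {..<t} s * (- (\<gamma> - 1) * (\<oint>x. p (s, x) * divv (s, x))))
    = (LINT s|time T. - (\<gamma> - 1) * (indicator {..<t} s * (\<oint>x. p (s, x) * divv (s, x))))"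
   by (rule L_integral_cong[OF refl]) (rule mult.left_commute)
  also have "... = - (\<gamma> - 1) * (LINT s|time T. indicator {..<t} s * (\<oint>x. p (s, x) * divv (s, x)))"
   by (rule integral_mult_right_zero)
  finally show ?case using elim by (simp add: neg)
 qed
 then show thesis by (rule that)
qed

end

lemma Lp_conv_mult_4: "Lp_conv 4 M f g ==> Lp_conv 4 M h k ==> Lp_conv 2 M (%n x. f n x * h n x) (%x. g x * k x)"
 using Lp_conv_mult[of 2 M f g h k] by simp

lemma Lp_conv_mult_2: "Lp_conv 2 M f g ==> Lp_conv 2 M h k ==> Lp_conv 1 M (%n x. f n x * h n x) (%x. g x * k x)"
 using Lp_conv_mult[of 1 M f g h k] by (simp only: mult_1_right)

lemma Lp_convD:
 assumes "Lp_conv p M f g"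
 shows "f n \<in> \<B> M" "integrable M (%x. \<bar>f n x\<bar> ^ p)"
  "g \<in> \<B> M" "integrable M (%x. \<bar>g x\<bar> ^ p)"
  "(%n. (LINT x|M. \<bar>f n x - g x\<bar> ^ p)) \<leadsto> 0"
 using assms by (auto simp: Lp_conv_def)

lemma Lp_conv_1_integrable: "Lp_conv 1 M f g ==> integrable M (f n)" "Lp_conv 1 M f g ==> integrable M g"
proof -
 assume a: "Lp_conv 1 M f g"
 have "integrable M (%x. \<bar>f n x\<bar>)" "integrable M (%x. \<bar>g x\<bar>)"
  using Lp_convD(2)[OF a, of n] Lp_convD(4)[OF a] by simp_all
 then show "integrable M (f n)" "integrable M g"
  using Lp_convD(1)[OF a, of n] Lp_convD(3)[OF a] by (simp_all add: integrable_abs_iff)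
qed

lemma bounded_in_Lp_torus:
 fixes g :: "real^'d::finite => 'b::real_normed_vector"
 assumes [measurable]: "g \<in> \<B> torus" and g: "!!x. norm (g x) \<le> B" and "p \<ge> 0"
 shows "g \<in> Lp torus p"
proof -
 have "integrable torus (%x. norm (g x) powr p)"
  by (rule torus.integrable_const_bound[of _ "B powr p"])
   (use g \<open>p \<ge> 0\<close> in \<open>auto intro!: AE_I2 powr_mono2\<close>)
 then show ?thesis by (simp add: Lp_def)
qed

lemma integrable_time_shift:
 fixes f :: "real => real"
 assumes f: "integrable (time T) f" and h: "0 \<le> h" "h \<le> T"
 shows "integrable (time T) (%t. indicator {..<T - h} t * f (t + h))"
  and "(LINT t|time T. indicator {..<T - h} t * f (t + h)) = (LINT t|time T. indicator {h<..} t * f t)"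
proof -
 define g where "g t = indicator {0<..<T} t * (indicator {h<..} t * f t)" for t
 have i: "integrable (time T) (%t. indicator {h<..} t * f t)"
  using integrable_mult_indicator[of "{h<..} \<inter> {0<..<T}" "time T" f] f
  by (subst L_integrable_cong[OF refl, where g = "%t. indicator ({h<..} \<inter> {0<..<T}) t *\<^sub>R f t"])
   (auto simp: sets_time indicator_def)
 then have g: "integrable lborel g"
  unfolding time_def g_def by (subst (asm) integrable_restrict_space) auto
 have eq: "g (h + 1 * t) = indicator {0<..<T} t * (indicator {..<T - h} t * f (t + h))" for t
  using h by (auto simp: g_def indicator_def add.commute)
 have "integrable lborel (%t. g (h + 1 * t))"
  by (rule lborel_integrable_real_affine[OF g]) simp
 then show "integrable (time T) (%t. indicator {..<T - h} t * f (t + h))"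
  unfolding eq time_def by (subst integrable_restrict_space) auto
 have "(LINT t|time T. indicator {h<..} t * f t) = (LINT t|lborel. g t)"
  unfolding time_def g_def by (subst integral_restrict_space) auto
 also have "... = (LINT t|lborel. g (h + 1 * t))"
  using lborel_integral_real_affine[of 1 g h] by simp
 also have "... = (LINT t|time T. indicator {..<T - h} t * f (t + h))"
  unfolding eq time_def by (subst integral_restrict_space) auto
 finally show "(LINT t|time T. indicator {..<T - h} t * f (t + h)) = (LINT t|time T. indicator {h<..} t * f t)" by simp
qed

lemma AE_time_shift:
 assumes "AE t in time T. P t" "0 \<le> h"
 shows "AE t in time T. t + h < T --> P (t + h)"
proof -
 have "AE t in lborel. t \<in> {0<..<T} --> P t"
  using assms(1) unfolding time_def by (subst (asm) AE_restrict_space_iff) auto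
 then have "AE t in distr lborel borel ((+) h). t \<in> {0<..<T} --> P t"
  by (subst lborel_distr_plus)
 then have "AE t in lborel. h + t \<in> {0<..<T} --> P (h + t)"
  by (rule AE_distrD[rotated]) simp
 then have "AE t in lborel. t \<in> {0<..<T} --> t + h < T --> P (t + h)"
  by eventually_elim (use assms(2) in \<open>auto simp: add.commute\<close>)
 then show ?thesis unfolding time_def by (subst AE_restrict_space_iff) auto
qed

context fluid
begin

lemma V_L2: "integrable (\<S> T) (%z. \<bar>V i z\<bar> ^ 2)"
proof -
 have "integrable (\<S> T) (%z. (V i z)\<^sup>2)"
 proof (rule spacetime.integrable_of_power[where p = 2])
  have "\<bar>(V i z)\<^sup>2\<bar> ^ 2 = \<bar>V i z\<bar> ^ 4" for z by simp
  then show "integrable (\<S> T) (%z. \<bar>(V i z)\<^sup>2\<bar> ^ 2)" using V_L4[of i] by presburger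
 qed simp_all
 then show ?thesis by simp
qed

definition kin :: "real => real"
 where "kin t = (\<oint>x. r (t, x) / 2 * (\<Sum>i\<in>UNIV. (V i (t, x))\<^sup>2))"

lemma kin_integrand: "integrable (\<S> T) (%z. r z / 2 * (\<Sum>i\<in>UNIV. (V i z)\<^sup>2))"
proof (rule L_integrable_bound)
 show "integrable (\<S> T) (%z. c / 2 * (\<Sum>i\<in>UNIV. (V i z)\<^sup>2))"
  using V_L2 by simp
 show "AE z in \<S> T. norm (r z / 2 * (\<Sum>i\<in>UNIV. (V i z)\<^sup>2)) \<le> norm (c / 2 * (\<Sum>i\<in>UNIV. (V i z)\<^sup>2))"
 proof (rule AE_I2)
  fix z
  have "0 \<le> (\<Sum>i\<in>UNIV. (V i z)\<^sup>2)" by (intro sum_nonneg) simp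
  then show "norm (r z / 2 * (\<Sum>i\<in>UNIV. (V i z)\<^sup>2)) \<le> norm (c / 2 * (\<Sum>i\<in>UNIV. (V i z)\<^sup>2))"
   using r_bounds[of z] by (simp add: mult_right_mono)
 qed
qed measurable

lemma kin_integrable: "integrable (time T) kin"
 unfolding kin_def[abs_def] using TX.integrable_fst'[OF kin_integrand] .

definition U :: "nat => 'd => real \<times> (real^'d) => real"
 where "U n i = (%(t, x). kernel_op torus (mollifier n) (%y. V i (t, y)) x)"

definition DU :: "nat => 'd => 'd => real \<times> (real^'d) => real"
 where "DU n i j = (%(t, x). kernel_op torus (mollifier n) (%y. D i j (t, y)) x)"

definition fwd :: "real => (real \<times> (real^'d) => real) => real \<times> (real^'d) => real"
 where "fwd h f = (%(t, x). kernel_op (time T) (forward_kernel h) (%s. f (s, x)) t)"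

lemma U_conv: "Lp_conv 4 (\<S> T) (%n. U n i) (V i)" "Lp_conv 2 (\<S> T) (%n. U n i) (V i)"
 unfolding U_def by (rule Lp_conv_mollify; use V_L4 V_L2 in simp)+

lemma DU_conv: "Lp_conv 2 (\<S> T) (%n. DU n i j) (D i j)"
 unfolding DU_def by (rule Lp_conv_mollify) (use D_L2 in simp_all)

lemma fwd_conv:
 assumes "!!n::nat. h n > 0" "h \<leadsto> 0" "f \<in> \<B> (\<S> T)" "0 < q"
  "integrable (\<S> T) (%z. \<bar>f z\<bar> ^ q)"
 shows "Lp_conv q (\<S> T) (%n. fwd (h n) f) f"
 unfolding fwd_def by (rule Lp_conv_forward[OF assms])

text \<open>At fixed \<open>h\<close> only membership in L^q is at stake; it is read off the first
  term of the convergent sequence with steps \<open>h / (n + 1)\<close>.\<close>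

lemma fwd_const_conv:
 assumes "h > 0" "f \<in> \<B> (\<S> T)" "0 < q" "integrable (\<S> T) (%z. \<bar>f z\<bar> ^ q)"
 shows "Lp_conv q (\<S> T) (%n. fwd h f) (fwd h f)"
proof -
 have lim: "(%n. h / (real n + 1)) \<leadsto> 0" by real_asymp
 have "Lp_conv q (\<S> T) (%n. fwd (h / (real n + 1)) f) f"
  by (rule fwd_conv[OF _ lim assms(2-)]) (use assms(1) in simp)
 from Lp_convD(1,2)[OF this, of 0] show ?thesis
  by (intro Lp_conv_const \<open>0 < q\<close>) simp_all
qed

end

section \<open>Weakly continuous representatives\<close>

locale fluid_rep = fluid T \<gamma> \<mu> lam c \<rho> v Dv
 for T \<gamma> \<mu> lam c :: real and \<rho> :: "real => real^'d::finite => real"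
  and v :: "real => real^'d => real^'d" and Dv :: "real => real^'d => real^'d^'d" +
 fixes \<rho>c :: "real => real^'d => real" and mc :: "real => real^'d => real^'d"
 assumes rep: "density_momentum_rep T \<gamma> \<rho> v \<rho>c mc"
begin

lemma rep_AE: "AE t in time T. AE x in torus. \<rho>c t x = r (t, x)"
 "AE t in time T. AE x in torus. \<forall>i. mc t x $ i = r (t, x) * V i (t, x)"
proof -
 have 1: "AE t in time T. AE x in torus. \<rho> t x = r (t, x)"
  using TX.AE_pair[OF r_AE] by simp
 have 2: "AE t in time T. AE x in torus. \<rho>c t x = \<rho> t x"
  "AE t in time T. AE x in torus. mc t x = \<rho> t x *\<^sub>R v t x"
  using rep by (auto simp: density_momentum_rep_def weak_rep_def)
 show "AE t in time T. AE x in torus. \<rho>c t x = r (t, x)"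
  using 1 2(1) by eventually_elim (use eventually_elim2 in fastforce)
 show "AE t in time T. AE x in torus. \<forall>i. mc t x $ i = r (t, x) * V i (t, x)"
  using 1 2(2)
 proof eventually_elim
  case (elim t)
  from elim show ?case by eventually_elim (simp add: V_def)
 qed
qed

lemma exponent: "2 * \<gamma> / (\<gamma> + 1) > 1"
 using \<gamma>_gt by (simp add: field_simps)

lemma \<rho>c_measurable: "t \<in> {0..T} ==> \<rho>c t \<in> \<B> torus"
 and \<rho>c_integrable: "t \<in> {0..T} ==> integrable torus (\<rho>c t)"
proof -
 assume t: "t \<in> {0..T}"
 then have L: "\<rho>c t \<in> Lp torus \<gamma>"
  using rep by (auto simp: density_momentum_rep_def weak_rep_def weakly_continuous_def)
 then show m: "\<rho>c t \<in> \<B> torus" by (simp add: Lp_def)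
 show "integrable torus (\<rho>c t)"
  by (rule torus.integrable_of_powr[OF m, of \<gamma>]) (use L \<gamma>_gt in \<open>auto simp: Lp_def\<close>)
qed

lemma mc_measurable: "t \<in> {0..T} ==> mc t \<in> \<B> torus"
 and mc_integrable: "t \<in> {0..T} ==> integrable torus (mc t)"
proof -
 assume t: "t \<in> {0..T}"
 then have L: "mc t \<in> Lp torus (2 * \<gamma> / (\<gamma> + 1))"
  using rep by (auto simp: density_momentum_rep_def weak_rep_def weakly_continuous_def)
 then show m: "mc t \<in> \<B> torus" by (simp add: Lp_def)
 have "integrable torus (%x. norm (mc t x))"
  by (rule torus.integrable_of_powr[of _ "2 * \<gamma> / (\<gamma> + 1)"])
   (use L exponent in \<open>auto simp: Lp_def\<close>)
 then show "integrable torus (mc t)" using m by (simp add: integrable_norm_iff)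
qed

lemma mc_nth_measurable: "t \<in> {0..T} ==> (%x. mc t x $ i) \<in> \<B> torus"
 by (rule measurable_compose[OF mc_measurable borel_measurable_nth])

lemma mc_nth_integrable: "t \<in> {0..T} ==> integrable torus (%x. mc t x $ i)"
 using integrable_bounded_linear[OF bounded_linear_vec_nth mc_integrable] .

lemma \<rho>c_continuous:
 assumes "g \<in> \<B> torus" "!!x. \<bar>g x\<bar> \<le> B"
 shows "continuous_on {0..T} (%t. (\<oint>x. \<rho>c t x * g x))"
proof -
 have "g \<in> Lp torus (\<gamma> / (\<gamma> - 1))"
  by (rule bounded_in_Lp_torus[of _ B]) (use assms \<gamma>_gt in auto)
 then show ?thesis
  using rep by (auto simp: density_momentum_rep_def weak_rep_def weakly_continuous_def)
qed

lemma mc_continuous: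
 assumes g: "g \<in> \<B> torus" "!!x. \<bar>g x\<bar> \<le> B"
 shows "continuous_on {0..T} (%t. (\<oint>x. mc t x $ i * g x))"
proof -
 let ?p = "2 * \<gamma> / (\<gamma> + 1)"
 have "(%x. g x *\<^sub>R axis i (1::real)) \<in> Lp torus (?p / (?p - 1))"
 proof (rule bounded_in_Lp_torus[of _ B])
  have "0 \<le> q / (q - 1)" if "1 < q" for q :: real using that by simp
  from this[OF exponent] show "0 \<le> ?p / (?p - 1)" .
 qed (use g in auto)
 then have "continuous_on {0..T} (%t. (\<oint>x. mc t x \<bullet> (g x *\<^sub>R axis i 1)))"
  using rep by (auto simp: density_momentum_rep_def weak_rep_def weakly_continuous_def)
 then show ?thesis by (simp add: inner_axis mult.commute)
qed

text \<open>Weak continuity is applied to globally bounded functions, whereas a continuous function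
  on the whole space need not be bounded. Clipping changes it only outside the cell.\<close>

lemma torus_continuous_bounded_version:
 fixes \<psi> :: "real^'d => real"
 assumes "continuous_on UNIV \<psi>"
 obtains g B where "g \<in> \<B> torus" "!!x. \<bar>g x\<bar> \<le> B" "!!x. x \<in> cbox 0 1 ==> g x = \<psi> x"
proof -
 obtain B where B: "0 \<le> B" "!!x. x \<in> cbox 0 1 ==> \<bar>\<psi> x\<bar> \<le> B" using continuous_bounded_on_cell[OF assms] by metis
 show thesis
 proof
  show "(%x. max (- B) (min B (\<psi> x))) \<in> \<B> torus"
   using borel_measurable_torusI[OF borel_measurable_continuous_onI[OF assms]] by measurable
  show "\<bar>max (- B) (min B (\<psi> x))\<bar> \<le> B" for x using B(1) by (auto simp: abs_le_iff)
  show "max (- B) (min B (\<psi> x)) = \<psi> x" if "x \<in> cbox 0 1" for x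
   using B(2)[OF that] by (auto simp: abs_le_iff max_def min_def)
 qed
qed

lemma \<rho>c_continuous_test:
 assumes "continuous_on UNIV \<psi>"
 shows "continuous_on {0..T} (%t. (\<oint>x. \<rho>c t x * \<psi> x))"
proof -
 obtain g B where g: "g \<in> \<B> torus" "!!x. \<bar>g x\<bar> \<le> B" "!!x. x \<in> cbox 0 1 ==> g x = \<psi> x"
  using torus_continuous_bounded_version[OF assms] by metis
 have "(\<oint>x. \<rho>c t x * g x) = (\<oint>x. \<rho>c t x * \<psi> x)" for t
  by (rule L_integral_cong) (simp_all add: g(3))
 then show ?thesis using \<rho>c_continuous[OF g(1,2)] by simp
qed

lemma mc_continuous_test:
 assumes "continuous_on UNIV \<psi>"
 shows "continuous_on {0..T} (%t. (\<oint>x. mc t x $ i * \<psi> x))"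
proof -
 obtain g B where g: "g \<in> \<B> torus" "!!x. \<bar>g x\<bar> \<le> B" "!!x. x \<in> cbox 0 1 ==> g x = \<psi> x"
  using torus_continuous_bounded_version[OF assms] by metis
 have "(\<oint>x. mc t x $ i * g x) = (\<oint>x. mc t x $ i * \<psi> x)" for t
  by (rule L_integral_cong) (simp_all add: g(3))
 then show ?thesis using mc_continuous[OF g(1,2), of i] by simp
qed

text \<open>Tested against \<open>0 \<le> g \<le> 1\<close>, the bounds hold for almost every time,
  hence by weak continuity at every time, including the end points.\<close>

lemma \<rho>c_bounds:
 assumes t: "t \<in> {0..T}"
 shows "AE x in torus. 0 \<le> \<rho>c t x \<and> \<rho>c t x \<le> c"
proof -
 note [measurable] = \<rho>c_measurable[OF t]
 have pos: "0 \<le> (\<oint>x. \<rho>c t x * g x)" and le: "(\<oint>x. \<rho>c t x * g x) \<le> c * (\<oint>x. g x)"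
  if g [measurable]: "g \<in> \<B> torus" and g01: "!!x. 0 \<le> g x" "!!x. g x \<le> 1" for g
 proof -
  have gi: "integrable torus g" by (rule torus.integrable_const_bound[of _ 1]) (use g01 in auto)
  have cont: "continuous_on {0..T} (%t. (\<oint>x. \<rho>c t x * g x))"
   by (rule \<rho>c_continuous[of _ 1]) (use g01 in auto)
  have eq: "AE s in time T. 0 \<le> (\<oint>x. \<rho>c s x * g x) \<and> (\<oint>x. \<rho>c s x * g x) \<le> c * (\<oint>x. g x)"
   using rep_AE(1) AE_space
  proof eventually_elim
   case (elim s)
   then have [measurable]: "\<rho>c s \<in> \<B> torus" by (intro \<rho>c_measurable) auto
   have [measurable]: "(%x. r (s, x)) \<in> \<B> torus" using elim(2) by measurable
   have "(\<oint>x. \<rho>c s x * g x) = (\<oint>x. r (s, x) * g x)"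
    using elim(1) by (intro integral_cong_AE) auto
   moreover have "(\<oint>x. r (s, x) * g x) \<le> (\<oint>x. c * g x)"
    using g01 r_bounds gi by (intro integral_mono') (auto intro: mult_right_mono simp: c_nonneg)
   moreover have "0 \<le> (\<oint>x. r (s, x) * g x)" using g01 r_bounds by simp
   ultimately show ?case by simp
  qed
  show "0 \<le> (\<oint>x. \<rho>c t x * g x)"
   by (rule continuous_AE_time_nonneg[OF T_pos cont _ t]) (use eq in eventually_elim, simp)
  have "0 \<le> c * (\<oint>x. g x) - (\<oint>x. \<rho>c t x * g x)"
   by (rule continuous_AE_time_nonneg[OF T_pos _ _ t, where f = "%t. c * (\<oint>x. g x) - (\<oint>x. \<rho>c t x * g x)"])
    (auto intro!: continuous_intros cont, use eq in eventually_elim, simp)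
  then show "(\<oint>x. \<rho>c t x * g x) \<le> c * (\<oint>x. g x)" by simp
 qed
 have i: "integrable torus (%x. \<rho>c t x * g x)" if [measurable]: "g \<in> \<B> torus" and "!!x. 0 \<le> g x" "!!x. g x \<le> 1" for g
  by (rule L_integrable_bound[OF \<rho>c_integrable[OF t]])
   (use that in \<open>auto simp: abs_mult intro!: AE_I2 mult_left_le\<close>)
 \<comment> \<open>The tests are the indicators of the sets where a bound fails; the resulting
   integrals of functions of one sign vanish.\<close>
 let ?n = "%x. if \<rho>c t x < 0 then 1 else 0 :: real" and ?u = "%x. if \<rho>c t x > c then 1 else 0 :: real"
 have m: "?n \<in> \<B> torus" "?u \<in> \<B> torus" by measurable
 have ui: "integrable torus ?u" by (rule torus.integrable_const_bound[of _ 1]) (use m in auto)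
 have "AE x in torus. - (\<rho>c t x * ?n x) = 0"
 proof (subst integral_nonneg_eq_0_iff_AE[symmetric])
  show "integrable torus (%x. - (\<rho>c t x * ?n x))" using i[OF m(1)] by simp
  have "(\<oint>x. - (\<rho>c t x * ?n x)) \<ge> 0" by (rule L_integral_nonneg) auto
  then show "(\<oint>x. - (\<rho>c t x * ?n x)) = 0" using pos[OF m(1)] by simp
 qed auto
 moreover have "AE x in torus. \<rho>c t x * ?u x - c * ?u x = 0"
 proof (subst integral_nonneg_eq_0_iff_AE[symmetric])
  show "integrable torus (%x. \<rho>c t x * ?u x - c * ?u x)" using i[OF m(2)] ui by simp
  have "(\<oint>x. \<rho>c t x * ?u x - c * ?u x) \<ge> 0" by (rule L_integral_nonneg) auto
  then show "(\<oint>x. \<rho>c t x * ?u x - c * ?u x) = 0" using le[OF m(2)] i[OF m(2)] ui by simp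
 qed auto
 ultimately show ?thesis by eventually_elim (auto split: if_splits)
qed

section \<open>The linear probe of the kinetic energy\<close>

definition KE :: "real => real"
 where "KE t = (\<oint>x. (if \<rho>c t x > 0 then (norm (mc t x))\<^sup>2 / (2 * \<rho>c t x) else 0))"

text \<open>By Young's inequality \<open>|m|^2 / (2 \<rho>)\<close> is the supremum of
  \<open>m u - \<rho> |u|^2 / 2\<close> over \<open>u\<close>, attained at the velocity. For fixed
  \<open>u\<close> the expression is linear in density and momentum, hence weakly continuous in time
  and accessible to the balance laws, unlike the kinetic energy itself.\<close>

definition probe :: "real => ('d => real^'d => real) => real"
 where "probe t u = (\<Sum>i\<in>UNIV. (\<oint>x. mc t x $ i * u i x)) - 1 / 2 * (\<oint>x. \<rho>c t x * (\<Sum>i\<in>UNIV. u i x * u i x))"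

lemma probe_eq_integral:
 assumes t: "t \<in> {0..T}" and u: "!!i. continuous_on UNIV (u i)"
 shows "integrable torus (%x. (\<Sum>i\<in>UNIV. mc t x $ i * u i x) - 1 / 2 * (\<rho>c t x * (\<Sum>i\<in>UNIV. u i x * u i x)))"
  and "probe t u = (\<oint>x. (\<Sum>i\<in>UNIV. mc t x $ i * u i x) - 1 / 2 * (\<rho>c t x * (\<Sum>i\<in>UNIV. u i x * u i x)))"
proof -
 have i1: "integrable torus (%x. mc t x $ i * u i x)" for i
  using continuous_times_integrable_torus[OF u[of i] mc_nth_integrable[OF t, of i]] by (simp add: mult.commute)
 have "continuous_on UNIV (%x. \<Sum>i\<in>UNIV. u i x * u i x)" by (intro continuous_intros u)
 from continuous_times_integrable_torus[OF this \<rho>c_integrable[OF t]]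
 have i2: "integrable torus (%x. \<rho>c t x * (\<Sum>i\<in>UNIV. u i x * u i x))" by (simp add: mult.commute)
 show "integrable torus (%x. (\<Sum>i\<in>UNIV. mc t x $ i * u i x) - 1 / 2 * (\<rho>c t x * (\<Sum>i\<in>UNIV. u i x * u i x)))"
  using i1 i2 by simp
 show "probe t u = (\<oint>x. (\<Sum>i\<in>UNIV. mc t x $ i * u i x) - 1 / 2 * (\<rho>c t x * (\<Sum>i\<in>UNIV. u i x * u i x)))"
  unfolding probe_def using i1 i2 by (simp add: L_integral_sum)
qed

lemma sum_Young:
 fixes m w :: "'d => real"
 assumes "a > 0"
 shows "(\<Sum>i\<in>UNIV. m i * w i) - 1 / 2 * (a * (\<Sum>i\<in>UNIV. w i * w i)) \<le> (\<Sum>i\<in>UNIV. (m i)\<^sup>2) / (2 * a)"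
proof -
 have "m i * w i - 1 / 2 * (a * (w i * w i)) \<le> (m i)\<^sup>2 / (2 * a)" for i
 proof -
  have "0 \<le> (m i - a * w i)\<^sup>2 / (2 * a)" using assms by simp
  also have "... = (m i)\<^sup>2 / (2 * a) - (m i * w i - 1 / 2 * (a * (w i * w i)))"
   using assms by (simp add: field_simps power2_eq_square)
  finally show ?thesis by simp
 qed
 then have "(\<Sum>i\<in>UNIV. m i * w i - 1 / 2 * (a * (w i * w i))) \<le> (\<Sum>i\<in>UNIV. (m i)\<^sup>2 / (2 * a))"
  by (rule sum_mono)
 then show ?thesis by (simp add: sum_subtractf sum_distrib_left sum_divide_distrib)
qed

lemma norm_square_sum: "(norm (a :: real^'d))\<^sup>2 = (\<Sum>i\<in>UNIV. (a $ i)\<^sup>2)"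
 unfolding power2_norm_eq_inner inner_vec_def by (simp add: power2_eq_square)

text \<open>Young's inequality where the density is positive. On the vacuum the kinetic energy
  counts nothing, so the momentum has to vanish there.\<close>

lemma probe_le_KE:
 assumes t: "t \<in> {0..T}" and u: "!!i. continuous_on UNIV (u i)"
  and vac: "AE x in torus. \<rho>c t x = 0 --> mc t x = 0"
  and KE: "integrable torus (%x. if \<rho>c t x > 0 then (norm (mc t x))\<^sup>2 / (2 * \<rho>c t x) else 0)"
 shows "probe t u \<le> KE t"
 unfolding probe_eq_integral(2)[OF t u] KE_def
proof (rule integral_mono_AE[OF probe_eq_integral(1)[OF t u] KE])
 show "AE x in torus. (\<Sum>i\<in>UNIV. mc t x $ i * u i x) - 1 / 2 * (\<rho>c t x * (\<Sum>i\<in>UNIV. u i x * u i x))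
   \<le> (if \<rho>c t x > 0 then (norm (mc t x))\<^sup>2 / (2 * \<rho>c t x) else 0)"
  using vac \<rho>c_bounds[OF t]
 proof eventually_elim
  case (elim x)
  show ?case
  proof (cases "\<rho>c t x > 0")
   case True
   then show ?thesis using sum_Young[OF True, of "%i. mc t x $ i" "%i. u i x"] by (simp add: norm_square_sum)
  next
   case False
   then have "\<rho>c t x = 0" using elim by linarith
   then show ?thesis using elim by simp
  qed
 qed
qed

text \<open>Completing the square, which is possible at times when the momentum is density times
  velocity.\<close>

lemma probe_kin:
 assumes t: "t \<in> {0<..<T}" and u: "!!i. continuous_on UNIV (u i)"
  and \<rho>: "AE x in torus. \<rho>c t x = r (t, x)" and m: "AE x in torus. \<forall>i. mc t x $ i = r (t, x) * V i (t, x)"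
  and k: "integrable torus (%x. r (t, x) / 2 * (\<Sum>i\<in>UNIV. (V i (t, x))\<^sup>2))"
 shows "integrable torus (%x. r (t, x) * (\<Sum>i\<in>UNIV. (V i (t, x) - u i x)\<^sup>2))"
  and "probe t u = kin t - 1 / 2 * (\<oint>x. r (t, x) * (\<Sum>i\<in>UNIV. (V i (t, x) - u i x)\<^sup>2))"
proof -
 have t': "t \<in> {0..T}" using t by auto
 let ?q = "%x. (\<Sum>i\<in>UNIV. mc t x $ i * u i x) - 1 / 2 * (\<rho>c t x * (\<Sum>i\<in>UNIV. u i x * u i x))"
 let ?k = "%x. r (t, x) / 2 * (\<Sum>i\<in>UNIV. (V i (t, x))\<^sup>2)"
 let ?e = "%x. r (t, x) * (\<Sum>i\<in>UNIV. (V i (t, x) - u i x)\<^sup>2)"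
 have ts: "t \<in> space (time T)" using t by simp
 have [measurable]: "(%x. r (t, x)) \<in> \<B> torus" "!!i. (%x. V i (t, x)) \<in> \<B> torus"
  using measurable_compose[OF measurable_Pair1'[OF ts] r_measurable]
   measurable_compose[OF measurable_Pair1'[OF ts] V_measurable] by simp_all
 have [measurable]: "!!i. u i \<in> \<B> torus"
  by (intro borel_measurable_torusI borel_measurable_continuous_onI u)
 note q = probe_eq_integral[of _ u, OF t' u]
 have em [measurable]: "?e \<in> \<B> torus" by measurable
 have eq: "AE x in torus. 2 * (?k x - ?q x) = ?e x"
  using \<rho> m
 proof eventually_elim
  case (elim x)
  have "(\<Sum>i\<in>UNIV. (V i (t, x) - u i x)\<^sup>2) = (\<Sum>i\<in>UNIV. (V i (t, x))\<^sup>2 - 2 * (V i (t, x) * u i x) + u i x * u i x)"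
   by (rule sum.cong) (simp_all add: power2_eq_square algebra_simps)
  then show ?case using elim
   by (simp add: sum.distrib sum_subtractf sum_distrib_left[symmetric] mult.assoc) (simp add: algebra_simps)
 qed
 have i: "integrable torus (%x. 2 * (?k x - ?q x))" by (intro integrable_mult_right L_integrable_diff k q(1))
 show ei: "integrable torus ?e"
  by (rule integrable_cong_AE_imp[OF i em]) (use eq in eventually_elim, simp)
 have "(\<oint>x. ?e x) = (\<oint>x. 2 * (?k x - ?q x))"
  using i ei eq by (intro integral_cong_AE) auto
 also have "... = 2 * (kin t - probe t u)"
  by (simp only: integral_mult_right_zero L_integral_diff[OF k q(1)] kin_def q(2))
 finally show "probe t u = kin t - 1 / 2 * (\<oint>x. ?e x)" by (simp add: diff_divide_distrib)
qed

text \<open>The fields \<open>u\<close> do not depend on time, so the momentum balance tested with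
  \<open>u i\<close> and the mass balance tested with \<open>|u|^2\<close> give the increment
  exactly. The factor 2 from differentiating the square meets the weight 1/2.\<close>

lemma probe_increment:
 assumes t: "t \<in> {0<..<T}" and h: "h > 0" and u: "!!i. periodic_smooth (u i)"
 shows "probe (min (t + h) T) u - probe t u = h * ((\<Sum>i\<in>UNIV. \<Sum>j\<in>UNIV. (\<oint>x. fwd h (F i j) (t, x) * gradient (u i) x $ j))
  - (\<Sum>i\<in>UNIV. \<Sum>j\<in>UNIV. (\<oint>x. fwd h (%z. r z * V j z) (t, x) * (u i x * gradient (u i) x $ j))))"
proof -
 let ?t' = "min (t + h) T" and ?\<psi> = "%x. \<Sum>i\<in>UNIV. u i x * u i x"
 have \<psi>: "periodic_smooth ?\<psi>" by (intro periodic_smooth_sum periodic_smooth_mult u)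
 have mom: "(\<oint>x. mc ?t' x $ i * u i x) - (\<oint>x. mc t x $ i * u i x)
   = h * (\<Sum>j\<in>UNIV. (\<oint>x. fwd h (F i j) (t, x) * gradient (u i) x $ j))" for i
  unfolding fwd_def case_prod_conv
 proof (rule balance_forward[where u = "%z. r z * V i z" and uc = "%t x. mc t x $ i", OF T_pos L1_facts(2) L1_facts(4) balance_momentum u _ _ _ t h])
  show "AE t in time T. AE x in torus. mc t x $ i = r (t, x) * V i (t, x)"
   using rep_AE(2)
  proof eventually_elim
   case (elim t) from elim show ?case by eventually_elim simp
  qed
 qed (auto intro: mc_nth_measurable mc_continuous_test periodic_smooth_continuous u)
 have dens: "(\<oint>x. \<rho>c ?t' x * ?\<psi> x) - (\<oint>x. \<rho>c t x * ?\<psi> x)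
   = h * (\<Sum>j\<in>UNIV. (\<oint>x. fwd h (%z. r z * V j z) (t, x) * gradient ?\<psi> x $ j))"
  unfolding fwd_def case_prod_conv
  by (rule balance_forward[where u = r and uc = \<rho>c, OF T_pos L1_facts(1) L1_facts(2) balance_mass \<psi> rep_AE(1) _ _ t h])
   (auto intro: \<rho>c_measurable \<rho>c_continuous_test[OF periodic_smooth_continuous[OF \<psi>]])
 have grad: "gradient ?\<psi> x $ j = (\<Sum>i\<in>UNIV. 2 * (u i x * gradient (u i) x $ j))" for x j
  by (subst gradient_sum)
   (auto intro!: smooth_mult periodic_smooth_smooth[OF u] sum.cong
    simp: gradient_mult[OF periodic_smooth_smooth[OF u] periodic_smooth_smooth[OF u]])
 have int: "integrable torus (%x. fwd h (%z. r z * V j z) (t, x) * (u i x * gradient (u i) x $ j))" for i j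
 proof -
  have "continuous_on UNIV (%x. u i x * gradient (u i) x $ j)"
   by (intro continuous_intros periodic_smooth_continuous[OF u] smooth_gradient_continuous[OF u])
  from continuous_times_integrable_torus[OF this forward_kernel_section_integrable(2)[OF h L1_facts(2)]]
  show ?thesis by (simp add: fwd_def mult.commute)
 qed
 have "(\<Sum>j\<in>UNIV. (\<oint>x. fwd h (%z. r z * V j z) (t, x) * gradient ?\<psi> x $ j))
   = (\<Sum>j\<in>UNIV. (\<oint>x. (\<Sum>i\<in>UNIV. 2 * (fwd h (%z. r z * V j z) (t, x) * (u i x * gradient (u i) x $ j)))))"
  unfolding grad by (simp add: sum_distrib_left mult.left_commute)
 also have "... = (\<Sum>j\<in>UNIV. \<Sum>i\<in>UNIV. 2 * (\<oint>x. fwd h (%z. r z * V j z) (t, x) * (u i x * gradient (u i) x $ j)))"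
  using int by (simp add: L_integral_sum)
 also have "... = 2 * (\<Sum>i\<in>UNIV. \<Sum>j\<in>UNIV. (\<oint>x. fwd h (%z. r z * V j z) (t, x) * (u i x * gradient (u i) x $ j)))"
  by (subst sum.swap) (simp add: sum_distrib_left)
 finally have dens': "(\<oint>x. \<rho>c ?t' x * ?\<psi> x) - (\<oint>x. \<rho>c t x * ?\<psi> x)
   = 2 * h * (\<Sum>i\<in>UNIV. \<Sum>j\<in>UNIV. (\<oint>x. fwd h (%z. r z * V j z) (t, x) * (u i x * gradient (u i) x $ j)))"
  using dens by simp
 have "probe ?t' u - probe t u = (\<Sum>i\<in>UNIV. (\<oint>x. mc ?t' x $ i * u i x) - (\<oint>x. mc t x $ i * u i x))
   - 1 / 2 * ((\<oint>x. \<rho>c ?t' x * ?\<psi> x) - (\<oint>x. \<rho>c t x * ?\<psi> x))"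
  unfolding probe_def by (simp add: sum_subtractf diff_divide_distrib)
 also have "... = h * (\<Sum>i\<in>UNIV. \<Sum>j\<in>UNIV. (\<oint>x. fwd h (F i j) (t, x) * gradient (u i) x $ j))
   - h * (\<Sum>i\<in>UNIV. \<Sum>j\<in>UNIV. (\<oint>x. fwd h (%z. r z * V j z) (t, x) * (u i x * gradient (u i) x $ j)))"
  unfolding mom dens' by (simp add: sum_distrib_left)
 finally show ?thesis by (simp add: right_diff_distrib)
qed

end

section \<open>The flux and its two limits\<close>

lemma Lp_conv_diff:
 assumes "Lp_conv p M f g" "Lp_conv p M h k"
 shows "Lp_conv p M (%n x. f n x - h n x) (%x. g x - k x)"
 using Lp_conv_add[OF assms(1) Lp_conv_cmult[OF assms(2), of "-1"]] by simp

context fluid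
begin

definition flux_approx :: "real => nat => real \<times> (real^'d) => real"
 where "flux_approx h n z = (\<Sum>i\<in>UNIV. \<Sum>j\<in>UNIV. fwd h (F i j) z * DU n i j z)
  - (\<Sum>i\<in>UNIV. \<Sum>j\<in>UNIV. fwd h (%z. r z * V j z) z * (U n i z * DU n i j z))"

definition flux_forward :: "real => real \<times> (real^'d) => real"
 where "flux_forward h z = (\<Sum>i\<in>UNIV. \<Sum>j\<in>UNIV. fwd h (F i j) z * D i j z)
  - (\<Sum>i\<in>UNIV. \<Sum>j\<in>UNIV. (fwd h (%z. r z * V j z) z * V i z) * D i j z)"

definition flux :: "real \<times> (real^'d) => real"
 where "flux z = p z * divv z - ((\<mu> + lam) * (divv z)\<^sup>2 + \<mu> * (\<Sum>i\<in>UNIV. \<Sum>j\<in>UNIV. (D i j z)\<^sup>2))"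

text \<open>Each term is a product in L^2 times L^2, or L^4 times L^4 times L^2. The cubic terms are
  where the integrability of the velocity to the fourth power enters.\<close>

lemma flux_approx_conv:
 assumes h: "h > 0"
 shows "Lp_conv 1 (\<S> T) (flux_approx h) (flux_forward h)"
proof -
 have F: "Lp_conv 2 (\<S> T) (%n. fwd h (F i j)) (fwd h (F i j))" for i j
  by (rule fwd_const_conv[OF h]) (use F_L2 in auto)
 have R: "Lp_conv 4 (\<S> T) (%n. fwd h (%z. r z * V j z)) (fwd h (%z. r z * V j z))" for j
  by (rule fwd_const_conv[OF h]) (use rV_L4 in auto)
 have "Lp_conv 1 (\<S> T) (%n z. (\<Sum>i\<in>UNIV. \<Sum>j\<in>UNIV. fwd h (F i j) z * DU n i j z)
   - (\<Sum>i\<in>UNIV. \<Sum>j\<in>UNIV. (fwd h (%z. r z * V j z) z * U n i z) * DU n i j z)) (flux_forward h)"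
  unfolding flux_forward_def[abs_def]
  by (intro Lp_conv_diff Lp_conv_sum Lp_conv_mult_2 Lp_conv_mult_4 F R DU_conv U_conv) auto
 then show ?thesis by (simp add: flux_approx_def[abs_def] mult.assoc)
qed

text \<open>In the limit the convective part of the momentum flux, paired with the velocity
  gradient, equals the mass flux term and cancels against it; pressure work and dissipation are
  left.\<close>

lemma flux_forward_conv:
 assumes h: "!!n::nat. h n > 0" "h \<leadsto> 0"
 shows "(%n. (LINT z|\<S> T. flux_forward (h n) z)) \<leadsto> (LINT z|\<S> T. flux z)" "integrable (\<S> T) flux"
proof -
 have F: "Lp_conv 2 (\<S> T) (%n. fwd (h n) (F i j)) (F i j)" for i j
  by (rule fwd_conv[OF h]) (use F_L2 in auto)
 have R: "Lp_conv 4 (\<S> T) (%n. fwd (h n) (%z. r z * V j z)) (%z. r z * V j z)" for j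
  by (rule fwd_conv[OF h]) (use rV_L4 in auto)
 have Dc: "Lp_conv 2 (\<S> T) (%n. D i j) (D i j)" for i j
  by (rule Lp_conv_const) (use D_L2 in auto)
 have Vc: "Lp_conv 4 (\<S> T) (%n. V i) (V i)" for i
  by (rule Lp_conv_const) (use V_L4 in auto)
 have "Lp_conv 1 (\<S> T) (%n. flux_forward (h n)) (%z. (\<Sum>i\<in>UNIV. \<Sum>j\<in>UNIV. F i j z * D i j z)
   - (\<Sum>i\<in>UNIV. \<Sum>j\<in>UNIV. ((r z * V j z) * V i z) * D i j z))"
  unfolding flux_forward_def[abs_def]
  by (intro Lp_conv_diff Lp_conv_sum Lp_conv_mult_2 Lp_conv_mult_4 F R Dc Vc) auto
 moreover have "(\<Sum>i\<in>UNIV. \<Sum>j\<in>UNIV. F i j z * D i j z)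
   - (\<Sum>i\<in>UNIV. \<Sum>j\<in>UNIV. ((r z * V j z) * V i z) * D i j z) = flux z" for z
 proof -
  have "(\<Sum>j\<in>UNIV. F i j z * D i j z) - (\<Sum>j\<in>UNIV. ((r z * V j z) * V i z) * D i j z)
    = (p z - (\<mu> + lam) * divv z) * D i i z - \<mu> * (\<Sum>j\<in>UNIV. (D i j z)\<^sup>2)" for i
  proof -
   have "F i j z * D i j z - ((r z * V j z) * V i z) * D i j z
     = (if i = j then (p z - (\<mu> + lam) * divv z) * D i j z else 0) - \<mu> * (D i j z)\<^sup>2" for j
    by (simp add: F_def algebra_simps power2_eq_square)
   then have "(\<Sum>j\<in>UNIV. F i j z * D i j z - ((r z * V j z) * V i z) * D i j z)
     = (p z - (\<mu> + lam) * divv z) * D i i z - \<mu> * (\<Sum>j\<in>UNIV. (D i j z)\<^sup>2)"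
    by (simp add: sum_subtractf sum_distrib_left)
   then show ?thesis by (simp add: sum_subtractf)
  qed
  then have "(\<Sum>i\<in>UNIV. (\<Sum>j\<in>UNIV. F i j z * D i j z) - (\<Sum>j\<in>UNIV. ((r z * V j z) * V i z) * D i j z))
    = (p z - (\<mu> + lam) * divv z) * divv z - \<mu> * (\<Sum>i\<in>UNIV. \<Sum>j\<in>UNIV. (D i j z)\<^sup>2)"
   by (simp add: sum_subtractf sum_distrib_left divv_def)
  then show ?thesis by (simp add: sum_subtractf flux_def algebra_simps power2_eq_square)
 qed
 ultimately have c: "Lp_conv 1 (\<S> T) (%n. flux_forward (h n)) flux" by simp
 show "(%n. (LINT z|\<S> T. flux_forward (h n) z)) \<leadsto> (LINT z|\<S> T. flux z)"
  by (rule Lp_conv_1_integral[OF c])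
 show "integrable (\<S> T) flux" by (rule Lp_conv_1_integrable(2)[OF c])
qed

definition defect :: "nat => real \<times> (real^'d) => real"
 where "defect n z = r z * (\<Sum>i\<in>UNIV. (V i z - U n i z)\<^sup>2)"

lemma defect_conv: "integrable (\<S> T) (defect n)" "(%n. (LINT z|\<S> T. defect n z)) \<leadsto> 0"
proof -
 have m [measurable]: "U n i \<in> \<B> (\<S> T)" for n i by (rule Lp_convD(1)[OF U_conv(1)])
 have [measurable]: "defect n \<in> \<B> (\<S> T)" for n unfolding defect_def[abs_def] by measurable
 have i: "integrable (\<S> T) (%z. (V i z - U n i z)\<^sup>2)" for n i
  using integrable_power_diff[OF _ _ V_L2 Lp_convD(2)[OF U_conv(2), of n i], of i] by simp
 have le: "0 \<le> defect n z" "defect n z \<le> c * (\<Sum>i\<in>UNIV. (V i z - U n i z)\<^sup>2)" for n z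
  unfolding defect_def using r_bounds[of z] by (auto intro!: mult_right_mono mult_nonneg_nonneg sum_nonneg)
 have ci: "integrable (\<S> T) (%z. c * (\<Sum>i\<in>UNIV. (V i z - U n i z)\<^sup>2))" for n using i by simp
 show di: "integrable (\<S> T) (defect n)" for n
  by (rule L_integrable_bound[OF ci[of n]])
   (use le[of n] in \<open>auto intro!: AE_I2 intro: order_trans[OF _ abs_ge_self]\<close>)
 have "(%n. (LINT z|\<S> T. (V i z - U n i z)\<^sup>2)) \<leadsto> 0" for i
  using Lp_convD(5)[OF U_conv(2), of i] by (simp add: power2_commute)
 then have "(%n. c * (\<Sum>i\<in>UNIV. (LINT z|\<S> T. (V i z - U n i z)\<^sup>2))) \<leadsto> c * (\<Sum>i\<in>(UNIV::'d set). 0)"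
  by (intro tendsto_intros)
 then have lim: "(%n. c * (\<Sum>i\<in>UNIV. (LINT z|\<S> T. (V i z - U n i z)\<^sup>2))) \<leadsto> 0" by simp
 show "(%n. (LINT z|\<S> T. defect n z)) \<leadsto> 0"
 proof (rule tendsto_sandwich[OF _ _ tendsto_const lim])
  show "eventually (%n. 0 \<le> (LINT z|\<S> T. defect n z)) sequentially"
   using le by (intro always_eventually allI L_integral_nonneg) auto
  have "(LINT z|\<S> T. defect n z) \<le> (LINT z|\<S> T. c * (\<Sum>i\<in>UNIV. (V i z - U n i z)\<^sup>2))" for n
   by (rule integral_mono[OF di ci]) (rule le)
  then show "eventually (%n. (LINT z|\<S> T. defect n z) \<le> c * (\<Sum>i\<in>UNIV. (LINT z|\<S> T. (V i z - U n i z)\<^sup>2))) sequentially"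
   using i by (simp add: L_integral_sum)
 qed
qed

lemma DU_gradient:
 "AE z in \<S> T. gradient (%x. U n i (fst z, x)) (snd z) $ j = DU n i j z"
proof -
 have "weak_grad T (%t x. v t x $ i) (%t x. Dv t x $ i)" using v_weak_grad by (simp add: weak_grad_vec_def)
 from weak_grad_mollify[OF T_pos this, of n j]
 show ?thesis by eventually_elim (simp add: U_def DU_def V_def D_def case_prod_unfold eta_contract_eq)
qed

end

section \<open>The kinetic energy balance from below\<close>

context fluid_rep
begin

text \<open>At the base time the probe misses the kinetic energy by half the defect, which is small
  for large \<open>n\<close>. At the later time its defect may be large, but has the favourable
  sign.\<close>

lemma kinetic_step:
 assumes h: "h > 0"
  and vac: "AE x in torus. \<rho>c T x = 0 --> mc T x = 0"
  and KE: "integrable torus (%x. if \<rho>c T x > 0 then (norm (mc T x))\<^sup>2 / (2 * \<rho>c T x) else 0)"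
 shows "AE t in time T. kin t - 1 / 2 * (\<oint>x. defect n (t, x)) + h * (\<oint>x. flux_approx h n (t, x))
  \<le> (if t + h < T then kin (t + h) else KE T)"
proof -
 have good: "AE t in time T. (AE x in torus. \<rho>c t x = r (t, x)) \<and> (AE x in torus. \<forall>i. mc t x $ i = r (t, x) * V i (t, x))
   \<and> integrable torus (%x. r (t, x) / 2 * (\<Sum>i\<in>UNIV. (V i (t, x))\<^sup>2)) \<and> 0 < t"
  using rep_AE TX.AE_integrable_fst'[OF kin_integrand] AE_space by eventually_elim auto
 have Vi: "AE t in time T. \<forall>i. integrable torus (%x. V i (t, x))"
  unfolding AE_all_countable using TX.AE_integrable_fst'[OF L1_facts(3)] by blast
 have gr: "AE t in time T. \<forall>i j. AE x in torus. gradient (%x. U n i (t, x)) x $ j = DU n i j (t, x)"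
  unfolding AE_all_countable using TX.AE_pair[OF DU_gradient] by simp
 show ?thesis
  \<comment> \<open>The identification of momentum with density times velocity is required at the
    base time and, as long as this is before \<open>T\<close>, at the shifted time.\<close>
  using good AE_time_shift[OF good less_imp_le[OF h]] Vi gr AE_space
 proof eventually_elim
  case (elim t)
  have t: "t \<in> {0<..<T}" and ts: "t \<in> space (time T)" using elim(5) by auto
  define u where "u i x = U n i (t, x)" for i x
  have u: "periodic_smooth (u i)" for i
   using separable_kernel_op(1)[OF mollifier_separable spec[OF elim(3), of i], of n]
   by (simp add: u_def[abs_def] U_def kernel_op_def[abs_def])
  have uc: "continuous_on UNIV (u i)" for i by (rule periodic_smooth_continuous[OF u])
  have Ft: "integrable torus (%x. fwd h (F i j) (t, x))" for i j
   using forward_kernel_section_integrable(2)[OF h L1_facts(4)] by (simp add: fwd_def)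
  have Rt: "integrable torus (%x. fwd h (%z. r z * V j z) (t, x))" for j
   using forward_kernel_section_integrable(2)[OF h L1_facts(2)] by (simp add: fwd_def)
  have i1: "integrable torus (%x. fwd h (F i j) (t, x) * gradient (u i) x $ j)" for i j
   using continuous_times_integrable_torus[OF smooth_gradient_continuous[OF u] Ft] by (simp add: mult.commute)
  have i2: "integrable torus (%x. fwd h (%z. r z * V j z) (t, x) * (u i x * gradient (u i) x $ j))" for i j
  proof -
   have "continuous_on UNIV (%x. u i x * gradient (u i) x $ j)"
    by (intro continuous_intros uc smooth_gradient_continuous[OF u])
   from continuous_times_integrable_torus[OF this Rt] show ?thesis by (simp add: mult.commute)
  qed
  have "probe (min (t + h) T) u - probe t u
    = h * (\<oint>x. (\<Sum>i\<in>UNIV. \<Sum>j\<in>UNIV. fwd h (F i j) (t, x) * gradient (u i) x $ j)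
     - (\<Sum>i\<in>UNIV. \<Sum>j\<in>UNIV. fwd h (%z. r z * V j z) (t, x) * (u i x * gradient (u i) x $ j)))"
   unfolding probe_increment[OF t h u]
   using i1 i2 by (simp add: L_integral_sum L_integral_diff L_integrable_sum)
  also have "(\<oint>x. (\<Sum>i\<in>UNIV. \<Sum>j\<in>UNIV. fwd h (F i j) (t, x) * gradient (u i) x $ j)
     - (\<Sum>i\<in>UNIV. \<Sum>j\<in>UNIV. fwd h (%z. r z * V j z) (t, x) * (u i x * gradient (u i) x $ j)))
    = (\<oint>x. flux_approx h n (t, x))"
  proof (rule integral_cong_AE)
   have "flux_approx h n \<in> \<B> (\<S> T)" by (rule Lp_convD(1)[OF flux_approx_conv[OF h]])
   from measurable_compose[OF measurable_Pair1'[OF ts] this]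
   show "(%x. flux_approx h n (t, x)) \<in> \<B> torus" .
   show "(%x. (\<Sum>i\<in>UNIV. \<Sum>j\<in>UNIV. fwd h (F i j) (t, x) * gradient (u i) x $ j)
     - (\<Sum>i\<in>UNIV. \<Sum>j\<in>UNIV. fwd h (%z. r z * V j z) (t, x) * (u i x * gradient (u i) x $ j))) \<in> \<B> torus"
    using i1 i2 by (intro borel_measurable_diff borel_measurable_sum) auto
   have "AE x in torus. \<forall>i j. gradient (u i) x $ j = DU n i j (t, x)"
    unfolding AE_all_countable using elim(4) by (simp add: u_def[abs_def])
   then show "AE x in torus. (\<Sum>i\<in>UNIV. \<Sum>j\<in>UNIV. fwd h (F i j) (t, x) * gradient (u i) x $ j)
     - (\<Sum>i\<in>UNIV. \<Sum>j\<in>UNIV. fwd h (%z. r z * V j z) (t, x) * (u i x * gradient (u i) x $ j)) = flux_approx h n (t, x)"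
    by eventually_elim (simp add: flux_approx_def u_def)
  qed
  finally have inc: "probe (min (t + h) T) u = probe t u + h * (\<oint>x. flux_approx h n (t, x))" by simp
  have pt: "probe t u = kin t - 1 / 2 * (\<oint>x. defect n (t, x))"
   using probe_kin(2)[of t u, OF t uc] elim(1) by (simp add: defect_def u_def)
  \<comment> \<open>Before \<open>T\<close> the nonnegative defect is dropped; at \<open>T\<close>,
    where no velocity is available, the bound by \<open>KE T\<close> takes over.\<close>
  have "probe (min (t + h) T) u \<le> (if t + h < T then kin (t + h) else KE T)"
  proof (cases "t + h < T")
   case True
   then have th: "t + h \<in> {0<..<T}" using t h by auto
   have "0 \<le> (\<oint>x. r (t + h, x) * (\<Sum>i\<in>UNIV. (V i (t + h, x) - u i x)\<^sup>2))"
    using r_bounds by (intro L_integral_nonneg mult_nonneg_nonneg sum_nonneg) auto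
   then show ?thesis
    using probe_kin(2)[of "t + h" u, OF th uc] elim(2) True by simp
  next
   case False
   then show ?thesis using probe_le_KE[of T u, OF _ uc vac KE] T_pos by (simp add: min_def)
  qed
  then show ?case using inc pt by linarith
 qed
qed

definition early :: "(real => real) => real => real"
 where "early f h = (LINT t|time T. indicator {..h} t * f t) / h"

text \<open>Integration of \<open>kinetic_step\<close> over the base times. The shifted integral of
  \<open>kin\<close> misses the first \<open>h\<close> units of time, which leaves the initial
  average on the left; base times within \<open>h\<close> of \<open>T\<close> contribute
  \<open>h\<close> times \<open>KE T\<close> on the right.\<close>

lemma kinetic_forward:
 assumes h: "0 < h" "h < T"
  and vac: "AE x in torus. \<rho>c T x = 0 --> mc T x = 0"
  and KE: "integrable torus (%x. if \<rho>c T x > 0 then (norm (mc T x))\<^sup>2 / (2 * \<rho>c T x) else 0)"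
 shows "early kin h + (LINT z|\<S> T. flux_forward h z) \<le> KE T"
proof -
 let ?R = "%t. if t + h < T then kin (t + h) else KE T"
 have R: "?R t = indicator {..<T - h} t * kin (t + h) + KE T * indicator {T - h..<T} t" if "t \<in> space (time T)" for t
  using that by (auto simp: indicator_def)
 have sh: "integrable (time T) (%t. indicator {..<T - h} t * kin (t + h))"
  "(LINT t|time T. indicator {..<T - h} t * kin (t + h)) = (LINT t|time T. indicator {h<..} t * kin t)"
  using integrable_time_shift[OF kin_integrable] h by auto
 have ind: "integrable (time T) (%t. indicator {T - h..<T} t :: real)" "(LINT t|time T. indicator {T - h..<T} t) = h"
 proof -
  have S: "{T - h..<T} \<in> sets (time T)" using h by (auto simp: sets_time)
  show "integrable (time T) (%t. indicator {T - h..<T} t :: real)"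
   using S by (intro integrable_real_indicator) (auto simp: time.emeasure_eq_measure)
  have "(LINT t|time T. indicator {T - h..<T} t) = measure (time T) {T - h..<T}"
   using S h by (subst L_integral_indicator) (auto simp: Int_absorb2 intro!: arg_cong[where f = "measure (time T)"])
  also have "... = h" using h by (subst measure_time) auto
  finally show "(LINT t|time T. indicator {T - h..<T} t) = h" .
 qed
 have Ri: "integrable (time T) ?R"
  by (subst L_integrable_cong[OF refl R]) (use sh ind in auto)
 have "(LINT t|time T. ?R t) = (LINT t|time T. indicator {..<T - h} t * kin (t + h) + KE T * indicator {T - h..<T} t)"
  by (rule L_integral_cong[OF refl R])
 also have "... = (LINT t|time T. indicator {h<..} t * kin t) + KE T * h"
  using sh ind by simp
 finally have RI: "(LINT t|time T. ?R t) = (LINT t|time T. indicator {h<..} t * kin t) + KE T * h" .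
 have le: "(LINT t|time T. kin t) - 1 / 2 * (LINT z|\<S> T. defect n z) + h * (LINT z|\<S> T. flux_approx h n z)
   \<le> (LINT t|time T. ?R t)" for n
 proof -
  have ai: "integrable (\<S> T) (flux_approx h n)" by (rule Lp_conv_1_integrable(1)[OF flux_approx_conv[OF h(1)]])
  have d: "integrable (time T) (%t. (\<oint>x. defect n (t, x)))" and a: "integrable (time T) (%t. (\<oint>x. flux_approx h n (t, x)))"
   using TX.integrable_fst'[OF defect_conv(1)] TX.integrable_fst'[OF ai] by auto
  have "(LINT t|time T. kin t - 1 / 2 * (\<oint>x. defect n (t, x)) + h * (\<oint>x. flux_approx h n (t, x))) \<le> (LINT t|time T. ?R t)"
   by (rule integral_mono_AE[OF _ Ri kinetic_step[OF h(1) vac KE]]) (use kin_integrable d a in simp)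
  then show ?thesis
   using kin_integrable d a TX.integral_fst'[OF defect_conv(1)] TX.integral_fst'[OF ai] by simp
 qed
 have lim: "(%n. (LINT t|time T. kin t) - 1 / 2 * (LINT z|\<S> T. defect n z) + h * (LINT z|\<S> T. flux_approx h n z))
   \<leadsto> (LINT t|time T. kin t) - 1 / 2 * 0 + h * (LINT z|\<S> T. flux_forward h z)"
  by (intro tendsto_intros defect_conv(2) Lp_conv_1_integral[OF flux_approx_conv[OF h(1)]])
 have main: "(LINT t|time T. kin t) + h * (LINT z|\<S> T. flux_forward h z) \<le> (LINT t|time T. ?R t)"
  using LIMSEQ_le_const2[OF lim] le by auto
 have "(LINT t|time T. kin t) = (LINT t|time T. indicator {..h} t * kin t) + (LINT t|time T. indicator {h<..} t * kin t)"
 proof -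
  have "integrable (time T) (%t. indicator {..h} t * kin t)" "integrable (time T) (%t. indicator {h<..} t * kin t)"
   by (intro integrable_time_indicator kin_integrable; simp)+
  from L_integral_add[OF this, symmetric] show ?thesis
   by (auto simp: indicator_def intro!: L_integral_cong)
 qed
 then have "(LINT t|time T. indicator {..h} t * kin t) + h * (LINT z|\<S> T. flux_forward h z) \<le> KE T * h"
  using main RI by linarith
 then show ?thesis using h(1) by (simp add: early_def field_simps)
qed

end

section \<open>Averages near the two end times\<close>

lemma measure_time_early: "0 < h ==> h < T ==> measure (time T) ({..h} \<inter> {0<..<T}) = h"
 and measure_time_late: "0 < h ==> h < T ==> measure (time T) ({T - h<..} \<inter> {0<..<T}) = h"
proof -
 assume h: "0 < h" "h < T"
 have "{..h} \<inter> {0<..<T} = {0<..h}" "{T - h<..} \<inter> {0<..<T} = {T - h<..<T}" using h by auto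
 then show "measure (time T) ({..h} \<inter> {0<..<T}) = h" "measure (time T) ({T - h<..} \<inter> {0<..<T}) = h"
  using h by (subst measure_time; auto)+
qed

lemma continuous_on_interval_bounded:
 fixes f :: "real => real"
 assumes "continuous_on {a..b} f"
 obtains B where "!!t. t \<in> {a..b} ==> \<bar>f t\<bar> \<le> B"
proof -
 have "bounded (f ` {a..b})" by (intro compact_imp_bounded compact_continuous_image assms) simp
 then obtain B where B: "\<forall>y\<in>f ` {a..b}. norm y \<le> B" unfolding bounded_iff by blast
 show thesis by (rule that[of B]) (use B in auto)
qed

text \<open>Stated for windows \<open>A h\<close> of measure \<open>h\<close> within distance
  \<open>h\<close> of \<open>a\<close>, so that one proof serves both ends of the interval.\<close>

lemma time_average_tendsto:
 fixes f :: "real => real" and A :: "real => real set"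
 assumes "T > 0" and f: "continuous_on {0..T} f" and a: "a \<in> {0..T}"
  and h: "!!n::nat. 0 < h n" "!!n. h n < T" "h \<leadsto> 0"
  and A: "!!h. A h \<in> sets borel" "!!h t. t \<in> A h ==> t \<in> {0<..<T} ==> \<bar>t - a\<bar> \<le> h"
  and m: "!!h. 0 < h ==> h < T ==> measure (time T) (A h \<inter> {0<..<T}) = h"
 shows "(%n. (LINT t|time T. indicator (A (h n)) t * f t) / h n) \<leadsto> f a"
proof -
 have fm: "f \<in> \<B> (time T)"
 proof -
  have "f \<in> \<B> (restrict_space borel {0<..<T})"
   by (rule borel_measurable_continuous_on_restrict) (rule continuous_on_subset[OF f], auto)
  then show ?thesis unfolding time_def by (simp cong: measurable_cong_sets add: sets_restrict_space)
 qed
 obtain B where B: "!!t. t \<in> {0..T} ==> \<bar>f t\<bar> \<le> B"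
  using continuous_on_interval_bounded[OF f] by metis
 have fi: "integrable (time T) f" by (rule time.integrable_const_bound[of _ B]) (use B fm in auto)
 have "(%n. \<bar>(LINT t|time T. indicator (A (h n)) t * f t) / h n - f a\<bar>) \<leadsto> 0"
 proof (rule tendsto_0_ge_le)
  fix e :: real assume "e > 0"
  then obtain d where d: "d > 0" "!!t. t \<in> {0..T} ==> \<bar>t - a\<bar> < d ==> \<bar>f t - f a\<bar> < e"
   using f a unfolding continuous_on_iff dist_real_def by metis
  have "eventually (%n. h n < d) sequentially" using order_tendstoD(2)[OF h(3)] d by auto
  then show "eventually (%n. \<bar>(LINT t|time T. indicator (A (h n)) t * f t) / h n - f a\<bar> \<le> e) sequentially"
  proof eventually_elim
   case (elim n)
   let ?I = "%t. indicator (A (h n)) t :: real"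
   have I: "integrable (time T) ?I" using integrable_time_indicator[OF A(1), of T "%_. 1"] by simp
   have If: "integrable (time T) (%t. ?I t * f t)" by (rule integrable_time_indicator[OF A(1) fi])
   have S: "A (h n) \<inter> {0<..<T} \<in> sets (time T)" using A(1) by (auto simp: sets_time)
   have I1: "(LINT t|time T. ?I t) = h n"
   proof -
    have "(LINT t|time T. ?I t) = (LINT t|time T. indicator (A (h n) \<inter> {0<..<T}) t)"
     by (rule L_integral_cong) (auto simp: indicator_def)
    also have "... = measure (time T) (A (h n) \<inter> {0<..<T})" by (simp add: Int_assoc)
    finally show ?thesis using m h by simp
   qed
   have "\<bar>(LINT t|time T. ?I t * f t) - h n * f a\<bar> = \<bar>(LINT t|time T. ?I t * (f t - f a))\<bar>"
    using I If m[OF h(1,2)] by (simp add: right_diff_distrib)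
   also have "... \<le> (LINT t|time T. \<bar>?I t * (f t - f a)\<bar>)" by (rule integral_abs_bound)
   also have "... \<le> (LINT t|time T. ?I t * e)"
   proof (rule integral_mono')
    fix t assume t: "t \<in> space (time T)"
    show "\<bar>?I t * (f t - f a)\<bar> \<le> ?I t * e"
    proof (cases "t \<in> A (h n)")
     case True
     then have "\<bar>t - a\<bar> < d" using A(2)[of t "h n"] t elim by auto
     then show ?thesis using d(2)[of t] t True by (simp add: less_imp_le)
    qed simp
   qed (use I \<open>e > 0\<close> in auto)
   also have "... = h n * e" using I1 by simp
   finally have "\<bar>(LINT t|time T. ?I t * f t) - h n * f a\<bar> / h n \<le> e"
    using h(1)[of n] by (simp add: field_simps)
   moreover have "\<bar>(LINT t|time T. ?I t * f t) / h n - f a\<bar> = \<bar>(LINT t|time T. ?I t * f t) - h n * f a\<bar> / h n"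
   proof -
    have "(LINT t|time T. ?I t * f t) / h n - f a = ((LINT t|time T. ?I t * f t) - h n * f a) / h n"
     using h(1)[of n] by (simp add: diff_divide_distrib)
    then show ?thesis using h(1)[of n] by (simp add: abs_divide)
   qed
   ultimately show ?case by simp
  qed
 qed simp
 then have "(%n. (LINT t|time T. indicator (A (h n)) t * f t) / h n - f a) \<leadsto> 0"
  by (simp only: tendsto_rabs_zero_iff)
 then show ?thesis by (simp add: LIM_zero_iff)
qed

lemma continuous_AE_time_integrable:
 assumes "continuous_on {0..T} f"
 shows "integrable (time T) (f :: real => real)"
proof -
 have fm: "f \<in> \<B> (time T)"
 proof -
  have "f \<in> \<B> (restrict_space borel {0<..<T})"
   by (rule borel_measurable_continuous_on_restrict) (rule continuous_on_subset[OF assms], auto)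
  then show ?thesis unfolding time_def by (simp cong: measurable_cong_sets add: sets_restrict_space)
 qed
 obtain B where B: "!!t. t \<in> {0..T} ==> \<bar>f t\<bar> \<le> B"
  using continuous_on_interval_bounded[OF assms] by metis
 show ?thesis by (rule time.integrable_const_bound[of _ B]) (use B fm in auto)
qed

context fluid
begin

definition pint :: "real => real"
 where "pint t = (\<oint>x. p (t, x))"

lemma pint_integrable: "integrable (time T) pint"
 unfolding pint_def[abs_def] using TX.integrable_fst'[OF L1_facts(7)] .

lemma energy_eq: "AE t in time T. energy \<gamma> (\<rho> t) (v t) = ennreal (kin t + pint t / (\<gamma> - 1))"
 using TX.AE_pair[OF r_AE] TX.AE_integrable_fst'[OF kin_integrand] TX.AE_integrable_fst'[OF L1_facts(7)]
proof eventually_elim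
 case (elim t)
 have pos: "0 \<le> r (t, x) / 2 * (\<Sum>i\<in>UNIV. (V i (t, x))\<^sup>2) + p (t, x) / (\<gamma> - 1)" for x
  using r_bounds[of "(t, x)"] p_bounds(1)[of "(t, x)"] \<gamma>_gt
  by (intro add_nonneg_nonneg mult_nonneg_nonneg sum_nonneg divide_nonneg_nonneg) auto
 have "energy \<gamma> (\<rho> t) (v t) = (NN x. ennreal (r (t, x) / 2 * (\<Sum>i\<in>UNIV. (V i (t, x))\<^sup>2) + p (t, x) / (\<gamma> - 1)))"
  unfolding energy_def
 proof (rule nn_integral_cong_AE)
  show "AE x in torus. ennreal (1 / 2 * \<rho> t x * (norm (v t x))\<^sup>2 + \<rho> t x powr \<gamma> / (\<gamma> - 1))
    = ennreal (r (t, x) / 2 * (\<Sum>i\<in>UNIV. (V i (t, x))\<^sup>2) + p (t, x) / (\<gamma> - 1))"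
   using elim(1)
  proof eventually_elim
   case (elim x)
   have "(norm (v t x))\<^sup>2 = (\<Sum>i\<in>UNIV. (V i (t, x))\<^sup>2)"
    unfolding power2_norm_eq_inner inner_vec_def V_def by (simp add: power2_eq_square)
   then show ?case using elim by (simp add: p_def)
  qed
 qed
 also have "... = ennreal (\<oint>x. r (t, x) / 2 * (\<Sum>i\<in>UNIV. (V i (t, x))\<^sup>2) + p (t, x) / (\<gamma> - 1))"
  using elim(2,3) pos by (intro nn_integral_eq_integral) auto
 also have "(\<oint>x. r (t, x) / 2 * (\<Sum>i\<in>UNIV. (V i (t, x))\<^sup>2) + p (t, x) / (\<gamma> - 1)) = kin t + pint t / (\<gamma> - 1)"
  using elim(2,3) by (simp add: kin_def pint_def)
 finally show ?case .
qed

end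

section \<open>A continuous minorant of the energy\<close>

context fluid_rep
begin

text \<open>A functional that is continuous in time, stays below the energy, and touches it at the
 time at which the parameters are read off.\<close>

definition lower :: "('d => real^'d => real) => (real^'d => real) => real => real"
 where "lower u s t = (\<Sum>i\<in>UNIV. (\<oint>x. mc t x $ i * u i x))
  - 1 / 2 * (\<oint>x. \<rho>c t x * (\<Sum>i\<in>UNIV. u i x * u i x))
  + 1 / (\<gamma> - 1) * (\<oint>x. \<rho>c t x * (\<gamma> * s x powr (\<gamma> - 1))) - (\<oint>x. s x powr \<gamma>)"

definition lower_density :: "('d => real^'d => real) => (real^'d => real) => real => real^'d => real"
 where "lower_density u s t x = (\<Sum>i\<in>UNIV. mc t x $ i * u i x) - 1 / 2 * (\<rho>c t x * (\<Sum>i\<in>UNIV. u i x * u i x))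
  + 1 / (\<gamma> - 1) * (\<rho>c t x * (\<gamma> * s x powr (\<gamma> - 1))) - s x powr \<gamma>"

context
 fixes u :: "'d => real^'d => real" and s :: "real^'d => real" and B :: real
 assumes u: "!!i. u i \<in> \<B> torus" "!!i x. \<bar>u i x\<bar> \<le> B"
  and s: "s \<in> \<B> torus" "!!x. 0 \<le> s x" "!!x. s x \<le> B"
begin

lemma lower_bounds:
 "\<bar>\<Sum>i\<in>UNIV. u i x * u i x\<bar> \<le> real CARD('d) * (B * B)" "\<bar>\<gamma> * s x powr (\<gamma> - 1)\<bar> \<le> \<gamma> * B powr (\<gamma> - 1)"
 "\<bar>s x powr \<gamma>\<bar> \<le> B powr \<gamma>"
proof -
 have "\<bar>\<Sum>i\<in>UNIV. u i x * u i x\<bar> \<le> (\<Sum>i\<in>(UNIV::'d set). B * B)"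
 proof (rule order_trans[OF sum_abs sum_mono])
  fix i
  have "0 \<le> B" using u(2)[of i x] by linarith
  then show "\<bar>u i x * u i x\<bar> \<le> B * B" unfolding abs_mult by (intro mult_mono u) auto
 qed
 then show "\<bar>\<Sum>i\<in>UNIV. u i x * u i x\<bar> \<le> real CARD('d) * (B * B)" by simp
 show "\<bar>\<gamma> * s x powr (\<gamma> - 1)\<bar> \<le> \<gamma> * B powr (\<gamma> - 1)"
  using \<gamma>_gt s(2,3)[of x] by (auto simp: abs_mult intro!: mult_left_mono powr_mono2)
 show "\<bar>s x powr \<gamma>\<bar> \<le> B powr \<gamma>" using \<gamma>_gt s(2,3)[of x] by (auto intro!: powr_mono2)
qed

lemma lower_continuous: "continuous_on {0..T} (lower u s)"
proof -
 note [measurable] = u(1) s(1)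
 have "continuous_on {0..T} (%t. (\<oint>x. \<rho>c t x * (\<Sum>i\<in>UNIV. u i x * u i x)))"
  "continuous_on {0..T} (%t. (\<oint>x. \<rho>c t x * (\<gamma> * s x powr (\<gamma> - 1))))"
  by (rule \<rho>c_continuous[OF _ lower_bounds(1)], measurable)
   (rule \<rho>c_continuous[OF _ lower_bounds(2)], measurable)
 then show ?thesis
  unfolding lower_def[abs_def] by (intro continuous_intros mc_continuous[OF u])
qed

lemma lower_eq_integral:
 assumes t: "t \<in> {0..T}"
 shows "integrable torus (lower_density u s t)" "lower u s t = (\<oint>x. lower_density u s t x)"
proof -
 note [measurable] = u(1) s(1)
 have bi: "integrable torus (%x. f x * g x)"
  if f: "integrable torus f" and [measurable]: "g \<in> \<B> torus" and g: "!!x. \<bar>g x\<bar> \<le> C" for f g :: "real^'d => real" and C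
  using integrable_bounded_times[OF f that(2) g] by (simp add: mult.commute)
 have i1: "integrable torus (%x. mc t x $ i * u i x)" for i by (rule bi[OF mc_nth_integrable[OF t] u])
 have i2: "integrable torus (%x. \<rho>c t x * (\<Sum>i\<in>UNIV. u i x * u i x))"
  by (rule bi[OF \<rho>c_integrable[OF t] _ lower_bounds(1)]) measurable
 have i3: "integrable torus (%x. \<rho>c t x * (\<gamma> * s x powr (\<gamma> - 1)))"
  by (rule bi[OF \<rho>c_integrable[OF t] _ lower_bounds(2)]) measurable
 have i4: "integrable torus (%x. s x powr \<gamma>)"
  by (rule torus.integrable_const_bound[of _ "B powr \<gamma>"]) (use lower_bounds(3) in auto)
 show "integrable torus (lower_density u s t)"
  unfolding lower_density_def[abs_def]
  by (intro L_integrable_diff L_integrable_add L_integrable_sum integrable_mult_right i1 i2 i3 i4)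
 show "lower u s t = (\<oint>x. lower_density u s t x)"
  unfolding lower_density_def lower_def
  by (simp only: L_integral_diff L_integral_add L_integral_sum integral_mult_right_zero
    L_integrable_diff L_integrable_add L_integrable_sum integrable_mult_right i1 i2 i3 i4)
qed

text \<open>Two convexity inequalities: Young's for the kinetic part, and for the internal part the
  tangent of the power at \<open>s\<close>. Equality would hold for \<open>u\<close> the velocity
  and \<open>s\<close> the density.\<close>

lemma lower_le: "AE t in time T. lower u s t \<le> kin t + pint t / (\<gamma> - 1)"
 using rep_AE TX.AE_integrable_fst'[OF kin_integrand] TX.AE_integrable_fst'[OF L1_facts(7)] AE_space
proof eventually_elim
 case (elim t)
 then have t: "t \<in> {0..T}" by auto
 have "lower u s t \<le> (\<oint>x. r (t, x) / 2 * (\<Sum>i\<in>UNIV. (V i (t, x))\<^sup>2) + p (t, x) / (\<gamma> - 1))"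
  unfolding lower_eq_integral(2)[OF t]
 proof (rule integral_mono_AE[OF lower_eq_integral(1)[OF t]])
  show "integrable torus (%x. r (t, x) / 2 * (\<Sum>i\<in>UNIV. (V i (t, x))\<^sup>2) + p (t, x) / (\<gamma> - 1))"
   using elim(3,4) by simp
  show "AE x in torus. lower_density u s t x \<le> r (t, x) / 2 * (\<Sum>i\<in>UNIV. (V i (t, x))\<^sup>2) + p (t, x) / (\<gamma> - 1)"
   using elim(1,2)
  proof eventually_elim
   case (elim x)
   have k: "(\<Sum>i\<in>UNIV. r (t, x) * V i (t, x) * u i x) - 1 / 2 * (r (t, x) * (\<Sum>i\<in>UNIV. u i x * u i x))
     \<le> r (t, x) / 2 * (\<Sum>i\<in>UNIV. (V i (t, x))\<^sup>2)"
   proof -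
    have "r (t, x) * V i (t, x) * u i x - 1 / 2 * (r (t, x) * (u i x * u i x)) \<le> r (t, x) / 2 * (V i (t, x))\<^sup>2" for i
    proof -
     have "0 \<le> r (t, x) / 2 * (V i (t, x) - u i x)\<^sup>2" using r_bounds by simp
     then show ?thesis by (simp add: power2_eq_square algebra_simps)
    qed
    then have "(\<Sum>i\<in>UNIV. r (t, x) * V i (t, x) * u i x - 1 / 2 * (r (t, x) * (u i x * u i x)))
      \<le> (\<Sum>i\<in>UNIV. r (t, x) / 2 * (V i (t, x))\<^sup>2)" by (rule sum_mono)
    then show ?thesis by (simp add: sum_subtractf sum_distrib_left)
   qed
   have q: "1 / (\<gamma> - 1) * (r (t, x) * (\<gamma> * s x powr (\<gamma> - 1))) - s x powr \<gamma> \<le> p (t, x) / (\<gamma> - 1)"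
   proof (cases "s x = 0")
    case True
    then show ?thesis using p_bounds(1) \<gamma>_gt by simp
   next
    case False
    then have "\<gamma> * r (t, x) * s x powr (\<gamma> - 1) \<le> r (t, x) powr \<gamma> + (\<gamma> - 1) * s x powr \<gamma>"
     using \<gamma>_gt s(2)[of x] r_bounds by (intro powr_tangent) auto
    then have "(\<gamma> * r (t, x) * s x powr (\<gamma> - 1)) / (\<gamma> - 1) \<le> (r (t, x) powr \<gamma> + (\<gamma> - 1) * s x powr \<gamma>) / (\<gamma> - 1)"
     using \<gamma>_gt by (intro divide_right_mono) auto
    then show ?thesis using \<gamma>_gt by (simp add: p_def add_divide_distrib mult_ac)
   qed
   have "lower_density u s t x = (\<Sum>i\<in>UNIV. r (t, x) * V i (t, x) * u i x) - 1 / 2 * (r (t, x) * (\<Sum>i\<in>UNIV. u i x * u i x))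
    + (1 / (\<gamma> - 1) * (r (t, x) * (\<gamma> * s x powr (\<gamma> - 1))) - s x powr \<gamma>)"
    using elim by (simp add: lower_density_def)
   then show ?case using k q by linarith
  qed
 qed
 then show ?case using elim(3,4) by (simp add: kin_def pint_def)
qed

end

text \<open>The optimal \<open>u\<close> in \<open>lower\<close> is momentum over density. It has to
  be bounded to be an admissible test, so it is set to zero where its size exceeds
  \<open>n\<close>.\<close>

definition ptrunc :: "real => nat => 'd => real^'d => real"
 where "ptrunc t n i x = (if \<rho>c t x > 0 \<and> norm (mc t x) \<le> real n * \<rho>c t x then mc t x $ i / \<rho>c t x else 0)"

definition strunc :: "real => real^'d => real"
 where "strunc t x = max 0 (min c (\<rho>c t x))"

lemma trunc_props:
 assumes t: "t \<in> {0..T}"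
 shows "ptrunc t n i \<in> \<B> torus" "\<bar>ptrunc t n i x\<bar> \<le> max (real n) c"
  "strunc t \<in> \<B> torus" "0 \<le> strunc t x" "strunc t x \<le> max (real n) c"
proof -
 note [measurable] = \<rho>c_measurable[OF t] mc_nth_measurable[OF t] mc_measurable[OF t]
 show "ptrunc t n i \<in> \<B> torus" "strunc t \<in> \<B> torus"
  unfolding ptrunc_def[abs_def] strunc_def[abs_def] by measurable
 have "\<bar>mc t x $ i\<bar> / \<rho>c t x \<le> real n" if "\<rho>c t x > 0" "norm (mc t x) \<le> real n * \<rho>c t x"
  using that component_le_norm_cart[of "mc t x" i] by (simp add: field_simps)
 then show "\<bar>ptrunc t n i x\<bar> \<le> max (real n) c"
  by (auto simp: ptrunc_def abs_divide le_max_iff_disj)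
 show "0 \<le> strunc t x" "strunc t x \<le> max (real n) c" using c_nonneg by (auto simp: strunc_def)
qed

text \<open>At these parameters the two convexity inequalities are equalities wherever the
  truncation is inactive, so \<open>lower\<close> is the energy with the kinetic part restricted to
  moderate velocities; monotone convergence does the rest.\<close>

lemma lower_trunc_SUP:
 assumes t: "t \<in> {0..T}"
 shows "(SUP n. ennreal (lower (ptrunc t n) (strunc t) t)) = energy_mom \<gamma> (\<rho>c t) (mc t)"
  and "0 \<le> lower (ptrunc t n) (strunc t) t"
proof -
 note [measurable] = \<rho>c_measurable[OF t] mc_nth_measurable[OF t] mc_measurable[OF t]
 note tp = trunc_props[OF t]
 define e where "e n x = (if \<rho>c t x > 0 \<and> norm (mc t x) \<le> real n * \<rho>c t x then (norm (mc t x))\<^sup>2 / (2 * \<rho>c t x) else 0)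
   + \<rho>c t x powr \<gamma> / (\<gamma> - 1)" for n x
 have e0: "0 \<le> e n x" for n x using \<gamma>_gt by (auto simp: e_def)
 have ed: "AE x in torus. lower_density (ptrunc t n) (strunc t) t x = e n x" for n
  using \<rho>c_bounds[OF t]
 proof eventually_elim
  case (elim x)
  then have st: "strunc t x = \<rho>c t x" by (simp add: strunc_def)
  have pr: "1 / (\<gamma> - 1) * (\<rho>c t x * (\<gamma> * \<rho>c t x powr (\<gamma> - 1))) - \<rho>c t x powr \<gamma> = \<rho>c t x powr \<gamma> / (\<gamma> - 1)"
  proof -
   have "\<rho>c t x * (\<gamma> * \<rho>c t x powr (\<gamma> - 1)) = \<gamma> * \<rho>c t x powr \<gamma>"
    using elim powr_mult_base[of "\<rho>c t x" "\<gamma> - 1"] by simp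
   then show ?thesis using \<gamma>_gt by (simp add: field_simps)
  qed
  have k: "(\<Sum>i\<in>UNIV. mc t x $ i * ptrunc t n i x) - 1 / 2 * (\<rho>c t x * (\<Sum>i\<in>UNIV. ptrunc t n i x * ptrunc t n i x))
    = (if \<rho>c t x > 0 \<and> norm (mc t x) \<le> real n * \<rho>c t x then (norm (mc t x))\<^sup>2 / (2 * \<rho>c t x) else 0)"
  proof (cases "\<rho>c t x > 0 \<and> norm (mc t x) \<le> real n * \<rho>c t x")
   case True
   then have "(\<Sum>i\<in>UNIV. mc t x $ i * ptrunc t n i x) = (\<Sum>i\<in>UNIV. (mc t x $ i)\<^sup>2) / \<rho>c t x"
    "\<rho>c t x * (\<Sum>i\<in>UNIV. ptrunc t n i x * ptrunc t n i x) = (\<Sum>i\<in>UNIV. (mc t x $ i)\<^sup>2) / \<rho>c t x"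
    by (simp_all add: ptrunc_def power2_eq_square sum_divide_distrib[symmetric])
   then show ?thesis using True by (simp add: norm_square_sum)
  next
   case False
   then have "ptrunc t n i x = 0" for i by (auto simp: ptrunc_def)
   then show ?thesis unfolding if_not_P[OF False] by simp
  qed
  show ?case unfolding lower_density_def st e_def k[symmetric] pr[symmetric] by simp
 qed
 have ei: "integrable torus (e n)" for n
 proof -
  have l: "integrable torus (lower_density (ptrunc t n) (strunc t) t)"
   by (rule lower_eq_integral(1)[OF tp(1,2,3,4,5) t])
  have m: "e n \<in> \<B> torus" unfolding e_def[abs_def] by measurable
  show ?thesis by (rule integrable_cong_AE_imp[OF l m]) (use ed[of n] in eventually_elim, simp)
 qed
 have eq: "lower (ptrunc t n) (strunc t) t = (\<oint>x. e n x)" for n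
 proof -
  note l = lower_eq_integral[OF tp(1,2,3,4,5) t]
  show ?thesis unfolding l(2) using l(1) ei ed by (intro integral_cong_AE) auto
 qed
 then show "0 \<le> lower (ptrunc t n) (strunc t) t" using e0 by simp
 have "(SUP n. ennreal (lower (ptrunc t n) (strunc t) t)) = (SUP n. (NN x. ennreal (e n x)))"
  unfolding eq using ei e0 by (simp add: nn_integral_eq_integral)
 also have "... = (NN x. (SUP n. ennreal (e n x)))"
 proof (rule nn_integral_monotone_convergence_SUP[symmetric])
  show "incseq (%n x. ennreal (e n x))"
  proof (rule incseq_SucI, rule le_funI, rule ennreal_leI)
   fix n x
   have "norm (mc t x) \<le> real n * \<rho>c t x ==> \<rho>c t x > 0 ==> norm (mc t x) \<le> real (Suc n) * \<rho>c t x"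
    by (rule order_trans, assumption) (simp add: distrib_right)
   then show "e n x \<le> e (Suc n) x" by (auto simp: e_def)
  qed
  show "(%x. ennreal (e n x)) \<in> \<B> torus" for n using ei[of n] by measurable
 qed
 also have "... = energy_mom \<gamma> (\<rho>c t) (mc t)"
  unfolding energy_mom_def
 proof (rule nn_integral_cong)
  fix x
  let ?E = "(if \<rho>c t x > 0 then (norm (mc t x))\<^sup>2 / (2 * \<rho>c t x) else 0) + \<rho>c t x powr \<gamma> / (\<gamma> - 1)"
  have le: "e n x \<le> ?E" for n by (auto simp: e_def)
  \<comment> \<open>Where the density is positive, the truncation is inactive from this
    \<open>n\<close> on; elsewhere neither side has a kinetic part.\<close>
  obtain n :: nat where n: "norm (mc t x) / \<rho>c t x \<le> real n" using real_arch_simple by blast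
  then have "e n x = ?E" by (auto simp: e_def field_simps)
  then have "ennreal ?E \<le> (SUP n. ennreal (e n x))" by (metis SUP_upper UNIV_I)
  moreover have "(SUP n. ennreal (e n x)) \<le> ennreal ?E" by (intro SUP_least ennreal_leI le)
  ultimately show "(SUP n. ennreal (e n x)) = ennreal ?E" by (rule antisym[rotated])
 qed
 finally show "(SUP n. ennreal (lower (ptrunc t n) (strunc t) t)) = energy_mom \<gamma> (\<rho>c t) (mc t)" .
qed

end

lemma powr_Lipschitz:
 fixes a b c \<gamma> :: real
 assumes "0 \<le> a" "a \<le> c" "0 \<le> b" "b \<le> c" "\<gamma> \<ge> 1"
 shows "\<bar>a powr \<gamma> - b powr \<gamma>\<bar> \<le> \<gamma> * c powr (\<gamma> - 1) * \<bar>a - b\<bar>"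
proof -
 have *: "b powr \<gamma> - a powr \<gamma> \<le> \<gamma> * c powr (\<gamma> - 1) * \<bar>a - b\<bar>" if ab: "0 \<le> a" "0 \<le> b" "b \<le> c" for a b
 proof (cases "b = 0")
  case True
  have "0 \<le> \<gamma> * c powr (\<gamma> - 1) * \<bar>a\<bar>" using assms(5) by simp
  moreover have "- (a powr \<gamma>) \<le> 0" by simp
  ultimately show ?thesis using True by (simp del: powr_ge_zero)
 next
  case False
  then have b: "b > 0" using ab by simp
  have "b * b powr (\<gamma> - 1) = b powr \<gamma>" using b powr_mult_base[of b "\<gamma> - 1"] by simp
  then have "b powr \<gamma> - a powr \<gamma> \<le> \<gamma> * b powr (\<gamma> - 1) * (b - a)"
   using powr_tangent[OF assms(5) ab(1) b] by (simp add: algebra_simps)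
  also have "... \<le> \<gamma> * b powr (\<gamma> - 1) * \<bar>a - b\<bar>" using assms(5) by (intro mult_left_mono) auto
  also have "... \<le> \<gamma> * c powr (\<gamma> - 1) * \<bar>a - b\<bar>"
   using assms(5) ab b by (intro mult_right_mono mult_left_mono powr_mono2) auto
  finally show ?thesis .
 qed
 show ?thesis using *[of a b] *[of b a] assms by (simp add: abs_le_iff abs_minus_commute)
qed

section \<open>Strong continuity of the density at the final time\<close>

context fluid_rep
begin

definition late :: "(real => real) => real => real"
 where "late f h = (LINT t|time T. indicator {T - h<..} t * f t) / h"

text \<open>The shift by 2 keeps the window inside the interval already for
  \<open>n = 0\<close>.\<close>

definition step :: "nat => real"
 where "step n = T / (real n + 2)"

lemma step: "0 < step n" "step n < T" "step \<leadsto> 0"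
proof -
 show "0 < step n" using T_pos unfolding step_def by (intro divide_pos_pos) auto
 show "step n < T" using mult_strict_left_mono[OF _ T_pos, of 1 "real n + 2"] by (simp add: step_def divide_less_eq)
 have "(%n. T / (real n + 2)) \<leadsto> 0" by real_asymp
 then show "step \<leadsto> 0" by (simp add: step_def[abs_def])
qed

lemma early_tendsto:
 assumes "continuous_on {0..T} f"
 shows "(%n. early f (step n)) \<leadsto> f 0"
 unfolding early_def
 by (rule time_average_tendsto[where A = "%h. {..h}", OF T_pos assms _ step])
  (use T_pos in \<open>auto simp: measure_time_early\<close>)

lemma late_tendsto:
 assumes "continuous_on {0..T} f"
 shows "(%n. late f (step n)) \<leadsto> f T"
 unfolding late_def
 by (rule time_average_tendsto[where A = "%h. {T - h<..}", OF T_pos assms _ step])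
  (use T_pos in \<open>auto simp: measure_time_late\<close>)

lemma early_AE_cong:
 assumes "integrable (time T) f" "integrable (time T) g" "AE t in time T. f t = g t"
 shows "early f h = early g h" "late f h = late g h"
proof -
 have "(LINT t|time T. indicator A t * f t) = (LINT t|time T. indicator A t * g t)" if "A \<in> sets borel" for A
  using integrable_time_indicator[OF that assms(1)] integrable_time_indicator[OF that assms(2)] assms(3)
  by (intro integral_cong_AE) auto
 then show "early f h = early g h" "late f h = late g h" by (simp_all add: early_def late_def)
qed

context
 fixes R :: "real => real^'d => real^'d"
 assumes R_grad: "weak_grad T (%t x. sqrt (\<rho> t x)) R"
  and R_L2: "integrable (\<S> T) (%(t, x). (norm (R t x))\<^sup>2)"
begin

private definition sq :: "real \<times> (real^'d) => real"
 where "sq z = sqrt (r z)"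

private definition G :: "'d => real \<times> (real^'d) => real"
 where "G j z = R (fst z) (snd z) $ j"

private definition W :: "nat => real \<times> (real^'d) => real"
 where "W n = (%(t, x). kernel_op torus (mollifier n) (%y. sq (t, y)) x)"

private definition GW :: "nat => 'd => real \<times> (real^'d) => real"
 where "GW n j = (%(t, x). kernel_op torus (mollifier n) (%y. G j (t, y)) x)"

private definition I :: "real => real \<times> (real^'d) => real"
 where "I h z = indicator {T - h<..} (fst z)"

text \<open>The final density, carried to all times so that it can be compared with \<open>r\<close>
  in space-time.\<close>

private definition g :: "real \<times> (real^'d) => real"
 where "g z = strunc T (snd z)"

private lemma T_in: "T \<in> {0..T}" using T_pos by simp

private lemma sq_measurable [measurable]: "sq \<in> \<B> (\<S> T)"
 unfolding sq_def[abs_def] by measurable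

private lemma sq_bounds: "\<bar>sq z\<bar> \<le> sqrt c" "sq z * sq z = r z"
 using r_bounds[of z] by (auto simp: sq_def)

private lemma G_measurable [measurable]: "G j \<in> \<B> (\<S> T)"
proof -
 have "(%z. R (fst z) (snd z)) \<in> \<B> (\<S> T)"
  using R_grad by (simp add: weak_grad_def L1_loc_def case_prod_unfold)
 from measurable_compose[OF this borel_measurable_nth] show ?thesis by (simp add: G_def[abs_def])
qed

private lemma G_L2: "integrable (\<S> T) (%z. \<bar>G j z\<bar> ^ 2)"
proof (rule L_integrable_bound)
 show "integrable (\<S> T) (%z. (norm (R (fst z) (snd z)))\<^sup>2)"
  using R_L2 by (simp add: case_prod_unfold)
 have "\<bar>G j z\<bar> ^ 2 \<le> (norm (R (fst z) (snd z)))\<^sup>2" for z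
  by (rule power_mono) (auto simp: G_def component_le_norm_cart)
 then show "AE z in \<S> T. norm (\<bar>G j z\<bar> ^ 2) \<le> norm ((norm (R (fst z) (snd z)))\<^sup>2)" by simp
qed measurable

private lemma I_measurable [measurable]: "I h \<in> \<B> (\<S> T)"
 unfolding I_def[abs_def]
 by (rule measurable_compose[OF measurable_fst]) (intro borel_measurable_timeI borel_measurable_indicator, simp)

private lemma I_bounds: "\<bar>I h z\<bar> \<le> 1" "0 \<le> I h z"
 by (auto simp: I_def indicator_def)

private lemma g_measurable [measurable]: "g \<in> \<B> (\<S> T)"
 unfolding g_def[abs_def] by (rule measurable_compose[OF measurable_snd trunc_props(3)[OF T_in]])

private lemma g_bounds: "0 \<le> g z" "g z \<le> c" "\<bar>g z - r z\<bar> \<le> c"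
 using c_nonneg r_bounds[of z] by (auto simp: g_def strunc_def)

private lemma W_conv: "Lp_conv 4 (\<S> T) W sq"
 unfolding W_def by (rule Lp_conv_mollify; (rule bounded_power_integrable[OF sq_measurable sq_bounds(1)] | simp))

private lemma GW_conv: "Lp_conv 2 (\<S> T) (%n. GW n j) (G j)"
 unfolding GW_def by (rule Lp_conv_mollify) (use G_L2 in simp_all)

private lemma sqrt_\<rho>: "AE t in time T. AE x in torus. sqrt (\<rho> t x) = sq (t, x)"
 using TX.AE_pair[OF r_AE]
proof eventually_elim
 case (elim t) from elim show ?case by eventually_elim (simp add: sq_def)
qed

text \<open>The mass balance from \<open>t\<close> to \<open>T\<close> is tested with the square of
  the mollified root of the density at time \<open>t\<close>. The gradient of that square is
  \<open>2 W\<close> times the gradient of \<open>W\<close>, so only the gradient of the root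
  enters. The indicator selects base times within \<open>h\<close> of \<open>T\<close>, for which
  the capped window ends at \<open>T\<close>.\<close>

private lemma density_step_slices:
 assumes h: "h > 0"
 shows "AE t in time T. I h (t, 0) * (\<oint>x. (g (t, x) - r (t, x)) * (W n (t, x) * W n (t, x)))
  = I h (t, 0) * (h * (\<oint>x. (\<Sum>j\<in>UNIV. 2 * ((fwd h (%z. r z * V j z) (t, x) * W n (t, x)) * GW n j (t, x)))))"
proof -
 have gr: "AE t in time T. \<forall>j. AE x in torus. gradient (kernel_op torus (mollifier n) (%x. sqrt (\<rho> t x))) x $ j = GW n j (t, x)"
 proof -
  have "AE z in \<S> T. gradient (kernel_op torus (mollifier n) (%x. sqrt (\<rho> (fst z) x))) (snd z) $ j = GW n j z" for j
   using weak_grad_mollify[OF T_pos R_grad, of n j] by eventually_elim (simp add: GW_def G_def case_prod_unfold)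
  from TX.AE_pair[OF this] show ?thesis unfolding AE_all_countable by simp
 qed
 have "AE t in time T. integrable torus (%x. sq (t, x))"
 proof -
  have "integrable (\<S> T) sq"
   by (rule spacetime.integrable_const_bound[of _ "sqrt c"]) (use sq_bounds in auto)
  from TX.AE_integrable_fst'[OF this] show ?thesis .
 qed
 then show ?thesis
  using gr sqrt_\<rho> rep_AE(1) AE_space
 proof eventually_elim
  case (elim t)
  have ts: "t \<in> space (time T)" and t: "t \<in> {0<..<T}" and t': "t \<in> {0..T}" using elim(5) by auto
  show ?case
  proof (cases "T - h < t")
   case False
   then show ?thesis by (simp add: I_def)
  next
   case True
   then have min: "min (t + h) T = T" by (simp add: min_def)
   define u where "u x = W n (t, x)" for x
   have ker: "kernel_op torus (mollifier n) (%x. sqrt (\<rho> t x)) = u"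
   proof
    fix x :: "real^'d"
    have m1: "(%x. sq (t, x)) \<in> \<B> torus" using elim(1) by simp
    have m2: "(%x. sqrt (\<rho> t x)) \<in> \<B> torus"
     using measurable_compose[OF measurable_compose[OF measurable_Pair1'[OF ts] \<rho>_measurable'] borel_measurable_sqrt] by simp
    have mm: "(%y. mollifier n x y) \<in> \<B> torus"
     by (rule borel_measurable_torusI[OF periodic_smooth_measurable[OF separable_sections(2)[OF mollifier_separable]]])
    show "kernel_op torus (mollifier n) (%x. sqrt (\<rho> t x)) x = u x"
     unfolding u_def W_def kernel_op_def case_prod_conv
     using elim(3) m1 m2 mm by (intro integral_cong_AE) auto
   qed
   have u: "periodic_smooth u"
    using separable_kernel_op(1)[OF mollifier_separable elim(1), of n] unfolding u_def[abs_def] W_def by simp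
   let ?\<psi> = "%x. u x * u x"
   have \<psi>: "periodic_smooth ?\<psi>" by (rule periodic_smooth_mult[OF u u])
   have grad: "gradient ?\<psi> x $ j = 2 * (u x * gradient u x $ j)" for x j
    by (simp add: gradient_mult[OF periodic_smooth_smooth[OF u] periodic_smooth_smooth[OF u]])
   have bal: "(\<oint>x. \<rho>c T x * ?\<psi> x) - (\<oint>x. \<rho>c t x * ?\<psi> x)
     = h * (\<Sum>j\<in>UNIV. (\<oint>x. fwd h (%z. r z * V j z) (t, x) * gradient ?\<psi> x $ j))"
    using balance_forward[where u = r and uc = \<rho>c, OF T_pos L1_facts(1) L1_facts(2) balance_mass \<psi> rep_AE(1) \<rho>c_measurable
      \<rho>c_continuous_test[OF periodic_smooth_continuous[OF \<psi>]] t h]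
    by (simp only: min fwd_def case_prod_conv)
   have i1: "integrable torus (%x. \<rho>c s x * ?\<psi> x)" if "s \<in> {0..T}" for s
    using continuous_times_integrable_torus[OF periodic_smooth_continuous[OF \<psi>] \<rho>c_integrable[OF that]] by (simp add: mult.commute)
   have fi: "integrable torus (%x. fwd h (%z. r z * V j z) (t, x) * gradient ?\<psi> x $ j)" for j
    using continuous_times_integrable_torus[OF smooth_gradient_continuous[OF \<psi>] forward_kernel_section_integrable(2)[OF h L1_facts(2)]]
    by (simp add: fwd_def mult.commute)
   have um: "u \<in> \<B> torus" by (rule borel_measurable_torusI[OF periodic_smooth_measurable[OF u]])
   have gm: "(%x. g (t, x)) \<in> \<B> torus" "(%x. r (t, x)) \<in> \<B> torus"
    "(%x. GW n j (t, x)) \<in> \<B> torus" for j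
    using measurable_compose[OF measurable_Pair1'[OF ts] g_measurable] measurable_compose[OF measurable_Pair1'[OF ts] r_measurable]
     measurable_compose[OF measurable_Pair1'[OF ts] Lp_convD(1)[OF GW_conv]] by simp_all
   have fm: "(%x. fwd h (%z. r z * V j z) (t, x)) \<in> \<B> torus" for j
    using forward_kernel_section_integrable(2)[OF h L1_facts(2)] by (simp add: fwd_def)
   have "(\<oint>x. (g (t, x) - r (t, x)) * (W n (t, x) * W n (t, x))) = (\<oint>x. \<rho>c T x * ?\<psi> x - \<rho>c t x * ?\<psi> x)"
   proof (rule integral_cong_AE)
    show "AE x in torus. (g (t, x) - r (t, x)) * (W n (t, x) * W n (t, x)) = \<rho>c T x * ?\<psi> x - \<rho>c t x * ?\<psi> x"
     using \<rho>c_bounds[OF T_in] elim(4)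
     by eventually_elim (simp add: g_def strunc_def u_def left_diff_distrib)
    show "(%x. (g (t, x) - r (t, x)) * (W n (t, x) * W n (t, x))) \<in> \<B> torus"
     unfolding u_def[symmetric] using gm um by measurable
    show "(%x. \<rho>c T x * ?\<psi> x - \<rho>c t x * ?\<psi> x) \<in> \<B> torus"
     using i1[OF T_in] i1[OF t'] by measurable
   qed
   also have "... = h * (\<Sum>j\<in>UNIV. (\<oint>x. fwd h (%z. r z * V j z) (t, x) * gradient ?\<psi> x $ j))"
    using bal i1[OF T_in] i1[OF t'] by simp
   also have "(\<Sum>j\<in>UNIV. (\<oint>x. fwd h (%z. r z * V j z) (t, x) * gradient ?\<psi> x $ j))
     = (\<oint>x. (\<Sum>j\<in>UNIV. fwd h (%z. r z * V j z) (t, x) * gradient ?\<psi> x $ j))"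
    using fi by (simp add: L_integral_sum)
   also have "... = (\<oint>x. (\<Sum>j\<in>UNIV. 2 * ((fwd h (%z. r z * V j z) (t, x) * W n (t, x)) * GW n j (t, x))))"
   proof (rule integral_cong_AE)
    have "AE x in torus. \<forall>j. gradient u x $ j = GW n j (t, x)"
     unfolding AE_all_countable using elim(2) by (simp add: ker)
    then show "AE x in torus. (\<Sum>j\<in>UNIV. fwd h (%z. r z * V j z) (t, x) * gradient ?\<psi> x $ j)
      = (\<Sum>j\<in>UNIV. 2 * ((fwd h (%z. r z * V j z) (t, x) * W n (t, x)) * GW n j (t, x)))"
     by eventually_elim (simp only: grad, simp add: u_def mult_ac)
    show "(%x. \<Sum>j\<in>UNIV. fwd h (%z. r z * V j z) (t, x) * gradient ?\<psi> x $ j) \<in> \<B> torus"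
     using fi by (intro borel_measurable_sum) auto
    show "(%x. \<Sum>j\<in>UNIV. 2 * ((fwd h (%z. r z * V j z) (t, x) * W n (t, x)) * GW n j (t, x))) \<in> \<B> torus"
     unfolding u_def[symmetric] using fm um gm(3) by measurable
   qed
   finally show ?thesis by simp
  qed
 qed
qed

text \<open>Removing the mollifier turns \<open>W^2\<close> into the density at the base time, that
  is, the mass balance tested with the density itself. The right-hand products are again of type L^4
  L^4 L^2.\<close>

private lemma density_identity:
 assumes h: "0 < h"
 shows "(LINT z|\<S> T. (I h z * (g z - r z)) * r z)
  = h * (LINT z|\<S> T. (\<Sum>j\<in>UNIV. 2 * (((I h z * fwd h (%z. r z * V j z) z) * sq z) * G j z)))"
proof -
 have R4: "Lp_conv 4 (\<S> T) (%n. fwd h (%z. r z * V j z)) (fwd h (%z. r z * V j z))" for j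
  by (rule fwd_const_conv[OF h]) (use rV_L4 in auto)
 have IR4: "Lp_conv 4 (\<S> T) (%n z. I h z * fwd h (%z. r z * V j z) z) (%z. I h z * fwd h (%z. r z * V j z) z)" for j
  using Lp_convD(3,4)[OF R4[of j]]
  by (intro Lp_conv_const bounded_times_power_integrable[OF _ _ I_bounds(1)]) auto
 have c1: "Lp_conv 2 (\<S> T) (%n z. I h z * (g z - r z)) (%z. I h z * (g z - r z))"
  by (intro Lp_conv_const bounded_times_power_integrable[OF _ _ I_bounds(1)] bounded_power_integrable[OF _ g_bounds(3)]) auto
 have L: "Lp_conv 1 (\<S> T) (%n z. (I h z * (g z - r z)) * (W n z * W n z)) (%z. (I h z * (g z - r z)) * (sq z * sq z))"
  by (intro Lp_conv_mult_2 Lp_conv_mult_4 c1 W_conv)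
 have Rr: "Lp_conv 1 (\<S> T) (%n z. \<Sum>j\<in>UNIV. 2 * (((I h z * fwd h (%z. r z * V j z) z) * W n z) * GW n j z))
   (%z. \<Sum>j\<in>UNIV. 2 * (((I h z * fwd h (%z. r z * V j z) z) * sq z) * G j z))"
  by (intro Lp_conv_sum Lp_conv_cmult Lp_conv_mult_2 Lp_conv_mult_4 IR4 W_conv GW_conv) simp
 have eq: "(LINT z|\<S> T. (I h z * (g z - r z)) * (W n z * W n z))
   = h * (LINT z|\<S> T. (\<Sum>j\<in>UNIV. 2 * (((I h z * fwd h (%z. r z * V j z) z) * W n z) * GW n j z)))" for n
 proof -
  note iL = Lp_conv_1_integrable(1)[OF L, of n] and iR = Lp_conv_1_integrable(1)[OF Rr, of n]
  have "(LINT z|\<S> T. (I h z * (g z - r z)) * (W n z * W n z))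
    = (LINT t|time T. (\<oint>x. (I h (t, x) * (g (t, x) - r (t, x))) * (W n (t, x) * W n (t, x))))"
   by (rule TX.integral_fst'[OF iL, symmetric])
  also have "... = (LINT t|time T. h * (\<oint>x. (\<Sum>j\<in>UNIV. 2 * (((I h (t, x) * fwd h (%z. r z * V j z) (t, x)) * W n (t, x)) * GW n j (t, x)))))"
  proof (rule integral_cong_AE)
   show "(%t. (\<oint>x. (I h (t, x) * (g (t, x) - r (t, x))) * (W n (t, x) * W n (t, x)))) \<in> \<B> (time T)"
    using TX.integrable_fst'[OF iL] by simp
   show "(%t. h * (\<oint>x. (\<Sum>j\<in>UNIV. 2 * (((I h (t, x) * fwd h (%z. r z * V j z) (t, x)) * W n (t, x)) * GW n j (t, x))))) \<in> \<B> (time T)"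
    by (intro borel_measurable_times borel_measurable_const borel_measurable_integrable[OF TX.integrable_fst'[OF iR]])
   show "AE t in time T. (\<oint>x. (I h (t, x) * (g (t, x) - r (t, x))) * (W n (t, x) * W n (t, x)))
    = h * (\<oint>x. (\<Sum>j\<in>UNIV. 2 * (((I h (t, x) * fwd h (%z. r z * V j z) (t, x)) * W n (t, x)) * GW n j (t, x))))"
    using density_step_slices[OF h, of n]
   proof eventually_elim
    case (elim t)
    define k where "k = I h (t, 0)"
    have I0: "I h (t, x) = k" for x by (simp add: I_def k_def)
    have "(k * (g (t, x) - r (t, x))) * (W n (t, x) * W n (t, x)) = k * ((g (t, x) - r (t, x)) * (W n (t, x) * W n (t, x)))"
     and "(\<Sum>j\<in>UNIV. 2 * (((k * fwd h (%z. r z * V j z) (t, x)) * W n (t, x)) * GW n j (t, x)))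
      = k * (\<Sum>j\<in>UNIV. 2 * ((fwd h (%z. r z * V j z) (t, x) * W n (t, x)) * GW n j (t, x)))" for x
     unfolding sum_distrib_left by (simp_all only: mult_ac)
    then show ?case using elim unfolding I0 by (simp only: integral_mult_right_zero mult.left_commute[of k h])
   qed
  qed
  also have "... = h * (LINT z|\<S> T. (\<Sum>j\<in>UNIV. 2 * (((I h z * fwd h (%z. r z * V j z) z) * W n z) * GW n j z)))"
   by (simp only: integral_mult_right_zero TX.integral_fst'[OF iR])
  finally show ?thesis .
 qed
 have "(LINT z|\<S> T. (I h z * (g z - r z)) * (sq z * sq z))
  = h * (LINT z|\<S> T. (\<Sum>j\<in>UNIV. 2 * (((I h z * fwd h (%z. r z * V j z) z) * sq z) * G j z)))"
  using Lp_conv_1_integral[OF L] tendsto_mult_left[OF Lp_conv_1_integral[OF Rr], of h] unfolding eq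
  by (rule LIMSEQ_unique)
 then show ?thesis by (simp add: sq_bounds(2))
qed

text \<open>The square \<open>(g - r)^2\<close> is split as \<open>g (g - r) - r (g - r)\<close>.
  The first part is weak continuity against the fixed function \<open>g\<close>; the second, whose
  test function moves with time, is \<open>density_identity\<close>.\<close>

private lemma density_defect_tendsto: "(%n. (LINT z|\<S> T. I (step n) z * (g z - r z)\<^sup>2) / step n) \<leadsto> 0"
proof -
 have bi: "integrable (\<S> T) f" if [measurable]: "f \<in> \<B> (\<S> T)" and f: "!!z. \<bar>f z\<bar> \<le> B" for f :: "real \<times> (real^'d) => real" and B
  by (rule spacetime.integrable_const_bound[of _ B]) (use f in auto)
 define X where "X z = (\<Sum>j\<in>UNIV. 2 * (((r z * V j z) * sq z) * G j z))" for z
 define Xn where "Xn n z = (\<Sum>j\<in>UNIV. 2 * ((fwd (step n) (%z. r z * V j z) z * sq z) * G j z))" for n z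
 have Xc: "Lp_conv 1 (\<S> T) Xn X"
 proof -
  have a: "Lp_conv 4 (\<S> T) (%n. fwd (step n) (%z. r z * V j z)) (%z. r z * V j z)" for j
   by (rule fwd_conv[OF step(1) step(3)]) (use rV_L4 in auto)
  have b: "Lp_conv 4 (\<S> T) (%n. sq) sq" "Lp_conv 2 (\<S> T) (%n. G j) (G j)" for j
   using G_L2 by (intro Lp_conv_const bounded_power_integrable[OF _ sq_bounds(1)]; simp)+
  show ?thesis unfolding Xn_def X_def
   by (intro Lp_conv_sum Lp_conv_cmult Lp_conv_mult_2 Lp_conv_mult_4 a b) simp
 qed
 note Xi = Lp_conv_1_integrable[OF Xc]
 note IX = integrable_bounded_times[OF _ I_measurable I_bounds(1)]
 have l1: "(%n. (LINT z|\<S> T. \<bar>Xn n z - X z\<bar>)) \<leadsto> 0" using Lp_convD(5)[OF Xc] by simp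
 have l2: "(%n. (LINT z|\<S> T. I (step n) z * \<bar>X z\<bar>)) \<leadsto> (LINT z|(\<S> T :: (real \<times> (real^'d)) measure). (0::real))"
 proof (rule integral_dominated_convergence[where w = "%z. \<bar>X z\<bar>"])
  show "AE z in \<S> T. (%n. I (step n) z * \<bar>X z\<bar>) \<leadsto> 0"
  proof (rule AE_I2)
   fix z assume "z \<in> space (\<S> T :: (real \<times> (real^'d)) measure)"
   then have "fst z < T" by (auto simp: space_pair_measure)
   then have "eventually (%n. step n < T - fst z) sequentially" using order_tendstoD(2)[OF step(3)] by simp
   then have "eventually (%n. I (step n) z * \<bar>X z\<bar> = 0) sequentially" by eventually_elim (simp add: I_def)
   then show "(%n. I (step n) z * \<bar>X z\<bar>) \<leadsto> 0" by (rule tendsto_eventually)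
  qed
  show "AE z in \<S> T. norm (I (step n) z * \<bar>X z\<bar>) \<le> \<bar>X z\<bar>" for n
   using I_bounds by (auto simp: abs_mult intro!: AE_I2 mult_left_le_one_le)
  show "integrable (\<S> T) (%z. \<bar>X z\<bar>)" using Xi(2) by simp
  then show "(%z. I (step n) z * \<bar>X z\<bar>) \<in> \<B> (\<S> T)" for n
   using Xi(2) by measurable
 qed simp
 \<comment> \<open>\<open>Xn\<close> converges in L^1 while the windows shrink to the final time, so
   its integrals over them vanish.\<close>
 have "(%n. (LINT z|\<S> T. I (step n) z * Xn n z)) \<leadsto> 0"
 proof (rule Lim_null_comparison)
  show "(%n. (LINT z|\<S> T. \<bar>Xn n z - X z\<bar>) + (LINT z|\<S> T. I (step n) z * \<bar>X z\<bar>)) \<leadsto> 0"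
   using tendsto_add[OF l1 l2] by simp
  show "eventually (%n. norm (LINT z|\<S> T. I (step n) z * Xn n z)
    \<le> (LINT z|\<S> T. \<bar>Xn n z - X z\<bar>) + (LINT z|\<S> T. I (step n) z * \<bar>X z\<bar>)) sequentially"
  proof (rule always_eventually, rule allI)
   fix n
   have "norm (LINT z|\<S> T. I (step n) z * Xn n z) \<le> (LINT z|\<S> T. \<bar>I (step n) z * Xn n z\<bar>)"
    using integral_abs_bound by simp
   also have "... \<le> (LINT z|\<S> T. \<bar>Xn n z - X z\<bar> + I (step n) z * \<bar>X z\<bar>)"
   proof (rule integral_mono)
    show "integrable (\<S> T) (%z. \<bar>I (step n) z * Xn n z\<bar>)" by (intro integrable_abs IX Xi)
    show "integrable (\<S> T) (%z. \<bar>Xn n z - X z\<bar> + I (step n) z * \<bar>X z\<bar>)"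
     by (intro L_integrable_add integrable_abs IX L_integrable_diff Xi)
    fix z
    show "\<bar>I (step n) z * Xn n z\<bar> \<le> \<bar>Xn n z - X z\<bar> + I (step n) z * \<bar>X z\<bar>"
     by (cases "T - step n < fst z") (auto simp: I_def)
   qed
   also have "... = (LINT z|\<S> T. \<bar>Xn n z - X z\<bar>) + (LINT z|\<S> T. I (step n) z * \<bar>X z\<bar>)"
    by (intro L_integral_add integrable_abs IX L_integrable_diff Xi)
   finally show "norm (LINT z|\<S> T. I (step n) z * Xn n z)
    \<le> (LINT z|\<S> T. \<bar>Xn n z - X z\<bar>) + (LINT z|\<S> T. I (step n) z * \<bar>X z\<bar>)" .
  qed
 qed
 \<comment> \<open>The factor \<open>h\<close> of \<open>density_identity\<close> cancels the
   division by the window length.\<close>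
 moreover have "(LINT z|\<S> T. I (step n) z * Xn n z) = (LINT z|\<S> T. (I (step n) z * (g z - r z)) * r z) / step n" for n
  using density_identity[OF step(1), of n] step(1)[of n] by (simp add: Xn_def sum_distrib_left mult_ac)
 ultimately have lim1: "(%n. (LINT z|\<S> T. (I (step n) z * (g z - r z)) * r z) / step n) \<leadsto> 0" by simp
 define a where "a t = (\<oint>x. \<rho>c t x * strunc T x)" for t
 have a_cont: "continuous_on {0..T} a"
  unfolding a_def[abs_def]
  by (rule \<rho>c_continuous[OF trunc_props(3)[OF T_in], where B = "max 0 c"])
   (use trunc_props(4)[OF T_in] trunc_props(5)[OF T_in, of _ 0] in auto)
 have "(%n. late (%t. a T - a t) (step n)) \<leadsto> a T - a T"
  by (rule late_tendsto) (intro continuous_intros a_cont)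
 moreover have "late (%t. a T - a t) (step n) = (LINT z|\<S> T. I (step n) z * (g z * (g z - r z))) / step n" for n
 proof -
  have i: "integrable (\<S> T) (%z. I (step n) z * (g z * (g z - r z)))"
  proof (rule bi)
   show "\<bar>I (step n) z * (g z * (g z - r z))\<bar> \<le> 1 * (c * c)" for z
    unfolding abs_mult using I_bounds g_bounds c_nonneg by (intro mult_mono) (auto simp: mult_nonneg_nonneg)
  qed measurable
  have "(LINT z|\<S> T. I (step n) z * (g z * (g z - r z)))
    = (LINT t|time T. (\<oint>x. I (step n) (t, x) * (g (t, x) * (g (t, x) - r (t, x)))))"
   by (rule TX.integral_fst'[OF i, symmetric])
  also have "... = (LINT t|time T. indicator {T - step n<..} t * (a T - a t))"
  proof (rule integral_cong_AE)
   show "(%t. (\<oint>x. I (step n) (t, x) * (g (t, x) * (g (t, x) - r (t, x))))) \<in> \<B> (time T)"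
    using TX.integrable_fst'[OF i] by simp
   have "integrable (time T) (%t. a T - a t)"
    by (rule continuous_AE_time_integrable) (intro continuous_intros a_cont)
   from integrable_time_indicator[OF _ this, of "{T - step n<..}"]
   show "(%t. indicator {T - step n<..} t * (a T - a t)) \<in> \<B> (time T)" by simp
   show "AE t in time T. (\<oint>x. I (step n) (t, x) * (g (t, x) * (g (t, x) - r (t, x)))) = indicator {T - step n<..} t * (a T - a t)"
    using rep_AE(1) AE_space
   proof eventually_elim
    case (elim t)
    have t: "t \<in> {0..T}" and ts: "t \<in> space (time T)" using elim(2) by auto
    have gi: "integrable torus (%x. \<rho>c s x * strunc T x)" if "s \<in> {0..T}" for s
     using integrable_bounded_times[OF \<rho>c_integrable[OF that] trunc_props(3)[OF T_in], of c] g_bounds[of "(0, x)" for x]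
     by (simp add: g_def mult.commute)
    have "(\<oint>x. g (t, x) * (g (t, x) - r (t, x))) = (\<oint>x. \<rho>c T x * strunc T x - \<rho>c t x * strunc T x)"
    proof (rule integral_cong_AE)
     show "AE x in torus. g (t, x) * (g (t, x) - r (t, x)) = \<rho>c T x * strunc T x - \<rho>c t x * strunc T x"
      using \<rho>c_bounds[OF T_in] elim(1) by eventually_elim (simp add: g_def strunc_def algebra_simps)
     show "(%x. g (t, x) * (g (t, x) - r (t, x))) \<in> \<B> torus"
      using measurable_compose[OF measurable_Pair1'[OF ts] g_measurable] measurable_compose[OF measurable_Pair1'[OF ts] r_measurable]
      by measurable
     show "(%x. \<rho>c T x * strunc T x - \<rho>c t x * strunc T x) \<in> \<B> torus"
      using gi[OF T_in] gi[OF t] by measurable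
    qed
    also have "... = a T - a t" using gi[OF T_in] gi[OF t] by (simp add: a_def)
    finally show ?case by (simp add: I_def)
   qed
  qed
  finally show ?thesis by (simp add: late_def)
 qed
 ultimately have lim2: "(%n. (LINT z|\<S> T. I (step n) z * (g z * (g z - r z))) / step n) \<leadsto> 0" by simp
 have "(LINT z|\<S> T. I h z * (g z - r z)\<^sup>2)
   = (LINT z|\<S> T. I h z * (g z * (g z - r z))) - (LINT z|\<S> T. (I h z * (g z - r z)) * r z)" for h
 proof -
  have 1: "integrable (\<S> T) (%z. I h z * (g z * (g z - r z)))"
  proof (rule bi)
   show "\<bar>I h z * (g z * (g z - r z))\<bar> \<le> 1 * (c * c)" for z
    unfolding abs_mult using I_bounds g_bounds c_nonneg by (intro mult_mono) (auto simp: mult_nonneg_nonneg)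
  qed measurable
  have 2: "integrable (\<S> T) (%z. (I h z * (g z - r z)) * r z)"
  proof (rule bi)
   show "\<bar>(I h z * (g z - r z)) * r z\<bar> \<le> (1 * c) * c" for z
    unfolding abs_mult using I_bounds g_bounds r_bounds c_nonneg by (intro mult_mono) (auto simp: mult_nonneg_nonneg)
  qed measurable
  have "I h z * (g z - r z)\<^sup>2 = I h z * (g z * (g z - r z)) - (I h z * (g z - r z)) * r z" for z
   by (simp add: power2_eq_square algebra_simps)
  then show ?thesis using 1 2 by simp
 qed
 then show ?thesis using tendsto_diff[OF lim2 lim1] by (simp add: diff_divide_distrib)
qed

text \<open>The renormalized equation gives a continuous version of the internal energy, but only up
  to null sets of times. That its value at \<open>T\<close> belongs to the representative of the
  density there follows from mean square convergence of the density in the final windows.\<close>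

theorem internal_energy_at_end:
 obtains C where "(%n. early pint (step n)) \<leadsto> C"
  and "(\<oint>x. \<rho>c T x powr \<gamma>) = C - (\<gamma> - 1) * (LINT z|\<S> T. p z * divv z)"
proof -
 note pd = p_divv_integrable
 define H where "H t = (\<oint>x. p (t, x) * divv (t, x))" for t
 have H: "integrable (time T) H" unfolding H_def[abs_def] using TX.integrable_fst'[OF pd] .
 obtain C where C: "AE t in time T. pint t = C - (\<gamma> - 1) * (LINT s|time T. indicator {..<t} s * H s)"
  unfolding pint_def H_def by (rule internal_energy_evolution)
 \<comment> \<open>The continuous version; averages of \<open>pint\<close> over windows at either
   end converge to its end values.\<close>
 define Q where "Q t = C - (\<gamma> - 1) * (LINT s|time T. indicator {..<t} s * H s)" for t
 have Qc: "continuous_on {0..T} Q"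
  unfolding Q_def[abs_def]
  by (intro continuous_intros continuous_on_subset[OF integral_before_continuous[OF H]]) auto
 have Qi: "integrable (time T) Q" by (rule continuous_AE_time_integrable[OF Qc])
 have CQ: "AE t in time T. pint t = Q t" using C by (simp add: Q_def)
 note av = early_AE_cong[OF pint_integrable Qi CQ]
 have "(LINT s|time T. indicator {..<0} s * H s) = (LINT s|time T. 0)"
  by (rule L_integral_cong) auto
 then have "Q 0 = C" by (simp add: Q_def)
 then have e: "(%n. early pint (step n)) \<leadsto> C" using early_tendsto[OF Qc] by (simp add: av)
 have l: "(%n. late pint (step n)) \<leadsto> Q T" using late_tendsto[OF Qc] by (simp add: av)
 have "(LINT s|time T. indicator {..<T} s * H s) = (LINT s|time T. H s)"
  by (rule L_integral_cong) auto
 also have "... = (LINT z|\<S> T. p z * divv z)" unfolding H_def by (rule TX.integral_fst'[OF pd])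
 finally have QT: "Q T = C - (\<gamma> - 1) * (LINT z|\<S> T. p z * divv z)" by (simp add: Q_def)
 define P where "P = (\<oint>x. strunc T x powr \<gamma>)"
 have P: "(\<oint>x. \<rho>c T x powr \<gamma>) = P"
  unfolding P_def
 proof (rule integral_cong_AE)
  show "AE x in torus. \<rho>c T x powr \<gamma> = strunc T x powr \<gamma>"
   using \<rho>c_bounds[OF T_in] by eventually_elim (simp add: strunc_def)
  show "(%x. \<rho>c T x powr \<gamma>) \<in> \<B> torus" using \<rho>c_measurable[OF T_in] by measurable
  show "(%x. strunc T x powr \<gamma>) \<in> \<B> torus" using trunc_props(3)[OF T_in] by measurable
 qed
 define K where "K = \<gamma> * c powr (\<gamma> - 1)"
 have K: "K \<ge> 0" using \<gamma>_gt by (simp add: K_def)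
 define \<Phi> where "\<Phi> n = (LINT z|\<S> T. I (step n) z * (g z - r z)\<^sup>2) / step n" for n
 have \<Phi>: "\<Phi> \<leadsto> 0" unfolding \<Phi>_def by (rule density_defect_tendsto)
 have sqi: "integrable (\<S> T) (%z. (g z - r z)\<^sup>2)"
  using bounded_power_integrable[OF _ g_bounds(3), where n = 2] by simp
 \<comment> \<open>\<open>K\<close> is the Lipschitz constant of the power on \<open>[0, c]\<close>.
   The free \<open>e\<close> exchanges the first power of the density error for its square, which is
   what \<open>\<Phi>\<close> controls.\<close>
 have bound: "\<bar>P - late pint (step n)\<bar> \<le> K * (e + \<Phi> n / e)" if e: "e > 0" for n e
 proof -
  have slice: "AE t in time T. \<bar>P - pint t\<bar> \<le> K * (e + (\<oint>x. (g (t, x) - r (t, x))\<^sup>2) / e)"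
   using TX.AE_integrable_fst'[OF sqi] TX.AE_integrable_fst'[OF L1_facts(7)] AE_space
  proof eventually_elim
   case (elim t)
   have si: "integrable torus (%x. strunc T x powr \<gamma>)"
    by (rule torus.integrable_const_bound[of _ "c powr \<gamma>"])
     (use trunc_props(3,4)[OF T_in] trunc_props(5)[OF T_in, of _ 0] c_nonneg \<gamma>_gt in \<open>auto intro!: AE_I2 powr_mono2\<close>)
   have "\<bar>P - pint t\<bar> = \<bar>(\<oint>x. strunc T x powr \<gamma> - p (t, x))\<bar>"
    using si elim(2) by (simp add: P_def pint_def)
   also have "... \<le> (\<oint>x. \<bar>strunc T x powr \<gamma> - p (t, x)\<bar>)" by (rule integral_abs_bound)
   also have "... \<le> (\<oint>x. K * (e + (g (t, x) - r (t, x))\<^sup>2 / e))"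
   proof (rule integral_mono)
    show "integrable torus (%x. \<bar>strunc T x powr \<gamma> - p (t, x)\<bar>)" using si elim(2) by simp
    show "integrable torus (%x. K * (e + (g (t, x) - r (t, x))\<^sup>2 / e))" using elim(1) by simp
    fix x
    have "\<bar>strunc T x powr \<gamma> - p (t, x)\<bar> \<le> K * \<bar>g (t, x) - r (t, x)\<bar>"
     unfolding p_def K_def g_def snd_conv
     using trunc_props(4)[OF T_in] trunc_props(5)[OF T_in, of _ 0] c_nonneg r_bounds \<gamma>_gt by (intro powr_Lipschitz) auto
    also have "... \<le> K * (e + (g (t, x) - r (t, x))\<^sup>2 / e)"
    proof (rule mult_left_mono[OF _ K])
     show "\<bar>y\<bar> \<le> e + y\<^sup>2 / e" for y
     proof -
      have "\<bar>y\<bar> * e \<le> e\<^sup>2 + \<bar>y\<bar>\<^sup>2"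
      proof (cases "\<bar>y\<bar> \<le> e")
       case True
       have "\<bar>y\<bar> * e \<le> e * e" using True e by (intro mult_right_mono) auto
       then show ?thesis by (simp add: power2_eq_square add_increasing2)
      next
       case False
       have "\<bar>y\<bar> * e \<le> \<bar>y\<bar> * \<bar>y\<bar>" using False by (intro mult_left_mono) auto
       then show ?thesis by (simp add: power2_eq_square add_increasing)
      qed
      then show ?thesis using e by (simp add: field_simps power2_eq_square)
     qed
    qed
    finally show "\<bar>strunc T x powr \<gamma> - p (t, x)\<bar> \<le> K * (e + (g (t, x) - r (t, x))\<^sup>2 / e)" .
   qed
   also have "... = K * (e + (\<oint>x. (g (t, x) - r (t, x))\<^sup>2) / e)" using elim(1) by simp
   finally show ?case .
  qed
  let ?J = "%t. indicator {T - step n<..} t :: real"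
  have J: "integrable (time T) ?J" using integrable_time_indicator[of "{T - step n<..}" T "%_. 1"] by simp
  have J1: "(LINT t|time T. ?J t) = step n" using measure_time_late[OF step(1,2)] by simp
  have Jp: "integrable (time T) (%t. ?J t * pint t)" by (rule integrable_time_indicator[OF _ pint_integrable]) simp
  have s: "integrable (time T) (%t. (\<oint>x. (g (t, x) - r (t, x))\<^sup>2))" using TX.integrable_fst'[OF sqi] .
  have Js: "integrable (time T) (%t. ?J t * (\<oint>x. (g (t, x) - r (t, x))\<^sup>2))" by (rule integrable_time_indicator[OF _ s]) simp
  have Iq: "integrable (\<S> T) (%z. I (step n) z * (g z - r z)\<^sup>2)"
   by (rule integrable_bounded_times[OF sqi I_measurable I_bounds(1)])
  have \<Phi>eq: "\<Phi> n = (LINT t|time T. ?J t * (\<oint>x. (g (t, x) - r (t, x))\<^sup>2)) / step n"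
   unfolding \<Phi>_def TX.integral_fst'[OF Iq, symmetric] by (simp add: I_def)
  have "\<bar>P * step n - (LINT t|time T. ?J t * pint t)\<bar> = \<bar>(LINT t|time T. ?J t * (P - pint t))\<bar>"
   using J Jp J1 by (simp add: right_diff_distrib mult.commute[of P] del: L_integral_indicator)
  also have "... \<le> (LINT t|time T. \<bar>?J t * (P - pint t)\<bar>)" by (rule integral_abs_bound)
  also have "... \<le> (LINT t|time T. ?J t * (K * (e + (\<oint>x. (g (t, x) - r (t, x))\<^sup>2) / e)))"
  proof (rule integral_mono_AE)
   show "integrable (time T) (%t. \<bar>?J t * (P - pint t)\<bar>)"
    using integrable_time_indicator[of "{T - step n<..}" T "%t. P - pint t"] pint_integrable by simp
   show "integrable (time T) (%t. ?J t * (K * (e + (\<oint>x. (g (t, x) - r (t, x))\<^sup>2) / e)))"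
    using s by (intro integrable_time_indicator) auto
   show "AE t in time T. \<bar>?J t * (P - pint t)\<bar> \<le> ?J t * (K * (e + (\<oint>x. (g (t, x) - r (t, x))\<^sup>2) / e))"
    using slice by eventually_elim (simp add: abs_mult mult_left_mono)
  qed
  also have "... = (LINT t|time T. (K * e) * ?J t + (K / e) * (?J t * (\<oint>x. (g (t, x) - r (t, x))\<^sup>2)))"
   by (rule L_integral_cong) (simp_all add: algebra_simps)
  also have "... = (K * e) * step n + (K / e) * (LINT t|time T. ?J t * (\<oint>x. (g (t, x) - r (t, x))\<^sup>2))"
   using J Js J1 by (simp del: L_integral_indicator)
  also have "... = step n * (K * (e + \<Phi> n / e))"
   unfolding \<Phi>eq using step(1)[of n] e by (simp add: field_simps)
  finally have "\<bar>P * step n - (LINT t|time T. ?J t * pint t)\<bar> / step n \<le> K * (e + \<Phi> n / e)"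
   using step(1)[of n] by (simp add: divide_le_eq mult.commute)
  moreover have "P - late pint (step n) = (P * step n - (LINT t|time T. ?J t * pint t)) / step n"
   unfolding late_def using step(1)[of n] by (simp add: diff_divide_distrib)
  ultimately show ?thesis using step(1)[of n] by (simp add: abs_divide)
 qed
 have le: "\<bar>P - Q T\<bar> \<le> K * e" if e: "e > 0" for e
 proof (rule LIMSEQ_le)
  show "(%n. \<bar>P - late pint (step n)\<bar>) \<leadsto> \<bar>P - Q T\<bar>" by (intro tendsto_intros l)
  have "(%n. K * (e + \<Phi> n / e)) \<leadsto> K * (e + 0 / e)" using e by (intro tendsto_intros \<Phi>) auto
  then show "(%n. K * (e + \<Phi> n / e)) \<leadsto> K * e" by simp
  show "\<exists>N. \<forall>n\<ge>N. \<bar>P - late pint (step n)\<bar> \<le> K * (e + \<Phi> n / e)" using bound[OF e] by blast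
 qed
 have "\<bar>P - Q T\<bar> \<le> 0"
 proof (rule field_le_epsilon)
  fix e :: real assume "e > 0"
  \<comment> \<open>\<open>K\<close> may be 0, namely when \<open>c\<close> is; hence
    \<open>K + 1\<close> in the denominator.\<close>
  then have "\<bar>P - Q T\<bar> \<le> K * (e / (K + 1))" using K by (intro le) simp
  also have "... \<le> e" using K \<open>e > 0\<close> by (simp add: field_simps)
  finally show "\<bar>P - Q T\<bar> \<le> 0 + e" by simp
 qed
 then have "(\<oint>x. \<rho>c T x powr \<gamma>) = C - (\<gamma> - 1) * (LINT z|\<S> T. p z * divv z)" using P QT by simp
 with e show thesis by (rule that)
qed

end

end

section \<open>The dissipation as a continuous function of time\<close>

context fluid
begin

definition dissipation_density :: "real \<times> (real^'d) => real"
 where "dissipation_density z = (\<mu> + lam) * (divv z)\<^sup>2 + \<mu> * (\<Sum>i\<in>UNIV. \<Sum>j\<in>UNIV. (D i j z)\<^sup>2)"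

definition dissipated :: "real => real"
 where "dissipated s = (LINT t|time T. indicator {..<s} t * (\<oint>x. dissipation_density (t, x)))"

lemma dissipation_density_integrable: "integrable (\<S> T) dissipation_density"
proof -
 have "integrable (\<S> T) (%z. (divv z)\<^sup>2)" "integrable (\<S> T) (%z. (D i j z)\<^sup>2)" for i j
  using divv_L2 D_L2[of i j] by simp_all
 then show ?thesis unfolding dissipation_density_def[abs_def]
  by (intro L_integrable_add integrable_mult_right L_integrable_sum)
qed

lemma dissipated_continuous: "continuous_on UNIV dissipated"
 unfolding dissipated_def[abs_def]
 by (rule integral_before_continuous) (rule TX.integrable_fst'[OF dissipation_density_integrable])

lemma dissipated_T: "dissipated T = (LINT z|\<S> T. dissipation_density z)"
proof -
 have "dissipated T = (LINT t|time T. (\<oint>x. dissipation_density (t, x)))"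
  unfolding dissipated_def by (rule L_integral_cong) auto
 then show ?thesis by (simp add: TX.integral_fst'[OF dissipation_density_integrable])
qed

context
 assumes coeff: "\<mu> \<ge> 0" "\<mu> + lam \<ge> 0"
begin

lemma dissipation_density_nonneg: "0 \<le> dissipation_density z"
 unfolding dissipation_density_def
 by (rule add_nonneg_nonneg; rule mult_nonneg_nonneg) (use coeff in \<open>simp_all add: sum_nonneg\<close>)

lemma dissipated_nonneg: "0 \<le> dissipated s"
 unfolding dissipated_def using dissipation_density_nonneg by (intro integral_nonneg_AE AE_I2) simp

lemma dissipation_eq:
 assumes s: "s \<in> {0..T}"
 shows "dissipation \<mu> lam s Dv = ennreal (dissipated s)"
proof -
 let ?e = "%t x. ennreal (\<mu> * (norm (Dv t x))\<^sup>2 + (\<mu> + lam) * (trace (Dv t x))\<^sup>2)"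
 have e: "?e t x = ennreal (dissipation_density (t, x))" for t x
 proof -
  have "(norm (Dv t x))\<^sup>2 = (\<Sum>i\<in>UNIV. \<Sum>j\<in>UNIV. (D i j (t, x))\<^sup>2)"
   unfolding power2_norm_eq_inner inner_vec_def D_def by (simp add: power2_eq_square inner_vec_def)
  moreover have "trace (Dv t x) = divv (t, x)" by (simp add: trace_def divv_def D_def)
  ultimately show ?thesis by (simp add: dissipation_density_def add.commute)
 qed
 let ?H = "%t. (\<oint>x. dissipation_density (t, x))"
 have "dissipation \<mu> lam s Dv = (\<integral>\<^sup>+t. (NN x. ennreal (dissipation_density (t, x))) \<partial>time s)"
  unfolding dissipation_def e ..
 also have "... = (\<integral>\<^sup>+t. (NN x. ennreal (dissipation_density (t, x))) * indicator {..<s} t \<partial>time T)"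
  unfolding time_def using s
  by (auto simp: nn_integral_restrict_space mult.assoc intro!: nn_integral_cong split: split_indicator)
 also have "... = (\<integral>\<^sup>+t. ennreal (indicator {..<s} t * ?H t) \<partial>time T)"
 proof (rule nn_integral_cong_AE)
  show "AE t in time T. (NN x. ennreal (dissipation_density (t, x))) * indicator {..<s} t = ennreal (indicator {..<s} t * ?H t)"
   using TX.AE_integrable_fst'[OF dissipation_density_integrable]
  proof eventually_elim
   case (elim t)
   have "(NN x. ennreal (dissipation_density (t, x))) = ennreal (?H t)"
    by (rule nn_integral_eq_integral[OF elim]) (simp add: dissipation_density_nonneg)
   then show ?case by (simp split: split_indicator)
  qed
 qed
 also have "... = ennreal (dissipated s)"
  unfolding dissipated_def
  by (intro nn_integral_eq_integral integrable_time_indicator TX.integrable_fst'[OF dissipation_density_integrable] AE_I2 mult_nonneg_nonneg integral_nonneg_AE)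
   (auto simp: dissipation_density_nonneg)
 finally show ?thesis .
qed

end

end

section \<open>Comparison of the energies at both ends\<close>

context fluid_rep
begin

definition E_end :: real
 where "E_end = KE T + (\<oint>x. \<rho>c T x powr \<gamma>) / (\<gamma> - 1)"

text \<open>The energy inequality holds for almost every time only. With the energy replaced by
  \<open>lower\<close>, both terms are continuous, so it persists at \<open>T\<close>.\<close>

lemma energy_bound_end:
 fixes u :: "'d => real^'d => real" and s :: "real^'d => real" and B E :: real
 assumes coeff: "\<mu> \<ge> 0" "\<mu> + lam \<ge> 0" and E: "E \<ge> 0"
  and ineq: "AE t in time T. energy \<gamma> (\<rho> t) (v t) + dissipation \<mu> lam t Dv \<le> ennreal E"
  and us: "!!i. u i \<in> \<B> torus" "!!i x. \<bar>u i x\<bar> \<le> B"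
   "s \<in> \<B> torus" "!!x. 0 \<le> s x" "!!x. s x \<le> B"
 shows "lower u s T + dissipated T \<le> E"
proof -
 have ll: "AE t in time T. lower u s t \<le> kin t + pint t / (\<gamma> - 1)" by (rule lower_le[OF us])
 have "0 \<le> E - dissipated T - lower u s T"
 proof (rule continuous_AE_time_nonneg[where f = "%t. E - dissipated t - lower u s t" and t = T, OF T_pos])
  show "continuous_on {0..T} (%t. E - dissipated t - lower u s t)"
   by (intro continuous_intros lower_continuous[OF us] continuous_on_subset[OF dissipated_continuous]) auto
  show "AE t in time T. 0 \<le> E - dissipated t - lower u s t"
   using ineq energy_eq ll AE_space
  proof eventually_elim
   case (elim t)
   have "dissipation \<mu> lam t Dv = ennreal (dissipated t)" using elim(4) by (intro dissipation_eq[OF coeff]) auto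
   then have le: "ennreal (kin t + pint t / (\<gamma> - 1)) + ennreal (dissipated t) \<le> ennreal E" using elim(1,2) by simp
   have "0 \<le> kin t + pint t / (\<gamma> - 1)"
    unfolding kin_def pint_def using r_bounds p_bounds \<gamma>_gt
    by (intro add_nonneg_nonneg divide_nonneg_nonneg integral_nonneg_AE AE_I2 mult_nonneg_nonneg sum_nonneg) auto
   then have "kin t + pint t / (\<gamma> - 1) + dissipated t \<le> E"
    using le dissipated_nonneg[OF coeff, of t] E by (simp flip: ennreal_plus)
   then show ?case using elim(3) by linarith
  qed
 qed (use T_pos in simp)
 then show ?thesis by simp
qed

context
 fixes E :: real
 assumes coeff: "\<mu> \<ge> 0" "\<mu> + lam \<ge> 0" and E: "E \<ge> 0"
  and ineq: "AE t in time T. energy \<gamma> (\<rho> t) (v t) + dissipation \<mu> lam t Dv \<le> ennreal E"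
begin

lemma T_mem: "T \<in> {0..T}" using T_pos by simp

lemma energy_mom_end_le: "energy_mom \<gamma> (\<rho>c T) (mc T) + dissipation \<mu> lam T Dv \<le> ennreal E"
proof -
 have bound: "lower (ptrunc T n) (strunc T) T + dissipated T \<le> E" for n
  by (rule energy_bound_end[OF coeff E ineq trunc_props[OF T_mem]])
 have le: "energy_mom \<gamma> (\<rho>c T) (mc T) \<le> ennreal (E - dissipated T)"
  unfolding lower_trunc_SUP(1)[OF T_mem, symmetric]
  by (intro SUP_least ennreal_leI) (simp add: le_diff_eq bound)
 have "0 \<le> E - dissipated T" using bound[of 0] lower_trunc_SUP(2)[OF T_mem, of 0] by simp
 then have "ennreal (E - dissipated T) + ennreal (dissipated T) = ennreal E"
  using dissipated_nonneg[OF coeff, of T] by (simp flip: ennreal_plus)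
 then show ?thesis using add_right_mono[OF le, of "ennreal (dissipated T)"] by (simp add: dissipation_eq[OF coeff T_mem])
qed

text \<open>Test velocities of size \<open>k\<close> on the vacuum of the final density see the momentum there,
 but no mass; letting \<open>k\<close> grow shows that this momentum vanishes.\<close>

lemma vacuum_end: "AE x in torus. \<rho>c T x = 0 --> mc T x = 0"
proof -
 note [measurable] = \<rho>c_measurable[OF T_mem] mc_nth_measurable[OF T_mem] mc_measurable[OF T_mem]
 define w where "w i x = (if \<rho>c T x \<le> 0 then \<bar>mc T x $ i\<bar> else 0)" for i x
 have w: "integrable torus (w i)" for i
  by (rule L_integrable_bound[OF mc_nth_integrable[OF T_mem, of i]]) (auto simp: w_def[abs_def])
 have w0: "0 \<le> (\<oint>x. w i x)" for i by (rule integral_nonneg_AE) (simp add: w_def)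
 have "k * (\<Sum>i\<in>UNIV. (\<oint>x. w i x)) \<le> E" if k: "k \<ge> 0" for k
 proof -
  define u where "u i x = (if \<rho>c T x \<le> 0 then k * sgn (mc T x $ i) else 0)" for i x
  have um: "u i \<in> \<B> torus" for i unfolding u_def[abs_def] by measurable
  have ub: "\<bar>u i x\<bar> \<le> k" for i x using k by (auto simp: u_def abs_mult sgn_if)
  have "lower u (%x. 0) T + dissipated T \<le> E"
   by (rule energy_bound_end[OF coeff E ineq um ub]) (use k in auto)
  moreover have "(\<oint>x. \<rho>c T x * (\<Sum>i\<in>UNIV. u i x * u i x)) = (LINT x|(torus :: (real^'d) measure). 0)"
  proof (rule integral_cong_AE)
   show "AE x in torus. \<rho>c T x * (\<Sum>i\<in>UNIV. u i x * u i x) = 0"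
    using \<rho>c_bounds[OF T_mem] proof eventually_elim
    case (elim x) show ?case by (cases "\<rho>c T x = 0") (use elim in \<open>auto simp: u_def\<close>)
   qed
   show "(%x. \<rho>c T x * (\<Sum>i\<in>UNIV. u i x * u i x)) \<in> \<B> torus" using um by measurable
  qed simp
  moreover have "(%x. mc T x $ i * u i x) = (%x. k * w i x)" for i
   by (auto simp: u_def w_def sgn_if)
  ultimately show ?thesis
   using dissipated_nonneg[OF coeff, of T] by (simp add: lower_def sum_distrib_left)
 qed
 \<comment> \<open>If the sum \<open>S\<close> were positive, the choice
   \<open>k = (E + 1) / S\<close> would give \<open>E + 1 \<le> E\<close>.\<close>
 from this[of "(E + 1) / S" for S] have "(\<Sum>i\<in>UNIV. (\<oint>x. w i x)) \<le> 0"
 proof (rule_tac ccontr)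
  assume A: "!!S. 0 \<le> (E + 1) / S ==> (E + 1) / S * (\<Sum>i\<in>UNIV. (\<oint>x. w i x)) \<le> E"
   and "\<not> (\<Sum>i\<in>UNIV. (\<oint>x. w i x)) \<le> 0"
  then show False using A[of "\<Sum>i\<in>UNIV. (\<oint>x. w i x)"] E by simp
 qed
 then have z: "(\<Sum>i\<in>UNIV. (\<oint>x. w i x)) = 0" using sum_nonneg[of UNIV "%i. (\<oint>x. w i x)"] w0 by fastforce
 have wz: "(\<oint>x. w i x) = 0" for i
  using z w0 by (subst (asm) sum_nonneg_eq_0_iff) auto
 have nn: "AE x in torus. 0 \<le> w i x" for i by (simp add: w_def)
 have "AE x in torus. w i x = 0" for i
  using wz[of i] integral_nonneg_eq_0_iff_AE[OF w nn] by blast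
 then have "AE x in torus. \<forall>i. w i x = 0" by (simp add: AE_all_countable)
 then show ?thesis by eventually_elim (auto simp: w_def vec_eq_iff split: if_splits)
qed

lemma KE_end_integrable: "integrable torus (%x. if \<rho>c T x > 0 then (norm (mc T x))\<^sup>2 / (2 * \<rho>c T x) else 0)"
 and energy_mom_end_eq: "energy_mom \<gamma> (\<rho>c T) (mc T) = ennreal E_end"
proof -
 note [measurable] = \<rho>c_measurable[OF T_mem] mc_measurable[OF T_mem]
 let ?k = "%x. if \<rho>c T x > 0 then (norm (mc T x))\<^sup>2 / (2 * \<rho>c T x) else 0"
 let ?p = "%x. \<rho>c T x powr \<gamma> / (\<gamma> - 1)"
 have k0: "0 \<le> ?k x" and p0: "0 \<le> ?p x" for x using \<gamma>_gt by auto
 have p: "integrable torus (%x. \<rho>c T x powr \<gamma>)"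
 proof (rule torus.integrable_const_bound)
  show "AE x in torus. norm (\<rho>c T x powr \<gamma>) \<le> c powr \<gamma>"
   using \<rho>c_bounds[OF T_mem] by eventually_elim (use \<gamma>_gt in \<open>auto intro: powr_mono2\<close>)
 qed measurable
 have "(NN x. ennreal (?k x)) \<le> energy_mom \<gamma> (\<rho>c T) (mc T)"
  unfolding energy_mom_def using p0 by (intro nn_integral_mono ennreal_leI) simp
 also have "... \<le> energy_mom \<gamma> (\<rho>c T) (mc T) + dissipation \<mu> lam T Dv" by simp
 also have "... \<le> ennreal E" by (rule energy_mom_end_le)
 also have "... < \<infinity>" by simp
 finally show k: "integrable torus ?k"
  using k0 by (intro integrableI_bounded) auto
 have "energy_mom \<gamma> (\<rho>c T) (mc T) = ennreal (\<oint>x. ?k x + ?p x)"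
  unfolding energy_mom_def using k p k0 p0
  by (intro nn_integral_eq_integral L_integrable_add AE_I2 add_nonneg_nonneg) auto
 then show "energy_mom \<gamma> (\<rho>c T) (mc T) = ennreal E_end"
  using k p by (simp add: E_end_def KE_def)
qed

text \<open>The pressure work enters the kinetic and the internal balance with opposite signs and
  cancels, leaving the dissipation. The initial averages of \<open>kin\<close> are not known to
  converge, so the averages of kinetic plus internal energy are bounded below by those of a
  continuous minorant \<open>L\<close>.\<close>

lemma lower_bound_end:
 fixes R :: "real => real^'d => real^'d"
 assumes R: "weak_grad T (%t x. sqrt (\<rho> t x)) R" "integrable (\<S> T) (%(t, x). (norm (R t x))\<^sup>2)"
  and L: "continuous_on {0..T} L" "AE t in time T. L t \<le> kin t + pint t / (\<gamma> - 1)"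
 shows "L 0 \<le> E_end + dissipated T"
proof -
 obtain C where C: "(%n. early pint (step n)) \<leadsto> C"
  "(\<oint>x. \<rho>c T x powr \<gamma>) = C - (\<gamma> - 1) * (LINT z|\<S> T. p z * divv z)"
  using internal_energy_at_end[OF R] .
 have Li: "integrable (time T) L" by (rule continuous_AE_time_integrable[OF L(1)])
 have le: "early L h \<le> early kin h + early pint h / (\<gamma> - 1)" if "h > 0" for h
 proof -
  have i: "integrable (time T) (%t. indicator {..h} t * f t)" if "integrable (time T) f" for f :: "real => real"
   by (rule integrable_time_indicator[OF _ that]) simp
  have "(LINT t|time T. indicator {..h} t * L t)
   \<le> (LINT t|time T. indicator {..h} t * kin t + indicator {..h} t * pint t / (\<gamma> - 1))"
  proof (rule integral_mono_AE)
   show "AE t in time T. indicator {..h} t * L t \<le> indicator {..h} t * kin t + indicator {..h} t * pint t / (\<gamma> - 1)"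
    using L(2) by eventually_elim (simp split: split_indicator)
  qed (intro i Li L_integrable_add integrable_divide kin_integrable pint_integrable)+
  also have "... = (LINT t|time T. indicator {..h} t * kin t) + (LINT t|time T. indicator {..h} t * pint t) / (\<gamma> - 1)"
   by (subst L_integral_add) (use i kin_integrable pint_integrable in auto)
  finally show ?thesis
   unfolding early_def using \<open>h > 0\<close> by (drule_tac divide_right_mono[where c = h]) (simp_all add: add_divide_distrib mult.commute)
 qed
 have "L 0 - C / (\<gamma> - 1) + (LINT z|\<S> T. flux z) \<le> KE T"
 proof (rule LIMSEQ_le_const2)
  show "(%n. early L (step n) - early pint (step n) / (\<gamma> - 1) + (LINT z|\<S> T. flux_forward (step n) z))
   \<leadsto> L 0 - C / (\<gamma> - 1) + (LINT z|\<S> T. flux z)"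
   using \<gamma>_gt by (intro tendsto_add tendsto_diff tendsto_divide tendsto_const early_tendsto L(1) C(1) flux_forward_conv step) auto
  have "early L (step n) - early pint (step n) / (\<gamma> - 1) + (LINT z|\<S> T. flux_forward (step n) z) \<le> KE T" for n
   using le[OF step(1)[of n]] kinetic_forward[OF step(1,2) vacuum_end KE_end_integrable, of n] by linarith
  then show "\<exists>N. \<forall>n\<ge>N. early L (step n) - early pint (step n) / (\<gamma> - 1) + (LINT z|\<S> T. flux_forward (step n) z) \<le> KE T" by blast
 qed
 moreover have "(LINT z|\<S> T. flux z) = (LINT z|\<S> T. p z * divv z) - dissipated T"
 proof -
  have "integrable (\<S> T) flux" by (rule flux_forward_conv(2)[OF step(1,3)])
  then have "(LINT z|\<S> T. flux z) + dissipated T = (LINT z|\<S> T. flux z + dissipation_density z)"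
   using dissipation_density_integrable by (simp add: dissipated_T)
  also have "... = (LINT z|\<S> T. p z * divv z)" by (simp add: flux_def dissipation_density_def)
  finally show ?thesis by simp
 qed
 moreover have "(\<oint>x. \<rho>c T x powr \<gamma>) / (\<gamma> - 1) = C / (\<gamma> - 1) - (LINT z|\<S> T. p z * divv z)"
  using C(2) \<gamma>_gt by (simp add: diff_divide_distrib)
 ultimately show ?thesis by (simp add: E_end_def)
qed

end

end

text \<open>Two representatives occur: the given one at time \<open>T\<close>, and the one carrying
  the initial data at time 0. They are linked through \<open>lower_le\<close>, whose right-hand side
  depends on density and velocity only.\<close>

theorem energy_equality_L4:
 fixes v :: "real => real^'d::finite => real^'d" and \<rho>0 :: "real^'d => real"
 assumes fluid: "fluid T \<gamma> \<mu> lam c \<rho> v Dv"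
  and reps: "density_momentum_rep T \<gamma> \<rho> v \<rho>c mc" "density_momentum_rep T \<gamma> \<rho> v \<rho>i mi"
  and coeff: "\<mu> \<ge> 0" "\<mu> + lam \<ge> 0"
  and init: "\<rho>0 \<in> \<B> torus" "v0 \<in> Lp torus 2"
   "AE x in torus. \<rho>i 0 x = \<rho>0 x" "AE x in torus. mi 0 x = \<rho>0 x *\<^sub>R v0 x"
  and ineq: "AE t in time T. energy \<gamma> (\<rho> t) (v t) + dissipation \<mu> lam t Dv \<le> energy \<gamma> \<rho>0 v0"
  and R: "weak_grad T (%t x. sqrt (\<rho> t x)) R" "integrable (\<S> T) (%(t, x). (norm (R t x))\<^sup>2)"
 shows "energy_mom \<gamma> (\<rho>c T) (mc T) + dissipation \<mu> lam T Dv = energy \<gamma> \<rho>0 v0 \<and> energy \<gamma> \<rho>0 v0 < \<infinity>"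
proof -
 interpret F: fluid T \<gamma> \<mu> lam c \<rho> v Dv by (rule fluid)
 interpret A: fluid_rep T \<gamma> \<mu> lam c \<rho> v Dv \<rho>c mc by unfold_locales (rule reps)
 interpret B: fluid_rep T \<gamma> \<mu> lam c \<rho> v Dv \<rho>i mi by unfold_locales (rule reps)
 have T0: "0 \<in> {0..T}" and TT: "T \<in> {0..T}" using F.T_pos by auto
 have bd: "AE x in torus. 0 \<le> \<rho>0 x \<and> \<rho>0 x \<le> c"
  using B.\<rho>c_bounds[OF T0] init(3) by eventually_elim simp
 have eq: "energy_mom \<gamma> (\<rho>i 0) (mi 0) = energy \<gamma> \<rho>0 v0"
  unfolding energy_mom_def energy_def
 proof (rule nn_integral_cong_AE)
  show "AE x in torus. ennreal ((if \<rho>i 0 x > 0 then (norm (mi 0 x))\<^sup>2 / (2 * \<rho>i 0 x) else 0) + \<rho>i 0 x powr \<gamma> / (\<gamma> - 1))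
   = ennreal (1 / 2 * \<rho>0 x * (norm (v0 x))\<^sup>2 + \<rho>0 x powr \<gamma> / (\<gamma> - 1))"
   using bd init(3,4) by eventually_elim (auto simp: power_mult_distrib power2_eq_square mult_ac)
 qed
 have "energy \<gamma> \<rho>0 v0 \<le> (NN x. ennreal (c * (norm (v0 x) powr 2) + c powr \<gamma> / (\<gamma> - 1)))"
  unfolding energy_def
 proof (rule nn_integral_mono_AE)
  show "AE x in torus. ennreal (1 / 2 * \<rho>0 x * (norm (v0 x))\<^sup>2 + \<rho>0 x powr \<gamma> / (\<gamma> - 1))
   \<le> ennreal (c * (norm (v0 x) powr 2) + c powr \<gamma> / (\<gamma> - 1))"
   using bd
  proof eventually_elim
   case (elim x)
   then have "\<rho>0 x * (norm (v0 x))\<^sup>2 \<le> c * (norm (v0 x))\<^sup>2" "0 \<le> \<rho>0 x * (norm (v0 x))\<^sup>2"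
    by (auto intro: mult_right_mono)
   then have "1 / 2 * \<rho>0 x * (norm (v0 x))\<^sup>2 \<le> c * norm (v0 x) powr 2" by (simp add: powr_numeral)
   then show ?case using F.\<gamma>_gt elim
    by (intro ennreal_leI add_mono divide_right_mono powr_mono2) auto
  qed
 qed
 also have "... = ennreal (\<oint>x. c * (norm (v0 x) powr 2) + c powr \<gamma> / (\<gamma> - 1))"
  using init(2) F.c_nonneg F.\<gamma>_gt by (intro nn_integral_eq_integral) (auto simp: Lp_def)
 also have "... < \<infinity>" by simp
 finally have fin: "energy \<gamma> \<rho>0 v0 < \<infinity>" .
 then obtain E where E: "E \<ge> 0" "energy \<gamma> \<rho>0 v0 = ennreal E"
  by (cases "energy \<gamma> \<rho>0 v0") auto
 note ineq' = ineq[unfolded E(2)]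
 \<comment> \<open>The minorant belongs to the second representative, with parameters read off at
   time 0; their supremum over \<open>n\<close> is the initial energy.\<close>
 have "B.lower (B.ptrunc 0 n) (B.strunc 0) 0 \<le> A.E_end + F.dissipated T" for n
  using B.lower_continuous[OF B.trunc_props[OF T0]] B.lower_le[OF B.trunc_props[OF T0]]
  by (rule A.lower_bound_end[OF coeff E(1) ineq' R])
 moreover have E_end: "0 \<le> A.E_end"
  unfolding A.E_end_def A.KE_def using F.\<gamma>_gt
  by (intro add_nonneg_nonneg divide_nonneg_nonneg integral_nonneg_AE AE_I2) auto
 ultimately have "energy \<gamma> \<rho>0 v0 \<le> ennreal (A.E_end + F.dissipated T)"
  unfolding eq[symmetric] B.lower_trunc_SUP(1)[OF T0, symmetric] by (intro SUP_least ennreal_leI)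
 also have "... \<le> energy_mom \<gamma> (\<rho>c T) (mc T) + dissipation \<mu> lam T Dv"
  unfolding A.energy_mom_end_eq[OF coeff E(1) ineq'] F.dissipation_eq[OF coeff TT]
  using E_end F.dissipated_nonneg[OF coeff] by simp
 finally show ?thesis using A.energy_mom_end_le[OF coeff E(1) ineq'] fin E(2) by (simp add: antisym)
qed

section \<open>Sobolev's inequality on the torus\<close>

lemma nn_integral_powr_from_0:
 assumes "s > 0" "0 \<le> y" "0 \<le> k"
 shows "(\<integral>\<^sup>+x. ennreal (k * (indicator {0..y} x * x powr (s - 1))) \<partial>lborel) = ennreal (k * (y powr s / s))"
proof -
 have "((%x. x powr (s - 1)) has_integral (y powr (s - 1 + 1) / (s - 1 + 1))) {0..y}"
  by (rule has_integral_powr_from_0) (use assms in auto)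
 from nn_integral_has_integral_lebesgue[OF _ has_integral_mult_right[OF this, of k]]
 show ?thesis using assms by (simp add: mult.left_commute)
qed

lemma nn_integral_powr_to_inf:
 assumes "s > 0" "0 < y" "0 \<le> k"
 shows "(\<integral>\<^sup>+x. ennreal (k * (indicator {y..} x * x powr (- s - 1))) \<partial>lborel) = ennreal (k * (y powr (- s) / s))"
proof -
 have "((%x. x powr (- s - 1)) has_integral (- (y powr (- s - 1 + 1)) / (- s - 1 + 1))) {y..}"
  by (rule has_integral_powr_to_inf) (use assms in auto)
 from nn_integral_has_integral_lebesgue[OF _ has_integral_mult_right[OF this, of k]]
 show ?thesis using assms by (simp add: mult.left_commute)
qed

text \<open>Marcinkiewicz' argument: a weak bound in which only the large values of \<open>g\<close> enter at each
 level integrates to a strong bound.\<close>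

lemma strong_type:
 fixes w g :: "'a => real"
 assumes "sigma_finite_measure M"
  and w [measurable]: "w \<in> \<B> M" and g [measurable]: "g \<in> \<B> M"
  and w0: "!!x. 0 \<le> w x" and g0: "!!x. 0 \<le> g x"
  and par: "r > 1" "b > 0" "A > 0" "B > 0"
  and weak: "!!l. l > 0 ==> emeasure M {x \<in> space M. l < w x}
   \<le> (\<integral>\<^sup>+y. ennreal (A * l powr (- 1 - b) * g y * indicator {..<g y} (B * l powr (1 + b))) \<partial>M)"
 shows "(\<integral>\<^sup>+x. ennreal (w x powr (r * (1 + b))) \<partial>M)
  \<le> ennreal (r * A / ((r - 1) * B powr (r - 1))) * (\<integral>\<^sup>+x. ennreal (g x powr r) \<partial>M)"
proof -
 interpret M: sigma_finite_measure M by fact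
 interpret P: pair_sigma_finite M lborel by unfold_locales
 define q where "q = r * (1 + b)"
 have q: "q > 0" using par by (simp add: q_def)
 \<comment> \<open>The layer cake formula: a q-th power is the integral of
   \<open>q l^(q - 1)\<close> over the levels below it.\<close>
 have "(\<integral>\<^sup>+x. ennreal (w x powr q) \<partial>M) = (\<integral>\<^sup>+x. (\<integral>\<^sup>+l. ennreal (q * (indicator {0..w x} l * l powr (q - 1))) \<partial>lborel) \<partial>M)"
 proof (rule nn_integral_cong)
  fix x
  show "ennreal (w x powr q) = (\<integral>\<^sup>+l. ennreal (q * (indicator {0..w x} l * l powr (q - 1))) \<partial>lborel)"
   using q w0 by (simp add: nn_integral_powr_from_0)
 qed
 also have "... = (\<integral>\<^sup>+x. (\<integral>\<^sup>+l. ennreal (q * l powr (q - 1)) * indicator {0<..} l * (if l < w x then 1 else 0) \<partial>lborel) \<partial>M)"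
 proof (rule nn_integral_cong, rule nn_integral_cong_AE)
  fix x
  have "AE l in lborel. l \<noteq> 0 \<and> l \<noteq> w x" by (simp add: AE_lborel_singleton AE_conj_iff)
  then show "AE l in lborel. ennreal (q * (indicator {0..w x} l * l powr (q - 1)))
    = ennreal (q * l powr (q - 1)) * indicator {0<..} l * (if l < w x then 1 else 0)"
   by eventually_elim (use w0 in \<open>auto split: split_indicator\<close>)
 qed
 also have "... = (\<integral>\<^sup>+l. (\<integral>\<^sup>+x. ennreal (q * l powr (q - 1)) * indicator {0<..} l * (if l < w x then 1 else 0) \<partial>M) \<partial>lborel)"
  by (rule P.Fubini'[symmetric]) measurable
 also have "... \<le> (\<integral>\<^sup>+l. (\<integral>\<^sup>+y. ennreal (q * A * g y * (indicator {0..(g y / B) powr (1 / (1 + b))} l * l powr ((r - 1) * (1 + b) - 1))) \<partial>M) \<partial>lborel)"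
 proof (rule nn_integral_mono)
  fix l :: real
  show "(\<integral>\<^sup>+x. ennreal (q * l powr (q - 1)) * indicator {0<..} l * (if l < w x then 1 else 0) \<partial>M)
   \<le> (\<integral>\<^sup>+y. ennreal (q * A * g y * (indicator {0..(g y / B) powr (1 / (1 + b))} l * l powr ((r - 1) * (1 + b) - 1))) \<partial>M)"
  proof (cases "l > 0")
   case True
   have "(\<integral>\<^sup>+x. (if l < w x then 1 else 0) \<partial>M) = emeasure M {x \<in> space M. l < w x}"
   proof -
    have "(\<integral>\<^sup>+x. (if l < w x then 1 else 0) \<partial>M) = (\<integral>\<^sup>+x. indicator {x \<in> space M. l < w x} x \<partial>M)"
     by (rule nn_integral_cong) simp
    then show ?thesis by simp
   qed
   then have "(\<integral>\<^sup>+x. ennreal (q * l powr (q - 1)) * indicator {0<..} l * (if l < w x then 1 else 0) \<partial>M)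
     = ennreal (q * l powr (q - 1)) * emeasure M {x \<in> space M. l < w x}"
    using True by (simp add: nn_integral_cmult)
   also have "... \<le> ennreal (q * l powr (q - 1)) * (\<integral>\<^sup>+y. ennreal (A * l powr (- 1 - b) * g y * indicator {..<g y} (B * l powr (1 + b))) \<partial>M)"
    by (intro mult_left_mono weak True) simp
   also have "... = (\<integral>\<^sup>+y. ennreal (q * l powr (q - 1) * (A * l powr (- 1 - b) * g y * indicator {..<g y} (B * l powr (1 + b)))) \<partial>M)"
    using q by (subst nn_integral_cmult[symmetric]) (auto simp: ennreal_mult')
   also have "... \<le> (\<integral>\<^sup>+y. ennreal (q * A * g y * (indicator {0..(g y / B) powr (1 / (1 + b))} l * l powr ((r - 1) * (1 + b) - 1))) \<partial>M)"
   proof (intro nn_integral_mono ennreal_leI)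
    fix y
    \<comment> \<open>Solving the level condition for \<open>l\<close> gives an interval of levels
      for each \<open>y\<close>, so that after Fubini the integral over levels is explicit.\<close>
    have "l \<le> (g y / B) powr (1 / (1 + b))" if "B * l powr (1 + b) < g y"
    proof -
     have "l = (l powr (1 + b)) powr (1 / (1 + b))" using True par by (simp add: powr_powr)
     also have "... \<le> (g y / B) powr (1 / (1 + b))"
      using that par by (intro powr_mono2) (auto simp: field_simps)
     finally show ?thesis .
    qed
    moreover have "l powr (q - 1) * l powr (- 1 - b) = l powr ((r - 1) * (1 + b) - 1)"
     by (simp add: powr_add[symmetric] q_def algebra_simps)
    ultimately show "q * l powr (q - 1) * (A * l powr (- 1 - b) * g y * indicator {..<g y} (B * l powr (1 + b)))
     \<le> q * A * g y * (indicator {0..(g y / B) powr (1 / (1 + b))} l * l powr ((r - 1) * (1 + b) - 1))"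
     using True q par g0[of y] by (auto simp: mult_ac split: split_indicator)
   qed
   finally show ?thesis .
  qed simp
 qed
 also have "... = (\<integral>\<^sup>+y. (\<integral>\<^sup>+l. ennreal (q * A * g y * (indicator {0..(g y / B) powr (1 / (1 + b))} l * l powr ((r - 1) * (1 + b) - 1))) \<partial>lborel) \<partial>M)"
  unfolding indicator_def atLeastAtMost_iff by (rule P.Fubini') measurable
 also have "... = (\<integral>\<^sup>+y. ennreal (r * A / ((r - 1) * B powr (r - 1))) * ennreal (g y powr r) \<partial>M)"
 proof (rule nn_integral_cong)
  fix y
  let ?s = "(r - 1) * (1 + b)" and ?y = "(g y / B) powr (1 / (1 + b))"
  have s: "?s > 0" using par by simp
  have "(\<integral>\<^sup>+l. ennreal (q * A * g y * (indicator {0..?y} l * l powr (?s - 1))) \<partial>lborel) = ennreal (q * A * g y * (?y powr ?s / ?s))"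
   using q par g0 s by (intro nn_integral_powr_from_0) auto
  also have "?y powr ?s = g y powr (r - 1) / B powr (r - 1)" using par g0 by (simp add: powr_powr powr_divide)
  also have "q * A * g y * (g y powr (r - 1) / B powr (r - 1) / ?s) = r * A / ((r - 1) * B powr (r - 1)) * g y powr r"
  proof -
   have "g y powr r = g y * g y powr (r - 1)" using g0[of y] powr_mult_base[of "g y" "r - 1"] by simp
   moreover have "1 + b \<noteq> 0" "r - 1 \<noteq> 0" "B powr (r - 1) \<noteq> 0" using par by auto
   ultimately show ?thesis by (simp add: q_def divide_simps)
  qed
  finally show "(\<integral>\<^sup>+l. ennreal (q * A * g y * (indicator {0..?y} l * l powr (?s - 1))) \<partial>lborel)
   = ennreal (r * A / ((r - 1) * B powr (r - 1))) * ennreal (g y powr r)"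
   using par by (simp flip: ennreal_mult')
 qed
 also have "... = ennreal (r * A / ((r - 1) * B powr (r - 1))) * (\<integral>\<^sup>+x. ennreal (g x powr r) \<partial>M)"
  by (rule nn_integral_cmult) measurable
 finally show ?thesis by (simp add: q_def)
qed

text \<open>Under \<open>w = s u\<close> the cell shrinks into itself, so nonnegativity bounds the
  integral by that over the whole cell; the Jacobian is the price.\<close>

lemma nn_integral_torus_scale:
 fixes h :: "real^'d::finite => ennreal"
 assumes h [measurable]: "h \<in> \<B> borel" "periodic h" and s: "0 < s" "s < 1"
 shows "(NN u. h (x + s *\<^sub>R u)) \<le> ennreal (s powr - real CARD('d)) * (NN u. h u)"
proof -
 let ?Q = "cbox 0 1 :: (real^'d) set"
 let ?k = "%w. h (x + w) * indicator ?Q (w /\<^sub>R s)"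
 have [measurable]: "?k \<in> \<B> lborel" by measurable
 have "(\<integral>\<^sup>+w. ?k w \<partial>lborel) = (\<integral>\<^sup>+w. ?k w \<partial>density (distr lborel borel (%u. 0 + s *\<^sub>R u)) (%_. \<bar>s\<bar> ^ DIM(real^'d)))"
  using s by (subst lborel_affine[of s 0]) auto
 also have "... = (\<integral>\<^sup>+u. ennreal (s ^ CARD('d)) * (h (x + s *\<^sub>R u) * indicator ?Q u) \<partial>lborel)"
  using s by (simp add: nn_integral_density nn_integral_distr)
 also have "... = ennreal (s ^ CARD('d)) * (NN u. h (x + s *\<^sub>R u))"
  by (simp add: nn_integral_cmult torus_def nn_integral_restrict_space)
 finally have eq: "ennreal (s ^ CARD('d)) * (NN u. h (x + s *\<^sub>R u)) = (\<integral>\<^sup>+w. ?k w \<partial>lborel)" ..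
 have "(\<integral>\<^sup>+w. ?k w \<partial>lborel) \<le> (\<integral>\<^sup>+w. h (x + w) * indicator ?Q w \<partial>lborel)"
 proof (rule nn_integral_mono)
  fix w :: "real^'d"
  have "w \<in> ?Q" if "w /\<^sub>R s \<in> ?Q"
   unfolding mem_cell
  proof
   fix i
   have "0 \<le> w $ i / s" "w $ i / s \<le> 1" using that by (simp_all add: mem_cell divide_inverse_commute)
   then show "0 \<le> w $ i \<and> w $ i \<le> 1" using s by (simp add: zero_le_divide_iff divide_le_eq)
  qed
  then show "?k w \<le> h (x + w) * indicator ?Q w" by (auto split: split_indicator)
 qed
 also have "... = (NN u. h u)"
  unfolding nn_integral_torus_shift[OF h, of x, symmetric] by (simp add: torus_def nn_integral_restrict_space)
 finally have le: "ennreal (s ^ CARD('d)) * (NN u. h (x + s *\<^sub>R u)) \<le> (NN u. h u)" unfolding eq .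
 have "s powr - real CARD('d) * s ^ CARD('d) = 1" using s by (simp add: powr_minus powr_realpow)
 then have e: "(NN u. h (x + s *\<^sub>R u)) = ennreal (s powr - real CARD('d)) * (ennreal (s ^ CARD('d)) * (NN u. h (x + s *\<^sub>R u)))"
  by (simp flip: mult.assoc ennreal_mult')
 note e
 also have "... \<le> ennreal (s powr - real CARD('d)) * (NN u. h u)" by (rule mult_left_mono[OF le]) simp
 finally show ?thesis .
qed


text \<open>Averages over the rays from \<open>x\<close> into the cell; it plays the role of the
  Riesz potential of order one, without a singular kernel.\<close>

definition potential :: "(real^'d::finite => real) => real^'d => ennreal"
 where "potential g x = (\<integral>\<^sup>+z. ennreal (g (x + fst z *\<^sub>R snd z)) \<partial>\<S> 1)"

lemma ray_measurable:
 fixes h :: "real^'d::finite => ennreal"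
 assumes [measurable]: "h \<in> \<B> borel"
 shows "(%z. h (x + fst z *\<^sub>R snd z)) \<in> \<B> (\<S> 1)"
  and "(%p. h (fst p + fst (snd p) *\<^sub>R snd (snd p))) \<in> \<B> (torus \<Otimes>\<^sub>M \<S> 1)"
  and "s \<in> space (time 1) ==> (%u. h (x + s *\<^sub>R u)) \<in> \<B> torus"
proof -
 have [measurable]: "(%t. t) \<in> \<B> (time 1)" "(%x. x) \<in> \<B> (torus :: (real^'d) measure)"
  by (auto intro: borel_measurable_timeI simp: torus_def intro!: measurable_restrict_space1)
 have a [measurable]: "(%z. x + fst z *\<^sub>R snd z) \<in> \<B> (\<S> 1)"
  "(%p. fst p + fst (snd p) *\<^sub>R snd (snd p)) \<in> \<B> ((torus :: (real^'d) measure) \<Otimes>\<^sub>M \<S> 1)"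
  "(%u. x + s *\<^sub>R u) \<in> \<B> torus"
  by (intro borel_measurable_add borel_measurable_scaleR borel_measurable_const; measurable)+
 show "(%z. h (x + fst z *\<^sub>R snd z)) \<in> \<B> (\<S> 1)"
  "(%p. h (fst p + fst (snd p) *\<^sub>R snd (snd p))) \<in> \<B> (torus \<Otimes>\<^sub>M \<S> 1)"
  "(%u. h (x + s *\<^sub>R u)) \<in> \<B> torus"
  using measurable_compose[OF a(1) assms] measurable_compose[OF a(2) assms] measurable_compose[OF a(3) assms] by simp_all
qed

text \<open>By translation invariance the mean of \<open>f\<close> is the mean of
  \<open>f (x + u)\<close> over the cell. The fundamental theorem along each ray bounds the
  difference, and the coordinates of \<open>u\<close> lie in \<open>[0, 1]\<close>, so the sum of
  absolute derivatives suffices.\<close>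

lemma oscillation_le_potential:
 fixes f :: "real^'d::finite => real"
 assumes f: "periodic_smooth f"
 shows "ennreal \<bar>f x - (\<oint>y. f y)\<bar> \<le> potential (%y. \<Sum>j\<in>UNIV. \<bar>gradient f y $ j\<bar>) x"
proof -
 let ?g = "%y. \<Sum>j\<in>UNIV. \<bar>gradient f y $ j\<bar>"
 have sm: "smooth f" by (rule periodic_smooth_smooth[OF f])
 have fm [measurable]: "f \<in> \<B> borel" by (rule periodic_smooth_measurable[OF f])
 have gc: "continuous_on A (%y. gradient f y $ j)" for A j
  by (rule smooth_gradient_continuous[OF f])
 have gm: "(%y. ennreal (?g y)) \<in> \<B> borel"
  by (intro measurable_compose[OF _ measurable_ennreal] borel_measurable_continuous_onI continuous_intros gc)
 have fi: "integrable torus f" by (rule continuous_integrable_torus[OF periodic_smooth_continuous[OF f]])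
 note sh = integral_torus_shift[OF fm periodic_smooth_periodic[OF f] fi, of x]
 have ray: "ennreal \<bar>f x - f (x + u)\<bar> \<le> (\<integral>\<^sup>+s. ennreal (?g (x + s *\<^sub>R u)) \<partial>time 1)" if u: "u \<in> cbox 0 1" for u
 proof -
  let ?\<phi>' = "%s. frechet_derivative f (at (x + s *\<^sub>R u)) u"
  have L: "linear (frechet_derivative f (at y))" for y
   by (rule linear_frechet_derivative) (use smooth_has_derivative[OF sm] in \<open>auto simp: differentiable_def\<close>)
  have lin: "frechet_derivative f (at y) u = (\<Sum>j\<in>UNIV. u $ j * gradient f y $ j)" for y
  proof -
   have "frechet_derivative f (at y) (\<Sum>j\<in>UNIV. u $ j *\<^sub>R axis j 1) = (\<Sum>j\<in>UNIV. u $ j * gradient f y $ j)"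
    by (simp add: linear_sum[OF L] linear_cmul[OF L] gradient_nth)
   then show ?thesis using basis_expansion[of u] by (simp add: scalar_mult_eq_scaleR)
  qed
  have "((%s. f (x + s *\<^sub>R u)) has_vector_derivative ?\<phi>' s) (at s within {0..1})" for s
  proof -
   have "((%s. x + s *\<^sub>R u) has_derivative (%h. h *\<^sub>R u)) (at s within {0..1})" by (auto intro!: derivative_eq_intros)
   from has_derivative_compose[OF this smooth_has_derivative[OF sm]]
   show ?thesis unfolding has_vector_derivative_def
    by (rule has_derivative_eq_rhs) (simp add: fun_eq_iff linear_cmul[OF L])
  qed
  then have I: "(?\<phi>' has_integral f (x + 1 *\<^sub>R u) - f (x + 0 *\<^sub>R u)) {0..1}"
   by (intro fundamental_theorem_of_calculus) auto
  have le: "\<bar>?\<phi>' s\<bar> \<le> ?g (x + s *\<^sub>R u)" for s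
   unfolding lin
  proof (rule order_trans[OF sum_abs sum_mono])
   fix j
   show "\<bar>u $ j * gradient f (x + s *\<^sub>R u) $ j\<bar> \<le> \<bar>gradient f (x + s *\<^sub>R u) $ j\<bar>"
    using u by (auto simp: mem_cell abs_mult intro!: mult_left_le_one_le)
  qed
  have gI: "(%s. ?g (x + s *\<^sub>R u)) integrable_on {0..1}"
   by (intro integrable_continuous_interval continuous_intros continuous_on_compose2[OF gc[of UNIV]]) auto
  have "norm (integral {0..1} ?\<phi>') \<le> integral {0..1} (%s. ?g (x + s *\<^sub>R u))"
   by (rule integral_norm_bound_integral[OF _ gI]) (use I le in auto)
  then have "ennreal \<bar>f x - f (x + u)\<bar> \<le> ennreal (integral {0..1} (%s. ?g (x + s *\<^sub>R u)))"
   using integral_unique[OF I] by (intro ennreal_leI) (simp add: abs_minus_commute)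
  also have "... = (\<integral>\<^sup>+s. ennreal (indicator {0..1} s * ?g (x + s *\<^sub>R u)) \<partial>lborel)"
   using nn_integral_has_integral_lebesgue[OF _ integrable_integral[OF gI]] by (simp add: sum_nonneg)
  also have "... = (\<integral>\<^sup>+s. ennreal (?g (x + s *\<^sub>R u)) * indicator {0<..<1} s \<partial>lborel)"
  proof (rule nn_integral_cong_AE)
   have "AE s in lborel. s \<noteq> 0 \<and> s \<noteq> (1::real)" by (simp add: AE_lborel_singleton AE_conj_iff)
   then show "AE s in lborel. ennreal (indicator {0..1} s * ?g (x + s *\<^sub>R u)) = ennreal (?g (x + s *\<^sub>R u)) * indicator {0<..<1} s"
    by eventually_elim (auto split: split_indicator)
  qed
  also have "... = (\<integral>\<^sup>+s. ennreal (?g (x + s *\<^sub>R u)) \<partial>time 1)" by (simp add: time_def nn_integral_restrict_space)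
  finally show ?thesis .
 qed
 have "f x - (\<oint>y. f y) = (\<oint>u. f x - f (x + u))"
  using sh fi by simp
 then have "ennreal \<bar>f x - (\<oint>y. f y)\<bar> \<le> (NN u. ennreal \<bar>f x - f (x + u)\<bar>)"
  using integral_norm_bound_ennreal[of torus "%u. f x - f (x + u)"] sh by simp
 also have "... \<le> (NN u. (\<integral>\<^sup>+s. ennreal (?g (x + s *\<^sub>R u)) \<partial>time 1))"
  by (rule nn_integral_mono) (use ray in auto)
 also have "... = potential ?g x"
  unfolding potential_def using TX.nn_integral_snd[OF ray_measurable(1)[OF gm], of x] by simp
 finally show ?thesis .
qed


text \<open>Rays are cut at length \<open>e\<close>. The far part is bounded through the L^r norm
  and scaling; in the near part, values of \<open>g\<close> up to \<open>h\<close> contribute at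
  most \<open>h e\<close>. Each of the two accounts for a quarter of the level \<open>l\<close>, so
  the excess of \<open>g\<close> over \<open>h\<close> must supply the other half.\<close>

lemma potential_weak:
 fixes g w :: "real^'d::finite => real"
 assumes gc: "continuous_on UNIV g" and per: "periodic g" and g0: "!!x. 0 \<le> g x"
  and r: "1 < r" "r < real CARD('d)" and b: "b = r / (real CARD('d) - r)" and K: "K = (8 * b) powr b"
  and le1: "(NN x. ennreal (g x powr r)) \<le> 1"
  and w [measurable]: "w \<in> \<B> torus" and wp: "!!x. ennreal (w x) \<le> potential g x" and l: "l > 0"
 shows "emeasure torus {x \<in> space torus. l < w x}
  \<le> (NN y. ennreal (2 * K * l powr (- 1 - b) * g y * indicator {..<g y} (1 / (4 * K) * l powr (1 + b))))"
proof -
 let ?d = "real CARD('d)"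
 have bp: "b > 0" using r b by simp
 have K0: "K > 0" using K bp by simp
 \<comment> \<open>\<open>e\<close> makes the tail integral of \<open>2 s^(-1/b - 1)\<close> from
   \<open>e\<close> on equal to \<open>l / 4\<close>, which determines \<open>K\<close>; then
   \<open>h\<close> is fixed by \<open>h e = l / 4\<close>.\<close>
 define e where "e = K * l powr (- b)"
 define h where "h = 1 / (4 * K) * l powr (1 + b)"
 have e0: "e > 0" and h0: "h \<ge> 0" using K0 l by (auto simp: e_def h_def)
 have he: "h * e = l / 4" using K0 l by (simp add: h_def e_def powr_add[symmetric])
 have eb: "2 * (e powr (- (1 / b)) / (1 / b)) = l / 4"
 proof -
  have "K powr (- (1 / b)) = 1 / (8 * b)" using bp by (simp add: K powr_powr powr_minus_divide)
  then have "e powr (- (1 / b)) = l / (8 * b)"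
   unfolding e_def using K0 l bp by (simp add: powr_mult powr_powr)
  then show ?thesis using bp by simp
 qed
 have dr: "- (?d / r) = - (1 / b) - 1" using r by (simp add: b diff_divide_distrib)
 define k where "k y = ennreal (g y * indicator {..<g y} h)" for y
 have gm [measurable]: "g \<in> \<B> borel" by (rule borel_measurable_continuous_onI[OF gc])
 have km [measurable]: "k \<in> \<B> borel" unfolding k_def[abs_def] indicator_def lessThan_iff by measurable
 have kp: "periodic k" using per by (simp add: k_def periodic_def)
 define N where "N x = (\<integral>\<^sup>+z. k (x + fst z *\<^sub>R snd z) * indicator {..<e} (fst z) \<partial>\<S> 1)" for x
 have em [measurable]: "(%s. indicator {..<e} s :: ennreal) \<in> \<B> (time 1)" "(%s. indicator {e..} s :: ennreal) \<in> \<B> (time 1)"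
  "(%s. s) \<in> \<B> (time 1)"
  by (intro borel_measurable_timeI; simp)+
 have far: "(NN u. ennreal (g (x + s *\<^sub>R u))) \<le> ennreal (2 * s powr (- (1 / b) - 1))" if s: "s \<in> space (time 1)" for x s
 proof -
  have s01: "0 < s" "s < 1" using s by auto
  define a where "a = s powr (- (1 / b) - 1)"
  have a0: "a > 0" using s01 by (simp add: a_def)
  have m: "(%y. ennreal (g y powr r)) \<in> \<B> borel" by measurable
  \<comment> \<open>A pointwise substitute for Hoelder's inequality. The value
    \<open>a = s^(-d/r)\<close> balances its two terms after integration, and
    \<open>d / r = 1 + 1 / b\<close>.\<close>
  have y: "y \<le> a + a powr (1 - r) * y powr r" if "0 \<le> y" for y
  proof (cases "y \<le> a")
   case True
   then show ?thesis by (simp add: add_increasing2)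
  next
   case False
   have "y = y powr (1 - r) * y powr r" using False a0 by (simp add: powr_add[symmetric])
   also have "... \<le> a powr (1 - r) * y powr r" using False a0 r by (intro mult_right_mono powr_mono2') auto
   finally show ?thesis using a0 by linarith
  qed
  have "(NN u. ennreal (g (x + s *\<^sub>R u)))
    \<le> (NN u. ennreal a + ennreal (a powr (1 - r)) * ennreal (g (x + s *\<^sub>R u) powr r))"
   using a0 y g0 by (intro nn_integral_mono) (simp add: ennreal_leI flip: ennreal_mult' ennreal_plus)
  also have "... = ennreal a + ennreal (a powr (1 - r)) * (NN u. ennreal (g (x + s *\<^sub>R u) powr r))"
   using ray_measurable(3)[OF m s, of x] by (simp add: nn_integral_add nn_integral_cmult emeasure_torus)
  also have "(NN u. ennreal (g (x + s *\<^sub>R u) powr r)) \<le> ennreal (s powr - ?d) * (NN u. ennreal (g u powr r))"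
   by (rule nn_integral_torus_scale[OF m _ s01]) (use per in \<open>simp add: periodic_def\<close>)
  also have "... \<le> ennreal (s powr - ?d)" using mult_left_mono[OF le1, of "ennreal (s powr - ?d)"] by simp
  also have "ennreal a + ennreal (a powr (1 - r)) * ennreal (s powr - ?d) = ennreal (2 * a)"
  proof -
   have "- (?d / r) * (1 - r) + - ?d = - (?d / r)" using r by (simp add: field_simps)
   then have "a powr (1 - r) * s powr - ?d = a"
    unfolding a_def dr[symmetric] powr_powr powr_add[symmetric] by simp
   then show ?thesis using a0 by (simp flip: ennreal_mult' ennreal_plus)
  qed
  finally show ?thesis by (simp add: a_def add_left_mono mult_left_mono)
 qed
 have pot: "potential g x \<le> ennreal (l / 2) + N x" for x
 proof -
  note km' = ray_measurable(1)[OF km, of x]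
  have gm': "(%y. ennreal (g y)) \<in> \<B> borel" by measurable
  have kN: "(%z. k (x + fst z *\<^sub>R snd z) * indicator {..<e} (fst z)) \<in> \<B> (\<S> 1)"
   by (intro borel_measurable_times_ennreal km' measurable_compose[OF measurable_fst em(1)])
  have "potential g x = (\<integral>\<^sup>+s. (NN u. ennreal (g (x + s *\<^sub>R u))) \<partial>time 1)"
   unfolding potential_def using torus.nn_integral_fst[OF ray_measurable(1)[OF gm', of x]] by simp
  also have "... \<le> (\<integral>\<^sup>+s. (ennreal h * indicator {..<e} s + ennreal (2 * (indicator {e..} s * s powr (- (1 / b) - 1))))
    + (NN u. k (x + s *\<^sub>R u) * indicator {..<e} s) \<partial>time 1)"
  proof (rule nn_integral_mono)
   fix s assume s: "s \<in> space (time 1)"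
   show "(NN u. ennreal (g (x + s *\<^sub>R u))) \<le> (ennreal h * indicator {..<e} s + ennreal (2 * (indicator {e..} s * s powr (- (1 / b) - 1))))
    + (NN u. k (x + s *\<^sub>R u) * indicator {..<e} s)"
   proof (cases "s < e")
    case True
    have "ennreal (g y) \<le> ennreal h + k y" for y
     using h0 g0[of y] by (auto simp: k_def not_less intro: ennreal_leI split: split_indicator)
    then have "(NN u. ennreal (g (x + s *\<^sub>R u))) \<le> (NN u. ennreal h + k (x + s *\<^sub>R u))"
     by (intro nn_integral_mono)
    also have "... = ennreal h + (NN u. k (x + s *\<^sub>R u))"
     using ray_measurable(3)[OF km s, of x] by (simp add: nn_integral_add emeasure_torus)
    finally show ?thesis using True by simp
   next
    case False
    then show ?thesis using far[OF s, of x] by simp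
   qed
  qed
  also have "... = ((\<integral>\<^sup>+s. ennreal h * indicator {..<e} s \<partial>time 1) + (\<integral>\<^sup>+s. ennreal (2 * (indicator {e..} s * s powr (- (1 / b) - 1))) \<partial>time 1))
    + (\<integral>\<^sup>+s. (NN u. k (x + s *\<^sub>R u) * indicator {..<e} s) \<partial>time 1)"
  proof -
   have 1: "(%s. (NN u. k (x + s *\<^sub>R u) * indicator {..<e} s)) \<in> \<B> (time 1)"
    using torus.borel_measurable_nn_integral_fst[OF kN] by simp
   have 2: "(%s. ennreal h * indicator {..<e} s) \<in> \<B> (time 1)" by measurable
   have 3: "(%s. ennreal (2 * (indicator {e..} s * s powr (- (1 / b) - 1)))) \<in> \<B> (time 1)"
    by (rule borel_measurable_timeI) measurable
   show ?thesis by (subst nn_integral_add[OF borel_measurable_add[OF 2 3] 1], subst nn_integral_add[OF 2 3]) rule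
  qed
  also have "(\<integral>\<^sup>+s. ennreal h * indicator {..<e} s \<partial>time 1) \<le> ennreal (l / 4)"
  proof -
   have "(\<integral>\<^sup>+s. ennreal h * indicator {..<e} s \<partial>time 1) \<le> (\<integral>\<^sup>+s. ennreal h * indicator {0..<e} s \<partial>lborel)"
    unfolding time_def by (subst nn_integral_restrict_space) (auto intro!: nn_integral_mono split: split_indicator)
   also have "... = ennreal (l / 4)" unfolding he[symmetric] using e0 h0 by (simp add: nn_integral_cmult ennreal_mult')
   finally show ?thesis .
  qed
  also have "(\<integral>\<^sup>+s. ennreal (2 * (indicator {e..} s * s powr (- (1 / b) - 1))) \<partial>time 1) \<le> ennreal (l / 4)"
  proof -
   have "(\<integral>\<^sup>+s. ennreal (2 * (indicator {e..} s * s powr (- (1 / b) - 1))) \<partial>time 1)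
     \<le> (\<integral>\<^sup>+s. ennreal (2 * (indicator {e..} s * s powr (- (1 / b) - 1))) \<partial>lborel)"
    unfolding time_def by (subst nn_integral_restrict_space) (auto intro!: nn_integral_mono split: split_indicator)
   then show ?thesis unfolding eb[symmetric] using nn_integral_powr_to_inf[of "1 / b" e 2] bp e0 by simp
  qed
  also have "(\<integral>\<^sup>+s. (NN u. k (x + s *\<^sub>R u) * indicator {..<e} s) \<partial>time 1) = N x"
   unfolding N_def using torus.nn_integral_fst[OF kN] by simp
  finally show ?thesis
   using l by (simp add: add_right_mono add_mono flip: ennreal_plus)
 qed
 have Nk: "(NN x. N x) \<le> ennreal e * (NN x. k x)"
 proof -
  interpret P: pair_sigma_finite "torus :: (real^'d) measure" "\<S> 1" by unfold_locales
  have m: "(%(x, z). k (x + fst z *\<^sub>R snd z) * indicator {..<e} (fst z)) \<in> \<B> ((torus :: (real^'d) measure) \<Otimes>\<^sub>M \<S> 1)"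
   unfolding case_prod_unfold
   by (intro borel_measurable_times_ennreal ray_measurable(2)[OF km] measurable_compose[OF measurable_compose[OF measurable_snd measurable_fst] em(1)])
  have "(NN x. N x) = (\<integral>\<^sup>+z. (NN x. k (x + fst z *\<^sub>R snd z) * indicator {..<e} (fst z)) \<partial>\<S> 1)"
   unfolding N_def using P.Fubini'[OF m] by simp
  also have "... = (\<integral>\<^sup>+z. (NN x. k x) * indicator {..<e} (fst z) \<partial>(\<S> 1 :: (real \<times> (real^'d)) measure))"
  proof (rule nn_integral_cong)
   fix z :: "real \<times> (real^'d)"
   show "(NN x. k (x + fst z *\<^sub>R snd z) * indicator {..<e} (fst z)) = (NN x. k x) * indicator {..<e} (fst z)"
    using nn_integral_torus_shift[OF km kp, of "fst z *\<^sub>R snd z"] by (cases "fst z < e") (simp_all add: add.commute)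
  qed
  also have "... = (\<integral>\<^sup>+s. (NN x. k x) * indicator {..<e} s \<partial>time 1)"
   by (subst torus.nn_integral_fst[symmetric]) (use em in \<open>auto simp: emeasure_torus intro!: borel_measurable_times_ennreal measurable_compose[OF measurable_fst em(1)]\<close>)
  also have "... \<le> (\<integral>\<^sup>+s. (NN x. k x) * indicator {0..<e} s \<partial>lborel)"
   unfolding time_def by (subst nn_integral_restrict_space) (auto intro!: nn_integral_mono split: split_indicator)
  also have "... = ennreal e * (NN x. k x)" using e0 by (simp add: nn_integral_cmult mult.commute)
  finally show ?thesis .
 qed
 let ?S = "{x \<in> space torus. l < w x}"
 have "ennreal (l / 2) * emeasure torus ?S = (NN x. ennreal (l / 2) * indicator ?S x)"
  by (rule nn_integral_cmult_indicator[symmetric]) measurable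
 also have "... \<le> (NN x. N x)"
 proof (rule nn_integral_mono)
  fix x
  show "ennreal (l / 2) * indicator ?S x \<le> N x"
  proof (cases "x \<in> ?S")
   case True
   then have "ennreal (l / 2) + ennreal (l / 2) \<le> ennreal (l / 2) + N x"
    using order_trans[OF ennreal_leI[of l "w x"] order_trans[OF wp[of x] pot[of x]]] l by (simp flip: ennreal_plus)
   then show ?thesis using True by (simp add: ennreal_add_left_cancel_le)
  qed simp
 qed
 also note Nk
 finally have le: "ennreal (2 / l) * (ennreal (l / 2) * emeasure torus ?S) \<le> ennreal (2 / l) * (ennreal e * (NN x. k x))"
  by (rule mult_left_mono) simp
 have "ennreal (2 / l) * (ennreal (l / 2) * emeasure torus ?S) = emeasure torus ?S"
  using l by (simp flip: mult.assoc ennreal_mult')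
 moreover have "ennreal (2 / l) * (ennreal e * (NN x. k x))
   = (NN y. ennreal (2 * K * l powr (- 1 - b) * g y * indicator {..<g y} (1 / (4 * K) * l powr (1 + b))))"
 proof -
  have "2 / l * e = 2 * K * l powr (- 1 - b)" using l by (simp add: e_def powr_diff powr_minus field_simps)
  then have "ennreal (2 / l) * (ennreal e * (NN x. k x)) = ennreal (2 * K * l powr (- 1 - b)) * (NN x. k x)"
   using l e0 by (simp flip: mult.assoc ennreal_mult')
  also have "... = (NN y. ennreal (2 * K * l powr (- 1 - b)) * k y)"
   by (rule nn_integral_cmult[symmetric]) (simp add: torus_def measurable_restrict_space1)
  finally show ?thesis using K0 by (simp add: k_def h_def mult.assoc flip: ennreal_mult')
 qed
 ultimately show ?thesis using le by simp
qed

text \<open>The exponent \<open>r (1 + r / (d - r))\<close> is the Sobolev conjugate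
  \<open>r d / (d - r)\<close>. Dividing by \<open>s\<close> reduces to a gradient of norm at most
  one, for which the weak bound is stated, and \<open>strong_type\<close> integrates it.\<close>

theorem Sobolev_smooth:
 assumes r: "1 < r" "r < real CARD('d::finite)"
 obtains C where "C \<ge> 0" "!!f :: real^'d => real. !!s. periodic_smooth f ==> s > 0 ==>
   (NN x. ennreal ((\<Sum>j\<in>UNIV. \<bar>gradient f x $ j\<bar>) powr r)) \<le> ennreal (s powr r) ==>
   (NN x. ennreal (\<bar>f x - (\<oint>y. f y)\<bar> powr (r * (1 + r / (real CARD('d) - r)))))
    \<le> ennreal (C * s powr (r * (1 + r / (real CARD('d) - r))))"
proof
 define b where "b = r / (real CARD('d) - r)"
 define K where "K = (8 * b) powr b"
 have b0: "b > 0" using r by (simp add: b_def)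
 then have K0: "K > 0" by (simp add: K_def)
 \<comment> \<open>The constant of \<open>strong_type\<close> with the values \<open>2 K\<close> and
   \<open>1 / (4 K)\<close> from \<open>potential_weak\<close>.\<close>
 define C where "C = r * (2 * K) / ((r - 1) * (1 / (4 * K)) powr (r - 1))"
 show C0: "C \<ge> 0" using r K0 by (simp add: C_def)
 fix f :: "real^'d => real" and s :: real
 assume f: "periodic_smooth f" and s: "s > 0"
  and le: "(NN x. ennreal ((\<Sum>j\<in>UNIV. \<bar>gradient f x $ j\<bar>) powr r)) \<le> ennreal (s powr r)"
 let ?g = "%x. \<Sum>j\<in>UNIV. \<bar>gradient f x $ j\<bar>" and ?m = "\<oint>y. f y" and ?q = "r * (1 + b)"
 define g where "g x = ?g x / s" for x
 define w where "w x = \<bar>f x - ?m\<bar> / s" for x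
 have gc0: "continuous_on UNIV ?g" by (intro continuous_intros smooth_gradient_continuous[OF f])
 then have gc: "continuous_on UNIV g" unfolding g_def[abs_def] using s by (intro continuous_on_divide continuous_on_const) auto
 have gm: "g \<in> \<B> torus" "?g \<in> \<B> torus"
  using borel_measurable_continuous_onI[OF gc] borel_measurable_continuous_onI[OF gc0] by (simp_all add: torus_def measurable_restrict_space1)
 have g0: "0 \<le> g x" for x using s by (simp add: g_def sum_nonneg)
 have fm: "f \<in> \<B> torus" using periodic_smooth_measurable[OF f] by (simp add: torus_def measurable_restrict_space1)
 then have wm: "w \<in> \<B> torus" unfolding w_def[abs_def] by measurable
 have gp: "periodic g"
 proof -
  have "gradient f (x + axis i 1) = gradient f x" for x i
  proof -
   have "(%y. f (y + axis i 1)) = f" using f by (auto simp: periodic_smooth_def)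
   moreover have "((%y. f (y + axis i 1)) has_derivative frechet_derivative f (at (x + axis i 1))) (at x)"
    using has_derivative_compose[OF _ smooth_has_derivative[OF periodic_smooth_smooth[OF f]], of "%y. y + axis i 1" "%h. h" x UNIV]
    by (simp add: has_derivative_add_const)
   ultimately have "frechet_derivative f (at x) = frechet_derivative f (at (x + axis i 1))"
    using frechet_derivative_at by metis
   then show ?thesis by (simp add: gradient_def)
  qed
  then show ?thesis by (simp add: periodic_def g_def)
 qed
 have wp: "ennreal (w x) \<le> potential g x" for x
 proof -
  have gm': "(%y. ennreal (?g y)) \<in> \<B> borel"
   by (intro measurable_compose[OF _ measurable_ennreal] borel_measurable_continuous_onI gc0)
  have "ennreal (w x) = ennreal (1 / s) * ennreal \<bar>f x - ?m\<bar>" using s by (simp add: w_def flip: ennreal_mult')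
  also have "... \<le> ennreal (1 / s) * potential ?g x" by (intro mult_left_mono oscillation_le_potential f) simp
  also have "... = potential g x"
   unfolding potential_def g_def using s nn_integral_cmult[OF ray_measurable(1)[OF gm', of x], of "ennreal (1 / s)"]
   by (simp flip: ennreal_mult')
  finally show ?thesis .
 qed
 have le1: "(NN x. ennreal (g x powr r)) \<le> 1"
 proof -
  have "(NN x. ennreal (g x powr r)) = (NN x. ennreal (s powr (- r)) * ennreal (?g x powr r))"
   using s by (intro nn_integral_cong) (simp add: g_def powr_divide sum_nonneg powr_minus_divide flip: ennreal_mult')
  also have "... = ennreal (s powr (- r)) * (NN x. ennreal (?g x powr r))"
   by (rule nn_integral_cmult, rule measurable_compose[OF gm(2)]) measurable
  also have "... \<le> ennreal (s powr (- r)) * ennreal (s powr r)" by (rule mult_left_mono[OF le]) simp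
  also have "... = 1" using s by (simp add: powr_minus flip: ennreal_mult')
  finally show ?thesis .
 qed
 have "(NN x. ennreal (w x powr ?q)) \<le> ennreal C * (NN x. ennreal (g x powr r))"
  unfolding C_def
  by (rule strong_type[OF _ wm gm(1) _ g0 r(1) b0 _ _ potential_weak[OF gc gp g0 r b_def K_def le1 wm wp]])
   (use s K0 torus.sigma_finite_measure_axioms in \<open>auto simp: w_def\<close>)
 also have "... \<le> ennreal C" using mult_left_mono[OF le1, of "ennreal C"] by simp
 finally have "ennreal (s powr ?q) * (NN x. ennreal (w x powr ?q)) \<le> ennreal (s powr ?q) * ennreal C"
  by (rule mult_left_mono) simp
 moreover have "ennreal (s powr ?q) * (NN x. ennreal (w x powr ?q)) = (NN x. ennreal (\<bar>f x - ?m\<bar> powr ?q))"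
  using s fm by (subst nn_integral_cmult[symmetric]) (auto simp: w_def powr_divide simp flip: ennreal_mult')
 ultimately show "(NN x. ennreal (\<bar>f x - ?m\<bar> powr (r * (1 + r / (real CARD('d) - r)))))
   \<le> ennreal (C * s powr (r * (1 + r / (real CARD('d) - r))))"
  using C0 by (simp add: b_def mult.commute flip: ennreal_mult')
qed

text \<open>A sum is at most the number of its terms times the largest one.\<close>

lemma sum_powr_le:
 fixes a :: "'d::finite => real"
 assumes "!!j. 0 \<le> a j" "r \<ge> 0"
 shows "(\<Sum>j\<in>UNIV. a j) powr r \<le> real CARD('d) powr r * (\<Sum>j\<in>UNIV. a j powr r)"
proof -
 obtain k where k: "!!j. a j \<le> a k"
  using finite_imageI[OF finite, of a "UNIV :: 'd set"] Max_in[of "range a"] Max_ge[of "range a"] by (metis UNIV_not_empty finite_imageI finite image_is_empty imageE rangeI)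
 have "(\<Sum>j\<in>UNIV. a j) \<le> (\<Sum>j\<in>(UNIV::'d set). a k)" by (intro sum_mono k)
 then have "(\<Sum>j\<in>UNIV. a j) powr r \<le> (real CARD('d) * a k) powr r" using assms by (intro powr_mono2 sum_nonneg) auto
 also have "... = real CARD('d) powr r * a k powr r" using assms by (simp add: powr_mult)
 also have "a k powr r \<le> (\<Sum>j\<in>UNIV. a j powr r)" by (rule member_le_sum) auto
 finally show ?thesis by (simp add: mult_left_mono)
qed

lemma add_powr_le: "0 \<le> a ==> 0 \<le> b ==> r \<ge> 0 ==> (a + b) powr r \<le> 2 powr r * (a powr r + b powr r)" for a b r :: real
 using sum_powr_le[of "%x::bool. if x then a else b" r] by (simp add: UNIV_bool add.commute)

text \<open>Splitting at the value \<open>N\<close> replaces Hoelder's inequality on a space of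
  measure one, at the cost of the factor 2.\<close>

lemma nn_integral_powr_le_smaller_exponent:
 fixes h :: "real^'d::finite => real"
 assumes [measurable]: "h \<in> \<B> torus" and h0: "!!x. 0 \<le> h x" and le: "(NN x. ennreal (h x powr q)) \<le> ennreal (N powr q)"
  and N: "N > 0" and a: "0 \<le> a" "a \<le> q"
 shows "(NN x. ennreal (h x powr a)) \<le> ennreal (2 * N powr a)"
proof -
 have pt: "h x powr a \<le> N powr a + N powr (a - q) * h x powr q" for x
 proof (cases "h x \<le> N")
  case True
  then have "h x powr a \<le> N powr a" using h0 a by (intro powr_mono2) auto
  then show ?thesis by (simp add: add_increasing2)
 next
  case False
  have "h x powr a = h x powr (a - q) * h x powr q" using False N by (simp add: powr_add[symmetric])
  also have "... \<le> N powr (a - q) * h x powr q" using False N a by (intro mult_right_mono powr_mono2') auto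
  finally show ?thesis by (simp add: add_increasing)
 qed
 have "(NN x. ennreal (h x powr a)) \<le> (NN x. ennreal (N powr a) + ennreal (N powr (a - q)) * ennreal (h x powr q))"
  using pt by (intro nn_integral_mono) (simp add: ennreal_leI flip: ennreal_mult' ennreal_plus)
 also have "... = ennreal (N powr a) + ennreal (N powr (a - q)) * (NN x. ennreal (h x powr q))"
  by (simp add: nn_integral_add nn_integral_cmult emeasure_torus)
 also have "... \<le> ennreal (N powr a) + ennreal (N powr (a - q)) * ennreal (N powr q)" by (intro add_left_mono mult_left_mono le) simp
 also have "... = ennreal (2 * N powr a)" using N by (simp add: powr_add[symmetric] flip: ennreal_mult' ennreal_plus)
 finally show ?thesis .
qed

lemma Lp_norm_powr:
 assumes "f \<in> Lp M q" "q > 0"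
 shows "(\<integral>\<^sup>+x. ennreal (norm (f x) powr q) \<partial>M) = ennreal (Lp_norm M q f powr q)"
proof -
 have "integrable M (%x. norm (f x) powr q)" using assms by (simp add: Lp_def)
 then have "(\<integral>\<^sup>+x. ennreal (norm (f x) powr q) \<partial>M) = ennreal (LINT x|M. norm (f x) powr q)"
  by (intro nn_integral_eq_integral) auto
 also have "(LINT x|M. norm (f x) powr q) = Lp_norm M q f powr q"
  using assms by (simp add: Lp_norm_def powr_powr integral_nonneg_AE)
 finally show ?thesis .
qed

lemma Lp_norm_nonneg: "0 \<le> Lp_norm M q f"
 by (simp add: Lp_norm_def)

text \<open>Adding 1 makes norms usable as scales, which must be positive in the Sobolev bounds; on
  a finite measure space this costs nothing.\<close>

lemma shifted_powr_integrable:
 assumes "N \<in> Lp (time T) p" "!!t. 0 \<le> N t" "p \<ge> 0" "k \<ge> 0"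
 shows "integrable (time T) (%t. (k * (1 + N t)) powr p)"
proof (rule L_integrable_bound)
 have i: "integrable (time T) (%t. N t powr p)" and [measurable]: "N \<in> \<B> (time T)" using assms by (simp_all add: Lp_def)
 show "integrable (time T) (%t. k powr p * (2 powr p * (1 + N t powr p)))" using i by simp
 show "(%t. (k * (1 + N t)) powr p) \<in> \<B> (time T)" by measurable
 show "AE t in time T. norm ((k * (1 + N t)) powr p) \<le> norm (k powr p * (2 powr p * (1 + N t powr p)))"
  using add_powr_le[of 1 "N t" p for t] assms by (auto simp: powr_mult intro!: AE_I2 mult_left_mono)
qed

lemma LpLqD:
 assumes "f \<in> LpLq T p q"
 shows "(%z. f (fst z) (snd z)) \<in> \<B> (\<S> T)" "AE t in time T. f t \<in> Lp torus q"
  "(%t. Lp_norm torus q (f t)) \<in> Lp (time T) p"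
 using assms by (simp_all add: LpLq_def case_prod_unfold)

lemma LpLq_integrable:
 fixes f :: "real => real^'d::finite => 'b::real_normed_vector"
 assumes f: "f \<in> LpLq T p q" and a: "0 < a" "a \<le> p" "a \<le> q"
 shows "integrable (\<S> T) (%(t, x). norm (f t x) powr a)"
proof -
 have [measurable]: "(%z. norm (f (fst z) (snd z))) \<in> \<B> (\<S> T)"
  by (rule measurable_compose[OF LpLqD(1)[OF f]]) simp
 let ?N = "%t. Lp_norm torus q (f t)"
 have "(\<integral>\<^sup>+z. ennreal (norm (f (fst z) (snd z)) powr a) \<partial>\<S> T)
   = (\<integral>\<^sup>+t. (NN x. ennreal (norm (f t x) powr a)) \<partial>time T)"
  by (subst torus.nn_integral_fst[symmetric]) auto
 also have "... \<le> (\<integral>\<^sup>+t. ennreal (2 * (1 * (1 + ?N t)) powr p) \<partial>time T)"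
 proof (rule nn_integral_mono_AE)
  show "AE t in time T. (NN x. ennreal (norm (f t x) powr a)) \<le> ennreal (2 * (1 * (1 + ?N t)) powr p)"
   using LpLqD(2)[OF f]
  proof eventually_elim
   case (elim t)
   then have [measurable]: "f t \<in> \<B> torus" by (simp add: Lp_def)
   have "(NN x. ennreal (norm (f t x) powr a)) \<le> ennreal (2 * (1 + ?N t) powr a)"
    using a Lp_norm_nonneg[of torus q "f t"]
    by (intro nn_integral_powr_le_smaller_exponent[where q = q]) (auto simp: Lp_norm_powr[OF elim] intro!: ennreal_leI powr_mono2)
   also have "... \<le> ennreal (2 * (1 * (1 + ?N t)) powr p)"
    using a Lp_norm_nonneg[of torus q "f t"] by (intro ennreal_leI) (simp add: powr_mono)
   finally show ?case .
  qed
 qed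
 also have "... < \<infinity>"
  using shifted_powr_integrable[OF LpLqD(3)[OF f] Lp_norm_nonneg, of 1] a by (subst nn_integral_eq_integral) auto
 finally show ?thesis unfolding case_prod_unfold
  by (intro integrableI_bounded) auto
qed

text \<open>Phrased with all admissible scales \<open>s\<close> instead of a norm, so that it is
  meaningful whether or not the gradient lies in L^r at that time.\<close>

abbreviation oscillation_bound :: "real => real => real => (real^'d::finite => real) => (real^'d => real^'d) => bool"
 where "oscillation_bound C r q f G \<equiv> integrable torus f \<and>
  (\<forall>s>0. (NN x. ennreal (norm (G x) powr r)) \<le> ennreal (s powr r) -->
   (NN x. ennreal (\<bar>f x - (\<oint>y. f y)\<bar> powr q)) \<le> ennreal (C * s powr q))"

text \<open>On almost every slice the smooth inequality is applied to the mollified function, whose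
  gradient is the mollified weak gradient and so obeys the same L^r bounds. A subsequence converges
  almost everywhere, and Fatou's lemma passes to the limit.\<close>

theorem Sobolev:
 assumes r: "1 < r" "r < real CARD('d::finite)" and q: "q = r * (1 + r / (real CARD('d) - r))"
 obtains C where "C \<ge> 0"
  "!!T (f :: real => real^'d => real) G. T > 0 ==> weak_grad T f G ==> AE t in time T. oscillation_bound C r q (f t) (G t)"
proof -
 obtain C where C: "C \<ge> 0" "!!f :: real^'d => real. !!s. periodic_smooth f ==> s > 0 ==>
   (NN x. ennreal ((\<Sum>j\<in>UNIV. \<bar>gradient f x $ j\<bar>) powr r)) \<le> ennreal (s powr r) ==>
   (NN x. ennreal (\<bar>f x - (\<oint>y. f y)\<bar> powr q)) \<le> ennreal (C * s powr q)"
  using Sobolev_smooth[OF r] unfolding q by blast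
 \<comment> \<open>One factor \<open>d^r\<close> comes from the power of the sum over components,
   another \<open>d\<close> from adding the bounds for the components.\<close>
 define \<kappa> where "\<kappa> = (real CARD('d) powr r * real CARD('d)) powr (1 / r)"
 have \<kappa>: "\<kappa> > 0" "\<kappa> powr r = real CARD('d) powr r * real CARD('d)" using r by (simp_all add: \<kappa>_def powr_powr)
 show thesis
 proof (rule that[of "C * \<kappa> powr q"])
  show "0 \<le> C * \<kappa> powr q" using C(1) by simp
  fix T and f :: "real => real^'d => real" and G :: "real => real^'d => real^'d"
  assume T: "T > 0" and wg: "weak_grad T f G"
  then have L: "f \<in> L1_loc T" "G \<in> L1_loc T" by (auto simp: weak_grad_def)
  have gr: "AE t in time T. \<forall>n j. AE x in torus. gradient (kernel_op torus (mollifier n) (f t)) x $ j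
    = kernel_op torus (mollifier n) (%y. G t y $ j) x"
   unfolding AE_all_countable using TX.AE_pair[OF weak_grad_mollify[OF T wg]] by simp
  show "AE t in time T. oscillation_bound (C * \<kappa> powr q) r q (f t) (G t)"
   using L1_loc_AE_integrable[OF L(1)] L1_loc_AE_integrable[OF L(2)] gr
  proof eventually_elim
   case (elim t)
   define w where "w n = kernel_op torus (mollifier n) (f t)" for n
   note fi = elim(1)
   have [measurable]: "f t \<in> \<B> torus" and Gt: "G t \<in> \<B> torus" using elim(1,2) by auto
   have Gm [measurable]: "(%y. G t y $ j) \<in> \<B> torus" for j by (rule measurable_compose[OF Gt borel_measurable_nth])
   have wps: "periodic_smooth (w n)" for n unfolding w_def by (rule separable_kernel_op(1)[OF mollifier_separable fi])
   have wi: "integrable torus (w n)" for n by (rule continuous_integrable_torus[OF periodic_smooth_continuous[OF wps]])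
   have [measurable]: "w n \<in> \<B> torus" for n using wi by auto
   have L1: "(%n. (\<oint>x. \<bar>w n x - f t x\<bar>)) \<leadsto> 0"
   proof -
    have "(%n. (\<oint>x. \<bar>w n x - f t x\<bar> ^ 1)) \<leadsto> 0"
     unfolding w_def by (rule kernel_op_tendsto[OF mollifier_kernel]; (rule mollify_tendsto_bounded)?) (use fi in auto)
    then show ?thesis by simp
   qed
   obtain \<sigma> :: "nat => nat" where \<sigma>: "strict_mono \<sigma>" "AE x in torus. (%n. w (\<sigma> n) x - f t x) \<leadsto> 0"
    using tendsto_L1_AE_subseq[of torus "%n x. w n x - f t x"] L1 wi fi by auto
   have m: "(%n. (\<oint>x. w n x)) \<leadsto> (\<oint>x. f t x)"
   proof (rule LIM_zero_cancel, rule Lim_null_comparison[OF _ L1], rule always_eventually, rule allI)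
    fix n
    show "norm ((\<oint>x. w n x) - (\<oint>x. f t x)) \<le> (\<oint>x. \<bar>w n x - f t x\<bar>)"
     using integral_abs_bound[of torus "%x. w n x - f t x"] wi fi by simp
   qed
   have "(NN x. ennreal (\<bar>f t x - (\<oint>y. f t y)\<bar> powr q)) \<le> ennreal (C * \<kappa> powr q * s powr q)"
    if s: "s > 0" and Gs: "(NN x. ennreal (norm (G t x) powr r)) \<le> ennreal (s powr r)" for s
   proof -
    have step: "(NN x. ennreal (\<bar>w n x - (\<oint>y. w n y)\<bar> powr q)) \<le> ennreal (C * (\<kappa> * s) powr q)" for n
    proof (rule C(2)[OF wps])
     interpret k: bounded_kernel torus "mollifier n :: real^'d => _" by (rule mollifier_kernel)
     have G: "integrable torus (%x. \<bar>G t x $ j\<bar> powr r)" "(NN x. ennreal (\<bar>G t x $ j\<bar> powr r)) \<le> ennreal (s powr r)" for j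
     proof -
      have "(NN x. ennreal (\<bar>G t x $ j\<bar> powr r)) \<le> (NN x. ennreal (norm (G t x) powr r))"
       using r component_le_norm_cart by (intro nn_integral_mono ennreal_leI powr_mono2) auto
      then show *: "(NN x. ennreal (\<bar>G t x $ j\<bar> powr r)) \<le> ennreal (s powr r)" using Gs by (rule order_trans)
      show "integrable torus (%x. \<bar>G t x $ j\<bar> powr r)"
       using * by (intro integrableI_bounded) (auto simp: le_less_trans)
     qed
     have Km: "(%x. ennreal (\<bar>kernel_op torus (mollifier n) (%y. G t y $ j) x\<bar> powr r)) \<in> \<B> torus" for j
      by (rule measurable_compose[OF k.kernel_op_measurable[OF Gm]]) measurable
     have "AE x in torus. \<forall>j. gradient (w n) x $ j = kernel_op torus (mollifier n) (%y. G t y $ j) x"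
      unfolding AE_all_countable using elim(3) by (simp add: w_def)
     then have "(NN x. ennreal ((\<Sum>j\<in>UNIV. \<bar>gradient (w n) x $ j\<bar>) powr r))
       \<le> (NN x. ennreal (real CARD('d) powr r) * (\<Sum>j\<in>UNIV. ennreal (\<bar>kernel_op torus (mollifier n) (%y. G t y $ j) x\<bar> powr r)))"
     proof (intro nn_integral_mono_AE, eventually_elim)
      case (elim x)
      then show ?case using r sum_powr_le[of "%j. \<bar>gradient (w n) x $ j\<bar>" r] by (simp add: sum_nonneg ennreal_leI flip: ennreal_mult')
     qed
     also have "... = ennreal (real CARD('d) powr r) * (\<Sum>j\<in>UNIV. (NN x. ennreal (\<bar>kernel_op torus (mollifier n) (%y. G t y $ j) x\<bar> powr r)))"
      by (simp only: nn_integral_cmult[OF borel_measurable_sum[OF Km]] nn_integral_sum[OF Km])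
     also have "... \<le> ennreal (real CARD('d) powr r) * (\<Sum>j\<in>(UNIV :: 'd set). ennreal (s powr r))"
     proof (intro mult_left_mono sum_mono)
      fix j
      note K = k.kernel_op_powr_integrable[OF Gm _ G(1), of j]
      have "(NN x. ennreal (\<bar>kernel_op torus (mollifier n) (%y. G t y $ j) x\<bar> powr r))
       = ennreal (\<oint>x. \<bar>kernel_op torus (mollifier n) (%y. G t y $ j) x\<bar> powr r)"
       using K r by (intro nn_integral_eq_integral) auto
      also have "... \<le> ennreal (\<oint>x. \<bar>G t x $ j\<bar> powr r)" using K r by (intro ennreal_leI) auto
      also have "... = (NN x. ennreal (\<bar>G t x $ j\<bar> powr r))" using G by (intro nn_integral_eq_integral[symmetric]) auto
      also note G(2)
      finally show "(NN x. ennreal (\<bar>kernel_op torus (mollifier n) (%y. G t y $ j) x\<bar> powr r)) \<le> ennreal (s powr r)" .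
     qed simp
     also have "... = ennreal ((\<kappa> * s) powr r)"
      using \<kappa> s by (simp add: powr_mult ennreal_of_nat_eq_real_of_nat mult.assoc flip: ennreal_mult')
     finally show "(NN x. ennreal ((\<Sum>j\<in>UNIV. \<bar>gradient (w n) x $ j\<bar>) powr r)) \<le> ennreal ((\<kappa> * s) powr r)" .
    qed (use \<kappa> s in simp)
    have "(NN x. ennreal (\<bar>f t x - (\<oint>y. f t y)\<bar> powr q))
      = (NN x. liminf (%n. ennreal (\<bar>w (\<sigma> n) x - (\<oint>y. w (\<sigma> n) y)\<bar> powr q)))"
    proof (rule nn_integral_cong_AE)
     have q0: "q > 0" unfolding q using r by (intro mult_pos_pos add_pos_pos divide_pos_pos) auto
     show "AE x in torus. ennreal (\<bar>f t x - (\<oint>y. f t y)\<bar> powr q)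
       = liminf (%n. ennreal (\<bar>w (\<sigma> n) x - (\<oint>y. w (\<sigma> n) y)\<bar> powr q))"
      using \<sigma>(2)
     proof eventually_elim
      case (elim x)
      have "(%n. w (\<sigma> n) x) \<leadsto> f t x" using elim by (rule LIM_zero_cancel)
      moreover have "(%n. (\<oint>y. w (\<sigma> n) y)) \<leadsto> (\<oint>y. f t y)"
       using LIMSEQ_subseq_LIMSEQ[OF m \<sigma>(1)] by (simp add: o_def)
      ultimately have "(%n. \<bar>w (\<sigma> n) x - (\<oint>y. w (\<sigma> n) y)\<bar>) \<leadsto> \<bar>f t x - (\<oint>y. f t y)\<bar>"
       by (intro tendsto_intros)
      then have "(%n. ennreal (\<bar>w (\<sigma> n) x - (\<oint>y. w (\<sigma> n) y)\<bar> powr q)) \<leadsto> ennreal (\<bar>f t x - (\<oint>y. f t y)\<bar> powr q)"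
       using q0 by (intro tendsto_ennrealI tendsto_powr2) auto
      then show ?case by (rule lim_imp_Liminf[OF sequentially_bot, symmetric])
     qed
    qed
    also have "... \<le> liminf (%n. (NN x. ennreal (\<bar>w (\<sigma> n) x - (\<oint>y. w (\<sigma> n) y)\<bar> powr q)))"
     by (rule nn_integral_liminf) measurable
    also have "... \<le> ennreal (C * (\<kappa> * s) powr q)"
     by (rule order_trans[OF Liminf_mono[OF always_eventually[rule_format, OF step]]]) (simp add: Liminf_const)
    finally show ?thesis using \<kappa> s by (simp add: powr_mult mult.assoc)
   qed
   with fi show ?case by blast
  qed
 qed
qed

section \<open>Fourth powers from mixed norms\<close>

lemma interpolation_slice:
 fixes h :: "real^'d::finite => real"
 assumes [measurable]: "h \<in> \<B> torus" and h0: "!!x. 0 \<le> h x" and X: "X \<ge> 1" and q: "3 < q" "q \<le> 4" and K: "K \<ge> 0"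
  and bounds: "(NN x. ennreal (h x powr q)) \<le> ennreal (K * X powr (q - 3))"
   "(NN x. ennreal (h x powr 6)) \<le> ennreal (K * X powr 3)"
 shows "(NN x. ennreal (h x powr 4)) \<le> ennreal (2 * K * X)"
proof -
 \<comment> \<open>Split at the value \<open>X\<close>: below it the exponent 4 is traded for
   \<open>q\<close>, above it for 6. The scaling of the two hypotheses makes both contributions
   proportional to \<open>X\<close>.\<close>
 have pt: "h x powr 4 \<le> X powr (4 - q) * h x powr q + X powr (- 2) * h x powr 6" for x
 proof (cases "h x \<le> X")
  case True
  have "h x powr 4 = h x powr (4 - q) * h x powr q" by (cases "h x = 0") (simp_all add: powr_add[symmetric])
  also have "... \<le> X powr (4 - q) * h x powr q" using True h0 q by (intro mult_right_mono powr_mono2) auto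
  finally show ?thesis by (simp add: add_increasing2)
 next
  case False
  have "h x powr 4 = h x powr (- 2) * h x powr 6" by (simp add: powr_add[symmetric])
  also have "... \<le> X powr (- 2) * h x powr 6" using False X by (intro mult_right_mono powr_mono2') auto
  finally show ?thesis by (simp add: add_increasing)
 qed
 have "(NN x. ennreal (h x powr 4))
   \<le> (NN x. ennreal (X powr (4 - q)) * ennreal (h x powr q) + ennreal (X powr (- 2)) * ennreal (h x powr 6))"
  using pt by (intro nn_integral_mono) (simp add: ennreal_leI flip: ennreal_mult' ennreal_plus)
 also have "... = ennreal (X powr (4 - q)) * (NN x. ennreal (h x powr q)) + ennreal (X powr (- 2)) * (NN x. ennreal (h x powr 6))"
  by (simp add: nn_integral_add nn_integral_cmult)
 also have "... \<le> ennreal (X powr (4 - q)) * ennreal (K * X powr (q - 3)) + ennreal (X powr (- 2)) * ennreal (K * X powr 3)"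
  by (intro add_mono mult_left_mono bounds) simp_all
 also have "... = ennreal (K * (X powr (4 - q) * X powr (q - 3)) + K * (X powr (- 2) * X powr 3))"
  using K by (simp add: mult.left_commute flip: ennreal_mult' ennreal_plus)
 also have "X powr (4 - q) * X powr (q - 3) = X" using X powr_add[of X "4 - q" "q - 3"] by simp
 also have "X powr (- 2) * X powr 3 = X" using X powr_add[of X "- 2" 3] by simp
 also have "K * X + K * X = 2 * K * X" by simp
 finally show ?thesis .
qed

lemma powr_mean_bound:
 fixes h :: "real^'d::finite => real"
 assumes [measurable]: "h \<in> \<B> torus" and q: "q \<ge> 0" and B: "B \<ge> 0" and m: "\<bar>m\<bar> \<le> Y"
  and le: "(NN x. ennreal (\<bar>h x - m\<bar> powr q)) \<le> ennreal B"
 shows "(NN x. ennreal (\<bar>h x\<bar> powr q)) \<le> ennreal (2 powr q * (B + Y powr q))"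
proof -
 have pt: "\<bar>h x\<bar> powr q \<le> 2 powr q * Y powr q + 2 powr q * \<bar>h x - m\<bar> powr q" for x
 proof -
  have "\<bar>h x\<bar> powr q \<le> (\<bar>h x - m\<bar> + Y) powr q" using q m by (intro powr_mono2) auto
  also have "... \<le> 2 powr q * (\<bar>h x - m\<bar> powr q + Y powr q)" using q m by (intro add_powr_le) auto
  finally show ?thesis by (simp add: algebra_simps)
 qed
 have "(NN x. ennreal (\<bar>h x\<bar> powr q)) \<le> (NN x. ennreal (2 powr q * Y powr q) + ennreal (2 powr q) * ennreal (\<bar>h x - m\<bar> powr q))"
  using pt by (intro nn_integral_mono) (simp add: ennreal_leI flip: ennreal_mult' ennreal_plus)
 also have "... = ennreal (2 powr q * Y powr q) + ennreal (2 powr q) * (NN x. ennreal (\<bar>h x - m\<bar> powr q))"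
  by (simp add: nn_integral_add nn_integral_cmult emeasure_torus)
 also have "... \<le> ennreal (2 powr q * Y powr q) + ennreal (2 powr q) * ennreal B" by (intro add_left_mono mult_left_mono le) simp
 also have "... = ennreal (2 powr q * (B + Y powr q))" using B by (simp add: algebra_simps flip: ennreal_mult' ennreal_plus)
 finally show ?thesis .
qed

text \<open>Scaling: at each time both bounds of \<open>interpolation_slice\<close> hold with \<open>X\<close> the sum of \<open>Y\<^sup>p\<close>
 and the dissipation, since \<open>q / p = q - 3\<close>.\<close>

theorem L4_criterion:
 fixes v :: "real => real^'d::finite => real^'d"
 assumes d: "CARD('d) \<in> {2, 3}" and T: "T > 0" and wg: "weak_grad_vec T v Dv"
  and vm: "(%(t, x). v t x) \<in> \<B> (\<S> T)" and D: "Dv \<in> LpLq T 2 2"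
  and pq: "1 / p + 3 / q = 1" "3 < q" "q \<le> 4"
  and Y: "!!t. 0 \<le> Y t" "integrable (time T) (%t. Y t powr p)" and K: "K \<ge> 0"
  and mean: "AE t in time T. \<forall>i. \<bar>(\<oint>x. v t x $ i)\<bar> \<le> Y t"
  and qb: "AE t in time T. \<forall>i. (NN x. ennreal (\<bar>v t x $ i\<bar> powr q)) \<le> ennreal (K * Y t powr q)"
 shows "integrable (\<S> T) (%(t, x). norm (v t x) ^ 4)"
proof -
 have p1: "1 / p = (q - 3) / q" using pq by (simp add: field_simps)
 then have p0: "p > 0" using pq by (smt (verit) divide_pos_pos zero_less_divide_1_iff)
 have qp: "q / p = q - 3" using p1 pq by (simp add: divide_inverse)
 have p4: "p \<ge> 4" 
 proof -
  have "1 / p \<le> 1 / 4" unfolding p1 using pq by (simp add: divide_le_eq)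
  then show ?thesis using p0 by (simp add: field_simps)
 qed
 \<comment> \<open>The Sobolev conjugate is 6 in both dimensions. In dimension 2 this means lowering
   the exponent of the gradient from 2 to 3/2.\<close>
 define r where "r = (if CARD('d) = 2 then 3 / 2 else 2 :: real)"
 have r: "1 < r" "r < real CARD('d)" "r \<le> 2" "6 = r * (1 + r / (real CARD('d) - r))" using d by (auto simp: r_def)
 obtain C where C: "C \<ge> 0" "!!T (f :: real => real^'d => real) G. T > 0 ==> weak_grad T f G ==> AE t in time T. oscillation_bound C r 6 (f t) (G t)"
  using Sobolev[OF r(1,2,4)] by blast
 have S: "AE t in time T. \<forall>i. oscillation_bound C r 6 (%x. v t x $ i) (%x. Dv t x $ i)"
  unfolding AE_all_countable
  by (rule allI, rule C(2)[OF T, of "%t x. v t x $ i" "%t x. Dv t x $ i" for i]) (use wg in \<open>simp add: weak_grad_vec_def\<close>)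
 let ?N = "%t. 1 + Lp_norm torus 2 (Dv t)"
 \<comment> \<open>Integrable in time, and large enough that \<open>Y^q \<le> X^(q - 3)\<close>, by
   \<open>q / p = q - 3\<close>, and that the sixth power of the gradient norm is at most
   \<open>X^3\<close>; the summand 1 gives \<open>X \<ge> 1\<close>.\<close>
 define X where "X t = Y t powr p + (1 * ?N t) powr 2" for t
 have Xi: "integrable (time T) X"
  unfolding X_def[abs_def] using shifted_powr_integrable[OF LpLqD(3)[OF D] Lp_norm_nonneg, of 1] Y(2) by simp
 have N1: "?N t \<ge> 1" for t using Lp_norm_nonneg[of torus 2 "Dv t"] by simp
 have X1: "X t \<ge> 1" for t using powr_mono2[of 2 1 "?N t"] N1[of t] by (simp add: X_def add_increasing)
 have YX: "Y t powr a \<le> X t powr (a / p)" if "a \<ge> 0" for a t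
 proof -
  have "Y t powr a = (Y t powr p) powr (a / p)" using p0 by (simp add: powr_powr)
  also have "... \<le> X t powr (a / p)" using that p0 by (intro powr_mono2) (auto simp: X_def)
  finally show ?thesis .
 qed
 define K' where "K' = max K (2 powr 6 * (C * 2 powr 6 + 1))"
 have K': "K' \<ge> 0" "K \<le> K'" "2 powr 6 * (C * 2 powr 6 + 1) \<le> K'" using K by (auto simp: K'_def)
 have slice: "AE t in time T. \<forall>i. (NN x. ennreal (\<bar>v t x $ i\<bar> powr 4)) \<le> ennreal (2 * K' * X t)"
  using S mean qb LpLqD(2)[OF D]
 proof eventually_elim
  case (elim t)
  have Dm [measurable]: "Dv t \<in> \<B> torus" using elim(4) by (simp add: Lp_def)
  show ?case
  proof
   fix i
   have vi: "integrable torus (%x. v t x $ i)" using elim(1) by blast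
   then have [measurable]: "(%x. v t x $ i) \<in> \<B> torus" by simp
   have l2: "(NN x. ennreal (norm (Dv t x) powr 2)) \<le> ennreal (?N t powr 2)"
    by (subst Lp_norm_powr[OF elim(4)], simp, rule ennreal_leI, rule powr_mono2) (auto simp: Lp_norm_nonneg)
   have "(NN x. ennreal (norm (Dv t x $ i) powr r)) \<le> (NN x. ennreal (norm (Dv t x) powr r))"
    using r by (intro nn_integral_mono ennreal_leI powr_mono2 Finite_Cartesian_Product.norm_nth_le) auto
   also have "... \<le> ennreal (2 * ?N t powr r)"
    using r N1[of t] Lp_norm_nonneg[of torus 2 "Dv t"]
    by (intro nn_integral_powr_le_smaller_exponent[OF _ _ l2]) auto
   also have "... \<le> ennreal ((2 * ?N t) powr r)"
   proof (rule ennreal_leI)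
    have "2 * ?N t powr r \<le> 2 powr r * ?N t powr r" using r powr_mono[of 1 r 2] by (intro mult_right_mono) auto
    also have "... = (2 * ?N t) powr r" using N1[of t] by (subst powr_mult) auto
    finally show "2 * ?N t powr r \<le> (2 * ?N t) powr r" .
   qed
   finally have "(NN x. ennreal (\<bar>v t x $ i - (\<oint>y. v t y $ i)\<bar> powr 6)) \<le> ennreal (C * (2 * ?N t) powr 6)"
    using elim(1) N1[of t] by auto
   from powr_mean_bound[OF _ _ _ _ this, of "Y t"]
   have "(NN x. ennreal (\<bar>v t x $ i\<bar> powr 6)) \<le> ennreal (2 powr 6 * (C * (2 * ?N t) powr 6 + Y t powr 6))"
    using elim(2) C(1) by simp
   also have "... \<le> ennreal (2 powr 6 * (C * 2 powr 6 + 1) * X t powr 3)"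
   proof (rule ennreal_leI)
    have "?N t powr 6 = (?N t powr 2) powr 3" by (simp only: powr_powr) simp
    also have "... \<le> X t powr 3" by (rule powr_mono2) (auto simp: X_def)
    finally have N: "?N t powr 6 \<le> X t powr 3" .
    \<comment> \<open>\<open>p \<ge> 4\<close> gives \<open>6 / p \<le> 3\<close>, so the mean also
      fits under \<open>X^3\<close>.\<close>
    have "X t powr (6 / p) \<le> X t powr 3" using X1[of t] p4 by (intro powr_mono) (auto simp: divide_le_eq)
    then have Y6: "Y t powr 6 \<le> X t powr 3" using YX[of 6 t] by simp
    have "C * (2 * ?N t) powr 6 \<le> C * 2 powr 6 * X t powr 3"
    proof -
     have "(2 * ?N t) powr 6 = 2 powr 6 * ?N t powr 6" using N1[of t] by (subst powr_mult) auto
     moreover have "C * 2 powr 6 * ?N t powr 6 \<le> C * 2 powr 6 * X t powr 3" using C(1) by (intro mult_left_mono[OF N]) simp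
     ultimately show ?thesis by (simp only: mult.assoc)
    qed
    then have "2 powr 6 * (C * (2 * ?N t) powr 6 + Y t powr 6) \<le> 2 powr 6 * (C * 2 powr 6 * X t powr 3 + X t powr 3)"
     using Y6 by (intro mult_left_mono add_mono) auto
    then show "2 powr 6 * (C * (2 * ?N t) powr 6 + Y t powr 6) \<le> 2 powr 6 * (C * 2 powr 6 + 1) * X t powr 3"
     by (simp only: distrib_right mult.assoc mult_1)
   qed
   also have "... \<le> ennreal (K' * X t powr 3)" using K'(3) by (intro ennreal_leI mult_right_mono) auto
   finally have b6: "(NN x. ennreal (\<bar>v t x $ i\<bar> powr 6)) \<le> ennreal (K' * X t powr 3)" .
   have "K * Y t powr q \<le> K' * X t powr (q - 3)"
    using YX[of q t] K K' pq unfolding qp by (intro mult_mono) auto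
   then have bq: "(NN x. ennreal (\<bar>v t x $ i\<bar> powr q)) \<le> ennreal (K' * X t powr (q - 3))"
    using elim(3) order_trans ennreal_leI by blast
   show "(NN x. ennreal (\<bar>v t x $ i\<bar> powr 4)) \<le> ennreal (2 * K' * X t)"
    by (rule interpolation_slice[OF _ _ X1 pq(2,3) K'(1) bq b6]) auto
  qed
 qed
 have vm': "(%z. v (fst z) (snd z)) \<in> \<B> (\<S> T)" using vm by (simp add: case_prod_unfold)
 have [measurable]: "(%z. v (fst z) (snd z) $ i) \<in> \<B> (\<S> T)" for i
  by (rule measurable_compose[OF vm' borel_measurable_nth])
 have i: "integrable (\<S> T) (%z. \<bar>v (fst z) (snd z) $ i\<bar> powr 4)" for i
 proof (rule integrableI_bounded)
  have "(\<integral>\<^sup>+z. ennreal (\<bar>v (fst z) (snd z) $ i\<bar> powr 4) \<partial>\<S> T) = (\<integral>\<^sup>+t. (NN x. ennreal (\<bar>v t x $ i\<bar> powr 4)) \<partial>time T)"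
   by (subst torus.nn_integral_fst[symmetric]) auto
  also have "... \<le> (\<integral>\<^sup>+t. ennreal (2 * K' * X t) \<partial>time T)"
   by (rule nn_integral_mono_AE) (use slice in eventually_elim, blast)
  also have "... = ennreal (LINT t|time T. 2 * K' * X t)"
   using Xi K'(1) X1 by (intro nn_integral_eq_integral) (auto intro!: AE_I2 mult_nonneg_nonneg intro: order_trans[OF zero_le_one])
  also have "... < \<infinity>" by simp
  finally show "(\<integral>\<^sup>+z. ennreal (norm (\<bar>v (fst z) (snd z) $ i\<bar> powr 4)) \<partial>\<S> T) < \<infinity>" by simp
 qed measurable
 show ?thesis
  unfolding case_prod_unfold
 proof (rule L_integrable_bound)
  show "integrable (\<S> T) (%z. real CARD('d) powr 4 * (\<Sum>i\<in>UNIV. \<bar>v (fst z) (snd z) $ i\<bar> powr 4))" using i by simp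
  show "(%z. norm (v (fst z) (snd z)) ^ 4) \<in> \<B> (\<S> T)" using vm' by measurable
  have "norm w ^ 4 \<le> real CARD('d) powr 4 * (\<Sum>i\<in>UNIV. \<bar>w $ i\<bar> powr 4)" for w :: "real^'d"
  proof -
   have "norm w ^ 4 = norm w powr 4" by (simp add: powr_numeral)
   also have "... \<le> (\<Sum>i\<in>UNIV. \<bar>w $ i\<bar>) powr 4" by (intro powr_mono2 norm_le_l1_cart) auto
   also have "... \<le> real CARD('d) powr 4 * (\<Sum>i\<in>UNIV. \<bar>w $ i\<bar> powr 4)" by (rule sum_powr_le) auto
   finally show ?thesis .
  qed
  then show "AE z in \<S> T. norm (norm (v (fst z) (snd z)) ^ 4) \<le> norm (real CARD('d) powr 4 * (\<Sum>i\<in>UNIV. \<bar>v (fst z) (snd z) $ i\<bar> powr 4))"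
   by (intro AE_I2) (simp add: order_trans[OF _ abs_ge_self])
 qed
qed

text \<open>A test function constant in space leaves only the time derivative.\<close>

lemma mass_conservation:
 fixes \<rho> :: "real => real^'d::finite => real"
 assumes T: "T > 0" and i: "integrable (\<S> T) (%(t, x). \<rho> t x)" and eq: "continuity_eq T \<rho> v"
 obtains M where "AE t in time T. (\<oint>x. \<rho> t x) = M"
proof -
 let ?u = "%t. (\<oint>x. \<rho> t x)"
 have i': "integrable (\<S> T) (%z. \<rho> (fst z) (snd z))" using i by (simp add: case_prod_unfold)
 have u: "integrable (time T) ?u" using TX.integrable_fst'[OF i'] by simp
 have z: "(LINT t|time T. deriv \<tau> t * ?u t + \<tau> t * 0) = 0" if \<tau>: "time_test T \<tau>" for \<tau>
 proof -
  have one: "periodic_smooth (%x :: real^'d. 1)" by (rule periodic_smooth_const)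
  have g0: "gradient (%x :: real^'d. 1) x = 0" for x
   using frechet_derivative_const[of "1::real"] by (simp add: gradient_def vec_eq_iff)
  have eq0: "(LINT z|\<S> T. \<rho> (fst z) (snd z) * deriv \<tau> (fst z)) = 0"
   using eq[unfolded continuity_eq_def, rule_format, OF test_fun_product(1)[OF \<tau> one]]
   unfolding test_fun_product(2,3)[OF \<tau> one] g0 by (simp add: case_prod_unfold)
  obtain B where "!!t. \<bar>deriv \<tau> t\<bar> \<le> B" using time_test_bounded[OF time_test_deriv[OF \<tau>]] by blast
  from bounded_time_times_integrable_spacetime[OF time_test_measurable[OF time_test_deriv[OF \<tau>]] this i']
  have int: "integrable (\<S> T) (%z. \<rho> (fst z) (snd z) * deriv \<tau> (fst z))" by (simp add: mult.commute)
  show ?thesis using TX.integral_fst'[OF int] eq0 by (simp add: mult.commute)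
 qed
 obtain C where "AE t in time T. ?u t = C + (LINT s|time T. indicator {..<t} s * 0)"
  by (rule du_Bois_Reymond_time[OF u _ T z]) simp_all
 then show thesis by (intro that[of C]) simp
qed

text \<open>With \<open>m\<close> the mean, \<open>|m| a \<le> a |w| + a |w - m|\<close>. The
  kinetic energy bounds the first term through \<open>k \<le> 1 + k^2\<close>, the bound on the
  density the second. Positive mass thus controls the mean of the velocity, which a gradient cannot
  see.\<close>

lemma mean_bound:
 fixes a w k :: "real^'d::finite => real"
 assumes a: "a \<in> \<B> torus" "AE x in torus. 0 \<le> a x \<and> a x \<le> c" and c: "c \<ge> 0" and w: "integrable torus w"
  and k: "integrable torus (%x. a x * (k x)\<^sup>2)" "(\<oint>x. a x * (k x)\<^sup>2) \<le> E" "!!x. \<bar>w x\<bar> \<le> k x"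
 shows "\<bar>(\<oint>x. w x)\<bar> * (\<oint>x. a x) \<le> c + E + c * (\<oint>x. \<bar>w x - (\<oint>y. w y)\<bar>)"
proof -
 let ?m = "\<oint>x. w x"
 note [measurable] = a(1) borel_measurable_integrable[OF w]
 have ai: "integrable torus a" by (rule torus.integrable_const_bound[of _ c]) (use a in auto)
 have o: "integrable torus (%x. \<bar>w x - ?m\<bar>)" using w by simp
 have "\<bar>?m\<bar> * (\<oint>x. a x) = (\<oint>x. \<bar>?m\<bar> * a x)" by simp
 also have "... \<le> (\<oint>x. c + a x * (k x)\<^sup>2 + c * \<bar>w x - ?m\<bar>)"
 proof (rule integral_mono_AE)
  show "integrable torus (%x. \<bar>?m\<bar> * a x)" using ai by simp
  show "integrable torus (%x. c + a x * (k x)\<^sup>2 + c * \<bar>w x - ?m\<bar>)" using k(1) o by simp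
  show "AE x in torus. \<bar>?m\<bar> * a x \<le> c + a x * (k x)\<^sup>2 + c * \<bar>w x - ?m\<bar>"
   using a(2)
  proof eventually_elim
   case (elim x)
   have "\<bar>?m\<bar> \<le> k x + \<bar>w x - ?m\<bar>" using k(3)[of x] by linarith
   then have "\<bar>?m\<bar> * a x \<le> (k x + \<bar>w x - ?m\<bar>) * a x" using elim by (intro mult_right_mono) auto
   also have "... = a x * k x + \<bar>w x - ?m\<bar> * a x" by (simp add: algebra_simps)
   also have "... \<le> (c + a x * (k x)\<^sup>2) + c * \<bar>w x - ?m\<bar>"
   proof (rule add_mono)
    have "2 * k x \<le> 1 + (k x)\<^sup>2" using zero_le_power2[of "k x - 1"] by (simp add: power2_diff)
    moreover have "0 \<le> (k x)\<^sup>2" by simp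
    ultimately have "k x \<le> 1 + (k x)\<^sup>2" by linarith
    then have "a x * k x \<le> a x * (1 + (k x)\<^sup>2)" using elim by (intro mult_left_mono) auto
    then show "a x * k x \<le> c + a x * (k x)\<^sup>2" using elim by (simp add: distrib_left)
    show "\<bar>w x - ?m\<bar> * a x \<le> c * \<bar>w x - ?m\<bar>" using elim by (subst mult.commute) (intro mult_right_mono, auto)
   qed
   finally show ?case .
  qed
 qed
 also have "... = c + (\<oint>x. a x * (k x)\<^sup>2) + c * (\<oint>x. \<bar>w x - ?m\<bar>)" using k(1) o by simp
 finally show ?thesis using k(2) by linarith
qed

text \<open>Weak continuity tested with the sign of the representative at the time in question gives
  its L^1 norm there.\<close>

lemma weak_rep_zero:
 fixes \<rho> :: "real => real^'d::finite => real"
 assumes T: "T > 0" and rep: "weak_rep T p \<rho> \<rho>c" and p: "p > 1" and z: "AE t in time T. AE x in torus. \<rho> t x = 0" and t: "t \<in> {0..T}"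
 shows "AE x in torus. \<rho>c t x = 0"
proof -
 have wc: "weakly_continuous T p \<rho>c" and eq: "AE t in time T. AE x in torus. \<rho>c t x = \<rho> t x" using rep by (auto simp: weak_rep_def)
 have Lp: "\<rho>c s \<in> Lp torus p" if "s \<in> {0..T}" for s using wc that by (auto simp: weakly_continuous_def)
 have [measurable]: "\<rho>c t \<in> \<B> torus" using Lp[OF t] by (simp add: Lp_def)
 have int: "integrable torus (\<rho>c t)"
  by (rule torus.integrable_of_powr[of _ p]) (use Lp[OF t] p in \<open>auto simp: Lp_def\<close>)
 let ?g = "%x. sgn (\<rho>c t x)"
 have gm: "?g \<in> \<B> torus" by measurable
 have "?g \<in> Lp torus (p / (p - 1))" by (rule bounded_in_Lp_torus[OF gm, of 1]) (use p in \<open>auto simp: sgn_if\<close>)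
 then have cont: "continuous_on {0..T} (%s. (\<oint>x. \<rho>c s x \<bullet> ?g x))" 
  using wc[unfolded weakly_continuous_def, THEN conjunct2, rule_format] by simp
 have ae0: "AE s in time T. (\<oint>x. \<rho>c s x \<bullet> ?g x) = 0"
  using eq z
 proof eventually_elim
  case (elim s)
  have "AE x in torus. \<rho>c s x \<bullet> ?g x = 0" using elim by eventually_elim simp
  then show ?case by (rule integral_eq_zero_AE)
 qed
 have "(\<oint>x. \<rho>c t x \<bullet> ?g x) = 0" by (rule continuous_AE_time_zero[OF T cont ae0 t])
 then have "(\<oint>x. \<bar>\<rho>c t x\<bar>) = 0" by (simp add: abs_sgn)
 then have "AE x in torus. \<bar>\<rho>c t x\<bar> = 0" using int by (subst (asm) integral_nonneg_eq_0_iff_AE) auto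
 then show ?thesis by simp
qed

text \<open>Without mass the momentum estimates are void, but so is the energy.\<close>

lemma energy_equality_vacuum:
 fixes v :: "real => real^'d::finite => real^'d" and \<rho> :: "real => real^'d => real"
  and Dv :: "real => real^'d => real^'d^'d"
 assumes T: "T > 0" and \<gamma>: "\<gamma> > 1" and z: "AE t in time T. AE x in torus. \<rho> t x = 0"
  and reps: "weak_rep T \<gamma> \<rho> \<rho>c" "weak_rep T \<gamma> \<rho> \<rho>i"
  and init: "AE x in torus. \<rho>i 0 x = \<rho>0 x"
  and ineq: "AE t in time T. energy \<gamma> (\<rho> t) (v t) + dissipation \<mu> lam t Dv \<le> energy \<gamma> \<rho>0 v0"
  and Dm: "(%(t, x). Dv t x) \<in> \<B> (\<S> T)"
 shows "energy_mom \<gamma> (\<rho>c T) (mc T) + dissipation \<mu> lam T Dv = energy \<gamma> \<rho>0 v0 \<and> energy \<gamma> \<rho>0 v0 < \<infinity>"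
proof -
 have z0: "AE x in torus. \<rho>0 x = 0"
  using weak_rep_zero[OF T reps(2) \<gamma> z, of 0] init T by (auto elim: eventually_elim2)
 have E0: "energy \<gamma> \<rho>0 v0 = 0"
 proof -
  have "energy \<gamma> \<rho>0 v0 = (\<integral>\<^sup>+x. 0 \<partial>(torus :: (real^'d) measure))"
   unfolding energy_def by (rule nn_integral_cong_AE) (use z0 in eventually_elim, simp)
  then show ?thesis by simp
 qed
 have ET: "energy_mom \<gamma> (\<rho>c T) (mc T) = 0"
 proof -
  have ae: "AE x in torus. \<rho>c T x = 0" using weak_rep_zero[OF T reps(1) \<gamma> z, of T] T by simp
  have "energy_mom \<gamma> (\<rho>c T) (mc T) = (\<integral>\<^sup>+x. 0 \<partial>(torus :: (real^'d) measure))"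
   unfolding energy_mom_def by (rule nn_integral_cong_AE) (use ae in eventually_elim, simp)
  then show ?thesis by simp
 qed
 let ?e = "%t x. ennreal (\<mu> * (norm (Dv t x))\<^sup>2 + (\<mu> + lam) * (trace (Dv t x))\<^sup>2)"
 let ?H = "%t. (NN x. ?e t x)"
 have Dm': "(%z. Dv (fst z) (snd z)) \<in> \<B> (\<S> T)" using Dm by (simp add: case_prod_unfold)
 have "(%A :: real^'d^'d. ennreal (\<mu> * (norm A)\<^sup>2 + (\<mu> + lam) * (trace A)\<^sup>2)) \<in> \<B> borel"
  unfolding trace_def by (intro measurable_compose[OF _ measurable_ennreal] borel_measurable_continuous_onI continuous_intros)
 from measurable_compose[OF Dm' this] have em: "(%z. ?e (fst z) (snd z)) \<in> \<B> (\<S> T)" by simp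
 have Hm [measurable]: "?H \<in> \<B> (time T)" using torus.borel_measurable_nn_integral_fst[OF em] by simp
 have diss: "dissipation \<mu> lam s Dv = (\<integral>\<^sup>+t. ?H t * indicator {..<s} t \<partial>time T)" if "s \<in> space (time T)" for s
  unfolding dissipation_def time_def using that
  by (auto simp: nn_integral_restrict_space mult.assoc intro!: nn_integral_cong split: split_indicator)
 have D0: "AE s in time T. dissipation \<mu> lam s Dv = 0" using ineq by eventually_elim (simp add: E0)
 \<comment> \<open>The energy inequality kills the dissipation only up to almost every time, so
   times approaching \<open>T\<close> are chosen at which it vanishes.\<close>
 have "\<exists>s\<in>space (time T). T - 1 / real (Suc n) < s \<and> dissipation \<mu> lam s Dv = 0" for n
 proof (rule ccontr)
  assume "\<not> ?thesis"
  then have "AE s in time T. s \<notin> {max 0 (T - 1 / real (Suc n))<..<T}" using D0 AE_space by (auto elim: eventually_elim2)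
  then have "emeasure (time T) {max 0 (T - 1 / real (Suc n))<..<T} = 0"
   by (intro AE_iff_measurable[THEN iffD1, rotated]) (auto simp: sets_time)
  moreover have "measure (time T) {max 0 (T - 1 / real (Suc n))<..<T} = T - max 0 (T - 1 / real (Suc n))"
   using T by (intro measure_time_Ioo) auto
  ultimately show False using T by (auto simp: measure_def max_def split: if_splits)
 qed
 then obtain s where s: "!!n. s n \<in> space (time T)" "!!n. T - 1 / real (Suc n) < s n" "!!n. dissipation \<mu> lam (s n) Dv = 0" by metis
 have "AE t in time T. \<forall>n. ?H t * indicator {..<s n} t = 0"
  unfolding AE_all_countable
 proof
  fix n
  have m: "(%t. ?H t * indicator {..<s n} t) \<in> \<B> (time T)"
   by (intro borel_measurable_times_ennreal Hm borel_measurable_timeI) simp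
  show "AE t in time T. ?H t * indicator {..<s n} t = 0"
   using s(3)[of n] nn_integral_0_iff_AE[OF m] unfolding diss[OF s(1)] by simp
 qed
 with AE_space have "AE t in time T. ?H t = 0"
 proof eventually_elim
  case (elim t)
  obtain n where "inverse (real (Suc n)) < T - t" using reals_Archimedean[of "T - t"] elim(1) by auto
  then have "t < s n" using s(2)[of n] by (simp add: inverse_eq_divide)
  then show ?case using elim(2)[rule_format, of n] by simp
 qed
 then have "(\<integral>\<^sup>+t. ?H t \<partial>time T) = 0" by (subst nn_integral_0_iff_AE) auto
 then have "dissipation \<mu> lam T Dv = 0" by (simp add: dissipation_def)
 then show ?thesis using E0 ET by simp
qed

text \<open>On a space of measure one the L^q norm bounds the mean as well, so one function
  \<open>Y\<close> serves both hypotheses of \<open>L4_criterion\<close>.\<close>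

lemma L4_of_LpLq:
 fixes v :: "real => real^'d::finite => real^'d"
 assumes d: "CARD('d) \<in> {2, 3}" and T: "T > 0" and wg: "weak_grad_vec T v Dv"
  and vm: "(%(t, x). v t x) \<in> \<B> (\<S> T)" and D: "Dv \<in> LpLq T 2 2"
  and pq: "1 / p + 3 / q = 1" "3 < q" "q \<le> 4" and v: "v \<in> LpLq T p q"
 shows "integrable (\<S> T) (%(t, x). norm (v t x) ^ 4)"
proof -
 let ?N = "%t. Lp_norm torus q (v t)"
 have p0: "p > 0" using pq by (smt (verit) divide_less_eq_1_pos zero_less_divide_1_iff)
 have Y0: "0 \<le> 2 * (1 + ?N t)" for t using Lp_norm_nonneg[of torus q "v t"] by simp
 have slice: "AE t in time T. (\<forall>i. \<bar>(\<oint>x. v t x $ i)\<bar> \<le> 2 * (1 + ?N t)) \<and>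
   (\<forall>i. (NN x. ennreal (\<bar>v t x $ i\<bar> powr q)) \<le> ennreal (1 * (2 * (1 + ?N t)) powr q))"
  using LpLqD(2)[OF v]
 proof eventually_elim
  case (elim t)
  have [measurable]: "v t \<in> \<B> torus" using elim by (simp add: Lp_def)
  have N: "0 \<le> ?N t" by (rule Lp_norm_nonneg)
  have le: "(NN x. ennreal (norm (v t x) powr q)) \<le> ennreal ((1 + ?N t) powr q)"
   using N pq by (subst Lp_norm_powr[OF elim]) (auto intro!: ennreal_leI powr_mono2)
  have "(NN x. ennreal (norm (v t x) powr 1)) \<le> ennreal (2 * (1 + ?N t) powr 1)"
   using N pq by (intro nn_integral_powr_le_smaller_exponent[OF _ _ le]) auto
  then have l1: "(NN x. ennreal (norm (v t x))) \<le> ennreal (2 * (1 + ?N t))" using N by simp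
  have "\<bar>(\<oint>x. v t x $ i)\<bar> \<le> 2 * (1 + ?N t)" for i
  proof (cases "integrable torus (%x. v t x $ i)")
   case True
   have "ennreal \<bar>(\<oint>x. v t x $ i)\<bar> \<le> (NN x. ennreal (norm (v t x $ i)))"
    using integral_norm_bound_ennreal[OF True] by simp
   also have "... \<le> (NN x. ennreal (norm (v t x)))" by (intro nn_integral_mono ennreal_leI Finite_Cartesian_Product.norm_nth_le)
   also note l1
   finally show ?thesis using Y0 by (simp add: ennreal_le_iff)
  qed (use Y0 in \<open>simp add: not_integrable_integral_eq\<close>)
  moreover have "(NN x. ennreal (\<bar>v t x $ i\<bar> powr q)) \<le> ennreal (1 * (2 * (1 + ?N t)) powr q)" for i
  proof -
   have "(NN x. ennreal (\<bar>v t x $ i\<bar> powr q)) \<le> (NN x. ennreal (norm (v t x) powr q))"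
    using pq component_le_norm_cart by (intro nn_integral_mono ennreal_leI powr_mono2) auto
   also note le
   also have "ennreal ((1 + ?N t) powr q) \<le> ennreal (1 * (2 * (1 + ?N t)) powr q)"
    using N pq by (intro ennreal_leI) (simp add: powr_mono2)
   finally show ?thesis .
  qed
  ultimately show ?case by blast
 qed
 show ?thesis
  by (rule L4_criterion[OF d T wg vm D pq Y0 shifted_powr_integrable[OF LpLqD(3)[OF v] Lp_norm_nonneg], where K = 1])
   (use slice p0 in \<open>auto elim: eventually_mono\<close>)
qed

text \<open>With \<open>q\<close> the Sobolev conjugate of \<open>r\<close>, that is
  \<open>1 / q = 1 / r - 1 / d\<close>, the condition on the gradient becomes
  \<open>1 / p + 3 / q = 1\<close> for the velocity, up to its mean; the mean comes from
  \<open>mean_bound\<close>.\<close>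

lemma L4_of_gradient:
 fixes v :: "real => real^'d::finite => real^'d" and Dv :: "real => real^'d => real^'d^'d"
 assumes d: "CARD('d) \<in> {2, 3}" and T: "T > 0" and wg: "weak_grad_vec T v Dv"
  and vm: "(%(t, x). v t x) \<in> \<B> (\<S> T)" and D: "Dv \<in> LpLq T 2 2"
  and pr: "1 / p + 3 / r = 1 + 3 / real CARD('d)" "3 * real CARD('d) / (real CARD('d) + 3) < r"
   "r \<le> 4 * real CARD('d) / (real CARD('d) + 4)" and Dr: "Dv \<in> LpLq T p r"
  and \<rho>m: "(%(t, x). \<rho> t x) \<in> \<B> (\<S> T)"
  and \<rho>b: "AE (t, x) in \<S> T. 0 \<le> \<rho> t x \<and> \<rho> t x \<le> c" and c: "c \<ge> 0"
  and kin: "(%t x. \<rho> t x * (norm (v t x))\<^sup>2) \<in> LinfL1 T"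
  and mass: "AE t in time T. (\<oint>x. \<rho> t x) = M" "M > 0"
 shows "integrable (\<S> T) (%(t, x). norm (v t x) ^ 4)"
proof -
 let ?d = "real CARD('d)"
 define q where "q = r * (1 + r / (?d - r))"
 have r: "1 < r" "r < ?d" using d pr(2,3) by (auto simp: field_simps)
 have iq: "1 / q = 1 / r - 1 / ?d"
 proof -
  have "q = r * ?d / (?d - r)" using r by (simp add: q_def field_simps)
  then have "1 / q = (?d - r) / (r * ?d)" by simp
  then show ?thesis using r by (simp add: diff_divide_distrib)
 qed
 have pq: "1 / p + 3 / q = 1" using pr(1) iq by (simp add: divide_inverse algebra_simps)
 have q0: "q > 0" unfolding q_def using r by (intro mult_pos_pos add_pos_pos divide_pos_pos) auto
 \<comment> \<open>The two bounds assumed for \<open>r\<close> are exactly these after subtracting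
   \<open>1 / d\<close> from reciprocals.\<close>
 have "1 / 4 \<le> 1 / q" "1 / q < 1 / 3" unfolding iq using d pr(2,3) r by (auto simp: field_simps)
 then have q34: "3 < q" "q \<le> 4" using q0 by (simp_all add: field_simps)
 have p0: "p > 0" using pq q34 by (smt (verit) divide_less_eq_1_pos zero_less_divide_1_iff)
 obtain C0 where C0: "C0 \<ge> 0" "!!T (f :: real => real^'d => real) G. T > 0 ==> weak_grad T f G ==> AE t in time T. oscillation_bound C0 r q (f t) (G t)"
  using Sobolev[OF r q_def] by blast
 define C where "C = C0 + 1"
 have S: "AE t in time T. \<forall>i. oscillation_bound C0 r q (%x. v t x $ i) (%x. Dv t x $ i)"
  unfolding AE_all_countable
  by (rule allI, rule C0(2)[OF T, of "%t x. v t x $ i" "%t x. Dv t x $ i" for i]) (use wg in \<open>simp add: weak_grad_vec_def\<close>)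
 obtain E where E: "AE t in time T. Lp_norm torus 1 (%x. \<rho> t x * (norm (v t x))\<^sup>2) \<le> E"
  and kL: "AE t in time T. (%x. \<rho> t x * (norm (v t x))\<^sup>2) \<in> Lp torus 1"
  using kin by (auto simp: LinfL1_def)
 let ?N = "%t. 1 + Lp_norm torus r (Dv t)"
 \<comment> \<open>The constant of \<open>mean_bound\<close> divided by the mass; at least 1, so
   that the oscillation bound is absorbed as well.\<close>
 define k where "k = max 1 ((c + \<bar>E\<bar> + c * (2 * C)) / M)"
 have k: "k \<ge> 1" "(c + \<bar>E\<bar> + c * (2 * C)) / M \<le> k" by (auto simp: k_def)
 have N1: "?N t \<ge> 1" for t using Lp_norm_nonneg[of torus r "Dv t"] by simp
 have slice: "AE t in time T. (\<forall>i. \<bar>(\<oint>x. v t x $ i)\<bar> \<le> k * ?N t) \<and>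
   (\<forall>i. (NN x. ennreal (\<bar>v t x $ i\<bar> powr q)) \<le> ennreal (2 powr q * (C + 1) * (k * ?N t) powr q))"
  using S LpLqD(2)[OF Dr] E kL mass(1) TX.AE_pair[OF \<rho>b] AE_space
 proof eventually_elim
  case (elim t)
  have \<rho>t: "(%x. \<rho> t x) \<in> \<B> torus"
   using measurable_compose[OF measurable_Pair1'[OF elim(7)] \<rho>m] by simp
  have "(%x. \<rho> t x * (norm (v t x))\<^sup>2) \<in> \<B> torus" "integrable torus (%x. norm (\<rho> t x * (norm (v t x))\<^sup>2))"
   using elim(4) by (simp_all add: Lp_def)
  then have Ea: "integrable torus (%x. \<rho> t x * (norm (v t x))\<^sup>2)" by (simp only: integrable_norm_iff)
  have "(\<oint>x. \<rho> t x * (norm (v t x))\<^sup>2) \<le> (\<oint>x. \<bar>\<rho> t x * (norm (v t x))\<^sup>2\<bar>)"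
   using Ea by (intro integral_mono) auto
  also have "... \<le> \<bar>E\<bar>" using elim(3) by (simp add: Lp_norm_def)
  finally have Eb: "(\<oint>x. \<rho> t x * (norm (v t x))\<^sup>2) \<le> \<bar>E\<bar>" .
  have one: "\<bar>(\<oint>x. v t x $ i)\<bar> \<le> k * ?N t \<and>
    (NN x. ennreal (\<bar>v t x $ i\<bar> powr q)) \<le> ennreal (2 powr q * (C + 1) * (k * ?N t) powr q)" for i
  proof -
   let ?m = "\<oint>x. v t x $ i"
   have vi: "integrable torus (%x. v t x $ i)" using elim(1) by blast
   then have [measurable]: "(%x. v t x $ i) \<in> \<B> torus" by simp
   have "(NN x. ennreal (norm (Dv t x $ i) powr r)) \<le> (NN x. ennreal (norm (Dv t x) powr r))"
    using r by (intro nn_integral_mono ennreal_leI powr_mono2 Finite_Cartesian_Product.norm_nth_le) auto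
   also have "... \<le> ennreal (?N t powr r)"
    using r by (subst Lp_norm_powr[OF elim(2)]) (auto intro!: ennreal_leI powr_mono2 simp: Lp_norm_nonneg)
   finally have "(NN x. ennreal (\<bar>v t x $ i - ?m\<bar> powr q)) \<le> ennreal (C0 * ?N t powr q)"
    using elim(1) N1[of t] by auto
   also have "... \<le> ennreal (C * ?N t powr q)" unfolding C_def by (intro ennreal_leI mult_right_mono) auto
   finally have Sq: "(NN x. ennreal (\<bar>v t x $ i - ?m\<bar> powr q)) \<le> ennreal (C * ?N t powr q)" .
   have C1: "C \<ge> 1" using C0 by (simp add: C_def)
   have "C * ?N t powr q \<le> (C * ?N t) powr q"
   proof -
    have "C * ?N t powr q \<le> C powr q * ?N t powr q" using C1 q34 powr_mono[of 1 q C] by (intro mult_right_mono) auto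
    also have "... = (C * ?N t) powr q" using C1 N1[of t] by (subst powr_mult) auto
    finally show ?thesis .
   qed
   then have "(NN x. ennreal (\<bar>v t x $ i - ?m\<bar> powr q)) \<le> ennreal ((C * ?N t) powr q)"
    using order_trans[OF Sq ennreal_leI] by blast
   from nn_integral_powr_le_smaller_exponent[OF _ _ this, of 1]
   have "(NN x. ennreal \<bar>v t x $ i - ?m\<bar>) \<le> ennreal (2 * (C * ?N t))"
    using C1 N1[of t] q34 by (simp add: mult_pos_pos)
   moreover have "(NN x. ennreal \<bar>v t x $ i - ?m\<bar>) = ennreal (\<oint>x. \<bar>v t x $ i - ?m\<bar>)"
    using vi by (intro nn_integral_eq_integral) auto
   ultimately have osc: "(\<oint>x. \<bar>v t x $ i - ?m\<bar>) \<le> 2 * (C * ?N t)"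
    using C1 N1[of t] by (simp add: ennreal_le_iff)
   have "\<bar>?m\<bar> * M \<le> c + \<bar>E\<bar> + c * (\<oint>x. \<bar>v t x $ i - ?m\<bar>)"
    using mean_bound[OF \<rho>t _ c vi Ea Eb] elim(5,6) component_le_norm_cart by auto
   also have "... \<le> (c + \<bar>E\<bar>) * ?N t + c * (2 * (C * ?N t))"
    using N1[of t] c osc mult_left_mono[OF N1[of t], of "c + \<bar>E\<bar>"] by (intro add_mono mult_left_mono) auto
   also have "... = (c + \<bar>E\<bar> + c * (2 * C)) * ?N t" by (simp add: algebra_simps)
   finally have "\<bar>?m\<bar> \<le> (c + \<bar>E\<bar> + c * (2 * C)) / M * ?N t" using mass(2) by (simp add: pos_le_divide_eq)
   also have "... \<le> k * ?N t" using k(2) N1[of t] by (intro mult_right_mono) auto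
   finally have m: "\<bar>?m\<bar> \<le> k * ?N t" .
   from powr_mean_bound[OF _ _ _ m Sq] have "(NN x. ennreal (\<bar>v t x $ i\<bar> powr q)) \<le> ennreal (2 powr q * (C * ?N t powr q + (k * ?N t) powr q))"
    using q34 C1 by simp
   also have "... \<le> ennreal (2 powr q * (C * (k * ?N t) powr q + (k * ?N t) powr q))"
    using N1[of t] k(1) C1 q34 by (intro ennreal_leI mult_left_mono add_mono powr_mono2) (auto intro: mult_right_mono[of 1 k "?N t", simplified])
   also have "2 powr q * (C * (k * ?N t) powr q + (k * ?N t) powr q) = 2 powr q * (C + 1) * (k * ?N t) powr q"
    by (simp only: distrib_right mult.assoc mult_1)
   finally show ?thesis using m by blast
  qed
  then show ?case by blast
 qed
 have Y0: "0 \<le> k * ?N t" for t using k(1) N1[of t] by simp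
 show ?thesis
  by (rule L4_criterion[OF d T wg vm D pq q34 Y0 shifted_powr_integrable[OF LpLqD(3)[OF Dr] Lp_norm_nonneg], where K = "2 powr q * (C + 1)"])
   (use slice p0 k(1) C0(1) in \<open>auto simp: C_def elim: eventually_mono\<close>)
qed

section \<open>Assembly of the four cases\<close>

theorem theorem1p1:
  fixes T \<gamma> \<mu> lam :: real
    and \<rho>0 :: "real^'d::finite \<Rightarrow> real" and v0 :: "real^'d \<Rightarrow> real^'d"
    and \<rho> \<rho>c :: "real \<Rightarrow> real^'d \<Rightarrow> real" and v mc :: "real \<Rightarrow> real^'d \<Rightarrow> real^'d"
    and Dv :: "real \<Rightarrow> real^'d \<Rightarrow> real^'d^'d"
  assumes "CARD('d) \<in> {2, 3}"
    and "T > 0" and "\<gamma> > 1"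
    and "\<mu> \<ge> 0" and "2 * \<mu> + real CARD('d) * lam > 0"
    and vacuum: "AE x in torus. \<rho>0 x = 0 \<longrightarrow> v0 x = 0"
    and sol: "weak_solution T \<gamma> \<mu> lam \<rho>0 v0 \<rho> v Dv"
    and rep: "density_momentum_rep T \<gamma> \<rho> v \<rho>c mc"
    and cond:
      "((\<exists>c2. AE (t, x) in spacetime T. 0 \<le> \<rho> t x \<and> \<rho> t x \<le> c2)
          \<and> (\<exists>R. weak_grad T (\<lambda>t x. sqrt (\<rho> t x)) R \<and> R \<in> LpLq T 4 4)
          \<and> Dv \<in> LpLq T 2 2 \<and> v0 \<in> Lp torus 2
          \<and> v \<in> LpLq T 4 4)
     \<or> ((\<exists>c2. AE (t, x) in spacetime T. 0 \<le> \<rho> t x \<and> \<rho> t x \<le> c2)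
          \<and> (\<exists>R. weak_grad T (\<lambda>t x. sqrt (\<rho> t x)) R \<and> R \<in> LpLq T 4 4)
          \<and> Dv \<in> LpLq T 2 2 \<and> v0 \<in> Lp torus 2
          \<and> (\<exists>p q. 1 / p + 3 / q = 1 \<and> 3 < q \<and> q \<le> 4 \<and> v \<in> LpLq T p q))
     \<or> ((\<exists>c2. AE (t, x) in spacetime T. 0 \<le> \<rho> t x \<and> \<rho> t x \<le> c2)
          \<and> (\<exists>R. weak_grad T (\<lambda>t x. sqrt (\<rho> t x)) R \<and> R \<in> LpLq T 4 2)
          \<and> Dv \<in> LpLq T 2 2 \<and> v0 \<in> Lp torus 3
          \<and> v \<in> LpLq T 4 6)
     \<or> ((\<exists>c2. AE (t, x) in spacetime T. 0 \<le> \<rho> t x \<and> \<rho> t x \<le> c2)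
          \<and> (\<exists>R. weak_grad T (\<lambda>t x. sqrt (\<rho> t x)) R \<and> R \<in> LpLq T 4 4)
          \<and> Dv \<in> LpLq T 2 2 \<and> v0 \<in> Lp torus 2
          \<and> (\<exists>p r. 1 / p + 3 / r = 1 + 3 / real CARD('d)
                \<and> 3 * real CARD('d) / (real CARD('d) + 3) < r
                \<and> r \<le> 4 * real CARD('d) / (real CARD('d) + 4) \<and> Dv \<in> LpLq T p r))"
  shows "energy_mom \<gamma> (\<rho>c T) (mc T) + dissipation \<mu> lam T Dv = energy \<gamma> \<rho>0 v0
    \<and> energy \<gamma> \<rho>0 v0 < \<infinity>"
proof -
 have d: "real CARD('d) = 2 \<or> real CARD('d) = 3" using assms(1) by auto
 \<comment> \<open>For negative \<open>lam\<close> one has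
   \<open>lam > - 2 \<mu> / d \<ge> - \<mu>\<close>, since \<open>d\<close> is at least 2.\<close>
 have coeff: "\<mu> + lam \<ge> 0" using assms(4,5) d by (cases "lam \<ge> 0") auto
 note T = \<open>T > 0\<close> and \<gamma> = \<open>\<gamma> > 1\<close>
 have s: "(%(t, x). \<rho> t x) \<in> \<B> (\<S> T)" "(%(t, x). v t x) \<in> \<B> (\<S> T)"
  "weak_grad_vec T v Dv" "(%t x. \<rho> t x * (norm (v t x))\<^sup>2) \<in> LinfL1 T" "Dv \<in> LpLq T 2 2"
  "continuity_eq T \<rho> v" "momentum_eq T \<gamma> \<mu> lam \<rho> v Dv" "renormalized T \<rho> v Dv"
  "AE t in time T. energy \<gamma> (\<rho> t) (v t) + dissipation \<mu> lam t Dv \<le> energy \<gamma> \<rho>0 v0"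
  "\<rho>0 \<in> \<B> torus" "v0 \<in> \<B> torus"
  using sol by (simp_all add: weak_solution_def)
 obtain \<rho>i mi where i: "density_momentum_rep T \<gamma> \<rho> v \<rho>i mi" "AE x in torus. \<rho>i 0 x = \<rho>0 x" "AE x in torus. mi 0 x = \<rho>0 x *\<^sub>R v0 x"
  using sol by (auto simp: weak_solution_def)
 obtain c2 where c2: "AE (t, x) in \<S> T. 0 \<le> \<rho> t x \<and> \<rho> t x \<le> c2" using cond by blast
 define c where "c = max 0 c2"
 have c: "c \<ge> 0" "AE (t, x) in \<S> T. 0 \<le> \<rho> t x \<and> \<rho> t x \<le> c"
  using c2 by (auto simp: c_def elim!: eventually_mono)
 obtain R where R: "weak_grad T (%t x. sqrt (\<rho> t x)) R" "R \<in> LpLq T 4 4 \<or> R \<in> LpLq T 4 2" using cond by blast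
 \<comment> \<open>Both integrability variants of the gradient of the root are used only through
   square integrability in space-time.\<close>
 have R2: "integrable (\<S> T) (%(t, x). (norm (R t x))\<^sup>2)"
 proof -
  have "integrable (\<S> T) (%(t, x). norm (R t x) powr 2)"
   using R(2) by (elim disjE) (drule LpLq_integrable[where a = 2]; simp)+
  then show ?thesis by simp
 qed
 have D2: "integrable (\<S> T) (%(t, x). (norm (Dv t x))\<^sup>2)"
  using LpLq_integrable[OF s(5), of 2] by simp
 \<comment> \<open>The third condition provides the exponent 3, which is stronger on a space of
   finite measure.\<close>
 have v02: "v0 \<in> Lp torus 2"
 proof -
  have "integrable torus (%x. norm (v0 x) powr 2)" if "v0 \<in> Lp torus 3"
  proof (rule L_integrable_bound)
   show "integrable torus (%x. 1 + norm (v0 x) powr 3)" using that by (simp add: Lp_def)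
   have "y powr 2 \<le> 1 + y powr 3" if "y \<ge> 0" for y :: real
   proof (cases "y \<le> 1")
    case True
    then have "y powr 2 \<le> 1" using that by (simp add: power_le_one)
    then show ?thesis by (simp add: add_increasing2)
   qed (simp add: powr_mono add_increasing del: powr_numeral)
   then show "AE x in torus. norm (norm (v0 x) powr 2) \<le> norm (1 + norm (v0 x) powr 3)"
    by (intro AE_I2) (simp del: powr_numeral)
  qed (use s(11) in measurable)
  then show ?thesis using cond s(11) by (auto simp: Lp_def)
 qed
 have Dm: "(%(t, x). Dv t x) \<in> \<B> (\<S> T)" using s(5) by (simp add: LpLq_def)
 have L4: ?thesis if "integrable (\<S> T) (%(t, x). norm (v t x) ^ 4)"
 proof -
  have "fluid T \<gamma> \<mu> lam c \<rho> v Dv"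
   by unfold_locales (use T \<gamma> c s(1-3,6-8) Dm that D2 in auto)
  then show ?thesis
   by (rule energy_equality_L4[OF _ rep i(1) assms(4) coeff s(10) v02 i(2,3) s(9) R(1) R2])
 qed
 have vacuum_or_L4: ?thesis
  if pr: "1 / p + 3 / r = 1 + 3 / real CARD('d)" "3 * real CARD('d) / (real CARD('d) + 3) < r"
   "r \<le> 4 * real CARD('d) / (real CARD('d) + 4)" "Dv \<in> LpLq T p r" for p r
 proof -
  have \<rho>i: "integrable (\<S> T) (%(t, x). \<rho> t x)"
   by (rule spacetime.integrable_const_bound[of _ c]) (use c s(1) in \<open>auto elim!: eventually_mono\<close>)
  obtain M where M: "AE t in time T. (\<oint>x. \<rho> t x) = M" using mass_conservation[OF T \<rho>i s(6)] .
  have slices: "AE t in time T. AE x in torus. 0 \<le> \<rho> t x \<and> \<rho> t x \<le> c"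
   using TX.AE_pair[OF c(2)] by simp
  consider "M > 0" | "M \<le> 0" by linarith
  then show ?thesis
  proof cases
   case 1
   show ?thesis by (rule L4[OF L4_of_gradient[OF assms(1) T s(3,2,5) pr s(1) c(2,1) s(4) M 1]])
  next
   case 2
   have "integrable (\<S> T) (%z. \<rho> (fst z) (snd z))" using \<rho>i by (simp add: case_prod_unfold)
   from TX.AE_integrable_fst'[OF this] have "AE t in time T. AE x in torus. \<rho> t x = 0"
    using M slices
   proof eventually_elim
    case (elim t)
    have nn: "AE x in torus. 0 \<le> \<rho> t x" using elim(3) by eventually_elim simp
    have "(\<oint>x. \<rho> t x) = 0" using elim(2) 2 integral_nonneg_AE[OF nn] by simp
    then show ?case using integral_nonneg_eq_0_iff_AE[of torus "\<rho> t"] elim(1) nn by simp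
   qed
   moreover have "weak_rep T \<gamma> \<rho> \<rho>c" "weak_rep T \<gamma> \<rho> \<rho>i"
    using rep i(1) by (auto simp: density_momentum_rep_def)
   ultimately show ?thesis using i(2) s(9) Dm
    by (intro energy_equality_vacuum[where v = v and \<rho> = \<rho> and \<rho>c = \<rho>c and \<rho>i = \<rho>i and mc = mc, OF T \<gamma>])
  qed
 qed
 have L4_powr: "integrable (\<S> T) (%(t, x). norm (v t x) ^ 4)" if "v \<in> LpLq T 4 q" "q \<ge> 4" for q
  using LpLq_integrable[OF that(1), of 4] that(2) by simp
 from cond consider "v \<in> LpLq T 4 4" | p q where "1 / p + 3 / q = 1" "3 < q" "q \<le> 4" "v \<in> LpLq T p q" | "v \<in> LpLq T 4 6"
  | p r where "1 / p + 3 / r = 1 + 3 / real CARD('d)" "3 * real CARD('d) / (real CARD('d) + 3) < r"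
   "r \<le> 4 * real CARD('d) / (real CARD('d) + 4)" "Dv \<in> LpLq T p r"
  by blast
 then show ?thesis
 proof cases
  case 1 then show ?thesis by (intro L4 L4_powr[of 4]) simp_all
 next
  case 2 then show ?thesis by (intro L4 L4_of_LpLq[OF assms(1) T s(3,2,5)])
 next
  case 3 then show ?thesis by (intro L4 L4_powr[of 6]) simp_all
 next
  case 4 then show ?thesis by (rule vacuum_or_L4)
 qed
qed

end
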